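(* Let $K$ be a field and $L=K[\alpha]$ a finite field extension of $K$ generated by an element $\alpha\notin K$ of degree $n=[L:K]$ with $n\equiv 0 \bmod 4$ (so $n\ge 4$) and $\alpha^n\in K^\times$. For $0\le i\le n-1$ let $L_i$ be the $K$-subspace of $L$ spanned by $1,\alpha,\dots,\alpha^i$. Let $V\subset L$ be a $K$-subspace containing $K$ such that: (1) $\dim_K V=n/4$; (2) the sum $V+\alpha V+\alpha^2V$ is direct; (3) $V^2=L_{n-4}$; (4) $L=VL_{n-3}$. Set $W=V\oplus\alpha V$ and $H=L_{n-2}$, let $t$ be an indeterminate, and let $R$ be the graded $K$-subalgebra $$R=K\oplus Wt\oplus Ht^2\oplus\bigoplus_{i\ge3}Lt^i$$ of the polynomial ring $L[t]$ (graded with $|t|=1$). Then $R$ is a standard graded Gorenstein domain of Krull dimension one. Moreover, the ideal $I=(t,\alpha t)R$ of $R$ is rigid, but not free as an $R$-module.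
   Context: For $K$-subspaces $U,U'$ of $L$, the product $UU'$ denotes the $K$-linear span of all products $uu'$ with $u\in U$, $u'\in U'$, and $U^2=UU$. An ideal $I$ of a commutative ring $R$ is rigid if $\operatorname{Ext}^1_R(I,I)=0$. A graded $K$-algebra $R=\bigoplus_{i\ge0}R_i$ with $R_0=K$ is standard graded if it is generated as a $K$-algebra by finitely many elements of degree one. *)

theory Defs
  imports "HOL-Algebra.Algebra" "HOL-Library.Extended_Nat"
begin

section \<open>Subspaces of a ring over a subfield\<close>

definition lin_subspace :: "('a, 'b) ring_scheme \<Rightarrow> 'a set \<Rightarrow> 'a set \<Rightarrow> bool" where
  "lin_subspace R k V \<longleftrightarrow>
     additive_subgroup V R \<and> (\<forall>c\<in>k. \<forall>v\<in>V. c \<otimes>\<^bsub>R\<^esub> v \<in> V)"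

text \<open>The product of two subspaces: the linear span of all products, i.e. the union of the
  spans of the finite lists of products.\<close>

definition span_prod :: "('a, 'b) ring_scheme \<Rightarrow> 'a set \<Rightarrow> 'a set \<Rightarrow> 'a set \<Rightarrow> 'a set" where
  "span_prod L K U V =
     \<Union> {ring.Span L K xs | xs. set xs \<subseteq> {u \<otimes>\<^bsub>L\<^esub> v | u v. u \<in> U \<and> v \<in> V}}"

definition power_span :: "('a, 'b) ring_scheme \<Rightarrow> 'a set \<Rightarrow> 'a \<Rightarrow> nat \<Rightarrow> 'a set" where
  "power_span L K x i = ring.Span L K (map (\<lambda>j. x [^]\<^bsub>L\<^esub> j) [0..<Suc i])"


section \<open>Graded algebras\<close>

text \<open>Here \<open>k\<close> is a subfield of \<open>R\<close>, and \<open>G i\<close> is the homogeneous component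
  of degree \<open>i\<close>. The third conjunct states that \<open>R\<close> is the internal direct sum of the
  components; a \<open>k\<close>-subalgebra is the same as a subring containing \<open>k\<close>.\<close>

definition standard_graded ::
  "'r set \<Rightarrow> ('r, 'b) ring_scheme \<Rightarrow> (nat \<Rightarrow> 'r set) \<Rightarrow> bool" where
  "standard_graded k R G \<longleftrightarrow>
     cring R \<and> subfield k R \<and>
     (\<forall>i. lin_subspace R k (G i)) \<and>
     (\<forall>x\<in>carrier R. \<exists>!f. (\<forall>i. f i \<in> G i) \<and> finite {i. f i \<noteq> \<zero>\<^bsub>R\<^esub>} \<and>
        x = finsum R f {i. f i \<noteq> \<zero>\<^bsub>R\<^esub>}) \<and>
     (\<forall>i j. \<forall>x\<in>G i. \<forall>y\<in>G j. x \<otimes>\<^bsub>R\<^esub> y \<in> G (i + j)) \<and>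
     G 0 = k \<and>
     (\<exists>S. finite S \<and> S \<subseteq> G 1 \<and> generate_ring R (k \<union> S) = carrier R)"

text \<open>For a family \<open>G\<close> of subsets of \<open>L\<close>: the set of all \<open>\<Sum> a\<^sub>i t\<^sup>i\<close> in \<open>L[t]\<close>
  with \<open>a\<^sub>i \<in> G i\<close>, with the operations of \<open>L[t]\<close>, and its part of degree \<open>i\<close>.\<close>

definition coeff_restricted ::
  "('a, 'b) ring_scheme \<Rightarrow> (nat \<Rightarrow> 'a set) \<Rightarrow> ('a, nat \<Rightarrow> 'a) up_ring" where
  "coeff_restricted L G =
     (UP L)\<lparr>carrier := {p \<in> carrier (UP L). \<forall>i. coeff (UP L) p i \<in> G i}\<rparr>"

definition homogeneous_part ::
  "('a, 'b) ring_scheme \<Rightarrow> (nat \<Rightarrow> 'a set) \<Rightarrow> nat \<Rightarrow> (nat \<Rightarrow> 'a) set" where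
  "homogeneous_part L G i = (\<lambda>a. monom (UP L) a i) ` G i"


section \<open>Krull dimension\<close>

definition krull_dim :: "('r, 'b) ring_scheme \<Rightarrow> enat" where
  "krull_dim R = Sup {enat n | n. \<exists>P :: nat \<Rightarrow> 'r set.
     (\<forall>i\<le>n. primeideal (P i) R) \<and> (\<forall>i<n. P i \<subset> P (Suc i))}"


section \<open>Modules\<close>

definition mod_hom ::
  "('r, 'x) ring_scheme \<Rightarrow> ('r, 'm, 'y) module_scheme \<Rightarrow> ('r, 'n, 'z) module_scheme \<Rightarrow> ('m \<Rightarrow> 'n) set"
  where
  "mod_hom R M N = {f \<in> carrier M \<rightarrow> carrier N.
     (\<forall>x\<in>carrier M. \<forall>y\<in>carrier M. f (x \<oplus>\<^bsub>M\<^esub> y) = f x \<oplus>\<^bsub>N\<^esub> f y) \<and>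
     (\<forall>r\<in>carrier R. \<forall>x\<in>carrier M. f (r \<odot>\<^bsub>M\<^esub> x) = r \<odot>\<^bsub>N\<^esub> f x)}"

definition is_basis :: "('r, 'x) ring_scheme \<Rightarrow> ('r, 'm, 'y) module_scheme \<Rightarrow> 'm set \<Rightarrow> bool" where
  "is_basis R M B \<longleftrightarrow> B \<subseteq> carrier M \<and>
     (\<forall>x\<in>carrier M. \<exists>!c. (\<forall>b. c b \<in> carrier R) \<and> (\<forall>b. b \<notin> B \<longrightarrow> c b = \<zero>\<^bsub>R\<^esub>) \<and>
        finite {b. c b \<noteq> \<zero>\<^bsub>R\<^esub>} \<and>
        x = finsum M (\<lambda>b. c b \<odot>\<^bsub>M\<^esub> b) {b. c b \<noteq> \<zero>\<^bsub>R\<^esub>})"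

definition free_mod :: "('r, 'x) ring_scheme \<Rightarrow> ('r, 'm, 'y) module_scheme \<Rightarrow> bool" where
  "free_mod R M \<longleftrightarrow> module R M \<and> (\<exists>B. is_basis R M B)"

text \<open>An ideal (or the ring itself) as a module. The fields \<open>mult\<close> and \<open>one\<close> of a module record
  play no role.\<close>

definition ideal_module :: "('r, 'x) ring_scheme \<Rightarrow> 'r set \<Rightarrow> ('r, 'r) module" where
  "ideal_module R I = \<lparr>carrier = I, monoid.mult = (\<otimes>\<^bsub>R\<^esub>), one = \<one>\<^bsub>R\<^esub>,
     ring.zero = \<zero>\<^bsub>R\<^esub>, ring.add = (\<oplus>\<^bsub>R\<^esub>), smult = (\<otimes>\<^bsub>R\<^esub>)\<rparr>"


section \<open>Vanishing of Ext\<close>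

text \<open>\<open>\<dots> \<rightarrow> P 2 \<rightarrow> P 1 \<rightarrow> P 0 \<rightarrow> M \<rightarrow> 0\<close>, with \<open>d k\<close> from \<open>P (Suc k)\<close> to \<open>P k\<close>
  and augmentation \<open>e\<close>.\<close>

definition free_resolution ::
  "('r, 'x) ring_scheme \<Rightarrow> ('r, 'm, 'y) module_scheme \<Rightarrow>
   (nat \<Rightarrow> ('r, 'p) module) \<Rightarrow> (nat \<Rightarrow> 'p \<Rightarrow> 'p) \<Rightarrow> ('p \<Rightarrow> 'm) \<Rightarrow> bool" where
  "free_resolution R M P d e \<longleftrightarrow>
     (\<forall>k. free_mod R (P k)) \<and>
     e \<in> mod_hom R (P 0) M \<and>
     (\<forall>k. d k \<in> mod_hom R (P (Suc k)) (P k)) \<and>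
     e ` carrier (P 0) = carrier M \<and>
     d 0 ` carrier (P (Suc 0)) = a_kernel (P 0) M e \<and>
     (\<forall>k. d (Suc k) ` carrier (P (Suc (Suc k))) = a_kernel (P (Suc k)) (P k) (d k))"

text \<open>Cocycles and coboundaries of degree \<open>i\<close> in the complex \<open>Hom(P, N)\<close>. Maps are compared
  on carriers only.\<close>

definition hom_cocycle ::
  "('r, 'x) ring_scheme \<Rightarrow> (nat \<Rightarrow> ('r, 'p) module) \<Rightarrow> (nat \<Rightarrow> 'p \<Rightarrow> 'p) \<Rightarrow>
   ('r, 'n, 'z) module_scheme \<Rightarrow> nat \<Rightarrow> ('p \<Rightarrow> 'n) \<Rightarrow> bool" where
  "hom_cocycle R P d N i f \<longleftrightarrow>
     f \<in> mod_hom R (P i) N \<and> (\<forall>x\<in>carrier (P (Suc i)). f (d i x) = \<zero>\<^bsub>N\<^esub>)"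

definition hom_coboundary ::
  "('r, 'x) ring_scheme \<Rightarrow> (nat \<Rightarrow> ('r, 'p) module) \<Rightarrow> (nat \<Rightarrow> 'p \<Rightarrow> 'p) \<Rightarrow>
   ('r, 'n, 'z) module_scheme \<Rightarrow> nat \<Rightarrow> ('p \<Rightarrow> 'n) \<Rightarrow> bool" where
  "hom_coboundary R P d N i f \<longleftrightarrow>
     (case i of
        0 \<Rightarrow> \<forall>x\<in>carrier (P 0). f x = \<zero>\<^bsub>N\<^esub>
      | Suc j \<Rightarrow> \<exists>g\<in>mod_hom R (P j) N. \<forall>x\<in>carrier (P (Suc j)). f x = g (d j x))"

text \<open>\<open>Ext\<^sup>i(M, N) = 0\<close>: the complex \<open>Hom(P, N)\<close> has no cohomology in degree \<open>i\<close>, for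
  some free resolution \<open>P\<close> of \<open>M\<close>; the cohomology does not depend on the choice of \<open>P\<close>.
  Every module on \<open>'m\<close> over a ring on \<open>'r\<close> has a free resolution whose terms have at
  most \<open>max(|'r|, |'m|, \<aleph>\<^sub>0)\<close> elements, which is the cardinality of \<open>('r \<times> 'm) list\<close>.\<close>

definition ext_vanishes ::
  "('r, 'x) ring_scheme \<Rightarrow> nat \<Rightarrow> ('r, 'm, 'y) module_scheme \<Rightarrow> ('r, 'n, 'z) module_scheme \<Rightarrow> bool"
  where
  "ext_vanishes R i M N \<longleftrightarrow>
     (\<exists>(P :: nat \<Rightarrow> ('r, ('r \<times> 'm) list) module) d e.
        free_resolution R M P d e \<and>
        (\<forall>f. hom_cocycle R P d N i f \<longrightarrow> hom_coboundary R P d N i f))"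

definition rigid_ideal :: "('r, 'x) ring_scheme \<Rightarrow> 'r set \<Rightarrow> bool" where
  "rigid_ideal R I \<longleftrightarrow>
     ideal I R \<and> ext_vanishes R 1 (ideal_module R I) (ideal_module R I)"


section \<open>Localization\<close>

definition loc_rel ::
  "('r, 'x) ring_scheme \<Rightarrow> 'r set \<Rightarrow> (('r \<times> 'r) \<times> ('r \<times> 'r)) set" where
  "loc_rel R P = {((a, s), (b, t)).
     a \<in> carrier R \<and> b \<in> carrier R \<and> s \<in> carrier R - P \<and> t \<in> carrier R - P \<and>
     (\<exists>u\<in>carrier R - P. u \<otimes>\<^bsub>R\<^esub> (a \<otimes>\<^bsub>R\<^esub> t) = u \<otimes>\<^bsub>R\<^esub> (b \<otimes>\<^bsub>R\<^esub> s))}"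

text \<open>\<open>R\<^sub>P\<close> for a prime ideal \<open>P\<close>; \<open>(a, s)\<close> represents \<open>a/s\<close>.\<close>

definition localization ::
  "('r, 'x) ring_scheme \<Rightarrow> 'r set \<Rightarrow> ('r \<times> 'r) set ring" where
  "localization R P = \<lparr>
     carrier = (carrier R \<times> (carrier R - P)) // loc_rel R P,
     monoid.mult = (\<lambda>x y. \<Union>(a, s)\<in>x. \<Union>(b, t)\<in>y.
        loc_rel R P `` {(a \<otimes>\<^bsub>R\<^esub> b, s \<otimes>\<^bsub>R\<^esub> t)}),
     one = loc_rel R P `` {(\<one>\<^bsub>R\<^esub>, \<one>\<^bsub>R\<^esub>)},
     ring.zero = loc_rel R P `` {(\<zero>\<^bsub>R\<^esub>, \<one>\<^bsub>R\<^esub>)},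
     ring.add = (\<lambda>x y. \<Union>(a, s)\<in>x. \<Union>(b, t)\<in>y.
        loc_rel R P `` {((a \<otimes>\<^bsub>R\<^esub> t) \<oplus>\<^bsub>R\<^esub> (b \<otimes>\<^bsub>R\<^esub> s), s \<otimes>\<^bsub>R\<^esub> t)})\<rparr>"


section \<open>Injective dimension and Gorenstein rings\<close>

text \<open>Injectivity is a statement about all pairs of modules \<open>A\<close>, \<open>B\<close>. A HOL formula cannot
  quantify over the type \<open>'u\<close> of their elements, so \<open>'u\<close> is a parameter; a theorem about
  \<open>TYPE('u)\<close> with \<open>'u\<close> a type variable covers test modules on all types.\<close>

definition injective_mod ::
  "'u itself \<Rightarrow> ('r, 'x) ring_scheme \<Rightarrow> ('r, 'e, 'y) module_scheme \<Rightarrow> bool" where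
  "injective_mod U R E \<longleftrightarrow> module R E \<and>
     (\<forall>(A :: ('r, 'u) module) (B :: ('r, 'u) module). \<forall>i\<in>mod_hom R A B. \<forall>f\<in>mod_hom R A E.
        module R A \<longrightarrow> module R B \<longrightarrow> inj_on i (carrier A) \<longrightarrow>
        (\<exists>g\<in>mod_hom R B E. \<forall>x\<in>carrier A. g (i x) = f x))"

text \<open>\<open>0 \<rightarrow> M \<rightarrow> E 0 \<rightarrow> E 1 \<rightarrow> \<dots>\<close>, with \<open>d k\<close> from \<open>E k\<close> to \<open>E (Suc k)\<close>
  and coaugmentation \<open>h\<close>.\<close>

definition injective_resolution ::
  "'u itself \<Rightarrow> ('r, 'x) ring_scheme \<Rightarrow> ('r, 'm, 'y) module_scheme \<Rightarrow>
   (nat \<Rightarrow> ('r, 'e) module) \<Rightarrow> (nat \<Rightarrow> 'e \<Rightarrow> 'e) \<Rightarrow> ('m \<Rightarrow> 'e) \<Rightarrow> bool" where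
  "injective_resolution U R M E d h \<longleftrightarrow>
     (\<forall>k. injective_mod U R (E k)) \<and>
     h \<in> mod_hom R M (E 0) \<and>
     (\<forall>k. d k \<in> mod_hom R (E k) (E (Suc k))) \<and>
     inj_on h (carrier M) \<and>
     h ` carrier M = a_kernel (E 0) (E (Suc 0)) (d 0) \<and>
     (\<forall>k. d k ` carrier (E k) = a_kernel (E (Suc k)) (E (Suc (Suc k))) (d (Suc k)))"

text \<open>The terms of the resolution may be taken on the type \<open>'r \<Rightarrow> 'm list\<close>: with
  \<open>D\<close> a divisible group containing \<open>M\<close>, of size at most \<open>max(|M|, \<aleph>\<^sub>0)\<close>, the
  group \<open>Hom\<^sub>\<int>(R, D)\<close> is an injective module containing \<open>M\<close>; so every injective hull of \<open>M\<close>
  fits in this type, and so do, iterating, all terms of a minimal injective resolution.\<close>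

definition finite_injective_dim ::
  "'u itself \<Rightarrow> ('r, 'x) ring_scheme \<Rightarrow> ('r, 'm, 'y) module_scheme \<Rightarrow> bool" where
  "finite_injective_dim U R M \<longleftrightarrow>
     (\<exists>(E :: nat \<Rightarrow> ('r, 'r \<Rightarrow> 'm list) module) d h n.
        injective_resolution U R M E d h \<and> (\<forall>k>n. carrier (E k) = {\<zero>\<^bsub>E k\<^esub>}))"

definition gorenstein :: "'u itself \<Rightarrow> ('r, 'x) ring_scheme \<Rightarrow> bool" where
  "gorenstein U R \<longleftrightarrow> cring R \<and> noetherian_ring R \<and>
     (\<forall>m. maximalideal m R \<longrightarrow>
        finite_injective_dim U (localization R m)
          (ideal_module (localization R m) (carrier (localization R m))))"

end

theory Submission
  imports Defs
begin

text \<open>Let \<open>\<tau> : L \<rightarrow> K\<close> be the coordinate at \<open>\<alpha>\<^sup>n\<^sup>-\<^sup>1\<close>, so that \<open>H\<close> is the kernel of \<open>\<tau>\<close> and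
  \<open>(x, y) \<mapsto> \<tau> (x y)\<close> is a nondegenerate form on \<open>L\<close>. Write \<open>G\<^sub>i\<close> for the graded pieces of \<open>R\<close> and \<open>L\<^sub>i\<close> for the span
  of \<open>1, \<alpha>, \<dots>, \<alpha>\<^sup>i\<close>. The theorem rests on the symmetry \<open>G\<^sub>i\<^sup>\<bottom> = G\<^sub>2\<^sub>-\<^sub>i\<close> for \<open>i \<le> 2\<close>: one has \<open>K\<^sup>\<bottom> = H\<close> by
  definition, and \<open>W\<^sup>\<bottom> = W\<close> because \<open>W\<^sup>2 \<subseteq> H\<close> follows from \<open>V\<^sup>2 = L\<^bsub>n-4\<^esub>\<close> while \<open>W\<close> has dimension \<open>n/2\<close>.

  This gives the Gorenstein property and the dimension. For \<open>a \<noteq> 0\<close> in \<open>R\<close> the quotient \<open>R/aR\<close> is finite dimensional,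
  since \<open>R\<close> contains everything of degree at least 3. It is a Frobenius algebra: division with remainder by \<open>a\<close> in \<open>L[t]\<close>,
  followed by \<open>\<tau>\<close> of the coefficient of degree 2 of the quotient, is a functional on \<open>R\<close> whose radical is \<open>aR\<close>, by the
  symmetry of the \<open>G\<^sub>i\<close> (\<open>Rg_quotient_dual\<close>). Any domain with such quotients is noetherian, its nonzero primes are
  maximal, and at every prime \<open>P\<close> the localization \<open>A\<close> satisfies Baer's criterion for \<open>F\<close> and \<open>F/A\<close>, where \<open>F\<close> is the
  fraction field: a map from an ideal to \<open>F/A\<close> takes values in some \<open>(1/a)A/A\<close>, a copy of \<open>A/aA\<close>, which is a
  self-injective ring. So \<open>0 \<rightarrow> A \<rightarrow> F \<rightarrow> F/A \<rightarrow> 0\<close> is a finite injective resolution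
  (\<open>localization_finite_injective_dim\<close>).

  The ring is generated in degree one: \<open>W\<^sup>2\<close> contains \<open>V\<^sup>2\<close>, \<open>\<alpha>V\<^sup>2\<close> and \<open>\<alpha>\<^sup>2V\<^sup>2\<close>, which span \<open>H\<close>, and \<open>WH\<close> contains
  \<open>VL\<^bsub>n-3\<^esub> = L\<close>; in higher degrees multiplication by \<open>t\<close> suffices.

  As to rigidity, the ideal \<open>I\<close> is covered by \<open>R\<^sup>2\<close> with kernel \<open>{(-\<alpha>u, u)}\<close>, so \<open>Ext\<^sup>1(I, I) = 0\<close> means that every
  linear map from this kernel to \<open>I\<close> extends to \<open>R\<^sup>2\<close> (\<open>ext1_vanishesI\<close>). Such a map is multiplication of \<open>u\<close>
  by a Laurent polynomial \<open>f\<close> over \<open>L\<close>, and it extends if and only if \<open>f \<in> t (R + \<alpha>R + \<alpha>\<^sup>2R)\<close>. Since \<open>u\<close> may be taken in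
  \<open>Vt\<close>, the coefficients of \<open>f\<close> vanish in degrees below 0, the one in degree 0 multiplies \<open>V\<close> into \<open>L\<^sub>1\<close>, and the one in
  degree 1 multiplies \<open>V\<close> into \<open>V + \<alpha>V + \<alpha>\<^sup>2V\<close>. The first is zero because of \<open>L = VL\<^bsub>n-3\<^esub>\<close>
  (\<open>multiplier_into_line\<close>), and the second lies in \<open>L\<^sub>2\<close> by duality (\<open>multiplier_into_V3\<close>). All other coefficients
  of \<open>f\<close> are unrestricted because \<open>L = W + \<alpha>W + \<alpha>\<^sup>2W\<close> (\<open>W_decomp\<close>) and \<open>L = H + \<alpha>H\<close>. Finally \<open>I\<close> is not
  free, for a free ideal of a domain is principal and \<open>1, \<alpha>\<close> are not both \<open>K\<close>-multiples of one element.\<close>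

section \<open>Subspaces over a subfield and duality\<close>

context ring
begin

lemma lin_subspaceI:
  assumes "V \<subseteq> carrier R" "\<zero> \<in> V" "\<And>x y. x \<in> V \<Longrightarrow> y \<in> V \<Longrightarrow> x \<oplus> y \<in> V"
    and "\<And>c x. c \<in> k \<Longrightarrow> x \<in> V \<Longrightarrow> c \<otimes> x \<in> V" "subring k R"
  shows "lin_subspace R k V"
proof -
  have neg: "\<ominus> x \<in> V" if "x \<in> V" for x
  proof -
    have "\<ominus> \<one> \<in> k" using subringE[OF assms(5)] by blast
    then have "\<ominus> \<one> \<otimes> x \<in> V" using assms(4) that by blast
    then show ?thesis using that assms(1) l_minus[of \<one> x] by auto
  qed
  have "subgroup V (add_monoid R)"
    by (rule add.subgroupI) (use assms neg in \<open>auto simp: a_inv_def\<close>)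
  then show ?thesis
    using assms(4) by (simp add: lin_subspace_def additive_subgroup_def)
qed

lemma lin_subspaceD:
  assumes "lin_subspace R k V"
  shows "V \<subseteq> carrier R" "\<zero> \<in> V" "\<And>x y. x \<in> V \<Longrightarrow> y \<in> V \<Longrightarrow> x \<oplus> y \<in> V"
    and "\<And>c x. c \<in> k \<Longrightarrow> x \<in> V \<Longrightarrow> c \<otimes> x \<in> V" "\<And>x. x \<in> V \<Longrightarrow> \<ominus> x \<in> V"
    and "\<And>x y. x \<in> V \<Longrightarrow> y \<in> V \<Longrightarrow> x \<ominus> y \<in> V"
proof -
  interpret additive_subgroup V R using assms by (simp add: lin_subspace_def)
  show "V \<subseteq> carrier R" "\<zero> \<in> V" "\<And>x y. x \<in> V \<Longrightarrow> y \<in> V \<Longrightarrow> x \<oplus> y \<in> V"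
    "\<And>x. x \<in> V \<Longrightarrow> \<ominus> x \<in> V"
    "\<And>x y. x \<in> V \<Longrightarrow> y \<in> V \<Longrightarrow> x \<ominus> y \<in> V"
    using a_subset by (auto simp: a_minus_def)
  show "\<And>c x. c \<in> k \<Longrightarrow> x \<in> V \<Longrightarrow> c \<otimes> x \<in> V"
    using assms by (simp add: lin_subspace_def)
qed

lemma ideal_lin_subspace:
  assumes "ideal J R" "k \<subseteq> carrier R"
  shows "lin_subspace R k J"
  using assms ideal.axioms(1)[OF assms(1)] ideal.I_l_closed[OF assms(1)]
  by (auto simp: lin_subspace_def)

text \<open>The span of \<open>xs\<close> together with a subspace \<open>C\<close>. It plays the part of the span of the images of \<open>xs\<close>
  in the quotient by \<open>C\<close>, so that finite dimensionality modulo \<open>C\<close> is stated without quotient spaces.\<close>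

definition rel_span :: "'a set \<Rightarrow> 'a set \<Rightarrow> 'a list \<Rightarrow> 'a set" where
  "rel_span k C xs = foldr (line_extension k) xs C"

lemma rel_span_Nil [simp]: "rel_span k C [] = C"
  and rel_span_Cons: "rel_span k C (x # xs) = line_extension k x (rel_span k C xs)"
  by (simp_all add: rel_span_def)

lemma Span_eq_rel_span: "Span k xs = rel_span k {\<zero>} xs"
  by (simp add: rel_span_def)

context
  fixes k assumes k: "subfield k R"
begin

lemma k_carrier: "k \<subseteq> carrier R"
  using subringE(1)[OF subfieldE(1)[OF k]] .

lemma line_extension_subspace:
  assumes "lin_subspace R k C" "x \<in> carrier R"
  shows "lin_subspace R k (line_extension k x C)"
  using line_extension_is_subgroup[OF k, of C x] line_extension_smult_closed[OF k, of C x]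
    lin_subspaceD[OF assms(1)] assms
  unfolding lin_subspace_def additive_subgroup_def by blast

lemma line_extension_base:
  assumes "C \<subseteq> carrier R" "x \<in> carrier R"
  shows "C \<subseteq> line_extension k x C"
proof
  fix c assume "c \<in> C"
  moreover from this have "c = \<zero> \<otimes> x \<oplus> c" using assms by auto
  moreover have "\<zero> \<in> k" using subringE(2)[OF subfieldE(1)[OF k]] .
  ultimately show "c \<in> line_extension k x C" unfolding line_extension_mem_iff by blast
qed

lemma line_extension_gen:
  assumes "\<zero> \<in> C" "x \<in> carrier R"
  shows "x \<in> line_extension k x C"
proof -
  have "x = \<one> \<otimes> x \<oplus> \<zero>" using assms by auto
  moreover have "\<one> \<in> k" using subringE(3)[OF subfieldE(1)[OF k]] .
  ultimately show ?thesis unfolding line_extension_mem_iff using assms(1) by blast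
qed

lemma rel_span_subspace:
  assumes "lin_subspace R k C" "set xs \<subseteq> carrier R"
  shows "lin_subspace R k (rel_span k C xs)"
  using assms(2) by (induct xs) (auto simp: rel_span_Cons assms(1) intro: line_extension_subspace)

lemma rel_span_base:
  assumes "lin_subspace R k C" "set xs \<subseteq> carrier R"
  shows "C \<subseteq> rel_span k C xs"
  using assms(2)
proof (induct xs)
  case (Cons x xs)
  then show ?case
    using line_extension_base[of "rel_span k C xs" x] lin_subspaceD(1)[OF rel_span_subspace[OF assms(1)]]
    by (auto simp: rel_span_Cons)
qed simp

lemma rel_span_gen:
  assumes "lin_subspace R k C" "set xs \<subseteq> carrier R"
  shows "set xs \<subseteq> rel_span k C xs"
  using assms(2)
proof (induct xs)
  case (Cons x xs)
  then have sub: "lin_subspace R k (rel_span k C xs)" and x: "x \<in> carrier R"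
    using rel_span_subspace[OF assms(1)] by auto
  show ?case
    using line_extension_base[OF lin_subspaceD(1)[OF sub] x] line_extension_gen[OF lin_subspaceD(2)[OF sub] x] Cons
    by (auto simp: rel_span_Cons)
qed simp

lemma rel_span_min:
  assumes "lin_subspace R k M" "C \<subseteq> M" "set xs \<subseteq> M"
  shows "rel_span k C xs \<subseteq> M"
  using assms(3)
proof (induct xs)
  case (Cons x xs)
  have "c \<otimes> x \<oplus> v \<in> M" if "c \<in> k" "v \<in> rel_span k C xs" for c v
    using Cons that by (intro lin_subspaceD(3,4)[OF assms(1)]) auto
  then show ?case by (auto simp: rel_span_Cons line_extension_mem_iff)
qed (use assms in auto)

lemma rel_span_mono:
  assumes "lin_subspace R k C" "lin_subspace R k D" "C \<subseteq> D" "set xs \<subseteq> carrier R"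
  shows "rel_span k C xs \<subseteq> rel_span k D xs"
  using rel_span_min[OF rel_span_subspace[OF assms(2,4)]] rel_span_base[OF assms(2,4)]
    rel_span_gen[OF assms(2,4)] assms(3) by blast

text \<open>Finite dimensionality modulo \<open>C\<close> passes to subspaces \<open>J\<close> by elimination of one generator \<open>x\<close> of the
  large space at a time: either no element of \<open>J\<close> has a nonzero coefficient at \<open>x\<close>, or subtracting multiples of one
  such element makes the coefficient vanish.\<close>

lemma subspace_finite_over:
  assumes C: "lin_subspace R k C" and J: "lin_subspace R k J" "C \<subseteq> J" and xs: "set xs \<subseteq> carrier R"
  shows "\<exists>js. set js \<subseteq> J \<and> J \<inter> rel_span k C xs \<subseteq> rel_span k C js"
  using xs
proof (induct xs)
  case Nil
  show ?case by (rule exI[of _ "[]"]) auto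
next
  case (Cons x xs)
  then obtain js where js: "set js \<subseteq> J" "J \<inter> rel_span k C xs \<subseteq> rel_span k C js" by auto
  note JD = lin_subspaceD[OF J(1)]
  have jsc: "set js \<subseteq> carrier R" using js JD by auto
  have sx: "lin_subspace R k (rel_span k C xs)" and x: "x \<in> carrier R"
    using rel_span_subspace[OF C] Cons by auto
  note sD = lin_subspaceD[OF sx]
  show ?case
  proof (cases "J \<inter> rel_span k C (x # xs) \<subseteq> rel_span k C xs")
    case True
    then show ?thesis using js by blast
  next
    case False
    then obtain y where y: "y \<in> J" "y \<in> rel_span k C (x # xs)" "y \<notin> rel_span k C xs" by blast
    then obtain c v where cv: "c \<in> k" "v \<in> rel_span k C xs" "y = c \<otimes> x \<oplus> v"
      by (auto simp: rel_span_Cons line_extension_mem_iff)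
    have cc: "c \<in> carrier R" "v \<in> carrier R" using cv k_carrier sD by auto
    have c0: "c \<noteq> \<zero>" using cv y x sD by auto
    have ci: "inv c \<in> k" "inv c \<otimes> c = \<one>" using subfield_m_inv[OF k, of c] cv c0 by auto
    have cic: "inv c \<in> carrier R" using ci k_carrier by auto
    have "J \<inter> rel_span k C (x # xs) \<subseteq> rel_span k C (y # js)"
    proof
      fix z assume z: "z \<in> J \<inter> rel_span k C (x # xs)"
      then obtain d w where dw: "d \<in> k" "w \<in> rel_span k C xs" "z = d \<otimes> x \<oplus> w"
        by (auto simp: rel_span_Cons line_extension_mem_iff)
      have dc: "d \<in> carrier R" "w \<in> carrier R" using dw k_carrier sD by auto
      define e where "e = d \<otimes> inv c"
      have e: "e \<in> k" "e \<in> carrier R" using subringE(6)[OF subfieldE(1)[OF k]] ci dw k_carrier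
        by (auto simp: e_def)
      have ec: "e \<otimes> c = d" using ci dc cc cic by (simp add: e_def m_assoc)
      have yc: "y \<in> carrier R" using y JD by auto
      have "z \<ominus> e \<otimes> y = (d \<otimes> x \<oplus> w) \<ominus> ((e \<otimes> c) \<otimes> x \<oplus> e \<otimes> v)"
        using cc e x by (simp add: cv(3) dw(3) r_distr m_assoc)
      also have "\<dots> = w \<ominus> e \<otimes> v"
        unfolding ec using dc cc e x by algebra
      finally have zy: "z \<ominus> e \<otimes> y = w \<ominus> e \<otimes> v" .
      have "z \<ominus> e \<otimes> y \<in> J" using JD z y e by auto
      moreover have "z \<ominus> e \<otimes> y \<in> rel_span k C xs" unfolding zy using sD dw cv e by auto
      ultimately have "z \<ominus> e \<otimes> y \<in> rel_span k C js" using js by blast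
      moreover have "z = e \<otimes> y \<oplus> (z \<ominus> e \<otimes> y)" using z JD e yc
      proof -
        have "z \<in> carrier R" using z JD by auto
        then show ?thesis using e yc by algebra
      qed
      ultimately show "z \<in> rel_span k C (y # js)" using e
        unfolding rel_span_Cons line_extension_mem_iff by blast
    qed
    moreover have "set (y # js) \<subseteq> J" using y js by auto
    ultimately show ?thesis by blast
  qed
qed

end

end

text \<open>The form \<open>(b, x) \<mapsto> \<mu> (b x)\<close> is associative, so its radical is an ideal, and it is nondegenerate on the
  quotient by the radical. If this quotient is finite dimensional, it is a Frobenius algebra; the lemmas below
  transfer the duality theory of such algebras to \<open>R\<close>, with subspaces taken modulo the radical.\<close>

locale ring_functional = cring R for R (structure) +
  fixes k :: "'a set" and \<mu> :: "'a \<Rightarrow> 'a"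
  assumes subfield_k: "subfield k R"
    and mu_closed: "\<And>x. x \<in> carrier R \<Longrightarrow> \<mu> x \<in> k"
    and mu_add: "\<And>x y. x \<in> carrier R \<Longrightarrow> y \<in> carrier R \<Longrightarrow> \<mu> (x \<oplus> y) = \<mu> x \<oplus> \<mu> y"
    and mu_smult: "\<And>c x. c \<in> k \<Longrightarrow> x \<in> carrier R \<Longrightarrow> \<mu> (c \<otimes> x) = c \<otimes> \<mu> x"
begin

definition radical :: "'a set" where
  "radical = {x \<in> carrier R. \<forall>b \<in> carrier R. \<mu> (b \<otimes> x) = \<zero>}"

lemma kc: "x \<in> k \<Longrightarrow> x \<in> carrier R"
  using k_carrier[OF subfield_k] by auto

lemma mu_carrier [simp]: "x \<in> carrier R \<Longrightarrow> \<mu> x \<in> carrier R"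
  using mu_closed kc by auto

lemma mu_zero [simp]: "\<mu> \<zero> = \<zero>"
  using mu_add[of \<zero> \<zero>] by (metis add.r_cancel_one mu_carrier r_zero zero_closed)

lemma mu_neg: assumes "x \<in> carrier R" shows "\<mu> (\<ominus> x) = \<ominus> \<mu> x"
proof -
  have "\<mu> (\<ominus> x) \<oplus> \<mu> x = \<zero>" using mu_add[of "\<ominus> x" x] assms by (simp add: l_neg)
  then show ?thesis using assms by (simp add: minus_equality)
qed

lemma mu_minus: "x \<in> carrier R \<Longrightarrow> y \<in> carrier R \<Longrightarrow> \<mu> (x \<ominus> y) = \<mu> x \<ominus> \<mu> y"
  by (simp add: a_minus_def mu_add mu_neg)

lemma radical_subspace: "lin_subspace R k radical"
proof (rule lin_subspaceI)
  show "subring k R" using subfieldE(1)[OF subfield_k] .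
  show "c \<otimes> x \<in> radical" if "c \<in> k" "x \<in> radical" for c x
  proof -
    have "\<mu> (b \<otimes> (c \<otimes> x)) = \<zero>" if b: "b \<in> carrier R" for b
    proof -
      have "b \<otimes> (c \<otimes> x) = c \<otimes> (b \<otimes> x)" using b \<open>c \<in> k\<close> \<open>x \<in> radical\<close> kc
        by (simp add: radical_def m_lcomm)
      then show ?thesis using b \<open>c \<in> k\<close> \<open>x \<in> radical\<close> kc by (simp add: radical_def mu_smult)
    qed
    then show ?thesis using that kc by (simp add: radical_def)
  qed
qed (auto simp: radical_def r_distr mu_add)

definition annihilated :: "'a set \<Rightarrow> 'a \<Rightarrow> bool" where
  "annihilated J b \<longleftrightarrow> b \<in> carrier R \<and> (\<forall>j\<in>J. \<mu> (b \<otimes> j) = \<zero>)"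

text \<open>Scale \<open>b\<close> by the inverse of \<open>\<mu> (b x)\<close>, an element of the field \<open>k\<close>.\<close>

lemma dual_element:
  assumes "x \<in> carrier R" "b \<in> carrier R" "annihilated J b" "\<mu> (b \<otimes> x) \<noteq> \<zero>" "J \<subseteq> carrier R"
  obtains b' where "annihilated J b'" "\<mu> (b' \<otimes> x) = \<one>"
proof
  let ?c = "\<mu> (b \<otimes> x)"
  have c: "?c \<in> k" "?c \<noteq> \<zero>" using mu_closed assms by auto
  have i: "inv ?c \<in> k" "inv ?c \<otimes> ?c = \<one>" using subfield_m_inv[OF subfield_k, of ?c] c by auto
  have ic: "inv ?c \<in> carrier R" using kc i by auto
  show "annihilated J (inv ?c \<otimes> b)" unfolding annihilated_def
  proof (intro conjI ballI)
    fix j assume j: "j \<in> J"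
    then have "j \<in> carrier R" using assms by auto
    then show "\<mu> (inv ?c \<otimes> b \<otimes> j) = \<zero>"
      using assms(2,3) j i ic by (simp add: annihilated_def mu_smult m_assoc)
  qed (use assms ic in auto)
  show "\<mu> (inv ?c \<otimes> b \<otimes> x) = \<one>" using assms i ic by (simp add: mu_smult m_assoc)
qed

text \<open>Induction on the number of generators. If \<open>b0\<close> annihilates the smaller span and pairs to \<open>1\<close> with the new
  generator \<open>j\<close>, then subtracting \<open>\<mu> (b0 x) j\<close> from \<open>x\<close> moves \<open>x\<close> into the double annihilator of the
  smaller span.\<close>

lemma double_annihilator:
  assumes "set xs \<subseteq> carrier R" "x \<in> carrier R"
    and "\<And>b. annihilated (rel_span k radical xs) b \<Longrightarrow> \<mu> (b \<otimes> x) = \<zero>"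
  shows "x \<in> rel_span k radical xs"
  using assms
proof (induct xs arbitrary: x)
  case Nil
  then show ?case by (auto simp: radical_def annihilated_def)
next
  case (Cons j xs)
  let ?U = "rel_span k radical xs"
  have U: "lin_subspace R k ?U" and j: "j \<in> carrier R"
    using rel_span_subspace[OF subfield_k radical_subspace] Cons by auto
  note UD = lin_subspaceD[OF U]
  show ?case
  proof (cases "j \<in> ?U")
    case True
    have "rel_span k radical (j # xs) \<subseteq> ?U"
      using True UD by (auto simp: rel_span_Cons line_extension_mem_iff)
    then have "\<mu> (b \<otimes> x) = \<zero>" if "annihilated ?U b" for b
      using that Cons(4)[of b] by (auto simp: annihilated_def)
    then have "x \<in> ?U" using Cons by auto
    then show ?thesis
      using line_extension_base[OF subfield_k UD(1) j] by (auto simp: rel_span_Cons)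
  next
    case False
    then obtain b1 where "annihilated ?U b1" "\<mu> (b1 \<otimes> j) \<noteq> \<zero>"
      using Cons(1)[of j] Cons(2) j by auto
    then obtain b0 where b0: "annihilated ?U b0" "\<mu> (b0 \<otimes> j) = \<one>"
      using dual_element[of j b1 ?U] j UD by (auto simp: annihilated_def)
    then have b0c: "b0 \<in> carrier R" by (simp add: annihilated_def)
    let ?m = "\<mu> (b0 \<otimes> x)"
    have x: "x \<in> carrier R" and m: "?m \<in> k" using Cons mu_closed b0c by auto
    have mc: "?m \<in> carrier R" using m kc by auto
    let ?x = "x \<ominus> ?m \<otimes> j"
    have "\<mu> (b \<otimes> ?x) = \<zero>" if b: "annihilated ?U b" for b
    proof -
      have bc: "b \<in> carrier R" using b by (simp add: annihilated_def)
      let ?l = "\<mu> (b \<otimes> j)"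
      have l: "?l \<in> k" and lc: "?l \<in> carrier R" using bc j mu_closed by auto
      let ?b = "b \<ominus> ?l \<otimes> b0"
      have ev: "\<mu> (?b \<otimes> y) = \<mu> (b \<otimes> y) \<ominus> ?l \<otimes> \<mu> (b0 \<otimes> y)" if y: "y \<in> carrier R" for y
      proof -
        have "?b \<otimes> y = b \<otimes> y \<ominus> ?l \<otimes> (b0 \<otimes> y)" using bc lc b0c y by algebra
        then show ?thesis using bc l lc b0c y by (simp add: mu_minus mu_smult)
      qed
      have "annihilated (rel_span k radical (j # xs)) ?b"
        unfolding annihilated_def
      proof (intro conjI ballI)
        show "?b \<in> carrier R" using bc lc b0c by auto
        fix z assume "z \<in> rel_span k radical (j # xs)"
        then obtain c v where cv: "c \<in> k" "v \<in> ?U" "z = c \<otimes> j \<oplus> v"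
          by (auto simp: rel_span_Cons line_extension_mem_iff)
        have cc: "c \<in> carrier R" "v \<in> carrier R" using cv kc UD by auto
        have bb: "?b \<in> carrier R" using bc lc b0c by auto
        have v0: "\<mu> (?b \<otimes> v) = \<zero>" using ev[OF cc(2)] b b0 cv lc by (simp add: annihilated_def a_minus_def)
        have j0: "\<mu> (?b \<otimes> j) = \<zero>" using ev[OF j] b0 lc by (simp add: a_minus_def r_neg)
        have "?b \<otimes> z = c \<otimes> (?b \<otimes> j) \<oplus> ?b \<otimes> v"
          unfolding cv(3) using bb cc j by (simp add: r_distr m_lcomm)
        then show "\<mu> (?b \<otimes> z) = \<zero>"
          using bb cc j cv v0 j0 by (simp add: mu_add mu_smult)
      qed
      then have "\<mu> (?b \<otimes> x) = \<zero>" using Cons(4) by blast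
      then have e: "\<mu> (b \<otimes> x) \<ominus> ?l \<otimes> ?m = \<zero>" using ev x by simp
      have "b \<otimes> ?x = b \<otimes> x \<ominus> ?m \<otimes> (b \<otimes> j)" using bc x mc j by algebra
      then have "\<mu> (b \<otimes> ?x) = \<mu> (b \<otimes> x) \<ominus> ?m \<otimes> ?l" using bc x mc m j
        by (simp add: mu_minus mu_smult)
      then show ?thesis using e mc lc by (simp add: m_comm)
    qed
    then have "?x \<in> ?U" using Cons(1)[of ?x] Cons(2) x mc j by auto
    moreover have "x = ?m \<otimes> j \<oplus> ?x" using x mc j by algebra
    ultimately show ?thesis using m unfolding rel_span_Cons line_extension_mem_iff by blast
  qed
qed

lemma dual_element_ex:
  assumes "set xs \<subseteq> carrier R" "x \<in> carrier R" "x \<notin> rel_span k radical xs"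
  obtains b where "annihilated (rel_span k radical xs) b" "\<mu> (b \<otimes> x) = \<one>"
proof -
  obtain b1 where b1: "annihilated (rel_span k radical xs) b1" "\<mu> (b1 \<otimes> x) \<noteq> \<zero>"
    using double_annihilator[OF assms(1,2)] assms(3) by blast
  then show thesis
    using dual_element[of x b1 "rel_span k radical xs"] assms(2) that
      lin_subspaceD(1)[OF rel_span_subspace[OF subfield_k radical_subspace assms(1)]]
    by (auto simp: annihilated_def)
qed

text \<open>An element \<open>b\<close> that represents \<open>\<nu>\<close> on the span of fewer generators is corrected by
  \<open>(\<nu> j - \<mu> (b j)) b0\<close>, where \<open>b0\<close> annihilates that span and pairs to \<open>1\<close> with the new generator \<open>j\<close>.\<close>

lemma functional_representable:
  assumes J: "lin_subspace R k J"
    and nu: "\<And>x. x \<in> J \<Longrightarrow> \<nu> x \<in> k"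
      "\<And>x y. x \<in> J \<Longrightarrow> y \<in> J \<Longrightarrow> \<nu> (x \<oplus> y) = \<nu> x \<oplus> \<nu> y"
      "\<And>c x. c \<in> k \<Longrightarrow> x \<in> J \<Longrightarrow> \<nu> (c \<otimes> x) = c \<otimes> \<nu> x"
      "\<And>x. x \<in> J \<Longrightarrow> x \<in> radical \<Longrightarrow> \<nu> x = \<zero>"
    and js: "set js \<subseteq> J"
  shows "\<exists>b\<in>carrier R. \<forall>x\<in>J \<inter> rel_span k radical js. \<nu> x = \<mu> (b \<otimes> x)"
  using js
proof (induct js)
  case Nil
  show ?case
    by (rule bexI[of _ \<zero>]) (use nu lin_subspaceD[OF radical_subspace] in auto)
next
  case (Cons j js)
  note JD = lin_subspaceD[OF J]
  let ?U = "rel_span k radical js"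
  have jsc: "set js \<subseteq> carrier R" and j: "j \<in> J" "j \<in> carrier R" using Cons JD by auto
  note UD = lin_subspaceD[OF rel_span_subspace[OF subfield_k radical_subspace jsc]]
  obtain b where b: "b \<in> carrier R" "\<And>x. x \<in> J \<inter> ?U \<Longrightarrow> \<nu> x = \<mu> (b \<otimes> x)"
    using Cons by auto
  show ?case
  proof (cases "j \<in> ?U")
    case True
    have "rel_span k radical (j # js) \<subseteq> ?U"
      using True UD by (auto simp: rel_span_Cons line_extension_mem_iff)
    then show ?thesis using b by blast
  next
    case False
    then obtain b0 where b0: "annihilated ?U b0" "\<mu> (b0 \<otimes> j) = \<one>"
      using dual_element_ex[OF jsc j(2)] by blast
    have b0c: "b0 \<in> carrier R" using b0 by (simp add: annihilated_def)
    let ?m = "\<nu> j \<ominus> \<mu> (b \<otimes> j)"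
    have m: "?m \<in> k" using nu(1)[OF j(1)] mu_closed[of "b \<otimes> j"] b j
        lin_subspaceD(6)[OF ideal_lin_subspace] subringE[OF subfieldE(1)[OF subfield_k]]
      by (auto simp: a_minus_def)
    have mc: "?m \<in> carrier R" "\<nu> j \<in> carrier R" using m kc nu j by auto
    let ?b = "b \<oplus> ?m \<otimes> b0"
    have "\<nu> x = \<mu> (?b \<otimes> x)" if x: "x \<in> J \<inter> rel_span k radical (j # js)" for x
    proof -
      obtain c v where cv: "c \<in> k" "v \<in> ?U" "x = c \<otimes> j \<oplus> v"
        using x by (auto simp: rel_span_Cons line_extension_mem_iff)
      have cc: "c \<in> carrier R" "v \<in> carrier R" using cv kc UD by auto
      have "x \<ominus> c \<otimes> j \<in> J" using JD(6)[OF _ JD(4)[OF cv(1) j(1)]] x by blast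
      moreover have "v = x \<ominus> c \<otimes> j" unfolding cv(3) using cc j by algebra
      ultimately have vJ: "v \<in> J" by simp
      have l: "\<nu> x = c \<otimes> \<nu> j \<oplus> \<mu> (b \<otimes> v)"
        unfolding cv(3) using nu(2)[of "c \<otimes> j" v] nu(3)[of c j] JD cv vJ j b by auto
      have ex: "?b \<otimes> x = c \<otimes> (b \<otimes> j) \<oplus> b \<otimes> v \<oplus> ?m \<otimes> (c \<otimes> (b0 \<otimes> j)) \<oplus> ?m \<otimes> (b0 \<otimes> v)"
        unfolding cv(3) using b(1) b0c mc(1) cc j by algebra
      have "\<mu> (?b \<otimes> x) = c \<otimes> \<mu> (b \<otimes> j) \<oplus> \<mu> (b \<otimes> v) \<oplus> ?m \<otimes> (c \<otimes> \<one>) \<oplus> ?m \<otimes> \<zero>"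
        unfolding ex using b(1) b0c mc(1) cc j m cv b0 by (simp add: mu_add mu_smult annihilated_def)
      also have "\<dots> = c \<otimes> \<nu> j \<oplus> \<mu> (b \<otimes> v)"
      proof -
        have "c \<otimes> p \<oplus> q \<oplus> (n \<ominus> p) \<otimes> (c \<otimes> \<one>) \<oplus> (n \<ominus> p) \<otimes> \<zero> = c \<otimes> n \<oplus> q"
          if "p \<in> carrier R" "q \<in> carrier R" "n \<in> carrier R" for p q n
        proof -
          have "c \<otimes> p \<oplus> q \<oplus> m \<otimes> (c \<otimes> \<one>) \<oplus> m \<otimes> \<zero> = c \<otimes> (p \<oplus> m) \<oplus> q" if "m \<in> carrier R" for m
            using that \<open>p \<in> _\<close> \<open>q \<in> _\<close> cc(1) by (simp add: r_distr m_comm a_ac)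
          moreover have "p \<oplus> (n \<ominus> p) = n" using that by algebra
          ultimately show ?thesis using that by simp
        qed
        then show ?thesis using mc(2) b(1) cc j by simp
      qed
      finally show ?thesis using l by simp
    qed
    moreover have "?b \<in> carrier R" using b b0c mc by auto
    ultimately show ?thesis by blast
  qed
qed

end

section \<open>Domains with Frobenius quotients\<close>

text \<open>A concrete form of the Gorenstein property for algebras of dimension one over a field: every \<open>R/aR\<close> with
  \<open>a \<noteq> 0\<close> is a finite dimensional Frobenius algebra, since some functional on it has no nonzero ideal in its kernel.\<close>

locale frobenius_domain = domain R for R (structure) +
  fixes k :: "'a set"
  assumes subfield_k: "subfield k R"
    and quotient_finite: "\<And>a. a \<in> carrier R \<Longrightarrow> a \<noteq> \<zero> \<Longrightarrow>
      \<exists>xs. set xs \<subseteq> carrier R \<and> carrier R \<subseteq> rel_span k (PIdl a) xs"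
    and quotient_dual: "\<And>a. a \<in> carrier R \<Longrightarrow> a \<noteq> \<zero> \<Longrightarrow>
      \<exists>\<mu>. ring_functional R k \<mu> \<and> ring_functional.radical R \<mu> = PIdl a"
begin

lemma kc: "x \<in> k \<Longrightarrow> x \<in> carrier R"
  using k_carrier[OF subfield_k] by auto

lemma ideal_subspace: "ideal J R \<Longrightarrow> lin_subspace R k J"
  using ideal_lin_subspace k_carrier[OF subfield_k] by blast

lemma ideal_finite_over:
  assumes "a \<in> carrier R" "a \<noteq> \<zero>" "ideal J R" "a \<in> J"
  obtains js where "set js \<subseteq> J" "J \<subseteq> rel_span k (PIdl a) js"
proof -
  obtain xs where xs: "set xs \<subseteq> carrier R" "carrier R \<subseteq> rel_span k (PIdl a) xs"
    using quotient_finite assms by blast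
  have "PIdl a \<subseteq> J" using cgenideal_minimal assms by blast
  then obtain js where "set js \<subseteq> J" "J \<inter> rel_span k (PIdl a) xs \<subseteq> rel_span k (PIdl a) js"
    using subspace_finite_over[OF subfield_k ideal_subspace[OF cgenideal_ideal[OF assms(1)]]
        ideal_subspace[OF assms(3)] _ xs(1)] by blast
  moreover have "J \<subseteq> carrier R" using ideal.Icarr[OF assms(3)] by blast
  ultimately show thesis using that xs(2) by blast
qed

text \<open>A nonzero ideal contains some \<open>aR\<close> with \<open>a \<noteq> 0\<close> and is finite dimensional modulo \<open>aR\<close>.\<close>

lemma noetherian: "noetherian_ring R"
proof (rule noetherian_ringI)
  fix J assume J: "ideal J R"
  have Jc: "J \<subseteq> carrier R" using ideal.Icarr[OF J] by blast
  show "\<exists>A\<subseteq>carrier R. finite A \<and> J = Idl A"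
  proof (cases "J \<subseteq> {\<zero>}")
    case True
    moreover have "\<zero> \<in> J" using additive_subgroup.zero_closed[OF ideal.axioms(1)[OF J]] .
    ultimately have "J = Idl {\<zero>}" unfolding genideal_zero by blast
    then show ?thesis by (intro exI[of _ "{\<zero>}"]) simp
  next
    case False
    then obtain a where a: "a \<in> J" "a \<noteq> \<zero>" by auto
    have ac: "a \<in> carrier R" using a Jc by auto
    obtain js where js: "set js \<subseteq> J" "J \<subseteq> rel_span k (PIdl a) js"
      using ideal_finite_over[OF ac a(2) J a(1)] by blast
    let ?A = "insert a (set js)"
    have A: "?A \<subseteq> carrier R" using a js Jc by auto
    have id: "ideal (Idl ?A) R" using genideal_ideal[OF A] .
    have "?A \<subseteq> Idl ?A" using genideal_self[OF A] .
    then have "rel_span k (PIdl a) js \<subseteq> Idl ?A"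
      using cgenideal_minimal[OF id]
      by (intro rel_span_min[OF subfield_k ideal_subspace[OF id]]) auto
    then have "J \<subseteq> Idl ?A" using js by blast
    moreover have "Idl ?A \<subseteq> J" by (rule genideal_minimal[OF J]) (use a js in auto)
    ultimately show ?thesis using A by (intro exI[of _ ?A]) auto
  qed
qed

text \<open>The contraction to \<open>R\<close> of the ideal generated by \<open>a\<close> in the localization at \<open>P\<close>.\<close>

definition local_part :: "'a set \<Rightarrow> 'a \<Rightarrow> 'a set" where
  "local_part P a = {b \<in> carrier R. \<exists>u\<in>carrier R - P. u \<otimes> b \<in> PIdl a}"

end

locale frobenius_domain_prime = frobenius_domain R k + P: primeideal P R for R (structure) and k P +
  fixes a
  assumes a: "a \<in> carrier R" "a \<noteq> \<zero>"
begin

abbreviation "C \<equiv> local_part P a"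

lemma complement_mult: "u \<in> carrier R - P \<Longrightarrow> v \<in> carrier R - P \<Longrightarrow> u \<otimes> v \<in> carrier R - P"
  using P.I_prime by auto

lemma complement_one: "\<one> \<in> carrier R - P"
  using P.I_notcarr P.one_imp_carrier by auto

lemma a_ideal: "ideal (PIdl a) R" using cgenideal_ideal a by simp

lemma a_ideal_carrier: "x \<in> PIdl a \<Longrightarrow> x \<in> carrier R" using ideal.Icarr[OF a_ideal] .

lemma a_ideal_closed: "x \<in> PIdl a \<Longrightarrow> r \<in> carrier R \<Longrightarrow> r \<otimes> x \<in> PIdl a"
  using ideal.I_l_closed[OF a_ideal] .

lemma local_partI: "u \<in> carrier R - P \<Longrightarrow> b \<in> carrier R \<Longrightarrow> u \<otimes> b \<in> PIdl a \<Longrightarrow> b \<in> C"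
  unfolding local_part_def by blast

lemma local_partE:
  assumes "b \<in> C"
  obtains u where "u \<in> carrier R - P" "b \<in> carrier R" "u \<otimes> b \<in> PIdl a"
  using assms unfolding local_part_def by blast

lemma local_part_base: "PIdl a \<subseteq> C"
  using local_partI[OF complement_one] a_ideal_carrier by auto

lemma local_part_cancel:
  assumes "s \<in> carrier R - P" "b \<in> carrier R" "s \<otimes> b \<in> C"
  shows "b \<in> C"
proof -
  obtain u where u: "u \<in> carrier R - P" "u \<otimes> (s \<otimes> b) \<in> PIdl a" using assms(3) by (auto elim: local_partE)
  then show ?thesis
    using local_partI[OF complement_mult[OF u(1) assms(1)] assms(2)] assms by (auto simp: m_assoc)
qed

lemma local_part_subspace: "lin_subspace R k C"
proof (rule lin_subspaceI)
  show "C \<subseteq> carrier R" by (auto simp: local_part_def)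
  show "\<zero> \<in> C"
    using local_part_base additive_subgroup.zero_closed[OF ideal.axioms(1)[OF a_ideal]] by blast
  show "x \<oplus> y \<in> C" if xy: "x \<in> C" "y \<in> C" for x y
  proof -
    obtain u where u: "u \<in> carrier R - P" "x \<in> carrier R" "u \<otimes> x \<in> PIdl a" using xy by (auto elim: local_partE)
    obtain v where v: "v \<in> carrier R - P" "y \<in> carrier R" "v \<otimes> y \<in> PIdl a" using xy by (auto elim: local_partE)
    have "(u \<otimes> v) \<otimes> (x \<oplus> y) = v \<otimes> (u \<otimes> x) \<oplus> u \<otimes> (v \<otimes> y)" using u v by (simp add: r_distr m_ac)
    also have "\<dots> \<in> PIdl a"
      using a_ideal_closed u v additive_subgroup.a_closed[OF ideal.axioms(1)[OF a_ideal]] by auto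
    finally show ?thesis using local_partI[OF complement_mult[OF u(1) v(1)]] u v by auto
  qed
  show "c \<otimes> x \<in> C" if "c \<in> k" "x \<in> C" for c x
  proof -
    obtain u where u: "u \<in> carrier R - P" "x \<in> carrier R" "u \<otimes> x \<in> PIdl a"
      using \<open>x \<in> C\<close> by (auto elim: local_partE)
    have "u \<otimes> (c \<otimes> x) = c \<otimes> (u \<otimes> x)" using u kc that by (simp add: m_lcomm)
    then show ?thesis using local_partI[OF u(1)] a_ideal_closed u kc that by auto
  qed
qed (rule subfieldE(1)[OF subfield_k])

lemma local_part_mult: "r \<in> carrier R \<Longrightarrow> x \<in> C \<Longrightarrow> r \<otimes> x \<in> C"
proof (elim local_partE)
  fix u assume r: "r \<in> carrier R" and u: "u \<in> carrier R - P" "x \<in> carrier R" "u \<otimes> x \<in> PIdl a"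
  have "u \<otimes> (r \<otimes> x) = r \<otimes> (u \<otimes> x)" using u r by (simp add: m_lcomm)
  then show "r \<otimes> x \<in> C" using local_partI[OF u(1)] a_ideal_closed u r by auto
qed

lemma local_part_ideal: "ideal C R"
proof (rule idealI[OF ring_axioms])
  show "subgroup C (add_monoid R)"
    using local_part_subspace by (simp add: lin_subspace_def additive_subgroup_def)
  show "x \<otimes> y \<in> C" if "y \<in> C" "x \<in> carrier R" for x y using local_part_mult that by blast
  then show "y \<otimes> x \<in> C" if "y \<in> C" "x \<in> carrier R" for x y
  proof -
    have "y \<in> carrier R" using that lin_subspaceD(1)[OF local_part_subspace] by blast
    then show ?thesis using that local_part_mult[of x y] m_comm[of x y] by simp
  qed
qed

text \<open>\<open>C/aR\<close> is finite dimensional, so the product of the elements \<open>u\<close> that belong to finitely many generators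
  serves for all of \<open>C\<close>.\<close>

lemma uniform_denominator: "\<exists>u\<in>carrier R - P. C = {b \<in> carrier R. u \<otimes> b \<in> PIdl a}"
proof -
  have aC: "a \<in> C" using local_part_base cgenideal_self a by blast
  obtain js where js: "set js \<subseteq> C" "C \<subseteq> rel_span k (PIdl a) js"
    using ideal_finite_over[OF a local_part_ideal aC] by blast
  have "\<exists>u\<in>carrier R - P. \<forall>j\<in>set js. u \<otimes> j \<in> PIdl a"
    using js(1)
  proof (induct js)
    case (Cons j js)
    then obtain u where u: "u \<in> carrier R - P" "\<And>j. j \<in> set js \<Longrightarrow> u \<otimes> j \<in> PIdl a" by auto
    obtain v where v: "v \<in> carrier R - P" "j \<in> carrier R" "v \<otimes> j \<in> PIdl a"
      using Cons by (auto elim: local_partE)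
    have "u \<otimes> v \<otimes> i \<in> PIdl a" if "i \<in> set (j # js)" for i
    proof (cases "i = j")
      case True
      then show ?thesis using a_ideal_closed[OF v(3), of u] u v by (simp add: m_assoc)
    next
      case False
      then have i: "i \<in> set js" "i \<in> carrier R"
        using that Cons lin_subspaceD(1)[OF local_part_subspace] by auto
      have "u \<otimes> v \<otimes> i = v \<otimes> (u \<otimes> i)" using u v i by (simp add: m_ac)
      then show ?thesis using a_ideal_closed[OF u(2)[OF i(1)], of v] v by simp
    qed
    then show ?case using complement_mult[OF u(1) v(1)] by blast
  qed (use complement_one in auto)
  then obtain u where u: "u \<in> carrier R - P" "\<And>j. j \<in> set js \<Longrightarrow> u \<otimes> j \<in> PIdl a" by blast
  let ?D = "{b \<in> carrier R. u \<otimes> b \<in> PIdl a}"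
  note aD = lin_subspaceD[OF ideal_subspace[OF a_ideal]]
  have D: "lin_subspace R k ?D"
  proof (rule lin_subspaceI)
    show "c \<otimes> x \<in> ?D" if "c \<in> k" "x \<in> ?D" for c x
    proof -
      have "u \<otimes> (c \<otimes> x) = c \<otimes> (u \<otimes> x)" using u kc that by (simp add: m_lcomm)
      then show ?thesis using a_ideal_closed[of "u \<otimes> x" c] kc that by auto
    qed
  qed (use u aD subfieldE(1)[OF subfield_k] in \<open>auto simp: r_distr\<close>)
  have "rel_span k (PIdl a) js \<subseteq> ?D"
    by (rule rel_span_min[OF subfield_k D])
      (use u js a_ideal_closed a_ideal_carrier lin_subspaceD(1)[OF local_part_subspace] in auto)
  then have "C = ?D" using js local_partI[OF u(1)] by blast
  then show ?thesis using u by blast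
qed

text \<open>\<open>R/C\<close> embeds into \<open>R/aR\<close> by multiplication with a suitable \<open>u\<close>, so it inherits a functional
  without nonzero ideals in its kernel.\<close>

lemma local_functional: "\<exists>\<mu>. ring_functional R k \<mu> \<and> ring_functional.radical R \<mu> = C"
proof -
  obtain u where u: "u \<in> carrier R - P" "C = {b \<in> carrier R. u \<otimes> b \<in> PIdl a}"
    using uniform_denominator by blast
  obtain \<mu> where mu: "ring_functional R k \<mu>" "ring_functional.radical R \<mu> = PIdl a"
    using quotient_dual a by blast
  interpret m: ring_functional R k \<mu> by fact
  let ?n = "\<lambda>b. \<mu> (u \<otimes> b)"
  have n: "ring_functional R k ?n"
  proof (intro ring_functional.intro ring_functional_axioms.intro is_cring)
    show "?n (c \<otimes> x) = c \<otimes> ?n x" if "c \<in> k" "x \<in> carrier R" for c x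
    proof -
      have "u \<otimes> (c \<otimes> x) = c \<otimes> (u \<otimes> x)" using u kc that by (simp add: m_lcomm)
      then show ?thesis using m.mu_smult that u by auto
    qed
  qed (use u m.mu_closed subfield_k m.mu_add in \<open>auto simp: r_distr\<close>)
  have "x \<in> ring_functional.radical R ?n \<longleftrightarrow> x \<in> C" if x: "x \<in> carrier R" for x
  proof -
    have "u \<otimes> (b \<otimes> x) = b \<otimes> (u \<otimes> x)" if "b \<in> carrier R" for b using u x that by (simp add: m_lcomm)
    then have "x \<in> ring_functional.radical R ?n \<longleftrightarrow> u \<otimes> x \<in> m.radical"
      using x u by (simp add: ring_functional.radical_def[OF n] m.radical_def)
    then show ?thesis using mu(2) u(2) x by auto
  qed
  then have "ring_functional.radical R ?n = C"
    using ring_functional.radical_def[OF n] lin_subspaceD(1)[OF local_part_subspace] by auto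
  then show ?thesis using n by blast
qed

text \<open>\<open>R/C\<close> is a self-injective ring: \<open>\<psi>\<close> gives representatives of an \<open>R\<close>-linear map from \<open>J\<close> to \<open>R/C\<close>. The
  functional \<open>\<mu> \<circ> \<psi>\<close> on \<open>J\<close> is represented by some \<open>b\<close>, and \<open>\<psi> j - b j\<close> pairs to zero with all of \<open>R\<close>
  because \<open>J\<close> is an ideal; hence it lies in the radical \<open>C\<close>.\<close>

lemma local_self_injective:
  assumes J: "ideal J R" "a \<in> J"
    and psi: "\<And>x. x \<in> J \<Longrightarrow> \<psi> x \<in> carrier R"
      "\<And>x y. x \<in> J \<Longrightarrow> y \<in> J \<Longrightarrow> \<psi> (x \<oplus> y) \<ominus> (\<psi> x \<oplus> \<psi> y) \<in> C"
      "\<And>r x. r \<in> carrier R \<Longrightarrow> x \<in> J \<Longrightarrow> \<psi> (r \<otimes> x) \<ominus> r \<otimes> \<psi> x \<in> C"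
      "\<And>x. x \<in> J \<Longrightarrow> x \<in> C \<Longrightarrow> \<psi> x \<in> C"
  shows "\<exists>b\<in>carrier R. \<forall>x\<in>J. \<psi> x \<ominus> b \<otimes> x \<in> C"
proof -
  obtain \<mu> where mu: "ring_functional R k \<mu>" "ring_functional.radical R \<mu> = C"
    using local_functional by blast
  interpret m: ring_functional R k \<mu> by fact
  have Jc: "J \<subseteq> carrier R" using ideal.Icarr[OF J(1)] by blast
  have muC: "\<mu> x = \<zero>" if "x \<in> C" for x
  proof -
    have "x \<in> m.radical" using that unfolding mu(2) .
    then have x: "x \<in> carrier R" "\<forall>b\<in>carrier R. \<mu> (b \<otimes> x) = \<zero>" unfolding m.radical_def by blast+
    show ?thesis using bspec[OF x(2) one_closed] l_one[OF x(1)] by (simp only:)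
  qed
  have mu_cong: "\<mu> x = \<mu> y" if "x \<ominus> y \<in> C" "x \<in> carrier R" "y \<in> carrier R" for x y
  proof -
    have "\<mu> x \<ominus> \<mu> y = \<zero>" using muC[OF that(1)] m.mu_minus[OF that(2,3)] by simp
    then show ?thesis using r_right_minus_eq that by simp
  qed
  note JD = lin_subspaceD[OF ideal_subspace[OF J(1)]]
  obtain js where js: "set js \<subseteq> J" "J \<subseteq> rel_span k (PIdl a) js"
    using ideal_finite_over[OF a J] by blast
  have "J \<subseteq> rel_span k C js"
    using js Jc rel_span_mono[OF subfield_k ideal_subspace[OF a_ideal] local_part_subspace local_part_base]
    by blast
  moreover have "\<exists>b\<in>carrier R. \<forall>x\<in>J \<inter> rel_span k m.radical js. \<mu> (\<psi> x) = \<mu> (b \<otimes> x)"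
  proof (rule m.functional_representable[OF ideal_subspace[OF J(1)] _ _ _ _ js(1)])
    show "\<mu> (\<psi> (x \<oplus> y)) = \<mu> (\<psi> x) \<oplus> \<mu> (\<psi> y)" if "x \<in> J" "y \<in> J" for x y
      using mu_cong[OF psi(2)[OF that]] psi(1) JD that by (simp add: m.mu_add)
    show "\<mu> (\<psi> (c \<otimes> x)) = c \<otimes> \<mu> (\<psi> x)" if "c \<in> k" "x \<in> J" for c x
      using mu_cong[OF psi(3)[OF kc[OF that(1)] that(2)]] psi(1) JD kc that by (simp add: m.mu_smult)
  qed (use psi mu m.mu_closed muC in auto)
  ultimately obtain b where b: "b \<in> carrier R" "\<And>x. x \<in> J \<Longrightarrow> \<mu> (\<psi> x) = \<mu> (b \<otimes> x)"
    using mu(2) by (metis IntI subsetD)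
  have "\<psi> x \<ominus> b \<otimes> x \<in> C" if x: "x \<in> J" for x
  proof -
    have xc: "x \<in> carrier R" and p: "\<psi> x \<in> carrier R" using x Jc psi by auto
    have "\<mu> (r \<otimes> (\<psi> x \<ominus> b \<otimes> x)) = \<zero>" if r: "r \<in> carrier R" for r
    proof -
      have rx: "r \<otimes> x \<in> J" using ideal.I_l_closed[OF J(1) x r] .
      have "r \<otimes> (\<psi> x \<ominus> b \<otimes> x) = r \<otimes> \<psi> x \<ominus> b \<otimes> (r \<otimes> x)" using r xc p b(1) by algebra
      then have "\<mu> (r \<otimes> (\<psi> x \<ominus> b \<otimes> x)) = \<mu> (r \<otimes> \<psi> x) \<ominus> \<mu> (b \<otimes> (r \<otimes> x))"
        using r xc p b(1) by (simp add: m.mu_minus)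
      also have "\<mu> (r \<otimes> \<psi> x) = \<mu> (\<psi> (r \<otimes> x))"
        using mu_cong[OF psi(3)[OF r x]] r p psi(1)[OF rx] by simp
      finally show ?thesis using b rx Jc r xc by (simp add: r_right_minus_eq)
    qed
    then have "\<psi> x \<ominus> b \<otimes> x \<in> m.radical" using xc p b by (simp add: m.radical_def)
    then show ?thesis using mu(2) by simp
  qed
  then have "\<forall>x\<in>J. \<psi> x \<ominus> b \<otimes> x \<in> C" by simp
  then show ?thesis using b(1) by (rule bexI)
qed

text \<open>\<open>s\<close> is regular modulo \<open>C\<close>, so division by \<open>s\<close> is a well defined linear map on \<open>(sR + C)/C\<close>. By
  self-injectivity it is multiplication by an element, which inverts \<open>s\<close>. Thus \<open>R/C\<close> is already the
  localization of \<open>R/aR\<close> at \<open>P\<close>.\<close>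

lemma local_inverse:
  assumes s: "s \<in> carrier R - P"
  shows "\<exists>s'\<in>carrier R. s \<otimes> s' \<ominus> \<one> \<in> C"
proof -
  have sc: "s \<in> carrier R" using s by auto
  let ?J = "PIdl s <+>\<^bsub>R\<^esub> C"
  have J: "ideal ?J R" using add_ideals[OF cgenideal_ideal[OF sc] local_part_ideal] .
  note CD = lin_subspaceD[OF local_part_subspace]
  note sD = lin_subspaceD[OF ideal_subspace[OF cgenideal_ideal[OF sc]]]
  define \<psi> where "\<psi> x = (SOME r. r \<in> carrier R \<and> x \<ominus> s \<otimes> r \<in> C)" for x
  have Jmem: "x \<in> ?J \<longleftrightarrow> (\<exists>r\<in>carrier R. \<exists>c\<in>C. x = r \<otimes> s \<oplus> c)" for x
    by (auto simp: set_add_def' cgenideal_def)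
  have psi: "\<psi> x \<in> carrier R \<and> x \<ominus> s \<otimes> \<psi> x \<in> C" if xJ: "x \<in> ?J" for x
  proof -
    obtain r c where rc: "r \<in> carrier R" "c \<in> C" "x = r \<otimes> s \<oplus> c" using xJ Jmem[of x] by blast
    have cc: "c \<in> carrier R" using rc CD by auto
    have "x \<ominus> s \<otimes> r = c" unfolding rc(3) using rc(1) cc sc by algebra
    then have "\<exists>r. r \<in> carrier R \<and> x \<ominus> s \<otimes> r \<in> C" using rc by auto
    then show ?thesis unfolding \<psi>_def by (rule someI_ex)
  qed
  have Jc: "x \<in> carrier R" if "x \<in> ?J" for x using ideal.Icarr[OF J that] .
  note JD = lin_subspaceD[OF ideal_subspace[OF J]]
  have "\<zero> \<otimes> s \<oplus> a \<in> ?J" using Jmem[of "\<zero> \<otimes> s \<oplus> a"] local_part_base cgenideal_self[OF a(1)] by blast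
  then have aJ: "a \<in> ?J" using a sc by simp
  have "\<exists>b\<in>carrier R. \<forall>x\<in>?J. \<psi> x \<ominus> b \<otimes> x \<in> C"
  proof (rule local_self_injective[OF J aJ])
    show "\<psi> x \<in> carrier R" if "x \<in> ?J" for x using psi that by blast
    show "\<psi> (x \<oplus> y) \<ominus> (\<psi> x \<oplus> \<psi> y) \<in> C" if xy: "x \<in> ?J" "y \<in> ?J" for x y
    proof (rule local_part_cancel[OF s])
      have c: "x \<in> carrier R" "y \<in> carrier R" "\<psi> x \<in> carrier R" "\<psi> y \<in> carrier R" "\<psi> (x \<oplus> y) \<in> carrier R"
        using psi xy Jc JD by auto
      then show "\<psi> (x \<oplus> y) \<ominus> (\<psi> x \<oplus> \<psi> y) \<in> carrier R" by auto
      have "(x \<ominus> s \<otimes> p) \<oplus> (y \<ominus> s \<otimes> q) \<ominus> (x \<oplus> y \<ominus> s \<otimes> r) = s \<otimes> (r \<ominus> (p \<oplus> q))"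
        if "p \<in> carrier R" "q \<in> carrier R" "r \<in> carrier R" for p q r
        using c(1,2) sc that by algebra
      then have "s \<otimes> (\<psi> (x \<oplus> y) \<ominus> (\<psi> x \<oplus> \<psi> y)) = (x \<ominus> s \<otimes> \<psi> x) \<oplus> (y \<ominus> s \<otimes> \<psi> y) \<ominus> (x \<oplus> y \<ominus> s \<otimes> \<psi> (x \<oplus> y))"
        using c by simp
      also have "\<dots> \<in> C" using psi[OF xy(1)] psi[OF xy(2)] psi[OF JD(3)[OF xy]] CD by auto
      finally show "s \<otimes> (\<psi> (x \<oplus> y) \<ominus> (\<psi> x \<oplus> \<psi> y)) \<in> C" .
    qed
    show "\<psi> (r \<otimes> x) \<ominus> r \<otimes> \<psi> x \<in> C" if r: "r \<in> carrier R" and x: "x \<in> ?J" for r x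
    proof (rule local_part_cancel[OF s])
      have rx: "r \<otimes> x \<in> ?J" using ideal.I_l_closed[OF J x r] .
      have c: "x \<in> carrier R" "\<psi> x \<in> carrier R" "\<psi> (r \<otimes> x) \<in> carrier R"
        using psi x rx Jc by auto
      then show "\<psi> (r \<otimes> x) \<ominus> r \<otimes> \<psi> x \<in> carrier R" using r by auto
      have "r \<otimes> (x \<ominus> s \<otimes> p) \<ominus> (r \<otimes> x \<ominus> s \<otimes> q) = s \<otimes> (q \<ominus> r \<otimes> p)"
        if "p \<in> carrier R" "q \<in> carrier R" for p q
        using c(1) r sc that by algebra
      then have "s \<otimes> (\<psi> (r \<otimes> x) \<ominus> r \<otimes> \<psi> x) = r \<otimes> (x \<ominus> s \<otimes> \<psi> x) \<ominus> (r \<otimes> x \<ominus> s \<otimes> \<psi> (r \<otimes> x))"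
        using c by simp
      also have "\<dots> \<in> C" using psi[OF x] psi[OF rx] CD local_part_mult[OF r] by auto
      finally show "s \<otimes> (\<psi> (r \<otimes> x) \<ominus> r \<otimes> \<psi> x) \<in> C" .
    qed
    show "\<psi> x \<in> C" if x: "x \<in> ?J" "x \<in> C" for x
    proof (rule local_part_cancel[OF s])
      show c: "\<psi> x \<in> carrier R" using psi x by auto
      have "x \<ominus> (x \<ominus> s \<otimes> p) = s \<otimes> p" if "p \<in> carrier R" for p
        using Jc[OF x(1)] sc that by algebra
      then have "s \<otimes> \<psi> x = x \<ominus> (x \<ominus> s \<otimes> \<psi> x)" using c by simp
      moreover have "x \<ominus> (x \<ominus> s \<otimes> \<psi> x) \<in> C" using psi[OF x(1)] x(2) CD(6) by blast
      ultimately show "s \<otimes> \<psi> x \<in> C" by simp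
    qed
  qed
  then obtain b where b: "b \<in> carrier R" "\<And>x. x \<in> ?J \<Longrightarrow> \<psi> x \<ominus> b \<otimes> x \<in> C" by blast
  have "\<one> \<otimes> s \<oplus> \<zero> \<in> ?J" using Jmem[of "\<one> \<otimes> s \<oplus> \<zero>"] CD(2) by blast
  then have sJ: "s \<in> ?J" using sc by simp
  have pc: "\<psi> s \<in> carrier R" and ps: "s \<ominus> s \<otimes> \<psi> s \<in> C" using psi[OF sJ] by auto
  have "s \<ominus> s \<otimes> p = s \<otimes> (\<one> \<ominus> p)" if "p \<in> carrier R" for p using sc that by algebra
  then have "s \<otimes> (\<one> \<ominus> \<psi> s) \<in> C" using ps pc by simp
  then have c1: "\<one> \<ominus> \<psi> s \<in> C" using local_part_cancel[OF s] pc by auto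
  have "s \<otimes> b \<ominus> \<one> = \<ominus> (p \<ominus> b \<otimes> s) \<ominus> (\<one> \<ominus> p)" if "p \<in> carrier R" for p
    using sc b(1) that by algebra
  then have "s \<otimes> b \<ominus> \<one> = \<ominus> (\<psi> s \<ominus> b \<otimes> s) \<ominus> (\<one> \<ominus> \<psi> s)" using pc by simp
  then have "s \<otimes> b \<ominus> \<one> \<in> C" using CD(6)[OF CD(5)[OF b(2)[OF sJ]] c1] by simp
  then show ?thesis using b(1) by (rule bexI)
qed

end

context frobenius_domain
begin

text \<open>For \<open>0 \<noteq> a \<in> P\<close> the ideal \<open>C = local_part P a\<close> is contained in \<open>P\<close>, and every element outside \<open>P\<close> is
  invertible modulo \<open>C\<close>.\<close>

lemma nonzero_prime_maximal:
  assumes "primeideal P R" "P \<noteq> {\<zero>}"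
  shows "maximalideal P R"
proof -
  interpret P: primeideal P R by fact
  have "\<zero> \<in> P" by simp
  then obtain a where aP: "a \<in> P" "a \<noteq> \<zero>" using assms(2) by blast
  then interpret frobenius_domain_prime R k P a
    by unfold_locales auto
  have CP: "C \<subseteq> P"
  proof
    fix b assume "b \<in> C"
    then obtain u where u: "u \<in> carrier R - P" "b \<in> carrier R" "u \<otimes> b \<in> PIdl a" by (auto elim: local_partE)
    then have "u \<otimes> b \<in> P" using cgenideal_minimal[OF P.is_ideal aP(1)] by blast
    then show "b \<in> P" using P.I_prime u by blast
  qed
  show ?thesis
  proof (rule maximalidealI[OF P.is_ideal P.I_notcarr])
    fix J assume J: "ideal J R" "P \<subseteq> J" "J \<subseteq> carrier R"
    show "J = P \<or> J = carrier R"
    proof (rule disjCI)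
      assume "J \<noteq> carrier R"
      show "J = P"
      proof (rule ccontr)
        assume "J \<noteq> P"
        then obtain s where s: "s \<in> J" "s \<in> carrier R - P" using J by blast
        obtain s' where s': "s' \<in> carrier R" "s \<otimes> s' \<ominus> \<one> \<in> C" using local_inverse[OF s(2)] by blast
        have "s \<otimes> s' \<in> J" using ideal.I_r_closed[OF J(1) s(1) s'(1)] .
        moreover have "s \<otimes> s' \<ominus> \<one> \<in> J" using s' CP J by blast
        ultimately have "s \<otimes> s' \<ominus> (s \<otimes> s' \<ominus> \<one>) \<in> J"
          using lin_subspaceD(6)[OF ideal_subspace[OF J(1)]] by blast
        moreover have "s \<otimes> s' \<ominus> (s \<otimes> s' \<ominus> \<one>) = \<one>"
          using s s' by (simp add: a_minus_def minus_add r_neg a_assoc[symmetric])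
        ultimately have "\<one> \<in> J" by simp
        then show False using ideal.one_imp_carrier[OF J(1)] \<open>J \<noteq> carrier R\<close> by blast
      qed
    qed
  qed
qed

lemma krull_dim_eq_1:
  assumes "primeideal M R" "M \<noteq> {\<zero>}"
  shows "krull_dim R = 1"
proof (rule antisym)
  let ?S = "{enat n | n. \<exists>P :: nat \<Rightarrow> 'a set.
     (\<forall>i\<le>n. primeideal (P i) R) \<and> (\<forall>i<n. P i \<subset> P (Suc i))}"
  have z: "\<zero> \<in> J" if "primeideal J R" for J
    using additive_subgroup.zero_closed[OF ideal.axioms(1)[OF primeideal.axioms(1)[OF that]]] .
  show "krull_dim R \<le> 1" unfolding krull_dim_def
  proof (rule Sup_least)
    fix x assume "x \<in> ?S"
    then obtain n P where n: "x = enat n" "\<And>i. i \<le> n \<Longrightarrow> primeideal (P i) R"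
      "\<And>i. i < n \<Longrightarrow> P i \<subset> P (Suc i)" by blast
    have "n \<le> 1"
    proof (rule ccontr)
      assume "\<not> n \<le> 1"
      then have p: "primeideal (P 0) R" "primeideal (P 1) R" "primeideal (P 2) R" "P 0 \<subset> P 1" "P 1 \<subset> P 2"
        using n(2)[of 0] n(2)[of 1] n(2)[of 2] n(3)[of 0] n(3)[of 1] by (simp_all add: numeral_2_eq_2)
      have "P 1 \<noteq> {\<zero>}" using p(4) z[OF p(1)] by auto
      then have "maximalideal (P 1) R" using nonzero_prime_maximal p(2) by blast
      then have "P 2 = P 1 \<or> P 2 = carrier R"
        using maximalideal.I_maximal[of "P 1" R "P 2"] primeideal.axioms(1)[OF p(3)] p(5)
          ideal.Icarr[OF primeideal.axioms(1)[OF p(3)]] by (meson psubset_imp_subset subsetI)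
      then show False using p(5) primeideal.I_notcarr[OF p(3)] by auto
    qed
    then show "x \<le> 1" using n(1) by (simp add: one_enat_def)
  qed
  have "enat 1 \<in> ?S"
  proof -
    let ?P = "\<lambda>i::nat. if i = 0 then {\<zero>} else M"
    have "(\<forall>i\<le>1. primeideal (?P i) R) \<and> (\<forall>i<1. ?P i \<subset> ?P (Suc i))"
      using assms z[OF assms(1)] zeroprimeideal by auto
    then have "\<exists>P :: nat \<Rightarrow> 'a set. (\<forall>i\<le>1. primeideal (P i) R) \<and> (\<forall>i<1. P i \<subset> P (Suc i))"
      by (rule exI[of _ ?P])
    then show ?thesis by (intro CollectI exI[of _ 1] conjI refl)
  qed
  then show "1 \<le> krull_dim R" unfolding krull_dim_def one_enat_def by (rule Sup_upper)
qed

end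

section \<open>Localizations of a domain\<close>

locale domain_localization = domain R + P: primeideal P R for R (structure) and P
begin

definition S where "S = carrier R - P"

definition frac :: "'a \<Rightarrow> 'a \<Rightarrow> ('a \<times> 'a) set" where
  "frac a s = loc_rel R P `` {(a, s)}"

lemma S_carrier [simp]: "s \<in> S \<Longrightarrow> s \<in> carrier R"
  and S_nonzero: "s \<in> S \<Longrightarrow> s \<noteq> \<zero>"
  and S_mult [simp]: "s \<in> S \<Longrightarrow> t \<in> S \<Longrightarrow> s \<otimes> t \<in> S"
  and S_one [simp]: "\<one> \<in> S"
  using P.I_prime P.I_notcarr P.one_imp_carrier by (auto simp: S_def)

text \<open>In a domain the factor \<open>u\<close> of \<^const>\<open>loc_rel\<close> can be cancelled.\<close>

lemma loc_rel_iff: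
  "((a, s), (b, t)) \<in> loc_rel R P \<longleftrightarrow>
     a \<in> carrier R \<and> b \<in> carrier R \<and> s \<in> S \<and> t \<in> S \<and> a \<otimes> t = b \<otimes> s"
proof -
  have "(\<exists>u\<in>S. u \<otimes> (a \<otimes> t) = u \<otimes> (b \<otimes> s)) \<longleftrightarrow> a \<otimes> t = b \<otimes> s"
    if "a \<in> carrier R" "b \<in> carrier R" "s \<in> S" "t \<in> S"
  proof
    assume "\<exists>u\<in>S. u \<otimes> (a \<otimes> t) = u \<otimes> (b \<otimes> s)"
    then obtain u where "u \<in> S" "u \<otimes> (a \<otimes> t) = u \<otimes> (b \<otimes> s)" by (rule bexE)
    then show "a \<otimes> t = b \<otimes> s" using m_lcancel[of u "a \<otimes> t" "b \<otimes> s"] S_nonzero[of u] that by simp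
  next
    assume "a \<otimes> t = b \<otimes> s"
    then show "\<exists>u\<in>S. u \<otimes> (a \<otimes> t) = u \<otimes> (b \<otimes> s)" by (intro bexI[of _ \<one>]) auto
  qed
  then show ?thesis unfolding loc_rel_def S_def by auto
qed

lemma equiv_loc_rel: "equiv (carrier R \<times> S) (loc_rel R P)"
proof (rule equivI)
  show "loc_rel R P \<subseteq> (carrier R \<times> S) \<times> (carrier R \<times> S)"
    using loc_rel_iff by auto
  show "refl_on (carrier R \<times> S) (loc_rel R P)"
    by (rule refl_onI) (auto simp: loc_rel_iff)
  show "sym (loc_rel R P)"
    by (rule symI) (auto simp: loc_rel_iff)
  show "trans (loc_rel R P)"
  proof (rule transI, clarify)
    fix a s b t c v
    assume *: "((a, s), b, t) \<in> loc_rel R P" "((b, t), c, v) \<in> loc_rel R P"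
    then have m: "a \<in> carrier R" "b \<in> carrier R" "c \<in> carrier R" "s \<in> S" "t \<in> S" "v \<in> S"
      and e: "a \<otimes> t = b \<otimes> s" "b \<otimes> v = c \<otimes> t" unfolding loc_rel_iff by auto
    have "t \<otimes> (a \<otimes> v) = (a \<otimes> t) \<otimes> v" using m by (simp add: m_ac)
    also have "\<dots> = (b \<otimes> v) \<otimes> s" unfolding e(1) using m by (simp add: m_ac)
    also have "\<dots> = t \<otimes> (c \<otimes> s)" unfolding e(2) using m by (simp add: m_ac)
    finally have "a \<otimes> v = c \<otimes> s" using m_lcancel[of t "a \<otimes> v" "c \<otimes> s"] S_nonzero[of t] m by simp
    then show "((a, s), c, v) \<in> loc_rel R P" using m by (simp add: loc_rel_iff)
  qed
qed

lemma frac_eq_iff: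
  assumes "a \<in> carrier R" "b \<in> carrier R" "s \<in> S" "t \<in> S"
  shows "frac a s = frac b t \<longleftrightarrow> a \<otimes> t = b \<otimes> s"
  using eq_equiv_class_iff[OF equiv_loc_rel, of "(a, s)" "(b, t)"] assms
  by (simp add: frac_def loc_rel_iff)

lemma frac_mem_iff: "(b, t) \<in> frac a s \<longleftrightarrow>
    a \<in> carrier R \<and> b \<in> carrier R \<and> s \<in> S \<and> t \<in> S \<and> a \<otimes> t = b \<otimes> s"
  by (simp add: frac_def loc_rel_iff)

abbreviation "A \<equiv> localization R P"

lemma A_carrier: "carrier A = {frac a s | a s. a \<in> carrier R \<and> s \<in> S}"
  unfolding localization_def frac_def quotient_def S_def by auto

lemma A_cases:
  assumes "x \<in> carrier A"
  obtains a s where "a \<in> carrier R" "s \<in> S" "x = frac a s"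
  using assms unfolding A_carrier by auto

lemma frac_closed [simp]: "a \<in> carrier R \<Longrightarrow> s \<in> S \<Longrightarrow> frac a s \<in> carrier A"
  unfolding A_carrier by auto

lemma UN_const_class:
  assumes "z \<in> Z" "\<And>x. x \<in> Z \<Longrightarrow> f x = c"
  shows "(\<Union>x\<in>Z. f x) = c"
  using assms by auto

lemma A_mult [simp]:
  assumes "a \<in> carrier R" "b \<in> carrier R" "s \<in> S" "t \<in> S"
  shows "frac a s \<otimes>\<^bsub>A\<^esub> frac b t = frac (a \<otimes> b) (s \<otimes> t)"
proof -
  have "(\<Union>x\<in>frac a s. \<Union>y\<in>frac b t. frac (fst x \<otimes> fst y) (snd x \<otimes> snd y)) = frac (a \<otimes> b) (s \<otimes> t)"
  proof (rule UN_const_class[of "(a, s)"], simp add: frac_mem_iff assms, rule UN_const_class[of "(b, t)"])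
    fix x y assume xy: "x \<in> frac a s" "y \<in> frac b t"
    obtain a' s' b' t' where [simp]: "x = (a', s')" "y = (b', t')" by (metis surj_pair)
    have m: "a' \<in> carrier R" "b' \<in> carrier R" "s' \<in> S" "t' \<in> S"
      and e: "a \<otimes> s' = a' \<otimes> s" "b \<otimes> t' = b' \<otimes> t"
      using xy by (simp_all add: frac_mem_iff)
    have "a' \<otimes> b' \<otimes> (s \<otimes> t) = (a' \<otimes> s) \<otimes> (b' \<otimes> t)" using m assms by (simp add: m_ac)
    also have "\<dots> = a \<otimes> b \<otimes> (s' \<otimes> t')" unfolding e[symmetric] using m assms by (simp add: m_ac)
    finally show "frac (fst x \<otimes> fst y) (snd x \<otimes> snd y) = frac (a \<otimes> b) (s \<otimes> t)"
      using m assms by (simp add: frac_eq_iff)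
  qed (simp add: frac_mem_iff assms)
  then show ?thesis by (simp add: localization_def frac_def[symmetric] case_prod_beta)
qed

lemma A_add [simp]:
  assumes "a \<in> carrier R" "b \<in> carrier R" "s \<in> S" "t \<in> S"
  shows "frac a s \<oplus>\<^bsub>A\<^esub> frac b t = frac (a \<otimes> t \<oplus> b \<otimes> s) (s \<otimes> t)"
proof -
  have "(\<Union>x\<in>frac a s. \<Union>y\<in>frac b t. frac (fst x \<otimes> snd y \<oplus> fst y \<otimes> snd x) (snd x \<otimes> snd y))
      = frac (a \<otimes> t \<oplus> b \<otimes> s) (s \<otimes> t)"
  proof (rule UN_const_class[of "(a, s)"], simp add: frac_mem_iff assms, rule UN_const_class[of "(b, t)"])
    fix x y assume xy: "x \<in> frac a s" "y \<in> frac b t"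
    obtain a' s' b' t' where [simp]: "x = (a', s')" "y = (b', t')" by (metis surj_pair)
    have m: "a' \<in> carrier R" "b' \<in> carrier R" "s' \<in> S" "t' \<in> S"
      and e: "a \<otimes> s' = a' \<otimes> s" "b \<otimes> t' = b' \<otimes> t"
      using xy by (simp_all add: frac_mem_iff)
    note mm = m(1,2) m(3,4)[THEN S_carrier] assms(1,2) assms(3,4)[THEN S_carrier]
    have "(a' \<otimes> t' \<oplus> b' \<otimes> s') \<otimes> (s \<otimes> t) = (a' \<otimes> s) \<otimes> (t \<otimes> t') \<oplus> (b' \<otimes> t) \<otimes> (s \<otimes> s')"
      using mm by algebra
    also have "\<dots> = (a \<otimes> s') \<otimes> (t \<otimes> t') \<oplus> (b \<otimes> t') \<otimes> (s \<otimes> s')" unfolding e ..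
    also have "\<dots> = (a \<otimes> t \<oplus> b \<otimes> s) \<otimes> (s' \<otimes> t')"
      using mm by algebra
    finally show "frac (fst x \<otimes> snd y \<oplus> fst y \<otimes> snd x) (snd x \<otimes> snd y) = frac (a \<otimes> t \<oplus> b \<otimes> s) (s \<otimes> t)"
      using m assms by (simp add: frac_eq_iff)
  qed (simp add: frac_mem_iff assms)
  then show ?thesis by (simp add: localization_def frac_def[symmetric] case_prod_beta)
qed

lemma A_one: "\<one>\<^bsub>A\<^esub> = frac \<one> \<one>" and A_zero: "\<zero>\<^bsub>A\<^esub> = frac \<zero> \<one>"
  by (simp_all add: localization_def frac_def)

lemma frac_eq_zero_iff: "a \<in> carrier R \<Longrightarrow> s \<in> S \<Longrightarrow> frac a s = \<zero>\<^bsub>A\<^esub> \<longleftrightarrow> a = \<zero>"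
  unfolding A_zero by (auto simp: frac_eq_iff)

lemma A_cring: "cring A"
proof (rule cringI)
  show "abelian_group A"
  proof (rule abelian_groupI)
    fix x y z assume "x \<in> carrier A" "y \<in> carrier A" "z \<in> carrier A"
    then obtain a s b t c v where *: "a \<in> carrier R" "s \<in> S" "x = frac a s" "b \<in> carrier R" "t \<in> S" "y = frac b t"
      "c \<in> carrier R" "v \<in> S" "z = frac c v" by (elim A_cases) blast
    note m = *(1,4,7) *(2,5,8)[THEN S_carrier]
    have "((a \<otimes> t \<oplus> b \<otimes> s) \<otimes> v \<oplus> c \<otimes> (s \<otimes> t)) = (a \<otimes> (t \<otimes> v) \<oplus> (b \<otimes> v \<oplus> c \<otimes> t) \<otimes> s)"
      using m by algebra
    then show "x \<oplus>\<^bsub>A\<^esub> y \<oplus>\<^bsub>A\<^esub> z = x \<oplus>\<^bsub>A\<^esub> (y \<oplus>\<^bsub>A\<^esub> z)" using * by (simp add: m_assoc)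
  next
    fix x y assume "x \<in> carrier A" "y \<in> carrier A"
    then obtain a s b t where *: "a \<in> carrier R" "s \<in> S" "x = frac a s" "b \<in> carrier R" "t \<in> S" "y = frac b t"
      by (elim A_cases) blast
    show "x \<oplus>\<^bsub>A\<^esub> y \<in> carrier A" using * by simp
    show "x \<oplus>\<^bsub>A\<^esub> y = y \<oplus>\<^bsub>A\<^esub> x" using * by (simp add: m_ac a_comm)
  next
    fix x assume "x \<in> carrier A"
    then obtain a s where *: "a \<in> carrier R" "s \<in> S" "x = frac a s" by (elim A_cases) blast
    show "\<zero>\<^bsub>A\<^esub> \<oplus>\<^bsub>A\<^esub> x = x" using * by (simp add: A_zero)
    have "frac (\<ominus> a) s \<oplus>\<^bsub>A\<^esub> x = \<zero>\<^bsub>A\<^esub>"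
      using * by (simp add: frac_eq_zero_iff l_minus l_neg)
    then show "\<exists>y\<in>carrier A. y \<oplus>\<^bsub>A\<^esub> x = \<zero>\<^bsub>A\<^esub>" using * by (intro bexI[of _ "frac (\<ominus> a) s"]) auto
  qed (simp add: A_zero)
  show "comm_monoid A"
  proof (rule comm_monoidI)
    fix x y z assume "x \<in> carrier A" "y \<in> carrier A" "z \<in> carrier A"
    then obtain a s b t c v where *: "a \<in> carrier R" "s \<in> S" "x = frac a s" "b \<in> carrier R" "t \<in> S" "y = frac b t"
      "c \<in> carrier R" "v \<in> S" "z = frac c v" by (elim A_cases) blast
    then show "x \<otimes>\<^bsub>A\<^esub> y \<otimes>\<^bsub>A\<^esub> z = x \<otimes>\<^bsub>A\<^esub> (y \<otimes>\<^bsub>A\<^esub> z)" by (simp add: m_assoc)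
  next
    fix x y assume "x \<in> carrier A" "y \<in> carrier A"
    then obtain a s b t where *: "a \<in> carrier R" "s \<in> S" "x = frac a s" "b \<in> carrier R" "t \<in> S" "y = frac b t"
      by (elim A_cases) blast
    then show "x \<otimes>\<^bsub>A\<^esub> y \<in> carrier A" "x \<otimes>\<^bsub>A\<^esub> y = y \<otimes>\<^bsub>A\<^esub> x" by (simp_all add: m_comm)
  next
    fix x assume "x \<in> carrier A"
    then obtain a s where *: "a \<in> carrier R" "s \<in> S" "x = frac a s" by (elim A_cases) blast
    then show "\<one>\<^bsub>A\<^esub> \<otimes>\<^bsub>A\<^esub> x = x" by (simp add: A_one)
  qed (simp add: A_one)
  fix x y z assume "x \<in> carrier A" "y \<in> carrier A" "z \<in> carrier A"
  then obtain a s b t c v where *: "a \<in> carrier R" "s \<in> S" "x = frac a s" "b \<in> carrier R" "t \<in> S" "y = frac b t"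
    "c \<in> carrier R" "v \<in> S" "z = frac c v" by (elim A_cases) blast
  note m = *(1,4,7) *(2,5,8)[THEN S_carrier]
  have "(a \<otimes> t \<oplus> b \<otimes> s) \<otimes> c \<otimes> (s \<otimes> v \<otimes> (t \<otimes> v)) =
        (a \<otimes> c \<otimes> (t \<otimes> v) \<oplus> b \<otimes> c \<otimes> (s \<otimes> v)) \<otimes> (s \<otimes> t \<otimes> v)" using m by algebra
  then show "(x \<oplus>\<^bsub>A\<^esub> y) \<otimes>\<^bsub>A\<^esub> z = x \<otimes>\<^bsub>A\<^esub> z \<oplus>\<^bsub>A\<^esub> y \<otimes>\<^bsub>A\<^esub> z"
    using * by (simp add: frac_eq_iff)
qed

end

context "domain"
begin

lemma fraction_field: "field (localization R {\<zero>})"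
proof -
  interpret Q: domain_localization R "{\<zero>}"
    using zeroprimeideal by (simp add: domain_localization_def domain_axioms)
  interpret A: cring "localization R {\<zero>}" using Q.A_cring .
  show ?thesis
  proof (rule A.cring_fieldI2)
    show "\<zero>\<^bsub>localization R {\<zero>}\<^esub> \<noteq> \<one>\<^bsub>localization R {\<zero>}\<^esub>"
      using Q.frac_eq_zero_iff[of \<one> \<one>] by (simp add: Q.A_one)
    fix x assume x: "x \<in> carrier (localization R {\<zero>})" "x \<noteq> \<zero>\<^bsub>localization R {\<zero>}\<^esub>"
    then obtain a s where *: "a \<in> carrier R" "s \<in> Q.S" "x = Q.frac a s" by (elim Q.A_cases) blast
    then have a: "a \<in> Q.S" using x Q.frac_eq_zero_iff[of a s] by (auto simp: Q.S_def)
    have "x \<otimes>\<^bsub>localization R {\<zero>}\<^esub> Q.frac s a = \<one>\<^bsub>localization R {\<zero>}\<^esub>"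
      using * a by (simp add: Q.A_one Q.frac_eq_iff m_comm)
    then show "\<exists>y\<in>carrier (localization R {\<zero>}). x \<otimes>\<^bsub>localization R {\<zero>}\<^esub> y = \<one>\<^bsub>localization R {\<zero>}\<^esub>"
      using * a by (intro bexI[of _ "Q.frac s a"]) auto
  qed
qed

end

text \<open>\<open>emb\<close> is the inclusion of the localization \<open>A\<close> at \<open>P\<close> into the fraction field \<open>F\<close>. A fraction is a
  class of pairs, and the class of the same pair in \<open>F\<close> is the image of the class in \<open>A\<close> under the relation of \<open>F\<close>.\<close>

locale fraction_localization = domain_localization R P for R (structure) and P
begin

abbreviation "F \<equiv> localization R {\<zero>}"

sublocale A: cring A by (rule A_cring)

sublocale F: field F by (rule fraction_field)

sublocale Q: domain_localization R "{\<zero>}"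
  using zeroprimeideal by (simp add: domain_localization_def domain_axioms)

definition emb :: "('a \<times> 'a) set \<Rightarrow> ('a \<times> 'a) set" where
  "emb x = loc_rel R {\<zero>} `` x"

lemma S_Q [simp]: "s \<in> S \<Longrightarrow> s \<in> Q.S"
  using S_nonzero by (auto simp: Q.S_def)

lemma emb_frac [simp]:
  assumes "a \<in> carrier R" "s \<in> S"
  shows "emb (frac a s) = Q.frac a s"
proof -
  have "emb (frac a s) = (\<Union>x\<in>frac a s. Q.frac (fst x) (snd x))"
    unfolding emb_def Q.frac_def by auto
  also have "\<dots> = Q.frac a s"
  proof (rule UN_const_class[of "(a, s)"])
    show "(a, s) \<in> frac a s" using assms by (simp add: frac_mem_iff)
    show "Q.frac (fst x) (snd x) = Q.frac a s" if "x \<in> frac a s" for x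
      using that assms by (cases x) (simp add: frac_mem_iff Q.frac_eq_iff)
  qed
  finally show ?thesis .
qed

lemma emb_hom: "emb \<in> ring_hom A F"
proof (rule ring_hom_memI)
  fix x y assume "x \<in> carrier A" "y \<in> carrier A"
  then obtain a s b t where *: "a \<in> carrier R" "s \<in> S" "x = frac a s" "b \<in> carrier R" "t \<in> S" "y = frac b t"
    by (elim A_cases) blast
  then show "emb x \<in> carrier F" "emb (x \<otimes>\<^bsub>A\<^esub> y) = emb x \<otimes>\<^bsub>F\<^esub> emb y"
    "emb (x \<oplus>\<^bsub>A\<^esub> y) = emb x \<oplus>\<^bsub>F\<^esub> emb y" by simp_all
qed (simp add: A_one Q.A_one)

lemma emb_inj: "inj_on emb (carrier A)"
proof (rule inj_onI)
  fix x y assume "x \<in> carrier A" "y \<in> carrier A" and e: "emb x = emb y"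
  then obtain a s b t where *: "a \<in> carrier R" "s \<in> S" "x = frac a s" "b \<in> carrier R" "t \<in> S" "y = frac b t"
    by (elim A_cases) blast
  then show "x = y" using e by (simp add: frac_eq_iff Q.frac_eq_iff)
qed

sublocale emb: ring_hom_cring A F emb
  by unfold_locales (rule emb_hom)

definition local_subring :: "('a \<times> 'a) set set" where
  "local_subring = emb ` carrier A"

lemma local_subring_frac [simp]: "a \<in> carrier R \<Longrightarrow> s \<in> S \<Longrightarrow> Q.frac a s \<in> local_subring"
  unfolding local_subring_def by (rule image_eqI[of _ _ "frac a s"]) auto

lemma local_subring_cases:
  assumes "x \<in> local_subring"
  obtains a s where "a \<in> carrier R" "s \<in> S" "x = Q.frac a s"
  using assms unfolding local_subring_def by (auto elim!: A_cases)

lemma local_subring_subring: "subring local_subring F"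
  unfolding local_subring_def
  using ring_hom_ring.img_is_subring[OF ring_hom_ringI2[OF A.ring_axioms F.ring_axioms emb_hom] A.carrier_is_subring] .

end

section \<open>Injective modules\<close>

lemma mod_homI:
  assumes "\<And>x. x \<in> carrier M \<Longrightarrow> f x \<in> carrier N"
    and "\<And>x y. x \<in> carrier M \<Longrightarrow> y \<in> carrier M \<Longrightarrow> f (x \<oplus>\<^bsub>M\<^esub> y) = f x \<oplus>\<^bsub>N\<^esub> f y"
    and "\<And>r x. r \<in> carrier R \<Longrightarrow> x \<in> carrier M \<Longrightarrow> f (r \<odot>\<^bsub>M\<^esub> x) = r \<odot>\<^bsub>N\<^esub> f x"
  shows "f \<in> mod_hom R M N"
  using assms by (simp add: mod_hom_def)

lemma mod_homD:
  assumes "f \<in> mod_hom R M N"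
  shows "\<And>x. x \<in> carrier M \<Longrightarrow> f x \<in> carrier N"
    and "\<And>x y. x \<in> carrier M \<Longrightarrow> y \<in> carrier M \<Longrightarrow> f (x \<oplus>\<^bsub>M\<^esub> y) = f x \<oplus>\<^bsub>N\<^esub> f y"
    and "\<And>r x. r \<in> carrier R \<Longrightarrow> x \<in> carrier M \<Longrightarrow> f (r \<odot>\<^bsub>M\<^esub> x) = r \<odot>\<^bsub>N\<^esub> f x"
  using assms by (auto simp: mod_hom_def)

lemma mod_hom_zero:
  assumes "module R M" "module R N" "f \<in> mod_hom R M N"
  shows "f \<zero>\<^bsub>M\<^esub> = \<zero>\<^bsub>N\<^esub>"
proof -
  interpret M: module R M by fact
  interpret N: module R N by fact
  have "f (\<zero>\<^bsub>R\<^esub> \<odot>\<^bsub>M\<^esub> \<zero>\<^bsub>M\<^esub>) = \<zero>\<^bsub>R\<^esub> \<odot>\<^bsub>N\<^esub> f \<zero>\<^bsub>M\<^esub>"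
    using mod_homD(3)[OF assms(3) M.R.zero_closed M.M.zero_closed] .
  then show ?thesis using mod_homD(1)[OF assms(3)] by simp
qed

lemma mod_hom_minus:
  assumes "module R M" "module R N" "f \<in> mod_hom R M N" "x \<in> carrier M" "y \<in> carrier M"
  shows "f (x \<ominus>\<^bsub>M\<^esub> y) = f x \<ominus>\<^bsub>N\<^esub> f y"
proof -
  interpret M: module R M by fact
  interpret N: module R N by fact
  note fD = mod_homD[OF assms(3)]
  have "f (\<ominus>\<^bsub>M\<^esub> y) = f ((\<ominus>\<^bsub>R\<^esub> \<one>\<^bsub>R\<^esub>) \<odot>\<^bsub>M\<^esub> y)" using assms by (simp add: M.smult_l_minus)
  also have "\<dots> = \<ominus>\<^bsub>N\<^esub> f y" using fD(3)[of "\<ominus>\<^bsub>R\<^esub> \<one>\<^bsub>R\<^esub>" y] fD(1) assms by (simp add: N.smult_l_minus)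
  finally show ?thesis using fD assms by (simp add: a_minus_def)
qed

lemma ideal_module_simps [simp]:
  "carrier (ideal_module R I) = I" "\<zero>\<^bsub>ideal_module R I\<^esub> = \<zero>\<^bsub>R\<^esub>"
  "x \<oplus>\<^bsub>ideal_module R I\<^esub> y = x \<oplus>\<^bsub>R\<^esub> y" "r \<odot>\<^bsub>ideal_module R I\<^esub> x = r \<otimes>\<^bsub>R\<^esub> x"
  by (simp_all add: ideal_module_def)

lemma (in cring) ideal_module_module:
  assumes "ideal I R"
  shows "module R (ideal_module R I)"
proof -
  interpret I: ideal I R by fact
  show ?thesis
  proof (rule moduleI)
    show "abelian_group (ideal_module R I)"
    proof (rule abelian_groupI)
      fix x assume x: "x \<in> carrier (ideal_module R I)"
      then show "\<exists>y\<in>carrier (ideal_module R I). y \<oplus>\<^bsub>ideal_module R I\<^esub> x = \<zero>\<^bsub>ideal_module R I\<^esub>"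
        by (intro bexI[of _ "\<ominus> x"]) (simp_all add: l_neg I.Icarr)
    qed (auto simp: I.Icarr a_assoc intro: a_comm)
  qed (auto simp: I.Icarr I.I_l_closed l_distr r_distr m_assoc is_cring)
qed

text \<open>Zorn's lemma is applied to the graphs of partial extensions of \<open>f\<close>, that is, to the submodules of
  \<open>B \<times> E\<close> that are single-valued and contain the graph of \<open>f\<close>. A maximal one is defined everywhere: for \<open>x\<close> outside
  its domain the map \<open>r \<mapsto> g (r x)\<close>, on the ideal of those \<open>r\<close> for which it is defined, has the form
  \<open>r \<mapsto> r e\<close>, so \<open>e\<close> is a possible value at \<open>x\<close>.\<close>

theorem baer_criterion:
  fixes R :: "('r, 'x) ring_scheme" (structure) and E :: "('r, 'e, 'y) module_scheme"
  assumes E: "module R E"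
    and baer: "\<And>J \<phi>. ideal J R \<Longrightarrow> \<phi> \<in> mod_hom R (ideal_module R J) E \<Longrightarrow>
      \<exists>e\<in>carrier E. \<forall>j\<in>J. \<phi> j = j \<odot>\<^bsub>E\<^esub> e"
  shows "injective_mod U R E"
  unfolding injective_mod_def
proof (intro conjI allI ballI impI E)
  fix A B :: "('r, 'u) module" and i f
  assume i: "i \<in> mod_hom R A B" and f: "f \<in> mod_hom R A E"
    and A: "module R A" and B: "module R B" and inj: "inj_on i (carrier A)"
  interpret E: module R E by fact
  interpret A: module R A by fact
  interpret B: module R B by fact
  note iD = mod_homD[OF i] and fD = mod_homD[OF f]
  define part where "part G \<longleftrightarrow> G \<subseteq> carrier B \<times> carrier E \<and> (\<forall>x\<in>carrier A. (i x, f x) \<in> G)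
    \<and> (\<forall>b c b' c'. (b, c) \<in> G \<longrightarrow> (b', c') \<in> G \<longrightarrow> (b \<oplus>\<^bsub>B\<^esub> b', c \<oplus>\<^bsub>E\<^esub> c') \<in> G)
    \<and> (\<forall>r\<in>carrier R. \<forall>b c. (b, c) \<in> G \<longrightarrow> (r \<odot>\<^bsub>B\<^esub> b, r \<odot>\<^bsub>E\<^esub> c) \<in> G)
    \<and> (\<forall>b c c'. (b, c) \<in> G \<longrightarrow> (b, c') \<in> G \<longrightarrow> c = c')" for G
  have partD: "\<And>b c. (b, c) \<in> G \<Longrightarrow> b \<in> carrier B \<and> c \<in> carrier E"
    "\<And>x. x \<in> carrier A \<Longrightarrow> (i x, f x) \<in> G"
    "\<And>b c b' c'. (b, c) \<in> G \<Longrightarrow> (b', c') \<in> G \<Longrightarrow> (b \<oplus>\<^bsub>B\<^esub> b', c \<oplus>\<^bsub>E\<^esub> c') \<in> G"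
    "\<And>r b c. r \<in> carrier R \<Longrightarrow> (b, c) \<in> G \<Longrightarrow> (r \<odot>\<^bsub>B\<^esub> b, r \<odot>\<^bsub>E\<^esub> c) \<in> G"
    "\<And>b c c'. (b, c) \<in> G \<Longrightarrow> (b, c') \<in> G \<Longrightarrow> c = c'"
    if "part G" for G
    using that unfolding part_def by (blast, blast, blast, blast, blast)
  let ?G0 = "(\<lambda>x. (i x, f x)) ` carrier A"
  have G0: "part ?G0" unfolding part_def
  proof (intro conjI)
    show "\<forall>b c b' c'. (b, c) \<in> ?G0 \<longrightarrow> (b', c') \<in> ?G0 \<longrightarrow> (b \<oplus>\<^bsub>B\<^esub> b', c \<oplus>\<^bsub>E\<^esub> c') \<in> ?G0"
    proof (intro allI impI)
      fix b c b' c' assume "(b, c) \<in> ?G0" "(b', c') \<in> ?G0"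
      then obtain x y where "x \<in> carrier A" "y \<in> carrier A" "b = i x" "c = f x" "b' = i y" "c' = f y" by auto
      then show "(b \<oplus>\<^bsub>B\<^esub> b', c \<oplus>\<^bsub>E\<^esub> c') \<in> ?G0"
        by (intro image_eqI[of _ _ "x \<oplus>\<^bsub>A\<^esub> y"]) (simp_all add: iD fD)
    qed
    show "\<forall>r\<in>carrier R. \<forall>b c. (b, c) \<in> ?G0 \<longrightarrow> (r \<odot>\<^bsub>B\<^esub> b, r \<odot>\<^bsub>E\<^esub> c) \<in> ?G0"
    proof (intro ballI allI impI)
      fix r b c assume r: "r \<in> carrier R" and "(b, c) \<in> ?G0"
      then obtain x where "x \<in> carrier A" "b = i x" "c = f x" by auto
      then show "(r \<odot>\<^bsub>B\<^esub> b, r \<odot>\<^bsub>E\<^esub> c) \<in> ?G0" using r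
        by (intro image_eqI[of _ _ "r \<odot>\<^bsub>A\<^esub> x"]) (simp_all add: iD fD)
    qed
    show "\<forall>b c c'. (b, c) \<in> ?G0 \<longrightarrow> (b, c') \<in> ?G0 \<longrightarrow> c = c'"
      using inj by (auto dest: inj_onD)
  qed (use iD fD in auto)
  have "\<exists>G\<in>Collect part. \<forall>G'\<in>Collect part. G \<subseteq> G' \<longrightarrow> G' = G"
  proof (rule subset_Zorn_nonempty)
    show "Collect part \<noteq> {}" using G0 by blast
    fix \<C> assume ne: "\<C> \<noteq> {}" and ch: "subset.chain (Collect part) \<C>"
    then have P: "\<And>G. G \<in> \<C> \<Longrightarrow> part G" and lin: "\<And>G G'. G \<in> \<C> \<Longrightarrow> G' \<in> \<C> \<Longrightarrow> G \<subseteq> G' \<or> G' \<subseteq> G"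
      by (auto simp: subset_chain_def)
    have two: "\<exists>G\<in>\<C>. p \<in> G \<and> q \<in> G" if pq: "p \<in> \<Union>\<C>" "q \<in> \<Union>\<C>" for p q
    proof -
      obtain G G' where G: "G \<in> \<C>" "p \<in> G" "G' \<in> \<C>" "q \<in> G'" using pq by blast
      then show ?thesis using lin[of G G'] by blast
    qed
    have "part (\<Union>\<C>)" unfolding part_def
    proof (intro conjI)
      show "\<Union>\<C> \<subseteq> carrier B \<times> carrier E" using P partD(1) by fastforce
      show "\<forall>x\<in>carrier A. (i x, f x) \<in> \<Union>\<C>" using ne P partD(2) by blast
      show "\<forall>b c b' c'. (b, c) \<in> \<Union>\<C> \<longrightarrow> (b', c') \<in> \<Union>\<C> \<longrightarrow> (b \<oplus>\<^bsub>B\<^esub> b', c \<oplus>\<^bsub>E\<^esub> c') \<in> \<Union>\<C>"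
      proof (intro allI impI)
        fix b c b' c' assume "(b, c) \<in> \<Union>\<C>" "(b', c') \<in> \<Union>\<C>"
        then obtain G where "G \<in> \<C>" "(b, c) \<in> G" "(b', c') \<in> G" using two by blast
        then show "(b \<oplus>\<^bsub>B\<^esub> b', c \<oplus>\<^bsub>E\<^esub> c') \<in> \<Union>\<C>" using partD(3)[OF P] by (intro UnionI)
      qed
      show "\<forall>r\<in>carrier R. \<forall>b c. (b, c) \<in> \<Union>\<C> \<longrightarrow> (r \<odot>\<^bsub>B\<^esub> b, r \<odot>\<^bsub>E\<^esub> c) \<in> \<Union>\<C>"
        using partD(4)[OF P] by (meson UnionE UnionI)
      show "\<forall>b c c'. (b, c) \<in> \<Union>\<C> \<longrightarrow> (b, c') \<in> \<Union>\<C> \<longrightarrow> c = c'"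
        using partD(5)[OF P] two by meson
    qed
    then show "\<Union>\<C> \<in> Collect part" by simp
  qed
  then obtain G where G: "part G" and max: "\<And>G'. part G' \<Longrightarrow> G \<subseteq> G' \<Longrightarrow> G' = G" by blast
  note GD = partD[OF G]
  have zero: "(\<zero>\<^bsub>B\<^esub>, \<zero>\<^bsub>E\<^esub>) \<in> G"
    using GD(4)[of "\<zero>" "i \<zero>\<^bsub>A\<^esub>" "f \<zero>\<^bsub>A\<^esub>"] GD(2)[of "\<zero>\<^bsub>A\<^esub>"] iD(1) fD(1) by simp
  have minus: "(b \<ominus>\<^bsub>B\<^esub> b', c \<ominus>\<^bsub>E\<^esub> c') \<in> G" if "(b, c) \<in> G" "(b', c') \<in> G" for b c b' c'
    using GD(3)[OF that(1) GD(4)[of "\<ominus> \<one>", OF _ that(2)]] GD(1)[OF that(2)] E.R.one_closed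
    by (simp add: B.smult_l_minus E.smult_l_minus a_minus_def)
  have total: "\<exists>c. (x, c) \<in> G" if x: "x \<in> carrier B" for x
  proof -
    let ?J = "{r \<in> carrier R. \<exists>c. (r \<odot>\<^bsub>B\<^esub> x, c) \<in> G}"
    define \<phi> where "\<phi> r = (THE c. (r \<odot>\<^bsub>B\<^esub> x, c) \<in> G)" for r
    have phi_eq: "\<phi> r = c" if "(r \<odot>\<^bsub>B\<^esub> x, c) \<in> G" for r c
      unfolding \<phi>_def using that GD(5) by (intro the_equality)
    have phi: "(r \<odot>\<^bsub>B\<^esub> x, \<phi> r) \<in> G" if "r \<in> ?J" for r
      using that phi_eq by auto
    have J: "ideal ?J R"
    proof (rule idealI[OF E.R.ring_axioms])
      show "subgroup ?J (add_monoid R)"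
      proof (rule E.R.add.subgroupI)
        show "?J \<noteq> {}" using zero x by (auto intro!: exI[of _ "\<zero>"])
        fix r assume r: "r \<in> ?J"
        then have "(\<zero>\<^bsub>B\<^esub> \<ominus>\<^bsub>B\<^esub> r \<odot>\<^bsub>B\<^esub> x, \<zero>\<^bsub>E\<^esub> \<ominus>\<^bsub>E\<^esub> \<phi> r) \<in> G" using minus[OF zero phi] by blast
        then show "\<ominus> r \<in> ?J" using r x
          by (auto simp: B.smult_l_minus a_minus_def)
        fix s assume s: "s \<in> ?J"
        have "(r \<odot>\<^bsub>B\<^esub> x \<oplus>\<^bsub>B\<^esub> s \<odot>\<^bsub>B\<^esub> x, \<phi> r \<oplus>\<^bsub>E\<^esub> \<phi> s) \<in> G" using GD(3)[OF phi[OF r] phi[OF s]] .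
        then have "((r \<oplus> s) \<odot>\<^bsub>B\<^esub> x, \<phi> r \<oplus>\<^bsub>E\<^esub> \<phi> s) \<in> G" using r s x by (simp add: B.smult_l_distr)
        then show "r \<oplus> s \<in> ?J" using r s by auto
      qed auto
      fix r s assume r: "r \<in> ?J" and s: "s \<in> carrier R"
      have "(s \<odot>\<^bsub>B\<^esub> (r \<odot>\<^bsub>B\<^esub> x), s \<odot>\<^bsub>E\<^esub> \<phi> r) \<in> G" using GD(4)[OF s phi[OF r]] .
      then have "((s \<otimes> r) \<odot>\<^bsub>B\<^esub> x, s \<odot>\<^bsub>E\<^esub> \<phi> r) \<in> G" using r s x by (simp add: B.smult_assoc1)
      then show "s \<otimes> r \<in> ?J" using r s by auto
      then show "r \<otimes> s \<in> ?J" using r s by (simp add: E.R.m_comm)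
    qed
    have "\<phi> \<in> mod_hom R (ideal_module R ?J) E"
    proof (rule mod_homI)
      fix r assume "r \<in> carrier (ideal_module R ?J)"
      then have r: "r \<in> ?J" by simp
      show "\<phi> r \<in> carrier E" using GD(1)[OF phi[OF r]] by blast
      fix s assume "s \<in> carrier (ideal_module R ?J)"
      then have s: "s \<in> ?J" by simp
      have "((r \<oplus> s) \<odot>\<^bsub>B\<^esub> x, \<phi> r \<oplus>\<^bsub>E\<^esub> \<phi> s) \<in> G"
        using GD(3)[OF phi[OF r] phi[OF s]] r s x by (simp add: B.smult_l_distr)
      then show "\<phi> (r \<oplus>\<^bsub>ideal_module R ?J\<^esub> s) = \<phi> r \<oplus>\<^bsub>E\<^esub> \<phi> s" using phi_eq by simp
    next
      fix s r assume s: "s \<in> carrier R" and "r \<in> carrier (ideal_module R ?J)"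
      then have r: "r \<in> ?J" by simp
      have "((s \<otimes> r) \<odot>\<^bsub>B\<^esub> x, s \<odot>\<^bsub>E\<^esub> \<phi> r) \<in> G"
        using GD(4)[OF s phi[OF r]] r s x by (simp add: B.smult_assoc1)
      then show "\<phi> (s \<odot>\<^bsub>ideal_module R ?J\<^esub> r) = s \<odot>\<^bsub>E\<^esub> \<phi> r" using phi_eq by simp
    qed
    then obtain e where e: "e \<in> carrier E" "\<And>r. r \<in> ?J \<Longrightarrow> \<phi> r = r \<odot>\<^bsub>E\<^esub> e"
      using baer[OF J] by blast
    \<comment> \<open>The extension of \<open>G\<close> by \<open>x \<mapsto> e\<close>; it is single-valued by the choice of \<open>e\<close>.\<close>
    define G' where "G' = {(b \<oplus>\<^bsub>B\<^esub> r \<odot>\<^bsub>B\<^esub> x, c \<oplus>\<^bsub>E\<^esub> r \<odot>\<^bsub>E\<^esub> e) | b c r. (b, c) \<in> G \<and> r \<in> carrier R}"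
    have G'I: "(b', c') \<in> G'" if "(b, c) \<in> G" "r \<in> carrier R" "b' = b \<oplus>\<^bsub>B\<^esub> r \<odot>\<^bsub>B\<^esub> x" "c' = c \<oplus>\<^bsub>E\<^esub> r \<odot>\<^bsub>E\<^esub> e"
      for b c r b' c' using that unfolding G'_def by blast
    have G'E: "\<exists>b c r. (b, c) \<in> G \<and> b \<in> carrier B \<and> c \<in> carrier E \<and> r \<in> carrier R \<and>
        b' = b \<oplus>\<^bsub>B\<^esub> r \<odot>\<^bsub>B\<^esub> x \<and> c' = c \<oplus>\<^bsub>E\<^esub> r \<odot>\<^bsub>E\<^esub> e" if "(b', c') \<in> G'" for b' c'
      using that GD(1) unfolding G'_def by blast
    have sub: "G \<subseteq> G'"
    proof (rule subrelI)
      fix b c assume bc: "(b, c) \<in> G"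
      show "(b, c) \<in> G'" using GD(1)[OF bc] x e by (intro G'I[OF bc E.R.zero_closed]) auto
    qed
    have "part G'" unfolding part_def
    proof (intro conjI)
      show "G' \<subseteq> carrier B \<times> carrier E" using G'E x e(1) by fastforce
      show "\<forall>y\<in>carrier A. (i y, f y) \<in> G'" using sub GD(2) by blast
      show "\<forall>b c b' c'. (b, c) \<in> G' \<longrightarrow> (b', c') \<in> G' \<longrightarrow> (b \<oplus>\<^bsub>B\<^esub> b', c \<oplus>\<^bsub>E\<^esub> c') \<in> G'"
      proof (intro allI impI)
        fix b1 c1 b2 c2 assume "(b1, c1) \<in> G'" "(b2, c2) \<in> G'"
        then obtain b c r b' c' s where *: "(b, c) \<in> G" "b \<in> carrier B" "c \<in> carrier E" "r \<in> carrier R"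
          "b1 = b \<oplus>\<^bsub>B\<^esub> r \<odot>\<^bsub>B\<^esub> x" "c1 = c \<oplus>\<^bsub>E\<^esub> r \<odot>\<^bsub>E\<^esub> e"
          "(b', c') \<in> G" "b' \<in> carrier B" "c' \<in> carrier E" "s \<in> carrier R"
          "b2 = b' \<oplus>\<^bsub>B\<^esub> s \<odot>\<^bsub>B\<^esub> x" "c2 = c' \<oplus>\<^bsub>E\<^esub> s \<odot>\<^bsub>E\<^esub> e" by (auto dest!: G'E)
        show "(b1 \<oplus>\<^bsub>B\<^esub> b2, c1 \<oplus>\<^bsub>E\<^esub> c2) \<in> G'"
          by (rule G'I[OF GD(3)[OF *(1,7)], of "r \<oplus> s"])
            (use * x e(1) in \<open>simp_all add: B.smult_l_distr E.smult_l_distr B.add.m_ac E.add.m_ac\<close>)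
      qed
      show "\<forall>s\<in>carrier R. \<forall>b c. (b, c) \<in> G' \<longrightarrow> (s \<odot>\<^bsub>B\<^esub> b, s \<odot>\<^bsub>E\<^esub> c) \<in> G'"
      proof (intro ballI allI impI)
        fix s b1 c1 assume s: "s \<in> carrier R" and "(b1, c1) \<in> G'"
        then obtain b c r where *: "(b, c) \<in> G" "b \<in> carrier B" "c \<in> carrier E" "r \<in> carrier R"
          "b1 = b \<oplus>\<^bsub>B\<^esub> r \<odot>\<^bsub>B\<^esub> x" "c1 = c \<oplus>\<^bsub>E\<^esub> r \<odot>\<^bsub>E\<^esub> e" by (auto dest!: G'E)
        show "(s \<odot>\<^bsub>B\<^esub> b1, s \<odot>\<^bsub>E\<^esub> c1) \<in> G'"
          by (rule G'I[OF GD(4)[OF s *(1)], of "s \<otimes> r"])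
            (use * s x e(1) in \<open>simp_all add: B.smult_r_distr E.smult_r_distr B.smult_assoc1 E.smult_assoc1\<close>)
      qed
      show "\<forall>b c c'. (b, c) \<in> G' \<longrightarrow> (b, c') \<in> G' \<longrightarrow> c = c'"
      proof (intro allI impI)
        fix b1 c1 c2 assume "(b1, c1) \<in> G'" "(b1, c2) \<in> G'"
        then obtain b c r b' c' s where *: "(b, c) \<in> G" "b \<in> carrier B" "c \<in> carrier E" "r \<in> carrier R"
          "b1 = b \<oplus>\<^bsub>B\<^esub> r \<odot>\<^bsub>B\<^esub> x" "c1 = c \<oplus>\<^bsub>E\<^esub> r \<odot>\<^bsub>E\<^esub> e"
          "(b', c') \<in> G" "b' \<in> carrier B" "c' \<in> carrier E" "s \<in> carrier R"
          "b1 = b' \<oplus>\<^bsub>B\<^esub> s \<odot>\<^bsub>B\<^esub> x" "c2 = c' \<oplus>\<^bsub>E\<^esub> s \<odot>\<^bsub>E\<^esub> e" by (auto dest!: G'E)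
        have grp: "r' = b' \<ominus>\<^bsub>M\<^esub> b \<oplus>\<^bsub>M\<^esub> s'"
          if "abelian_group M" "b \<oplus>\<^bsub>M\<^esub> r' = b' \<oplus>\<^bsub>M\<^esub> s'" "b \<in> carrier M" "r' \<in> carrier M" "b' \<in> carrier M" "s' \<in> carrier M"
          for M :: "('r, 'u) module" and b r' b' s'
        proof -
          interpret M: abelian_group M by fact
          have "r' = (b \<oplus>\<^bsub>M\<^esub> r') \<ominus>\<^bsub>M\<^esub> b" using that(3,4) by (simp add: a_minus_def M.a_comm[of b r'] M.a_assoc M.r_neg)
          moreover have "(b' \<oplus>\<^bsub>M\<^esub> s') \<ominus>\<^bsub>M\<^esub> b = b' \<ominus>\<^bsub>M\<^esub> b \<oplus>\<^bsub>M\<^esub> s'"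
            using that(3,5,6) by (simp add: a_minus_def M.a_ac)
          ultimately show ?thesis using that(2) by simp
        qed
        have "r \<odot>\<^bsub>B\<^esub> x = b' \<ominus>\<^bsub>B\<^esub> b \<oplus>\<^bsub>B\<^esub> s \<odot>\<^bsub>B\<^esub> x"
          using * x by (intro grp[OF B.abelian_group_axioms]) auto
        then have "r \<odot>\<^bsub>B\<^esub> x \<ominus>\<^bsub>B\<^esub> s \<odot>\<^bsub>B\<^esub> x = b' \<ominus>\<^bsub>B\<^esub> b"
          using * x by (simp add: a_minus_def B.a_assoc B.r_neg)
        then have rs: "(r \<ominus> s) \<odot>\<^bsub>B\<^esub> x = b' \<ominus>\<^bsub>B\<^esub> b"
          using * x by (simp add: a_minus_def B.smult_l_distr B.smult_l_minus)
        have "((r \<ominus> s) \<odot>\<^bsub>B\<^esub> x, c' \<ominus>\<^bsub>E\<^esub> c) \<in> G" unfolding rs using minus[OF *(7,1)] .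
        then have "c' \<ominus>\<^bsub>E\<^esub> c = (r \<ominus> s) \<odot>\<^bsub>E\<^esub> e" using e(2)[of "r \<ominus> s"] phi_eq * by auto
        then have "c' \<ominus>\<^bsub>E\<^esub> c = r \<odot>\<^bsub>E\<^esub> e \<ominus>\<^bsub>E\<^esub> s \<odot>\<^bsub>E\<^esub> e"
          using * e(1) by (simp add: a_minus_def E.smult_l_distr E.smult_l_minus)
        then have "c \<oplus>\<^bsub>E\<^esub> (c' \<ominus>\<^bsub>E\<^esub> c) \<oplus>\<^bsub>E\<^esub> s \<odot>\<^bsub>E\<^esub> e = c \<oplus>\<^bsub>E\<^esub> (r \<odot>\<^bsub>E\<^esub> e \<ominus>\<^bsub>E\<^esub> s \<odot>\<^bsub>E\<^esub> e) \<oplus>\<^bsub>E\<^esub> s \<odot>\<^bsub>E\<^esub> e"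
          by simp
        then show "c1 = c2" using * e(1)
          by (simp add: a_minus_def E.a_assoc E.l_neg E.r_neg E.add.m_ac E.r_neg1 E.r_neg2)
      qed
    qed
    then have "G' = G" using max sub by blast
    moreover have "(x, e) \<in> G'" using x e(1) by (intro G'I[OF zero E.R.one_closed]) auto
    ultimately show ?thesis by blast
  qed
  define g where "g b = (THE c. (b, c) \<in> G)" for b
  have g_eq: "g b = c" if "(b, c) \<in> G" for b c
    unfolding g_def using that GD(5) by (intro the_equality)
  have g: "(b, g b) \<in> G" if "b \<in> carrier B" for b
    using total[OF that] g_eq by auto
  show "\<exists>g\<in>mod_hom R B E. \<forall>x\<in>carrier A. g (i x) = f x"
  proof (rule bexI[of _ g])
    show "\<forall>x\<in>carrier A. g (i x) = f x" using g_eq GD(2) by simp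
    show "g \<in> mod_hom R B E"
      by (rule mod_homI) (use GD(1)[OF g] g_eq[OF GD(3)[OF g g]] g_eq[OF GD(4)[OF _ g]] in simp_all)
  qed
qed

text \<open>The quotient \<open>M/N\<close>, realized on an arbitrary type through a map \<open>enc\<close> on \<open>M\<close> whose fibres are
  the cosets of \<open>N\<close>.\<close>

definition push_module :: "('r, 'm, 'y) module_scheme \<Rightarrow> ('m \<Rightarrow> 'e) \<Rightarrow> ('r, 'e) module" where
  "push_module M enc = \<lparr>carrier = enc ` carrier M,
     monoid.mult = (\<lambda>u v. enc \<zero>\<^bsub>M\<^esub>), one = enc \<zero>\<^bsub>M\<^esub>, ring.zero = enc \<zero>\<^bsub>M\<^esub>,
     ring.add = (\<lambda>u v. enc (inv_into (carrier M) enc u \<oplus>\<^bsub>M\<^esub> inv_into (carrier M) enc v)),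
     smult = (\<lambda>r u. enc (r \<odot>\<^bsub>M\<^esub> inv_into (carrier M) enc u))\<rparr>"

locale module_push = module R M for R (structure) and M :: "('r, 'm, 'y) module_scheme" (structure) +
  fixes N :: "'m set" and enc :: "'m \<Rightarrow> 'e"
  assumes submod: "submodule N R M"
    and enc_eq_iff: "\<And>x y. x \<in> carrier M \<Longrightarrow> y \<in> carrier M \<Longrightarrow> enc x = enc y \<longleftrightarrow> x \<ominus>\<^bsub>M\<^esub> y \<in> N"
begin

abbreviation "E \<equiv> push_module M enc"

abbreviation "dec \<equiv> inv_into (carrier M) enc"

lemmas N_props = submoduleE[OF submod]

lemma E_carrier: "carrier E = enc ` carrier M"
  by (simp add: push_module_def)

lemma dec_closed: "u \<in> carrier E \<Longrightarrow> dec u \<in> carrier M"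
  by (simp add: E_carrier inv_into_into)

lemma enc_dec: "u \<in> carrier E \<Longrightarrow> enc (dec u) = u"
  by (simp add: E_carrier f_inv_into_f)

lemma dec_enc: "x \<in> carrier M \<Longrightarrow> dec (enc x) \<ominus>\<^bsub>M\<^esub> x \<in> N"
  using enc_eq_iff[of "dec (enc x)" x] enc_dec[of "enc x"] dec_closed[of "enc x"] by (simp add: E_carrier)

lemma E_zero: "\<zero>\<^bsub>E\<^esub> = enc \<zero>\<^bsub>M\<^esub>"
  by (simp add: push_module_def)

lemma enc_eq_zero_iff: "x \<in> carrier M \<Longrightarrow> enc x = \<zero>\<^bsub>E\<^esub> \<longleftrightarrow> x \<in> N"
proof -
  assume x: "x \<in> carrier M"
  have "\<ominus>\<^bsub>M\<^esub> \<zero>\<^bsub>M\<^esub> = \<zero>\<^bsub>M\<^esub>" by (rule M.minus_equality) auto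
  then have "x \<ominus>\<^bsub>M\<^esub> \<zero>\<^bsub>M\<^esub> = x" unfolding a_minus_def using x by (metis M.r_zero)
  then show ?thesis using enc_eq_iff[OF x M.zero_closed] by (simp add: E_zero)
qed

lemma enc_add:
  assumes "x \<in> carrier M" "y \<in> carrier M"
  shows "enc x \<oplus>\<^bsub>E\<^esub> enc y = enc (x \<oplus>\<^bsub>M\<^esub> y)"
proof -
  have c: "dec (enc x) \<in> carrier M" "dec (enc y) \<in> carrier M"
    using assms dec_closed by (auto simp: E_carrier)
  have "(dec (enc x) \<oplus>\<^bsub>M\<^esub> dec (enc y)) \<ominus>\<^bsub>M\<^esub> (x \<oplus>\<^bsub>M\<^esub> y) = (dec (enc x) \<ominus>\<^bsub>M\<^esub> x) \<oplus>\<^bsub>M\<^esub> (dec (enc y) \<ominus>\<^bsub>M\<^esub> y)"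
    using assms c by (simp add: a_minus_def M.add.m_ac M.minus_add)
  also have "\<dots> \<in> N" using N_props(5) dec_enc assms by simp
  finally show ?thesis using assms c by (simp add: push_module_def enc_eq_iff)
qed

lemma enc_smult:
  assumes "r \<in> carrier R" "x \<in> carrier M"
  shows "r \<odot>\<^bsub>E\<^esub> enc x = enc (r \<odot>\<^bsub>M\<^esub> x)"
proof -
  have c: "dec (enc x) \<in> carrier M" using assms dec_closed by (auto simp: E_carrier)
  have "r \<odot>\<^bsub>M\<^esub> dec (enc x) \<ominus>\<^bsub>M\<^esub> r \<odot>\<^bsub>M\<^esub> x = r \<odot>\<^bsub>M\<^esub> (dec (enc x) \<ominus>\<^bsub>M\<^esub> x)"
    using assms c by (simp add: a_minus_def smult_r_distr smult_r_minus)
  also have "\<dots> \<in> N" using N_props(4) dec_enc assms by simp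
  finally show ?thesis using assms c by (simp add: push_module_def enc_eq_iff)
qed

lemma E_cases:
  assumes "u \<in> carrier E"
  obtains x where "x \<in> carrier M" "u = enc x"
  using assms by (auto simp: E_carrier)

lemma enc_closed: "x \<in> carrier M \<Longrightarrow> enc x \<in> carrier E"
  by (simp add: E_carrier)

lemma push_module_module: "module R E"
proof (rule moduleI)
  show "abelian_group E"
  proof (rule abelian_groupI)
    fix u v w assume "u \<in> carrier E" "v \<in> carrier E" "w \<in> carrier E"
    then show "u \<oplus>\<^bsub>E\<^esub> v \<oplus>\<^bsub>E\<^esub> w = u \<oplus>\<^bsub>E\<^esub> (v \<oplus>\<^bsub>E\<^esub> w)"
      by (elim E_cases) (simp add: enc_add M.a_assoc)
  next
    fix u v assume "u \<in> carrier E" "v \<in> carrier E"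
    then show "u \<oplus>\<^bsub>E\<^esub> v \<in> carrier E" "u \<oplus>\<^bsub>E\<^esub> v = v \<oplus>\<^bsub>E\<^esub> u"
      by (elim E_cases, simp add: enc_add enc_closed M.a_comm)+
  next
    fix u assume "u \<in> carrier E"
    then obtain x where x: "x \<in> carrier M" "u = enc x" by (rule E_cases)
    then show "\<zero>\<^bsub>E\<^esub> \<oplus>\<^bsub>E\<^esub> u = u" by (simp add: E_zero enc_add)
    show "\<exists>v\<in>carrier E. v \<oplus>\<^bsub>E\<^esub> u = \<zero>\<^bsub>E\<^esub>"
      using x by (intro bexI[of _ "enc (\<ominus>\<^bsub>M\<^esub> x)"]) (simp_all add: E_zero enc_add enc_closed M.l_neg)
  qed (simp add: E_zero enc_closed)
  fix r s u v assume r: "r \<in> carrier R" and s: "s \<in> carrier R" and u: "u \<in> carrier E" and v: "v \<in> carrier E"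
  show "(r \<oplus> s) \<odot>\<^bsub>E\<^esub> u = r \<odot>\<^bsub>E\<^esub> u \<oplus>\<^bsub>E\<^esub> s \<odot>\<^bsub>E\<^esub> u"
    using u r s by (elim E_cases) (simp add: enc_add enc_smult smult_l_distr)
  show "r \<odot>\<^bsub>E\<^esub> (u \<oplus>\<^bsub>E\<^esub> v) = r \<odot>\<^bsub>E\<^esub> u \<oplus>\<^bsub>E\<^esub> r \<odot>\<^bsub>E\<^esub> v"
    using u v r by (elim E_cases) (simp add: enc_add enc_smult smult_r_distr)
  show "(r \<otimes> s) \<odot>\<^bsub>E\<^esub> u = r \<odot>\<^bsub>E\<^esub> (s \<odot>\<^bsub>E\<^esub> u)"
    using u r s by (elim E_cases) (simp add: enc_add enc_smult smult_assoc1)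
  show "r \<odot>\<^bsub>E\<^esub> u \<in> carrier E"
    using u r by (elim E_cases) (simp add: enc_smult enc_closed)
next
  fix u assume u: "u \<in> carrier E"
  then show "\<one> \<odot>\<^bsub>E\<^esub> u = u" by (elim E_cases) (simp add: enc_smult)
qed (rule R.is_cring)

text \<open>A map from an ideal to \<open>M/N\<close> is lifted to a family \<open>x\<close> of representatives in \<open>M\<close>, which is linear modulo
  \<open>N\<close>. Then injectivity of \<open>M/N\<close> can be tested within \<open>M\<close>, without mention of the encoding.\<close>

lemma push_injective:
  assumes "\<And>J x. ideal J R \<Longrightarrow> (\<And>j. j \<in> J \<Longrightarrow> x j \<in> carrier M) \<Longrightarrow>
      (\<And>i j. i \<in> J \<Longrightarrow> j \<in> J \<Longrightarrow> x (i \<oplus> j) \<ominus>\<^bsub>M\<^esub> (x i \<oplus>\<^bsub>M\<^esub> x j) \<in> N) \<Longrightarrow>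
      (\<And>r j. r \<in> carrier R \<Longrightarrow> j \<in> J \<Longrightarrow> x (r \<otimes> j) \<ominus>\<^bsub>M\<^esub> r \<odot>\<^bsub>M\<^esub> x j \<in> N) \<Longrightarrow>
      \<exists>e\<in>carrier M. \<forall>j\<in>J. x j \<ominus>\<^bsub>M\<^esub> j \<odot>\<^bsub>M\<^esub> e \<in> N"
  shows "injective_mod U R E"
proof (rule baer_criterion[OF push_module_module])
  fix J \<phi> assume J: "ideal J R" and phi: "\<phi> \<in> mod_hom R (ideal_module R J) E"
  note pD = mod_homD[OF phi, simplified]
  have x: "dec (\<phi> j) \<in> carrier M" "enc (dec (\<phi> j)) = \<phi> j" if "j \<in> J" for j
    using dec_closed enc_dec pD(1)[OF that] by auto
  have cl: "i \<oplus> j \<in> J" if "i \<in> J" "j \<in> J" for i j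
    using additive_subgroup.a_closed[OF ideal.axioms(1)[OF J] that] .
  have "\<exists>e\<in>carrier M. \<forall>j\<in>J. dec (\<phi> j) \<ominus>\<^bsub>M\<^esub> j \<odot>\<^bsub>M\<^esub> e \<in> N"
  proof (rule assms[OF J])
    show "dec (\<phi> (i \<oplus> j)) \<ominus>\<^bsub>M\<^esub> (dec (\<phi> i) \<oplus>\<^bsub>M\<^esub> dec (\<phi> j)) \<in> N" if ij: "i \<in> J" "j \<in> J" for i j
    proof -
      have "enc (dec (\<phi> (i \<oplus> j))) = enc (dec (\<phi> i) \<oplus>\<^bsub>M\<^esub> dec (\<phi> j))"
        using trans[OF x(2)[OF cl[OF ij]] pD(2)[OF ij]] enc_add[OF x(1)[OF ij(1)] x(1)[OF ij(2)]]
          x(2)[OF ij(1)] x(2)[OF ij(2)] by metis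
      then show ?thesis using enc_eq_iff x(1) ij cl by simp
    qed
    show "dec (\<phi> (r \<otimes> j)) \<ominus>\<^bsub>M\<^esub> r \<odot>\<^bsub>M\<^esub> dec (\<phi> j) \<in> N" if rj: "r \<in> carrier R" "j \<in> J" for r j
    proof -
      have rjJ: "r \<otimes> j \<in> J" using ideal.I_l_closed[OF J rj(2,1)] .
      have "enc (dec (\<phi> (r \<otimes> j))) = enc (r \<odot>\<^bsub>M\<^esub> dec (\<phi> j))"
        using trans[OF x(2)[OF rjJ] pD(3)[OF rj]] enc_smult[OF rj(1) x(1)[OF rj(2)]] x(2)[OF rj(2)] by metis
      then show ?thesis using enc_eq_iff x(1) rj rjJ by simp
    qed
  qed (rule x(1))
  then obtain e where e: "e \<in> carrier M" and eq: "\<And>j. j \<in> J \<Longrightarrow> dec (\<phi> j) \<ominus>\<^bsub>M\<^esub> j \<odot>\<^bsub>M\<^esub> e \<in> N"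
    by (elim bexE) simp
  have "\<phi> j = j \<odot>\<^bsub>E\<^esub> enc e" if j: "j \<in> J" for j
  proof -
    have jc: "j \<in> carrier R" using ideal.Icarr[OF J j] .
    have "enc (dec (\<phi> j)) = enc (j \<odot>\<^bsub>M\<^esub> e)" using enc_eq_iff[OF x(1)[OF j]] eq[OF j] e jc by simp
    then show ?thesis using x(2)[OF j] enc_smult[OF jc e] by simp
  qed
  then show "\<exists>e\<in>carrier E. \<forall>j\<in>J. \<phi> j = j \<odot>\<^bsub>E\<^esub> e"
    by (intro bexI[of _ "enc e"] ballI enc_closed[OF e])
qed

end

section \<open>Injective resolutions over the localizations\<close>

text \<open>A ring along a homomorphism \<open>h\<close> from \<open>A\<close>, as an \<open>A\<close>-module.\<close>

definition hom_module :: "('b, 'y) ring_scheme \<Rightarrow> ('a \<Rightarrow> 'b) \<Rightarrow> ('a, 'b) module" where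
  "hom_module F h = \<lparr>carrier = carrier F, monoid.mult = (\<otimes>\<^bsub>F\<^esub>), one = \<one>\<^bsub>F\<^esub>,
     ring.zero = \<zero>\<^bsub>F\<^esub>, ring.add = (\<oplus>\<^bsub>F\<^esub>), smult = (\<lambda>r x. h r \<otimes>\<^bsub>F\<^esub> x)\<rparr>"

lemma hom_module_simps [simp]:
  "carrier (hom_module F h) = carrier F" "\<zero>\<^bsub>hom_module F h\<^esub> = \<zero>\<^bsub>F\<^esub>"
  "x \<oplus>\<^bsub>hom_module F h\<^esub> y = x \<oplus>\<^bsub>F\<^esub> y" "r \<odot>\<^bsub>hom_module F h\<^esub> x = h r \<otimes>\<^bsub>F\<^esub> x"
  by (simp_all add: hom_module_def)

lemma hom_module_a_inv: "\<ominus>\<^bsub>hom_module F h\<^esub> x = \<ominus>\<^bsub>F\<^esub> x"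
  by (simp add: a_inv_def m_inv_def hom_module_def)

lemma hom_module_minus [simp]: "x \<ominus>\<^bsub>hom_module F h\<^esub> y = x \<ominus>\<^bsub>F\<^esub> y"
  by (simp add: a_minus_def hom_module_a_inv)

lemma (in ring_hom_cring) hom_module_module: "module R (hom_module S h)"
proof (rule moduleI)
  show "abelian_group (hom_module S h)"
  proof (rule abelian_groupI)
    fix x assume "x \<in> carrier (hom_module S h)"
    then show "\<exists>y\<in>carrier (hom_module S h). y \<oplus>\<^bsub>hom_module S h\<^esub> x = \<zero>\<^bsub>hom_module S h\<^esub>"
      by (intro bexI[of _ "\<ominus>\<^bsub>S\<^esub> x"]) (simp_all add: S.l_neg)
  qed (simp_all add: S.a_ac)
qed (simp_all add: R.is_cring S.l_distr S.r_distr S.m_assoc)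

lemma (in ring) cgenidealE:
  assumes "x \<in> PIdl a"
  obtains r where "r \<in> carrier R" "x = r \<otimes> a"
  using assms unfolding cgenideal_def by blast

locale frobenius_local = frobenius_domain R k + fraction_localization R P
  for R (structure) and k P
begin

definition inc :: "'a \<Rightarrow> ('a \<times> 'a) set" where
  "inc r = Q.frac r \<one>"

lemma inc_hom: "inc \<in> ring_hom R F"
  by (rule ring_hom_memI) (simp_all add: inc_def Q.A_one)

sublocale inc: ring_hom_cring R F inc
  by unfold_locales (rule inc_hom)

abbreviation "T \<equiv> local_subring"

lemmas T_props = subringE[OF local_subring_subring]

lemma T_carrier: "x \<in> T \<Longrightarrow> x \<in> carrier F"
  and T_zero: "\<zero>\<^bsub>F\<^esub> \<in> T"
  and T_add: "x \<in> T \<Longrightarrow> y \<in> T \<Longrightarrow> x \<oplus>\<^bsub>F\<^esub> y \<in> T"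
  and T_mult: "x \<in> T \<Longrightarrow> y \<in> T \<Longrightarrow> x \<otimes>\<^bsub>F\<^esub> y \<in> T"
  and T_neg: "x \<in> T \<Longrightarrow> \<ominus>\<^bsub>F\<^esub> x \<in> T"
  using T_props by auto

lemma T_minus: "x \<in> T \<Longrightarrow> y \<in> T \<Longrightarrow> x \<ominus>\<^bsub>F\<^esub> y \<in> T"
  by (simp add: a_minus_def T_add T_neg)

lemma inc_T: "r \<in> carrier R \<Longrightarrow> inc r \<in> T"
  by (simp add: inc_def)

lemma T_cong:
  assumes "x \<ominus>\<^bsub>F\<^esub> y \<in> T" "y \<in> T" "x \<in> carrier F"
  shows "x \<in> T"
proof -
  have "x = (x \<ominus>\<^bsub>F\<^esub> y) \<oplus>\<^bsub>F\<^esub> y" using assms T_carrier by (simp add: a_minus_def F.a_assoc F.l_neg)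
  then show ?thesis using T_add[OF assms(1,2)] by simp
qed

lemma common_denominator:
  assumes "finite Y" "\<And>y. y \<in> Y \<Longrightarrow> x y \<in> carrier F"
  shows "\<exists>d\<in>carrier R - {\<zero>}. \<forall>y\<in>Y. inc d \<otimes>\<^bsub>F\<^esub> x y \<in> T"
  using assms
proof (induct Y)
  case (insert y Y)
  then obtain d where d: "d \<in> carrier R" "d \<noteq> \<zero>" "\<And>y. y \<in> Y \<Longrightarrow> inc d \<otimes>\<^bsub>F\<^esub> x y \<in> T" by auto
  obtain a b where ab: "a \<in> carrier R" "b \<in> Q.S" "x y = Q.frac a b"
    using insert(4)[of y] by (auto elim: Q.A_cases)
  have b: "b \<in> carrier R" "b \<noteq> \<zero>" using ab(2) Q.S_nonzero by auto
  have "inc b \<otimes>\<^bsub>F\<^esub> x y = inc a"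
    using ab by (simp add: inc_def Q.frac_eq_iff m_ac)
  moreover have "inc (b \<otimes> d) \<otimes>\<^bsub>F\<^esub> x y = inc d \<otimes>\<^bsub>F\<^esub> (inc b \<otimes>\<^bsub>F\<^esub> x y)"
    using b d insert(4)[of y] by (simp add: F.m_ac)
  ultimately have y: "inc (b \<otimes> d) \<otimes>\<^bsub>F\<^esub> x y = inc d \<otimes>\<^bsub>F\<^esub> inc a" by simp
  have "inc (b \<otimes> d) \<otimes>\<^bsub>F\<^esub> x z \<in> T" if "z \<in> insert y Y" for z
  proof (cases "z = y")
    case True
    then show ?thesis using y T_mult inc_T d ab by simp
  next
    case False
    then have z: "z \<in> Y" using that by simp
    have "inc (b \<otimes> d) \<otimes>\<^bsub>F\<^esub> x z = inc b \<otimes>\<^bsub>F\<^esub> (inc d \<otimes>\<^bsub>F\<^esub> x z)"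
      using b d insert(4)[of z] z by (simp add: F.m_assoc)
    then show ?thesis using T_mult[OF inc_T[OF b(1)] d(3)[OF z]] by simp
  qed
  moreover have "b \<otimes> d \<in> carrier R - {\<zero>}" using b d integral by auto
  ultimately show ?case by blast
qed (use one_not_zero in auto)

text \<open>On a nonzero ideal \<open>J\<close> of \<open>R\<close> a map to \<open>F/A\<close> is killed by some nonzero \<open>a \<in> J\<close>, so its values lie in
  \<open>(1/a)A/A\<close>, a copy of \<open>A/aA = R/C\<close>; hence \<open>local_self_injective\<close> applies.\<close>

lemma fraction_quotient_baer:
  assumes J: "ideal J R"
    and x: "\<And>j. j \<in> J \<Longrightarrow> x j \<in> carrier F"
    and add: "\<And>i j. i \<in> J \<Longrightarrow> j \<in> J \<Longrightarrow> x (i \<oplus> j) \<ominus>\<^bsub>F\<^esub> (x i \<oplus>\<^bsub>F\<^esub> x j) \<in> T"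
    and smult: "\<And>r j. r \<in> carrier R \<Longrightarrow> j \<in> J \<Longrightarrow> x (r \<otimes> j) \<ominus>\<^bsub>F\<^esub> inc r \<otimes>\<^bsub>F\<^esub> x j \<in> T"
  shows "\<exists>e\<in>carrier F. \<forall>j\<in>J. x j \<ominus>\<^bsub>F\<^esub> inc j \<otimes>\<^bsub>F\<^esub> e \<in> T"
proof -
  interpret J: ideal J R by fact
  have scale: "x (r \<otimes> j) \<in> T" if "r \<in> carrier R" "j \<in> J" "inc r \<otimes>\<^bsub>F\<^esub> x j \<in> T" for r j
    using T_cong[OF smult[OF that(1,2)] that(3)] x J.I_l_closed[OF that(2,1)] by blast
  show ?thesis
  proof (cases "J \<subseteq> {\<zero>}")
    case True
    have "x (\<zero> \<otimes> \<zero>) \<in> T" by (rule scale) (use x T_zero in auto)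
    then have x0: "x \<zero> \<in> T" by simp
    have "x j \<ominus>\<^bsub>F\<^esub> inc j \<otimes>\<^bsub>F\<^esub> \<zero>\<^bsub>F\<^esub> \<in> T" if "j \<in> J" for j
    proof -
      have "j = \<zero>" using True that by blast
      then show ?thesis using x0 T_minus[OF x0 T_zero] by simp
    qed
    then show ?thesis by (intro bexI[of _ "\<zero>\<^bsub>F\<^esub>"]) auto
  next
    case False
    then obtain c where c: "c \<in> J" "c \<noteq> \<zero>" by auto
    have cc: "c \<in> carrier R" using c J.Icarr by simp
    obtain Y where Y: "Y \<subseteq> carrier R" "finite Y" "J = Idl Y"
      using noetherian_ring.finetely_gen[OF noetherian J] by auto
    have YJ: "Y \<subseteq> J" using genideal_self[OF Y(1)] Y(3) by simp
    then have "\<exists>d\<in>carrier R - {\<zero>}. \<forall>y\<in>Y. inc d \<otimes>\<^bsub>F\<^esub> x y \<in> T"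
      by (intro common_denominator[OF Y(2)] x) blast
    then obtain d where d': "d \<in> carrier R - {\<zero>}" "\<forall>y\<in>Y. inc d \<otimes>\<^bsub>F\<^esub> x y \<in> T" by (rule bexE)
    then have d: "d \<in> carrier R" "d \<noteq> \<zero>" and dY: "\<And>y. y \<in> Y \<Longrightarrow> inc d \<otimes>\<^bsub>F\<^esub> x y \<in> T" by simp_all
    let ?D = "{j \<in> J. inc d \<otimes>\<^bsub>F\<^esub> x j \<in> T}"
    have Dmult: "r \<otimes> j \<in> ?D" if r: "r \<in> carrier R" and j: "j \<in> ?D" for r j
    proof -
      have rj: "r \<otimes> j \<in> J" using J.I_l_closed r j by blast
      have m: "x j \<in> carrier F" "x (r \<otimes> j) \<in> carrier F" "inc d \<in> carrier F" "inc r \<in> carrier F"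
        using x j rj d r by auto
      have "inc d \<otimes>\<^bsub>F\<^esub> x (r \<otimes> j) = inc d \<otimes>\<^bsub>F\<^esub> (x (r \<otimes> j) \<ominus>\<^bsub>F\<^esub> inc r \<otimes>\<^bsub>F\<^esub> x j) \<oplus>\<^bsub>F\<^esub> inc r \<otimes>\<^bsub>F\<^esub> (inc d \<otimes>\<^bsub>F\<^esub> x j)"
        using m by algebra
      also have "\<dots> \<in> T" using smult[OF r] j inc_T d r T_add T_mult by auto
      finally show ?thesis using rj by simp
    qed
    have D: "ideal ?D R"
    proof (rule idealI[OF ring_axioms])
      show "subgroup ?D (add_monoid R)"
      proof (rule add.subgroupI)
        show "?D \<subseteq> carrier R" using J.Icarr by blast
        have "\<zero> \<otimes> c \<in> ?D"
        proof -
          have "x (\<zero> \<otimes> c) \<in> T" by (rule scale) (use c x T_zero in auto)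
          then show ?thesis using cc T_mult[OF inc_T[OF d(1)]] by simp
        qed
        then show "?D \<noteq> {}" by blast
        show "\<ominus> j \<in> ?D" if j: "j \<in> ?D" for j
          using Dmult[OF _ j, of "\<ominus> \<one>"] j J.Icarr by (simp add: l_minus)
        show "i \<oplus> j \<in> ?D" if ij: "i \<in> ?D" "j \<in> ?D" for i j
        proof -
          have s: "i \<oplus> j \<in> J" using ij by simp
          have m: "x i \<in> carrier F" "x j \<in> carrier F" "x (i \<oplus> j) \<in> carrier F" "inc d \<in> carrier F"
            using x ij s d by auto
          have "inc d \<otimes>\<^bsub>F\<^esub> x (i \<oplus> j) = inc d \<otimes>\<^bsub>F\<^esub> (x (i \<oplus> j) \<ominus>\<^bsub>F\<^esub> (x i \<oplus>\<^bsub>F\<^esub> x j))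
              \<oplus>\<^bsub>F\<^esub> (inc d \<otimes>\<^bsub>F\<^esub> x i \<oplus>\<^bsub>F\<^esub> inc d \<otimes>\<^bsub>F\<^esub> x j)"
            using m by algebra
          also have "\<dots> \<in> T" using add ij inc_T d T_add T_mult by auto
          finally show ?thesis using s by simp
        qed
      qed
      show *: "r \<otimes> j \<in> ?D" if "j \<in> ?D" "r \<in> carrier R" for r j using Dmult[OF that(2,1)] .
      show "j \<otimes> r \<in> ?D" if "j \<in> ?D" "r \<in> carrier R" for r j
      proof -
        have "j \<in> carrier R" using that(1) J.Icarr by simp
        then show ?thesis using *[OF that] m_comm[OF _ that(2), of j] by simp
      qed
    qed
    have "Idl Y \<subseteq> ?D" by (rule genideal_minimal[OF D]) (use YJ dY in auto)
    then have dJ: "inc d \<otimes>\<^bsub>F\<^esub> x j \<in> T" if "j \<in> J" for j using that Y(3) by auto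
    \<comment> \<open>\<open>d\<close> clears the denominators of all values of \<open>x\<close>, and the factor \<open>c\<close> puts \<open>a\<close> into \<open>J\<close>.\<close>
    define a where "a = d \<otimes> c"
    have a: "a \<in> carrier R" "a \<noteq> \<zero>" using integral[OF _ d(1) cc] d(1,2) c(2) cc by (auto simp: a_def)
    have aJ: "a \<in> J" using J.I_l_closed c d by (simp add: a_def)
    have xa: "x a \<in> T" unfolding a_def by (rule scale[OF d(1) c(1) dJ[OF c(1)]])
    have ax: "inc a \<otimes>\<^bsub>F\<^esub> x j \<in> T" if j: "j \<in> J" for j
    proof -
      have "inc a \<otimes>\<^bsub>F\<^esub> x j = inc c \<otimes>\<^bsub>F\<^esub> (inc d \<otimes>\<^bsub>F\<^esub> x j)"
        using d cc x[OF j] by (simp add: a_def F.m_ac)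
      then show ?thesis using T_mult[OF inc_T[OF cc] dJ[OF j]] by simp
    qed
    interpret L: frobenius_domain_prime R k P a by unfold_locales (rule a)+
    have aS: "a \<in> Q.S" using a by (simp add: Q.S_def)
    define w where "w = Q.frac \<one> a"
    have w: "w \<in> carrier F" using aS by (simp add: w_def)
    have wa: "inc a \<otimes>\<^bsub>F\<^esub> w = \<one>\<^bsub>F\<^esub>"
      using a aS by (simp add: w_def inc_def Q.A_one Q.frac_eq_iff)
    have frac_w: "inc p \<otimes>\<^bsub>F\<^esub> w = Q.frac p a" if "p \<in> carrier R" for p
      using that aS a by (simp add: w_def inc_def)
    have w_iff: "inc p \<otimes>\<^bsub>F\<^esub> w \<in> T \<longleftrightarrow> p \<in> L.C" if p: "p \<in> carrier R" for p
    proof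
      assume "inc p \<otimes>\<^bsub>F\<^esub> w \<in> T"
      then obtain b s where bs: "b \<in> carrier R" "s \<in> S" "Q.frac p a = Q.frac b s"
        unfolding frac_w[OF p] by (rule local_subring_cases)
      then have "p \<otimes> s = b \<otimes> a" using p aS by (simp add: Q.frac_eq_iff)
      then have "s \<otimes> p = b \<otimes> a" using m_comm[of s p] bs(2) p by simp
      then have "s \<otimes> p \<in> PIdl a" unfolding cgenideal_def using bs(1) by (intro CollectI exI[of _ b] conjI)
      moreover have "s \<in> carrier R - P" using bs(2) unfolding S_def .
      ultimately show "p \<in> L.C" using L.local_partI[OF _ p] by blast
    next
      assume "p \<in> L.C"
      then obtain u where u: "u \<in> carrier R - P" "p \<in> carrier R" "u \<otimes> p \<in> PIdl a" by (rule L.local_partE)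
      from u(3) obtain r where r: "r \<in> carrier R" "u \<otimes> p = r \<otimes> a" by (rule cgenidealE)
      have uS: "u \<in> S" using u(1) unfolding S_def .
      have "p \<otimes> u = r \<otimes> a" using trans[OF m_comm[OF p S_carrier[OF uS]] r(2)] .
      then have "Q.frac p a = Q.frac r u" using Q.frac_eq_iff[OF p r(1) aS S_Q[OF uS]] by blast
      then show "inc p \<otimes>\<^bsub>F\<^esub> w \<in> T" using frac_w[OF p] local_subring_frac[OF r(1) uS] by simp
    qed
    have w_D: "p \<in> L.C" if "inc p \<otimes>\<^bsub>F\<^esub> w \<in> T" "p \<in> carrier R" for p using w_iff[OF that(2)] that(1) by (rule iffD1)
    have ex: "\<exists>p. p \<in> carrier R \<and> x j \<ominus>\<^bsub>F\<^esub> inc p \<otimes>\<^bsub>F\<^esub> w \<in> T" if j: "j \<in> J" for j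
    proof -
      obtain b s where bs: "b \<in> carrier R" "s \<in> S" "inc a \<otimes>\<^bsub>F\<^esub> x j = Q.frac b s"
        using ax[OF j] by (rule local_subring_cases)
      have "s \<in> carrier R - P" using bs(2) unfolding S_def .
      then obtain s' where s': "s' \<in> carrier R" "s \<otimes> s' \<ominus> \<one> \<in> L.C"
        using L.local_inverse by (meson bexE)
      let ?f = "Q.frac b s"
      have f: "?f \<in> carrier F" "?f \<in> T" using bs(1,2) by simp_all
      have fs: "?f \<otimes>\<^bsub>F\<^esub> inc s = inc b" using bs(1,2) by (simp add: inc_def Q.frac_eq_iff m_ac)
      have m: "inc a \<in> carrier F" "x j \<in> carrier F" "inc s \<in> carrier F" "inc s' \<in> carrier F"
        using a(1) x[OF j] bs(2) s'(1) by simp_all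
      have xw: "x j = ?f \<otimes>\<^bsub>F\<^esub> w"
      proof -
        have "x j = (inc a \<otimes>\<^bsub>F\<^esub> w) \<otimes>\<^bsub>F\<^esub> x j" using m wa by simp
        also have "\<dots> = ?f \<otimes>\<^bsub>F\<^esub> w" unfolding bs(3)[symmetric] using m w by (simp add: F.m_ac)
        finally show ?thesis .
      qed
      have "inc (b \<otimes> s') = ?f \<otimes>\<^bsub>F\<^esub> inc s \<otimes>\<^bsub>F\<^esub> inc s'" using bs(1,2) s'(1) fs[symmetric] by simp
      moreover have "inc (s \<otimes> s' \<ominus> \<one>) = inc s \<otimes>\<^bsub>F\<^esub> inc s' \<ominus>\<^bsub>F\<^esub> \<one>\<^bsub>F\<^esub>"
        using bs(2) s'(1) by (simp add: a_minus_def)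
      moreover have "?f \<otimes>\<^bsub>F\<^esub> w \<ominus>\<^bsub>F\<^esub> (?f \<otimes>\<^bsub>F\<^esub> inc s \<otimes>\<^bsub>F\<^esub> inc s') \<otimes>\<^bsub>F\<^esub> w
          = \<ominus>\<^bsub>F\<^esub> (?f \<otimes>\<^bsub>F\<^esub> ((inc s \<otimes>\<^bsub>F\<^esub> inc s' \<ominus>\<^bsub>F\<^esub> \<one>\<^bsub>F\<^esub>) \<otimes>\<^bsub>F\<^esub> w))"
        using f(1) m w by algebra
      ultimately have "x j \<ominus>\<^bsub>F\<^esub> inc (b \<otimes> s') \<otimes>\<^bsub>F\<^esub> w = \<ominus>\<^bsub>F\<^esub> (?f \<otimes>\<^bsub>F\<^esub> (inc (s \<otimes> s' \<ominus> \<one>) \<otimes>\<^bsub>F\<^esub> w))"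
        using xw by simp
      moreover have "inc (s \<otimes> s' \<ominus> \<one>) \<otimes>\<^bsub>F\<^esub> w \<in> T" using w_iff[of "s \<otimes> s' \<ominus> \<one>"] s' bs(2) by simp
      ultimately have "x j \<ominus>\<^bsub>F\<^esub> inc (b \<otimes> s') \<otimes>\<^bsub>F\<^esub> w \<in> T" using T_neg[OF T_mult[OF f(2)]] by simp
      then show ?thesis using bs(1) s'(1) by (intro exI[of _ "b \<otimes> s'"]) simp
    qed
    define \<psi> where "\<psi> j = (SOME p. p \<in> carrier R \<and> x j \<ominus>\<^bsub>F\<^esub> inc p \<otimes>\<^bsub>F\<^esub> w \<in> T)" for j
    have psi: "\<psi> j \<in> carrier R" "x j \<ominus>\<^bsub>F\<^esub> inc (\<psi> j) \<otimes>\<^bsub>F\<^esub> w \<in> T" if "j \<in> J" for j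
      using someI_ex[OF ex[OF that]] unfolding \<psi>_def by simp_all
    have "\<exists>b\<in>carrier R. \<forall>j\<in>J. \<psi> j \<ominus> b \<otimes> j \<in> L.C"
    proof (rule L.local_self_injective[OF J aJ psi(1)])
      fix i j assume ij: "i \<in> J" "j \<in> J"
      have s: "i \<oplus> j \<in> J" using ij by simp
      have "inc (\<psi> (i \<oplus> j) \<ominus> (\<psi> i \<oplus> \<psi> j)) = inc (\<psi> (i \<oplus> j)) \<ominus>\<^bsub>F\<^esub> (inc (\<psi> i) \<oplus>\<^bsub>F\<^esub> inc (\<psi> j))"
        using psi(1) ij s by (simp add: a_minus_def)
      moreover have "(pr \<ominus>\<^bsub>F\<^esub> (pi \<oplus>\<^bsub>F\<^esub> pj)) \<otimes>\<^bsub>F\<^esub> w = (xr \<ominus>\<^bsub>F\<^esub> (xi \<oplus>\<^bsub>F\<^esub> xj)) \<ominus>\<^bsub>F\<^esub> (xr \<ominus>\<^bsub>F\<^esub> pr \<otimes>\<^bsub>F\<^esub> w)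
           \<oplus>\<^bsub>F\<^esub> ((xi \<ominus>\<^bsub>F\<^esub> pi \<otimes>\<^bsub>F\<^esub> w) \<oplus>\<^bsub>F\<^esub> (xj \<ominus>\<^bsub>F\<^esub> pj \<otimes>\<^bsub>F\<^esub> w))"
        if "pr \<in> carrier F" "pi \<in> carrier F" "pj \<in> carrier F" "xr \<in> carrier F" "xi \<in> carrier F" "xj \<in> carrier F"
        for pr pi pj xr xi xj using that w by algebra
      ultimately have "inc (\<psi> (i \<oplus> j) \<ominus> (\<psi> i \<oplus> \<psi> j)) \<otimes>\<^bsub>F\<^esub> w
          = (x (i \<oplus> j) \<ominus>\<^bsub>F\<^esub> (x i \<oplus>\<^bsub>F\<^esub> x j)) \<ominus>\<^bsub>F\<^esub> (x (i \<oplus> j) \<ominus>\<^bsub>F\<^esub> inc (\<psi> (i \<oplus> j)) \<otimes>\<^bsub>F\<^esub> w)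
           \<oplus>\<^bsub>F\<^esub> ((x i \<ominus>\<^bsub>F\<^esub> inc (\<psi> i) \<otimes>\<^bsub>F\<^esub> w) \<oplus>\<^bsub>F\<^esub> (x j \<ominus>\<^bsub>F\<^esub> inc (\<psi> j) \<otimes>\<^bsub>F\<^esub> w))"
        using psi(1) x ij s by simp
      moreover have "\<dots> \<in> T" by (rule T_add[OF T_minus[OF add[OF ij] psi(2)[OF s]] T_add[OF psi(2)[OF ij(1)] psi(2)[OF ij(2)]]])
      ultimately have "inc (\<psi> (i \<oplus> j) \<ominus> (\<psi> i \<oplus> \<psi> j)) \<otimes>\<^bsub>F\<^esub> w \<in> T" by (simp only:)
      then show "\<psi> (i \<oplus> j) \<ominus> (\<psi> i \<oplus> \<psi> j) \<in> L.C" by (rule w_D) (use psi(1) ij s in simp)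
    next
      fix r j assume r: "r \<in> carrier R" and j: "j \<in> J"
      have s: "r \<otimes> j \<in> J" using J.I_l_closed[OF j r] .
      have "inc (\<psi> (r \<otimes> j) \<ominus> r \<otimes> \<psi> j) = inc (\<psi> (r \<otimes> j)) \<ominus>\<^bsub>F\<^esub> inc r \<otimes>\<^bsub>F\<^esub> inc (\<psi> j)"
        using psi(1) r j s by (simp add: a_minus_def)
      moreover have "(pr \<ominus>\<^bsub>F\<^esub> i \<otimes>\<^bsub>F\<^esub> pj) \<otimes>\<^bsub>F\<^esub> w = (xr \<ominus>\<^bsub>F\<^esub> i \<otimes>\<^bsub>F\<^esub> xj) \<ominus>\<^bsub>F\<^esub> (xr \<ominus>\<^bsub>F\<^esub> pr \<otimes>\<^bsub>F\<^esub> w)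
           \<oplus>\<^bsub>F\<^esub> i \<otimes>\<^bsub>F\<^esub> (xj \<ominus>\<^bsub>F\<^esub> pj \<otimes>\<^bsub>F\<^esub> w)"
        if "pr \<in> carrier F" "pj \<in> carrier F" "i \<in> carrier F" "xr \<in> carrier F" "xj \<in> carrier F"
        for pr pj xr xj i using that w by algebra
      ultimately have "inc (\<psi> (r \<otimes> j) \<ominus> r \<otimes> \<psi> j) \<otimes>\<^bsub>F\<^esub> w
          = (x (r \<otimes> j) \<ominus>\<^bsub>F\<^esub> inc r \<otimes>\<^bsub>F\<^esub> x j) \<ominus>\<^bsub>F\<^esub> (x (r \<otimes> j) \<ominus>\<^bsub>F\<^esub> inc (\<psi> (r \<otimes> j)) \<otimes>\<^bsub>F\<^esub> w)
           \<oplus>\<^bsub>F\<^esub> inc r \<otimes>\<^bsub>F\<^esub> (x j \<ominus>\<^bsub>F\<^esub> inc (\<psi> j) \<otimes>\<^bsub>F\<^esub> w)"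
        using psi(1) x r j s by simp
      moreover have "\<dots> \<in> T" by (rule T_add[OF T_minus[OF smult[OF r j] psi(2)[OF s]] T_mult[OF inc_T[OF r] psi(2)[OF j]]])
      ultimately have "inc (\<psi> (r \<otimes> j) \<ominus> r \<otimes> \<psi> j) \<otimes>\<^bsub>F\<^esub> w \<in> T" by (simp only:)
      then show "\<psi> (r \<otimes> j) \<ominus> r \<otimes> \<psi> j \<in> L.C" by (rule w_D) (use psi(1) r j s in simp)
    next
      fix j assume j: "j \<in> J" "j \<in> L.C"
      obtain u where u: "u \<in> carrier R - P" "j \<in> carrier R" "u \<otimes> j \<in> PIdl a" using j(2) by (rule L.local_partE)
      from u(3) obtain r where r: "r \<in> carrier R" "u \<otimes> j = r \<otimes> a" by (rule cgenidealE)
      have uS: "u \<in> S" "u \<in> carrier R" using u(1) unfolding S_def by blast+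
      have xj: "x j \<in> carrier F" using x j by simp
      have "x (r \<otimes> a) \<in> T" by (rule scale[OF r(1) aJ T_mult[OF inc_T[OF r(1)] xa]])
      then have uj: "x (u \<otimes> j) \<in> T" unfolding r(2) .
      have c: "x (u \<otimes> j) \<in> carrier F" "inc u \<otimes>\<^bsub>F\<^esub> x j \<in> carrier F" using T_carrier[OF uj] xj uS(2) by simp_all
      have "inc u \<otimes>\<^bsub>F\<^esub> x j = x (u \<otimes> j) \<ominus>\<^bsub>F\<^esub> (x (u \<otimes> j) \<ominus>\<^bsub>F\<^esub> inc u \<otimes>\<^bsub>F\<^esub> x j)"
        using c by algebra
      then have "inc u \<otimes>\<^bsub>F\<^esub> x j \<in> T" using T_minus[OF uj smult[OF uS(2) j(1)]] by simp
      then have "Q.frac \<one> u \<otimes>\<^bsub>F\<^esub> (inc u \<otimes>\<^bsub>F\<^esub> x j) \<in> T" using local_subring_frac[OF one_closed uS(1)] by (rule T_mult[rotated])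
      moreover have "Q.frac \<one> u \<otimes>\<^bsub>F\<^esub> inc u = \<one>\<^bsub>F\<^esub>" using uS by (simp add: inc_def Q.A_one Q.frac_eq_iff)
      ultimately have xT: "x j \<in> T" using xj uS by (simp add: F.m_assoc[symmetric])
      have pc: "inc (\<psi> j) \<otimes>\<^bsub>F\<^esub> w \<in> carrier F" using psi(1)[OF j(1)] w by simp
      have "inc (\<psi> j) \<otimes>\<^bsub>F\<^esub> w = x j \<ominus>\<^bsub>F\<^esub> (x j \<ominus>\<^bsub>F\<^esub> inc (\<psi> j) \<otimes>\<^bsub>F\<^esub> w)" using pc xj by algebra
      then have "inc (\<psi> j) \<otimes>\<^bsub>F\<^esub> w \<in> T" using T_minus[OF xT psi(2)[OF j(1)]] by simp
      then show "\<psi> j \<in> L.C" by (rule w_D) (rule psi(1)[OF j(1)])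
    qed
    then obtain b where b: "b \<in> carrier R" and bC: "\<And>j. j \<in> J \<Longrightarrow> \<psi> j \<ominus> b \<otimes> j \<in> L.C"
      by (elim bexE) simp
    have "x j \<ominus>\<^bsub>F\<^esub> inc j \<otimes>\<^bsub>F\<^esub> (inc b \<otimes>\<^bsub>F\<^esub> w) \<in> T" if j: "j \<in> J" for j
    proof -
      have jc: "j \<in> carrier R" using j J.Icarr by simp
      have hom: "inc (\<psi> j \<ominus> b \<otimes> j) = inc (\<psi> j) \<ominus>\<^bsub>F\<^esub> inc b \<otimes>\<^bsub>F\<^esub> inc j" using psi(1)[OF j] b jc by (simp add: a_minus_def)
      have id: "xj \<ominus>\<^bsub>F\<^esub> i \<otimes>\<^bsub>F\<^esub> (b \<otimes>\<^bsub>F\<^esub> w) = (xj \<ominus>\<^bsub>F\<^esub> p \<otimes>\<^bsub>F\<^esub> w) \<oplus>\<^bsub>F\<^esub> (p \<ominus>\<^bsub>F\<^esub> b \<otimes>\<^bsub>F\<^esub> i) \<otimes>\<^bsub>F\<^esub> w"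
        if "xj \<in> carrier F" "i \<in> carrier F" "b \<in> carrier F" "p \<in> carrier F" for xj i b p
        using that w by algebra
      have "x j \<ominus>\<^bsub>F\<^esub> inc j \<otimes>\<^bsub>F\<^esub> (inc b \<otimes>\<^bsub>F\<^esub> w) =
          (x j \<ominus>\<^bsub>F\<^esub> inc (\<psi> j) \<otimes>\<^bsub>F\<^esub> w) \<oplus>\<^bsub>F\<^esub> inc (\<psi> j \<ominus> b \<otimes> j) \<otimes>\<^bsub>F\<^esub> w"
        unfolding hom using x[OF j] psi(1)[OF j] b jc by (intro id) simp_all
      moreover have "inc (\<psi> j \<ominus> b \<otimes> j) \<otimes>\<^bsub>F\<^esub> w \<in> T" using w_iff[of "\<psi> j \<ominus> b \<otimes> j"] bC[OF j] psi(1)[OF j] b jc by simp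
      ultimately show ?thesis using T_add[OF psi(2)[OF j]] by simp
    qed
    then show ?thesis using b w by (intro bexI[of _ "inc b \<otimes>\<^bsub>F\<^esub> w"]) auto
  qed
qed

abbreviation "FM \<equiv> hom_module F emb"

lemma FM_module: "module A FM" by (rule emb.hom_module_module)

lemma FM_submoduleI:
  assumes "N \<subseteq> carrier F" "\<zero>\<^bsub>F\<^esub> \<in> N" "\<And>x y. x \<in> N \<Longrightarrow> y \<in> N \<Longrightarrow> x \<oplus>\<^bsub>F\<^esub> y \<in> N"
    and "\<And>r x. r \<in> carrier A \<Longrightarrow> x \<in> N \<Longrightarrow> emb r \<otimes>\<^bsub>F\<^esub> x \<in> N"
  shows "submodule N A FM"
proof -
  interpret FM: module A FM by (rule FM_module)
  show ?thesis
  proof (rule FM.submoduleI)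
    fix x assume x: "x \<in> N"
    have "emb (\<ominus>\<^bsub>A\<^esub> \<one>\<^bsub>A\<^esub>) \<otimes>\<^bsub>F\<^esub> x \<in> N" by (rule assms(4)) (use x in auto)
    then show "\<ominus>\<^bsub>FM\<^esub> x \<in> N" using x assms(1) by (auto simp: hom_module_a_inv F.l_minus)
  qed (use assms in simp_all)
qed

text \<open>The fraction field is injective since it is divisible and torsion free.\<close>

lemma fraction_field_baer:
  assumes J: "ideal J A" and x: "\<And>j. j \<in> J \<Longrightarrow> x j \<in> carrier F"
    and smult: "\<And>r j. r \<in> carrier A \<Longrightarrow> j \<in> J \<Longrightarrow> x (r \<otimes>\<^bsub>A\<^esub> j) = emb r \<otimes>\<^bsub>F\<^esub> x j"
  shows "\<exists>e\<in>carrier F. \<forall>j\<in>J. x j = emb j \<otimes>\<^bsub>F\<^esub> e"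
proof (cases "J \<subseteq> {\<zero>\<^bsub>A\<^esub>}")
  case True
  interpret J: ideal J A by fact
  have x0: "x \<zero>\<^bsub>A\<^esub> = \<zero>\<^bsub>F\<^esub>" using smult[of "\<zero>\<^bsub>A\<^esub>" "\<zero>\<^bsub>A\<^esub>"] x by simp
  have "x j = emb j \<otimes>\<^bsub>F\<^esub> \<zero>\<^bsub>F\<^esub>" if "j \<in> J" for j
  proof -
    have "j = \<zero>\<^bsub>A\<^esub>" using True that by blast
    then show ?thesis using x0 by simp
  qed
  then show ?thesis by (intro bexI[of _ "\<zero>\<^bsub>F\<^esub>"]) auto
next
  case False
  interpret J: ideal J A by fact
  obtain c where c: "c \<in> J" "c \<noteq> \<zero>\<^bsub>A\<^esub>" using False by auto
  have cc: "c \<in> carrier A" using c J.Icarr by simp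
  have "emb c \<noteq> \<zero>\<^bsub>F\<^esub>" using c cc inj_onD[OF emb_inj, of c "\<zero>\<^bsub>A\<^esub>"] by auto
  then have u: "emb c \<in> Units F" using cc by (simp add: F.field_Units)
  let ?i = "inv\<^bsub>F\<^esub> emb c"
  have i: "?i \<in> carrier F" "?i \<otimes>\<^bsub>F\<^esub> emb c = \<one>\<^bsub>F\<^esub>" using u by auto
  have "x j = emb j \<otimes>\<^bsub>F\<^esub> (?i \<otimes>\<^bsub>F\<^esub> x c)" if j: "j \<in> J" for j
  proof -
    have jc: "j \<in> carrier A" using j J.Icarr by simp
    have e: "emb c \<otimes>\<^bsub>F\<^esub> x j = emb j \<otimes>\<^bsub>F\<^esub> x c"
      using smult[OF cc j] smult[OF jc c(1)] A.m_comm[OF cc jc] by simp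
    have "x j = ?i \<otimes>\<^bsub>F\<^esub> (emb c \<otimes>\<^bsub>F\<^esub> x j)" using i x[OF j] cc by (simp add: F.m_assoc[symmetric])
    then show ?thesis unfolding e using i x[OF c(1)] jc by (simp add: F.m_lcomm)
  qed
  then show ?thesis using i x[OF c(1)] by (intro bexI[of _ "?i \<otimes>\<^bsub>F\<^esub> x c"]) auto
qed

text \<open>The kernels of \<open>F \<rightarrow> F\<close>, \<open>F \<rightarrow> F/A\<close> and \<open>F \<rightarrow> 0\<close>. All terms of an injective resolution have to
  live on one type; \<open>res_enc n\<close> encodes the cosets of \<open>res_sub n\<close> there.\<close>

definition res_sub :: "nat \<Rightarrow> ('a \<times> 'a) set set" where
  "res_sub n = (if n = 0 then {\<zero>\<^bsub>F\<^esub>} else if n = 1 then T else carrier F)"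

definition res_enc :: "nat \<Rightarrow> ('a \<times> 'a) set \<Rightarrow> ('a \<times> 'a) set \<Rightarrow> ('a \<times> 'a) set list" where
  "res_enc n x = (\<lambda>_. if n = 0 then [x]
     else if n = 1 then [SOME y. y \<in> carrier F \<and> x \<ominus>\<^bsub>F\<^esub> y \<in> T] else [])"

text \<open>A choice that depends on the coset only, so that the fibres of \<open>res_enc 1\<close> are the cosets of \<open>T\<close>.\<close>

lemma some_representative_eq_iff:
  assumes "x \<in> carrier F" "y \<in> carrier F"
  shows "(SOME z. z \<in> carrier F \<and> x \<ominus>\<^bsub>F\<^esub> z \<in> T) = (SOME z. z \<in> carrier F \<and> y \<ominus>\<^bsub>F\<^esub> z \<in> T)
    \<longleftrightarrow> x \<ominus>\<^bsub>F\<^esub> y \<in> T"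
proof
  let ?s = "\<lambda>x. SOME z. z \<in> carrier F \<and> x \<ominus>\<^bsub>F\<^esub> z \<in> T"
  have s: "?s x \<in> carrier F \<and> x \<ominus>\<^bsub>F\<^esub> ?s x \<in> T" if "x \<in> carrier F" for x
  proof (rule someI[of _ x])
    show "x \<in> carrier F \<and> x \<ominus>\<^bsub>F\<^esub> x \<in> T" using that T_zero by (simp add: a_minus_def F.r_neg)
  qed
  assume e: "?s x = ?s y"
  define z where "z = ?s x"
  have z: "z \<in> carrier F" "x \<ominus>\<^bsub>F\<^esub> z \<in> T" using s[OF assms(1)] by (simp_all add: z_def)
  have "y \<ominus>\<^bsub>F\<^esub> z \<in> T" using s[OF assms(2)] e by (simp add: z_def)
  then have "x \<ominus>\<^bsub>F\<^esub> z \<ominus>\<^bsub>F\<^esub> (y \<ominus>\<^bsub>F\<^esub> z) \<in> T" by (rule T_minus[OF z(2)])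
  moreover have "x \<ominus>\<^bsub>F\<^esub> z \<ominus>\<^bsub>F\<^esub> (y \<ominus>\<^bsub>F\<^esub> z) = x \<ominus>\<^bsub>F\<^esub> y" using assms z(1) by algebra
  ultimately show "x \<ominus>\<^bsub>F\<^esub> y \<in> T" by simp
next
  assume xy: "x \<ominus>\<^bsub>F\<^esub> y \<in> T"
  have "x \<ominus>\<^bsub>F\<^esub> z \<in> T \<longleftrightarrow> y \<ominus>\<^bsub>F\<^esub> z \<in> T" if z: "z \<in> carrier F" for z
  proof -
    have e: "x \<ominus>\<^bsub>F\<^esub> z = (x \<ominus>\<^bsub>F\<^esub> y) \<oplus>\<^bsub>F\<^esub> (y \<ominus>\<^bsub>F\<^esub> z)" "y \<ominus>\<^bsub>F\<^esub> z = (x \<ominus>\<^bsub>F\<^esub> z) \<ominus>\<^bsub>F\<^esub> (x \<ominus>\<^bsub>F\<^esub> y)"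
      using assms z by algebra+
    show ?thesis
    proof
      assume "x \<ominus>\<^bsub>F\<^esub> z \<in> T"
      then show "y \<ominus>\<^bsub>F\<^esub> z \<in> T" using T_minus[OF _ xy] e(2) by simp
    next
      assume "y \<ominus>\<^bsub>F\<^esub> z \<in> T"
      then show "x \<ominus>\<^bsub>F\<^esub> z \<in> T" using T_add[OF xy] e(1) by simp
    qed
  qed
  then have "(\<lambda>z. z \<in> carrier F \<and> x \<ominus>\<^bsub>F\<^esub> z \<in> T) = (\<lambda>z. z \<in> carrier F \<and> y \<ominus>\<^bsub>F\<^esub> z \<in> T)" by auto
  then show "(SOME z. z \<in> carrier F \<and> x \<ominus>\<^bsub>F\<^esub> z \<in> T) = (SOME z. z \<in> carrier F \<and> y \<ominus>\<^bsub>F\<^esub> z \<in> T)" by simp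
qed

lemma emb_T: "r \<in> carrier A \<Longrightarrow> emb r \<in> T"
  by (simp add: local_subring_def)

lemma res_push: "module_push A FM (res_sub n) (res_enc n)"
proof (rule module_push.intro[OF FM_module module_push_axioms.intro])
  show "submodule (res_sub n) A FM"
    by (rule FM_submoduleI)
      (auto simp: res_sub_def T_zero T_add T_carrier emb_T T_mult split: if_splits)
  fix x y assume "x \<in> carrier FM" "y \<in> carrier FM"
  then have xy: "x \<in> carrier F" "y \<in> carrier F" by simp_all
  have "(res_enc n x = res_enc n y) = (res_enc n x undefined = res_enc n y undefined)"
    by (auto simp: res_enc_def fun_eq_iff)
  also have "\<dots> = (x \<ominus>\<^bsub>F\<^esub> y \<in> res_sub n)"
    using some_representative_eq_iff[OF xy] xy by (auto simp: res_enc_def res_sub_def)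
  finally show "(res_enc n x = res_enc n y) = (x \<ominus>\<^bsub>FM\<^esub> y \<in> res_sub n)" by simp
qed

lemma T_eq_image: "T = emb ` carrier A" by (simp add: local_subring_def)

lemma res_injective: "injective_mod U A (push_module FM (res_enc n))"
proof -
  interpret E: module_push A FM "res_sub n" "res_enc n" by (rule res_push)
  show ?thesis
  proof (rule E.push_injective)
    fix J x
    assume J: "ideal J A" and x: "\<And>j. j \<in> J \<Longrightarrow> x j \<in> carrier FM"
      and add: "\<And>i j. i \<in> J \<Longrightarrow> j \<in> J \<Longrightarrow> x (i \<oplus>\<^bsub>A\<^esub> j) \<ominus>\<^bsub>FM\<^esub> (x i \<oplus>\<^bsub>FM\<^esub> x j) \<in> res_sub n"
      and smult: "\<And>r j. r \<in> carrier A \<Longrightarrow> j \<in> J \<Longrightarrow> x (r \<otimes>\<^bsub>A\<^esub> j) \<ominus>\<^bsub>FM\<^esub> r \<odot>\<^bsub>FM\<^esub> x j \<in> res_sub n"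
    interpret J: ideal J A by fact
    note x = x[simplified] and add = add[simplified] and smult = smult[simplified]
    consider "n = 0" | "n = 1" | "n \<ge> 2" by linarith
    then show "\<exists>e\<in>carrier FM. \<forall>j\<in>J. x j \<ominus>\<^bsub>FM\<^esub> j \<odot>\<^bsub>FM\<^esub> e \<in> res_sub n"
    proof cases
      case 1
      have sm: "x (r \<otimes>\<^bsub>A\<^esub> j) = emb r \<otimes>\<^bsub>F\<^esub> x j" if "r \<in> carrier A" "j \<in> J" for r j
        using smult[OF that] 1 x J.I_l_closed that by (simp add: res_sub_def)
      have "\<exists>e\<in>carrier F. \<forall>j\<in>J. x j = emb j \<otimes>\<^bsub>F\<^esub> e"
        by (rule fraction_field_baer[OF J x sm])
      then obtain e where e: "e \<in> carrier F" "\<And>j. j \<in> J \<Longrightarrow> x j = emb j \<otimes>\<^bsub>F\<^esub> e"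
        by (elim bexE) simp
      have "x j \<ominus>\<^bsub>F\<^esub> emb j \<otimes>\<^bsub>F\<^esub> e = \<zero>\<^bsub>F\<^esub>" if "j \<in> J" for j
        using e(2)[OF that] e(1) J.Icarr[OF that] by (simp add: a_minus_def F.r_neg)
      then show ?thesis using 1 e(1) by (intro bexI[of _ e]) (simp_all add: res_sub_def)
    next
      case 2
      then have rs: "res_sub n = T" by (simp add: res_sub_def)
      let ?J = "{r \<in> carrier R. frac r \<one> \<in> J}"
      have inc_emb: "inc r = emb (frac r \<one>)" if "r \<in> carrier R" for r using that by (simp add: inc_def)
      have J0: "ideal ?J R"
      proof (rule idealI[OF ring_axioms])
        have neg: "\<ominus> r \<in> ?J" if "r \<in> ?J" for r
        proof -
          have "frac (\<ominus> \<one>) \<one> \<otimes>\<^bsub>A\<^esub> frac r \<one> \<in> J" using that by (intro J.I_l_closed) auto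
          then show ?thesis using that by (simp add: l_minus)
        qed
        show "subgroup ?J (add_monoid R)"
        proof (rule add.subgroupI)
          have "\<zero> \<in> ?J" using J.zero_closed by (simp add: A_zero)
          then show "?J \<noteq> {}" by blast
          fix r s assume "r \<in> ?J" "s \<in> ?J"
          moreover from this have "frac r \<one> \<oplus>\<^bsub>A\<^esub> frac s \<one> \<in> J" by (intro J.a_closed) auto
          ultimately show "r \<oplus> s \<in> ?J" by simp
        qed (use neg in auto)
        fix r s assume r: "r \<in> ?J" and s: "s \<in> carrier R"
        have "frac s \<one> \<otimes>\<^bsub>A\<^esub> frac r \<one> \<in> J" using r s by (intro J.I_l_closed) auto
        then show "s \<otimes> r \<in> ?J" using r s by simp
        then show "r \<otimes> s \<in> ?J" using r s by (simp add: m_comm)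
      qed
      have "\<exists>e\<in>carrier F. \<forall>r\<in>?J. x (frac r \<one>) \<ominus>\<^bsub>F\<^esub> inc r \<otimes>\<^bsub>F\<^esub> e \<in> T"
      proof (rule fraction_quotient_baer[OF J0])
        show "x (frac (i \<oplus> j) \<one>) \<ominus>\<^bsub>F\<^esub> (x (frac i \<one>) \<oplus>\<^bsub>F\<^esub> x (frac j \<one>)) \<in> T" if "i \<in> ?J" "j \<in> ?J" for i j
          using add[of "frac i \<one>" "frac j \<one>"] that rs by simp
        show "x (frac (r \<otimes> j) \<one>) \<ominus>\<^bsub>F\<^esub> inc r \<otimes>\<^bsub>F\<^esub> x (frac j \<one>) \<in> T" if "r \<in> carrier R" "j \<in> ?J" for r j
          using smult[of "frac r \<one>" "frac j \<one>"] that rs by (simp add: inc_def)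
      qed (use x in simp)
      then obtain e where e: "e \<in> carrier F"
        and eT: "\<And>r. r \<in> ?J \<Longrightarrow> x (frac r \<one>) \<ominus>\<^bsub>F\<^esub> inc r \<otimes>\<^bsub>F\<^esub> e \<in> T" by (elim bexE) simp
      have "x j \<ominus>\<^bsub>F\<^esub> emb j \<otimes>\<^bsub>F\<^esub> e \<in> T" if j: "j \<in> J" for j
      proof -
        have jA: "j \<in> carrier A" using J.Icarr[OF j] .
        then obtain a s where as: "a \<in> carrier R" "s \<in> S" "j = frac a s" by (rule A_cases)
        have eq: "frac s \<one> \<otimes>\<^bsub>A\<^esub> j = frac a \<one>" using as by (simp add: frac_eq_iff m_ac)
        have "frac s \<one> \<otimes>\<^bsub>A\<^esub> j \<in> J" by (rule J.I_l_closed[OF j]) (use as in simp)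
        then have aJ: "a \<in> ?J" using eq as by simp
        have m: "x j \<in> carrier F" "emb j \<in> carrier F" "inc s \<in> carrier F" "x (frac a \<one>) \<in> carrier F"
          using x j jA as aJ by auto
        have t1: "x (frac a \<one>) \<ominus>\<^bsub>F\<^esub> inc s \<otimes>\<^bsub>F\<^esub> x j \<in> T"
          using smult[of "frac s \<one>" j] as j rs eq by (simp add: inc_def)
        have t2: "x (frac a \<one>) \<ominus>\<^bsub>F\<^esub> (inc s \<otimes>\<^bsub>F\<^esub> emb j) \<otimes>\<^bsub>F\<^esub> e \<in> T"
        proof -
          have "inc a = inc s \<otimes>\<^bsub>F\<^esub> emb j" using as by (simp add: inc_def Q.frac_eq_iff m_ac)
          then show ?thesis using eT[OF aJ] by simp
        qed
        let ?u = "Q.frac \<one> s"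
        have u: "?u \<in> T" "?u \<in> carrier F" "?u \<otimes>\<^bsub>F\<^esub> inc s = \<one>\<^bsub>F\<^esub>"
          using as by (simp_all add: inc_def Q.A_one Q.frac_eq_iff)
        have "?u \<otimes>\<^bsub>F\<^esub> ((x (frac a \<one>) \<ominus>\<^bsub>F\<^esub> (inc s \<otimes>\<^bsub>F\<^esub> emb j) \<otimes>\<^bsub>F\<^esub> e) \<ominus>\<^bsub>F\<^esub> (x (frac a \<one>) \<ominus>\<^bsub>F\<^esub> inc s \<otimes>\<^bsub>F\<^esub> x j))
            = (?u \<otimes>\<^bsub>F\<^esub> inc s) \<otimes>\<^bsub>F\<^esub> (x j \<ominus>\<^bsub>F\<^esub> emb j \<otimes>\<^bsub>F\<^esub> e)"
          using m e u(2) by algebra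
        then have "x j \<ominus>\<^bsub>F\<^esub> emb j \<otimes>\<^bsub>F\<^esub> e = ?u \<otimes>\<^bsub>F\<^esub> ((x (frac a \<one>) \<ominus>\<^bsub>F\<^esub> (inc s \<otimes>\<^bsub>F\<^esub> emb j) \<otimes>\<^bsub>F\<^esub> e) \<ominus>\<^bsub>F\<^esub> (x (frac a \<one>) \<ominus>\<^bsub>F\<^esub> inc s \<otimes>\<^bsub>F\<^esub> x j))"
          using u(3) m e by simp
        moreover have "\<dots> \<in> T" by (rule T_mult[OF u(1) T_minus[OF t2 t1]])
        ultimately show ?thesis by (simp only:)
      qed
      then show ?thesis using e rs by (intro bexI[of _ e]) simp_all
    next
      case 3
      then have "res_sub n = carrier F" by (simp add: res_sub_def)
      then show ?thesis using x J.Icarr by (intro bexI[of _ "\<zero>\<^bsub>F\<^esub>"]) auto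
    qed
  qed
qed

text \<open>The sequence \<open>0 \<rightarrow> A \<rightarrow> F \<rightarrow> F/A \<rightarrow> 0\<close> is an injective resolution of \<open>A\<close>.\<close>

lemma localization_finite_injective_dim:
  "finite_injective_dim U A (ideal_module A (carrier A))"
proof -
  let ?E = "\<lambda>n. push_module FM (res_enc n)"
  let ?dec = "\<lambda>n. inv_into (carrier FM) (res_enc n)"
  define d where "d n u = res_enc (Suc n) (if n = 0 then ?dec n u else \<zero>\<^bsub>F\<^esub>)" for n u
  define h where "h r = res_enc 0 (emb r)" for r
  have d0: "d 0 (res_enc 0 x) = res_enc 1 x" if "x \<in> carrier F" for x
  proof -
    interpret E: module_push A FM "res_sub 0" "res_enc 0" by (rule res_push)
    have "?dec 0 (res_enc 0 x) \<ominus>\<^bsub>F\<^esub> x \<in> {\<zero>\<^bsub>F\<^esub>}" "?dec 0 (res_enc 0 x) \<in> carrier F"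
      using E.dec_enc[of x] E.dec_closed[OF E.enc_closed, of x] that by (simp_all add: res_sub_def)
    then have "?dec 0 (res_enc 0 x) = x" using that by simp
    then show ?thesis by (simp add: d_def)
  qed
  have enc0: "res_enc n \<zero>\<^bsub>F\<^esub> = \<zero>\<^bsub>?E n\<^esub>" for n by (simp add: push_module_def)
  have dS: "d (Suc n) u = \<zero>\<^bsub>?E (Suc (Suc n))\<^esub>" for n u by (simp add: d_def enc0)
  have triv: "carrier (?E n) = {\<zero>\<^bsub>?E n\<^esub>}" if "n \<ge> 2" for n
    using that enc0[of n] by (auto simp: push_module_def res_enc_def)
  have "injective_resolution U A (ideal_module A (carrier A)) ?E d h"
    unfolding injective_resolution_def
  proof (intro conjI allI)
    show "injective_mod U A (?E k)" for k by (rule res_injective)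
    interpret E0: module_push A FM "res_sub 0" "res_enc 0" by (rule res_push)
    interpret E1: module_push A FM "res_sub 1" "res_enc 1" by (rule res_push)
    show "h \<in> mod_hom A (ideal_module A (carrier A)) (?E 0)"
      by (rule mod_homI) (simp_all add: h_def E0.enc_closed E0.enc_add E0.enc_smult)
    show "inj_on h (carrier (ideal_module A (carrier A)))"
    proof (rule inj_onI)
      fix r s assume rs: "r \<in> carrier (ideal_module A (carrier A))" "s \<in> carrier (ideal_module A (carrier A))" "h r = h s"
      then have "emb r \<ominus>\<^bsub>F\<^esub> emb s \<in> {\<zero>\<^bsub>F\<^esub>}" using E0.enc_eq_iff[of "emb r" "emb s"] by (simp add: h_def res_sub_def)
      then show "r = s" using rs inj_onD[OF emb_inj, of r s] by simp
    qed
    show "d n \<in> mod_hom A (?E n) (?E (Suc n))" for n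
    proof (cases n)
      case 0
      have "d 0 \<in> mod_hom A (?E 0) (?E 1)"
      proof (rule mod_homI)
        fix u v assume "u \<in> carrier (?E 0)" "v \<in> carrier (?E 0)"
        then obtain x y where xy: "x \<in> carrier F" "u = res_enc 0 x" "y \<in> carrier F" "v = res_enc 0 y"
          using E0.E_cases by (metis hom_module_simps(1))
        then show "d 0 u \<in> carrier (?E 1)" using E1.enc_closed by (simp add: d0)
        show "d 0 (u \<oplus>\<^bsub>?E 0\<^esub> v) = d 0 u \<oplus>\<^bsub>?E 1\<^esub> d 0 v"
          using xy by (simp add: d0 E0.enc_add E1.enc_add[unfolded One_nat_def])
      next
        fix r u assume r: "r \<in> carrier A" and "u \<in> carrier (?E 0)"
        then obtain x where x: "x \<in> carrier F" "u = res_enc 0 x"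
          using E0.E_cases by (metis hom_module_simps(1))
        show "d 0 (r \<odot>\<^bsub>?E 0\<^esub> u) = r \<odot>\<^bsub>?E 1\<^esub> d 0 u"
          using x r by (simp add: d0 E0.enc_smult E1.enc_smult[unfolded One_nat_def])
      qed
      then show ?thesis using 0 by simp
    next
      case (Suc m)
      interpret E: module_push A FM "res_sub (Suc n)" "res_enc (Suc n)" by (rule res_push)
      interpret EM: module A "?E (Suc n)" by (rule E.push_module_module)
      show ?thesis by (rule mod_homI) (simp_all add: Suc dS EM.M.zero_closed[unfolded Suc] EM.smult_r_null[unfolded Suc]
            EM.M.l_zero[OF EM.M.zero_closed, unfolded Suc])
    qed
    show "h ` carrier (ideal_module A (carrier A)) = a_kernel (?E 0) (?E (Suc 0)) (d 0)"
    proof -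
      have "a_kernel (?E 0) (?E (Suc 0)) (d 0) = res_enc 0 ` {x \<in> carrier F. x \<in> T}"
        unfolding a_kernel_def' using d0 E1.enc_eq_zero_iff by (auto simp: E0.E_carrier res_sub_def)
      also have "{x \<in> carrier F. x \<in> T} = emb ` carrier A" using T_carrier T_eq_image by auto
      finally show ?thesis by (simp add: h_def image_image)
    qed
    show "d n ` carrier (?E n) = a_kernel (?E (Suc n)) (?E (Suc (Suc n))) (d (Suc n))" for n
    proof (cases n)
      case 0
      have "d 0 ` carrier (?E 0) = carrier (?E 1)"
        unfolding E0.E_carrier E1.E_carrier image_image using d0 by (intro image_cong) simp_all
      then show ?thesis using 0 by (simp add: a_kernel_def' dS)
    next
      case (Suc m)
      have "carrier (?E n) \<noteq> {}" by (simp add: push_module_def F.carrier_not_empty)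
      then have "d n ` carrier (?E n) = {\<zero>\<^bsub>?E (Suc n)\<^esub>}" using Suc by (auto simp: dS)
      also have "\<dots> = a_kernel (?E (Suc n)) (?E (Suc (Suc n))) (d (Suc n))"
        using triv[of "Suc n"] Suc by (auto simp: a_kernel_def' dS)
      finally show ?thesis .
    qed
  qed
  moreover have "\<forall>n>1. carrier (?E n) = {\<zero>\<^bsub>?E n\<^esub>}" using triv by simp
  ultimately show ?thesis unfolding finite_injective_dim_def by blast
qed

end

lemma (in frobenius_domain) gorenstein: "gorenstein U R"
  unfolding gorenstein_def
proof (intro conjI allI impI is_cring noetherian)
  fix P assume "maximalideal P R"
  then interpret P: primeideal P R by (rule maximalideal_prime)
  interpret frobenius_local R k P by unfold_locales
  show "finite_injective_dim U A (ideal_module A (carrier A))"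
    by (rule localization_finite_injective_dim)
qed

section \<open>Free resolutions over noetherian rings\<close>

text \<open>The free module \<open>R\<^sup>n\<close>, realized on the type of the terms of a free resolution by pairing each entry with
  a fixed element.\<close>

definition tuple :: "nat \<Rightarrow> (nat \<Rightarrow> 'r) \<Rightarrow> ('r \<times> 'm) list" where
  "tuple n f = map (\<lambda>i. (f i, undefined)) [0..<n]"

definition entry :: "('r \<times> 'm) list \<Rightarrow> nat \<Rightarrow> 'r" where
  "entry xs i = fst (xs ! i)"

definition tuple_module :: "('r, 'x) ring_scheme \<Rightarrow> nat \<Rightarrow> ('r, ('r \<times> 'm) list) module" where
  "tuple_module R n = \<lparr>carrier = {tuple n f | f. \<forall>i<n. f i \<in> carrier R},
     monoid.mult = (\<lambda>xs ys. tuple n (\<lambda>i. \<zero>\<^bsub>R\<^esub>)), one = tuple n (\<lambda>i. \<zero>\<^bsub>R\<^esub>),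
     ring.zero = tuple n (\<lambda>i. \<zero>\<^bsub>R\<^esub>), ring.add = (\<lambda>xs ys. tuple n (\<lambda>i. entry xs i \<oplus>\<^bsub>R\<^esub> entry ys i)),
     smult = (\<lambda>r xs. tuple n (\<lambda>i. r \<otimes>\<^bsub>R\<^esub> entry xs i))\<rparr>"

lemma entry_tuple [simp]: "i < n \<Longrightarrow> entry (tuple n f) i = f i"
  by (simp add: entry_def tuple_def)

lemma tuple_cong: "(\<And>i. i < n \<Longrightarrow> f i = g i) \<Longrightarrow> tuple n f = tuple n g"
  by (simp add: tuple_def)

lemma tuple_closed [simp]: "(\<And>i. i < n \<Longrightarrow> f i \<in> carrier R) \<Longrightarrow> tuple n f \<in> carrier (tuple_module R n)"
  by (auto simp: tuple_module_def)

lemma entry_closed [simp]: "x \<in> carrier (tuple_module R n) \<Longrightarrow> i < n \<Longrightarrow> entry x i \<in> carrier R"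
  by (auto simp: tuple_module_def)

lemma tuple_eqI:
  assumes "x \<in> carrier (tuple_module R n)" "y \<in> carrier (tuple_module R n)" "\<And>i. i < n \<Longrightarrow> entry x i = entry y i"
  shows "x = y"
proof -
  obtain f g where "x = tuple n f" "y = tuple n g" using assms(1,2) by (auto simp: tuple_module_def)
  then show ?thesis using assms(3) by (auto intro: tuple_cong)
qed

lemma tuple_add: "x \<oplus>\<^bsub>tuple_module R n\<^esub> y = tuple n (\<lambda>i. entry x i \<oplus>\<^bsub>R\<^esub> entry y i)"
  and tuple_smult: "r \<odot>\<^bsub>tuple_module R n\<^esub> x = tuple n (\<lambda>i. r \<otimes>\<^bsub>R\<^esub> entry x i)"
  and tuple_zero: "\<zero>\<^bsub>tuple_module R n\<^esub> = tuple n (\<lambda>i. \<zero>\<^bsub>R\<^esub>)"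
  by (simp_all add: tuple_module_def)

lemma entry_add [simp]: "i < n \<Longrightarrow> entry (x \<oplus>\<^bsub>tuple_module R n\<^esub> y) i = entry x i \<oplus>\<^bsub>R\<^esub> entry y i"
  and entry_smult [simp]: "i < n \<Longrightarrow> entry (r \<odot>\<^bsub>tuple_module R n\<^esub> x) i = r \<otimes>\<^bsub>R\<^esub> entry x i"
  and entry_zero [simp]: "i < n \<Longrightarrow> entry (\<zero>\<^bsub>tuple_module R n\<^esub>) i = \<zero>\<^bsub>R\<^esub>"
  by (simp_all add: tuple_add tuple_smult tuple_zero)

context cring
begin

abbreviation "Tup \<equiv> tuple_module R"

lemma tuple_module_module: "module R (Tup n)"
proof (rule moduleI)
  show "abelian_group (Tup n)"
  proof (rule abelian_groupI)
    fix x y z :: "('a \<times> 'm) list" assume "x \<in> carrier (Tup n)" "y \<in> carrier (Tup n)" "z \<in> carrier (Tup n)"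
    then show "x \<oplus>\<^bsub>Tup n\<^esub> y \<oplus>\<^bsub>Tup n\<^esub> z = x \<oplus>\<^bsub>Tup n\<^esub> (y \<oplus>\<^bsub>Tup n\<^esub> z)"
      by (simp add: tuple_add a_assoc cong: tuple_cong)
  next
    fix x y :: "('a \<times> 'm) list" assume "x \<in> carrier (Tup n)" "y \<in> carrier (Tup n)"
    then show "x \<oplus>\<^bsub>Tup n\<^esub> y \<in> carrier (Tup n)" "x \<oplus>\<^bsub>Tup n\<^esub> y = y \<oplus>\<^bsub>Tup n\<^esub> x"
      by (simp_all add: tuple_add a_comm cong: tuple_cong)
  next
    show "\<zero>\<^bsub>Tup n\<^esub> \<in> carrier (Tup n)" by (simp add: tuple_zero)
    fix x :: "('a \<times> 'm) list" assume x: "x \<in> carrier (Tup n)"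
    show "\<zero>\<^bsub>Tup n\<^esub> \<oplus>\<^bsub>Tup n\<^esub> x = x"
      by (rule tuple_eqI[of _ R n]) (use x in \<open>simp_all add: tuple_zero tuple_add\<close>)
    have "tuple n (\<lambda>i. \<ominus> entry x i) \<oplus>\<^bsub>Tup n\<^esub> x = \<zero>\<^bsub>Tup n\<^esub>"
      using x by (simp add: tuple_add tuple_zero l_neg cong: tuple_cong)
    then show "\<exists>y\<in>carrier (Tup n). y \<oplus>\<^bsub>Tup n\<^esub> x = \<zero>\<^bsub>Tup n\<^esub>"
      using x by (intro bexI[of _ "tuple n (\<lambda>i. \<ominus> entry x i)"]) simp_all
  qed
next
  fix x :: "('a \<times> 'm) list" assume x: "x \<in> carrier (Tup n)"
  show "\<one> \<odot>\<^bsub>Tup n\<^esub> x = x"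
    by (rule tuple_eqI[of _ R n]) (use x in \<open>simp_all add: tuple_smult\<close>)
qed (simp_all add: is_cring tuple_smult tuple_add l_distr r_distr m_assoc cong: tuple_cong)

lemma entry_finsum:
  fixes f :: "'i \<Rightarrow> ('a \<times> 'm) list"
  assumes "finite B" "f \<in> B \<rightarrow> carrier (Tup n)" "i < n"
  shows "entry (finsum (Tup n) f B) i = (\<Oplus>b\<in>B. entry (f b) i)"
proof -
  interpret T: module R "Tup n :: ('a, ('a \<times> 'm) list) module" by (rule tuple_module_module)
  show ?thesis using assms
  proof (induct B)
    case (insert b B)
    then have "f b \<in> carrier (Tup n)" "f \<in> B \<rightarrow> carrier (Tup n)" by auto
    moreover from this have "(\<lambda>b. entry (f b) i) \<in> B \<rightarrow> carrier R" using insert(5) by (auto simp: Pi_iff)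
    ultimately show ?case using insert by simp
  qed (simp add: assms(3))
qed

end

context "domain"
begin

definition unit_tuple :: "nat \<Rightarrow> nat \<Rightarrow> ('a \<times> 'm) list" where
  "unit_tuple n j = tuple n (\<lambda>i. if i = j then \<one> else \<zero>)"

lemma unit_tuple_closed: "unit_tuple n j \<in> carrier (Tup n)"
  by (simp add: unit_tuple_def)

lemma unit_tuple_eq_iff:
  "i < n \<Longrightarrow> j < n \<Longrightarrow> (unit_tuple n i :: ('a \<times> 'm) list) = unit_tuple n j \<longleftrightarrow> i = j"
proof
  assume "i < n" "j < n" and e: "(unit_tuple n i :: ('a \<times> 'm) list) = unit_tuple n j"
  have "entry (unit_tuple n i :: ('a \<times> 'm) list) i = entry (unit_tuple n j :: ('a \<times> 'm) list) i"
    using e by (rule arg_cong)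
  then show "i = j" using \<open>i < n\<close> by (auto simp: unit_tuple_def split: if_splits)
qed simp

lemma unit_tuple_combination:
  fixes c :: "('a \<times> 'm) list \<Rightarrow> 'a"
  assumes c: "\<And>b. c b \<in> carrier R" "\<And>b. b \<notin> unit_tuple n ` {..<n} \<Longrightarrow> c b = \<zero>" and i: "i < n"
  shows "entry (finsum (Tup n) (\<lambda>b. c b \<odot>\<^bsub>Tup n\<^esub> b) {b. c b \<noteq> \<zero>}) i = c (unit_tuple n i)"
proof -
  interpret T: module R "Tup n :: ('a, ('a \<times> 'm) list) module" by (rule tuple_module_module)
  let ?S = "{b. c b \<noteq> \<zero>}"
  have sub: "?S \<subseteq> unit_tuple n ` {..<n}" using c(2) by blast
  then have fin: "finite ?S" by (rule finite_subset) simp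
  have cl: "b \<in> carrier (Tup n)" if "b \<in> ?S" for b using that sub unit_tuple_closed by blast
  have "entry (finsum (Tup n) (\<lambda>b. c b \<odot>\<^bsub>Tup n\<^esub> b) ?S) i = (\<Oplus>b\<in>?S. entry (c b \<odot>\<^bsub>Tup n\<^esub> b) i)"
    by (rule entry_finsum[OF fin]) (use c(1) cl i in auto)
  also have "\<dots> = (\<Oplus>b\<in>?S. if unit_tuple n i = b then c b else \<zero>)"
  proof (rule finsum_cong')
    fix b assume b: "b \<in> ?S"
    then obtain j where j: "j < n" "b = unit_tuple n j" using sub by auto
    have "entry b i = (if i = j then \<one> else \<zero>)" using i j by (simp add: unit_tuple_def)
    then show "entry (c b \<odot>\<^bsub>Tup n\<^esub> b) i = (if unit_tuple n i = b then c b else \<zero>)"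
      using c(1)[of b] i j(1) unit_tuple_eq_iff[OF i j(1), where ?'m = 'm] unfolding j(2) by simp
  qed (use c(1) in auto)
  also have "\<dots> = c (unit_tuple n i)"
  proof (cases "c (unit_tuple n i) = \<zero>")
    case True
    then have "(\<Oplus>b\<in>?S. if unit_tuple n i = b then c b else \<zero>) = (\<Oplus>b\<in>?S. \<zero>)"
      by (intro finsum_cong') auto
    then show ?thesis using True by simp
  next
    case False
    then show ?thesis using c(1) fin by (intro finsum_singleton) auto
  qed
  finally show ?thesis .
qed

lemma tuple_module_free: "free_mod R (Tup n :: ('a, ('a \<times> 'm) list) module)"
  unfolding free_mod_def
proof (intro conjI exI tuple_module_module)
  let ?B = "unit_tuple n ` {..<n} :: ('a \<times> 'm) list set"
  interpret T: module R "Tup n :: ('a, ('a \<times> 'm) list) module" by (rule tuple_module_module)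
  show "is_basis R (Tup n) ?B"
    unfolding is_basis_def
  proof (intro conjI ballI)
    show "?B \<subseteq> carrier (Tup n)" using unit_tuple_closed by blast
    fix x :: "('a \<times> 'm) list" assume x: "x \<in> carrier (Tup n)"
    define c where "c b = (if b \<in> ?B then entry x (inv_into {..<n} (unit_tuple n) b) else \<zero>)" for b
    have inj: "inj_on (unit_tuple n :: nat \<Rightarrow> ('a \<times> 'm) list) {..<n}"
      using unit_tuple_eq_iff by (auto simp: inj_on_def)
    have c_e: "c (unit_tuple n i) = entry x i" if "i < n" for i
      using that inv_into_f_f[OF inj, of i] by (simp add: c_def)
    have c: "c b \<in> carrier R" for b
    proof (cases "b \<in> ?B")
      case True
      then obtain i where "i < n" "b = unit_tuple n i" by auto
      then show ?thesis using c_e x by simp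
    qed (simp add: c_def)
    have c0: "c b = \<zero>" if "b \<notin> ?B" for b using that by (simp add: c_def)
    have finc: "finite {b. c' b \<noteq> \<zero>}" if "\<And>b. b \<notin> ?B \<Longrightarrow> c' b = \<zero>" for c'
      by (rule finite_subset[of _ ?B]) (use that in auto)
    have sumcl: "finsum (Tup n) (\<lambda>b. c' b \<odot>\<^bsub>Tup n\<^esub> b) {b. c' b \<noteq> \<zero>} \<in> carrier (Tup n)"
      if "\<And>b. c' b \<in> carrier R" "\<And>b. b \<notin> ?B \<Longrightarrow> c' b = \<zero>" for c'
    proof (rule T.M.finsum_closed, rule Pi_I)
      fix b assume "b \<in> {b. c' b \<noteq> \<zero>}"
      then have "b \<in> ?B" using that(2) by blast
      then have "b \<in> carrier (Tup n)" using unit_tuple_closed by blast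
      then show "c' b \<odot>\<^bsub>Tup n\<^esub> b \<in> carrier (Tup n)" using that(1) by simp
    qed
    show "\<exists>!c. (\<forall>b. c b \<in> carrier R) \<and> (\<forall>b. b \<notin> ?B \<longrightarrow> c b = \<zero>) \<and> finite {b. c b \<noteq> \<zero>} \<and>
        x = finsum (Tup n) (\<lambda>b. c b \<odot>\<^bsub>Tup n\<^esub> b) {b. c b \<noteq> \<zero>}"
    proof (rule ex1I[of _ c], intro conjI allI impI)
      show "x = finsum (Tup n) (\<lambda>b. c b \<odot>\<^bsub>Tup n\<^esub> b) {b. c b \<noteq> \<zero>}"
        by (rule tuple_eqI[OF x sumcl[OF c c0]]) (simp_all add: unit_tuple_combination[OF c c0] c_e)
    next
      fix c' assume "(\<forall>b. c' b \<in> carrier R) \<and> (\<forall>b. b \<notin> ?B \<longrightarrow> c' b = \<zero>) \<and> finite {b. c' b \<noteq> \<zero>} \<and>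
        x = finsum (Tup n) (\<lambda>b. c' b \<odot>\<^bsub>Tup n\<^esub> b) {b. c' b \<noteq> \<zero>}"
      then have c': "\<And>b. c' b \<in> carrier R" "\<And>b. b \<notin> ?B \<Longrightarrow> c' b = \<zero>"
        "x = finsum (Tup n) (\<lambda>b. c' b \<odot>\<^bsub>Tup n\<^esub> b) {b. c' b \<noteq> \<zero>}" by blast+
      have "entry x i = c' (unit_tuple n i)" if "i < n" for i
        unfolding c'(3) by (rule unit_tuple_combination[OF c'(1,2) that])
      then have "c' (unit_tuple n i) = c (unit_tuple n i)" if "i < n" for i using that c_e by simp
      then show "c' = c" using c'(2) c0 by (intro ext) (metis imageE lessThan_iff)
    qed (use c c0 finc in auto)
  qed
qed

end

context module
begin

text \<open>The linear map \<open>R\<^sup>n \<rightarrow> M\<close> that sends the unit vectors to \<open>y 0, \<dots>, y (n - 1)\<close>.\<close>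

definition tuple_lift :: "nat \<Rightarrow> (nat \<Rightarrow> 'c) \<Rightarrow> ('a \<times> 'm) list \<Rightarrow> 'c" where
  "tuple_lift n y xs = (\<Oplus>\<^bsub>M\<^esub>i\<in>{..<n}. entry xs i \<odot>\<^bsub>M\<^esub> y i)"

lemma tuple_lift_hom:
  assumes y: "\<And>i. i < n \<Longrightarrow> y i \<in> carrier M"
  shows "tuple_lift n y \<in> mod_hom R (tuple_module R n) M"
proof (rule mod_homI)
  fix x :: "('a \<times> 'm) list" assume x: "x \<in> carrier (tuple_module R n)"
  show "tuple_lift n y x \<in> carrier M" unfolding tuple_lift_def
    by (rule M.finsum_closed) (use x y in auto)
  fix z :: "('a \<times> 'm) list" assume z: "z \<in> carrier (tuple_module R n)"
  have "tuple_lift n y (x \<oplus>\<^bsub>tuple_module R n\<^esub> z)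
      = (\<Oplus>\<^bsub>M\<^esub>i\<in>{..<n}. entry x i \<odot>\<^bsub>M\<^esub> y i \<oplus>\<^bsub>M\<^esub> entry z i \<odot>\<^bsub>M\<^esub> y i)"
    unfolding tuple_lift_def by (rule M.finsum_cong') (use x y z in \<open>auto simp: smult_l_distr\<close>)
  also have "\<dots> = tuple_lift n y x \<oplus>\<^bsub>M\<^esub> tuple_lift n y z"
    unfolding tuple_lift_def by (rule M.finsum_addf) (use x y z in auto)
  finally show "tuple_lift n y (x \<oplus>\<^bsub>tuple_module R n\<^esub> z) = tuple_lift n y x \<oplus>\<^bsub>M\<^esub> tuple_lift n y z" .
next
  fix r and x :: "('a \<times> 'm) list" assume r: "r \<in> carrier R" and x: "x \<in> carrier (tuple_module R n)"
  have "tuple_lift n y (r \<odot>\<^bsub>tuple_module R n\<^esub> x) = (\<Oplus>\<^bsub>M\<^esub>i\<in>{..<n}. r \<odot>\<^bsub>M\<^esub> (entry x i \<odot>\<^bsub>M\<^esub> y i))"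
    unfolding tuple_lift_def by (rule M.finsum_cong') (use x y r in \<open>auto simp: smult_assoc1\<close>)
  also have "\<dots> = r \<odot>\<^bsub>M\<^esub> tuple_lift n y x"
    unfolding tuple_lift_def by (rule finsum_smult_ldistr[symmetric]) (use x y r in auto)
  finally show "tuple_lift n y (r \<odot>\<^bsub>tuple_module R n\<^esub> x) = r \<odot>\<^bsub>M\<^esub> tuple_lift n y x" .
qed

lemma tuple_lift_unit:
  assumes y: "\<And>i. i < n \<Longrightarrow> y i \<in> carrier M" and j: "j < n"
  shows "tuple_lift n y (tuple n (\<lambda>i. if i = j then \<one> else \<zero>)) = y j"
proof -
  have "tuple_lift n y (tuple n (\<lambda>i. if i = j then \<one> else \<zero>)) = (\<Oplus>\<^bsub>M\<^esub>i\<in>{..<n}. if j = i then y i else \<zero>\<^bsub>M\<^esub>)"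
    unfolding tuple_lift_def by (rule M.finsum_cong') (use y in auto)
  also have "\<dots> = y j" using y j by (intro M.finsum_singleton) auto
  finally show ?thesis .
qed

end

lemma image_submodule:
  assumes "module R M" "module R N" "f \<in> mod_hom R M N"
  shows "submodule (f ` carrier M) R N"
proof -
  interpret M: module R M by fact
  interpret N: module R N by fact
  note fD = mod_homD[OF assms(3)]
  show ?thesis
  proof (rule N.submoduleI)
    show "f ` carrier M \<subseteq> carrier N" using fD by auto
    show "\<zero>\<^bsub>N\<^esub> \<in> f ` carrier M" using mod_hom_zero[OF assms] by (intro image_eqI[of _ _ "\<zero>\<^bsub>M\<^esub>"]) simp_all
    fix a assume "a \<in> f ` carrier M"
    then obtain x where x: "x \<in> carrier M" "a = f x" by auto
    have "f (\<zero>\<^bsub>M\<^esub> \<ominus>\<^bsub>M\<^esub> x) = \<zero>\<^bsub>N\<^esub> \<ominus>\<^bsub>N\<^esub> f x"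
      using mod_hom_minus[OF assms, of "\<zero>\<^bsub>M\<^esub>" x] mod_hom_zero[OF assms] x by simp
    then show "\<ominus>\<^bsub>N\<^esub> a \<in> f ` carrier M" using x fD
      by (intro image_eqI[of _ _ "\<zero>\<^bsub>M\<^esub> \<ominus>\<^bsub>M\<^esub> x"]) (simp_all add: a_minus_def)
    fix b assume "b \<in> f ` carrier M"
    then obtain y where y: "y \<in> carrier M" "b = f y" by auto
    then show "a \<oplus>\<^bsub>N\<^esub> b \<in> f ` carrier M" using x fD by (intro image_eqI[of _ _ "x \<oplus>\<^bsub>M\<^esub> y"]) simp_all
  next
    fix r a assume r: "r \<in> carrier R" and "a \<in> f ` carrier M"
    then obtain x where x: "x \<in> carrier M" "a = f x" by auto
    then show "r \<odot>\<^bsub>N\<^esub> a \<in> f ` carrier M" using r fD by (intro image_eqI[of _ _ "r \<odot>\<^bsub>M\<^esub> x"]) simp_all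
  qed
qed

lemma kernel_submodule:
  assumes "module R M" "module R N" "f \<in> mod_hom R M N"
  shows "submodule (a_kernel M N f) R M"
proof -
  interpret M: module R M by fact
  interpret N: module R N by fact
  note fD = mod_homD[OF assms(3)]
  show ?thesis unfolding a_kernel_def'
  proof (rule M.submoduleI)
    show "\<zero>\<^bsub>M\<^esub> \<in> {x \<in> carrier M. f x = \<zero>\<^bsub>N\<^esub>}" using mod_hom_zero[OF assms] by simp
    fix a assume a: "a \<in> {x \<in> carrier M. f x = \<zero>\<^bsub>N\<^esub>}"
    then have "f (\<zero>\<^bsub>M\<^esub> \<ominus>\<^bsub>M\<^esub> a) = \<zero>\<^bsub>N\<^esub> \<ominus>\<^bsub>N\<^esub> \<zero>\<^bsub>N\<^esub>"
      using mod_hom_minus[OF assms, of "\<zero>\<^bsub>M\<^esub>" a] mod_hom_zero[OF assms] by simp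
    then show "\<ominus>\<^bsub>M\<^esub> a \<in> {x \<in> carrier M. f x = \<zero>\<^bsub>N\<^esub>}" using a by (simp add: a_minus_def N.r_neg)
  qed (use fD in auto)
qed

text \<open>Hilbert's argument, one coordinate at a time. The \<open>j\<close>-th entries of the vectors of \<open>N\<close> that vanish from
  \<open>j + 1\<close> on form an ideal; vectors whose entries generate it, together with generators for the vectors that vanish
  from \<open>j\<close> on, generate the vectors that vanish from \<open>j + 1\<close> on. Generation is expressed through the submodules
  \<open>Q\<close> that contain \<open>Y\<close>.\<close>

lemma (in cring) tuple_submodule_finite:
  fixes N :: "('a \<times> 'm) list set"
  assumes noeth: "noetherian_ring R" and N: "submodule N R (Tup n)" and "j \<le> n"
  shows "\<exists>Y. finite Y \<and> Y \<subseteq> N \<and>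
    (\<forall>Q. submodule Q R (Tup n) \<longrightarrow> Y \<subseteq> Q \<longrightarrow> {x \<in> N. \<forall>i<n. j \<le> i \<longrightarrow> entry x i = \<zero>} \<subseteq> Q)"
  using assms(3)
proof (induct j)
  case 0
  interpret T: module R "Tup n :: ('a, ('a \<times> 'm) list) module" by (rule tuple_module_module)
  have "{x \<in> N. \<forall>i<n. 0 \<le> i \<longrightarrow> entry x i = \<zero>} \<subseteq> Q" if "submodule Q R (Tup n)" for Q
  proof
    fix x assume x: "x \<in> {x \<in> N. \<forall>i<n. 0 \<le> i \<longrightarrow> entry x i = \<zero>}"
    have "x = \<zero>\<^bsub>Tup n\<^esub>"
      by (rule tuple_eqI[of _ R n]) (use x T.submoduleE(1)[OF N] in auto)
    then show "x \<in> Q" using subgroup.one_closed[OF submodule.axioms(1)[OF that]] by simp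
  qed
  then show ?case by (intro exI[of _ "{}"]) auto
next
  case (Suc j)
  interpret T: module R "Tup n :: ('a, ('a \<times> 'm) list) module" by (rule tuple_module_module)
  note ND = T.submoduleE[OF N]
  have jn: "j < n" using Suc by simp
  obtain Y where Y: "finite Y" "Y \<subseteq> N" "\<And>Q. submodule Q R (Tup n) \<Longrightarrow> Y \<subseteq> Q \<Longrightarrow>
      {x \<in> N. \<forall>i<n. j \<le> i \<longrightarrow> entry x i = \<zero>} \<subseteq> Q" using Suc by auto
  let ?N = "{x \<in> N. \<forall>i<n. Suc j \<le> i \<longrightarrow> entry x i = \<zero>}"
  have entry_uminus: "entry (\<ominus>\<^bsub>Tup n\<^esub> x) i = \<ominus> entry x i" if "x \<in> carrier (Tup n)" "i < n" for x :: "('a \<times> 'm) list" and i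
  proof -
    have "entry (\<ominus>\<^bsub>Tup n\<^esub> x) i \<oplus> entry x i = entry (\<ominus>\<^bsub>Tup n\<^esub> x \<oplus>\<^bsub>Tup n\<^esub> x) i" using that(2) by simp
    also have "\<dots> = \<zero>" using that by (simp add: T.M.l_neg)
    finally show ?thesis using minus_equality[of "entry (\<ominus>\<^bsub>Tup n\<^esub> x) i" "entry x i"] that
        entry_closed[OF T.M.a_inv_closed[OF that(1)] that(2)] by simp
  qed
  have leading: "ideal ((\<lambda>x. entry x j) ` (?N \<inter> Q)) R" if Q: "submodule Q R (Tup n)" for Q
  proof -
    note QD = T.submoduleE[OF Q]
    have z: "\<zero>\<^bsub>Tup n\<^esub> \<in> ?N \<inter> Q"
      using subgroup.one_closed[OF submodule.axioms(1)[OF Q]] subgroup.one_closed[OF submodule.axioms(1)[OF N]] by simp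
    have sm: "r \<odot>\<^bsub>Tup n\<^esub> x \<in> ?N \<inter> Q" if "r \<in> carrier R" "x \<in> ?N \<inter> Q" for r x
      using that ND QD by auto
    show ?thesis
    proof (rule idealI[OF ring_axioms])
      show "subgroup ((\<lambda>x. entry x j) ` (?N \<inter> Q)) (add_monoid R)"
      proof (rule add.subgroupI)
        show "(\<lambda>x. entry x j) ` (?N \<inter> Q) \<subseteq> carrier R" using ND(1) jn by (auto intro!: entry_closed)
        show "(\<lambda>x. entry x j) ` (?N \<inter> Q) \<noteq> {}" using z by blast
        fix a assume "a \<in> (\<lambda>x. entry x j) ` (?N \<inter> Q)"
        then obtain x where x: "x \<in> ?N \<inter> Q" "a = entry x j" by blast
        then have xc: "x \<in> carrier (Tup n)" using ND(1) by blast
        show "\<ominus> a \<in> (\<lambda>x. entry x j) ` (?N \<inter> Q)"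
          using x xc ND(3) QD(3) jn by (intro image_eqI[of _ _ "\<ominus>\<^bsub>Tup n\<^esub> x"]) (simp_all add: entry_uminus)
        fix b assume "b \<in> (\<lambda>x. entry x j) ` (?N \<inter> Q)"
        then obtain y where y: "y \<in> ?N \<inter> Q" "b = entry y j" by blast
        show "a \<oplus> b \<in> (\<lambda>x. entry x j) ` (?N \<inter> Q)"
          using x y ND(5) QD(5) jn by (intro image_eqI[of _ _ "x \<oplus>\<^bsub>Tup n\<^esub> y"]) simp_all
      qed
      fix a r assume "a \<in> (\<lambda>x. entry x j) ` (?N \<inter> Q)" and r: "r \<in> carrier R"
      then obtain x where x: "x \<in> ?N \<inter> Q" "a = entry x j" by blast
      show ra: "r \<otimes> a \<in> (\<lambda>x. entry x j) ` (?N \<inter> Q)"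
        using x jn by (intro image_eqI[OF _ sm[OF r x(1)]]) simp
      have "a \<in> carrier R" using x ND(1) jn by (auto intro!: entry_closed)
      then show "a \<otimes> r \<in> (\<lambda>x. entry x j) ` (?N \<inter> Q)" using ra r by (simp add: m_comm)
    qed
  qed
  obtain A where A: "A \<subseteq> carrier R" "finite A" "(\<lambda>x. entry x j) ` (?N \<inter> N) = Idl A"
    using noetherian_ring.finetely_gen[OF noeth leading[OF N]] by (elim exE conjE) (rule that)
  have AN: "A \<subseteq> (\<lambda>x. entry x j) ` (?N \<inter> N)" using genideal_self[OF A(1)] unfolding A(3) .
  obtain Y' where X: "Y' \<subseteq> ?N \<inter> N" "finite Y'" "A = (\<lambda>x. entry x j) ` Y'"
    using finite_subset_image[OF A(2) AN] by (elim exE conjE) (rule that)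
  have "?N \<subseteq> Q" if Q: "submodule Q R (Tup n)" and YX: "Y \<union> Y' \<subseteq> Q" for Q
  proof
    note QD = T.submoduleE[OF Q]
    fix x assume x: "x \<in> ?N"
    have "Idl A \<subseteq> (\<lambda>x. entry x j) ` (?N \<inter> Q)"
    proof (rule genideal_minimal[OF leading[OF Q]])
      show "A \<subseteq> (\<lambda>x. entry x j) ` (?N \<inter> Q)" unfolding X(3) by (rule image_mono) (use X(1) YX in blast)
    qed
    moreover have "entry x j \<in> Idl A" unfolding A(3)[symmetric] by (rule imageI) (use x in blast)
    ultimately have "entry x j \<in> (\<lambda>x. entry x j) ` (?N \<inter> Q)" by (rule subsetD)
    then obtain y where y': "entry x j = entry y j" "y \<in> ?N \<inter> Q" by (rule imageE)
    then have y: "y \<in> ?N" "y \<in> Q" "entry x j = entry y j" by simp_all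
    have xy: "x \<in> carrier (Tup n)" "y \<in> carrier (Tup n)" using x y ND(1) by auto
    let ?z = "x \<oplus>\<^bsub>Tup n\<^esub> \<ominus>\<^bsub>Tup n\<^esub> y"
    have "entry ?z i = \<zero>" if i: "i < n" "j \<le> i" for i
    proof (cases "i = j")
      case True
      then show ?thesis using xy i y(3) by (simp add: entry_uminus r_neg)
    next
      case False
      then have "entry x i = \<zero>" "entry y i = \<zero>" using x y(1) i by auto
      then show ?thesis using xy i by (simp add: entry_uminus)
    qed
    moreover have "?z \<in> N" using x y ND(3,5) by simp
    ultimately have "?z \<in> Q" using Y(3)[OF Q] YX by blast
    then have "?z \<oplus>\<^bsub>Tup n\<^esub> y \<in> Q" using y QD(5) by blast
    then show "x \<in> Q" using xy by (simp add: T.M.a_assoc T.M.l_neg)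
  qed
  then show ?case using X(1,2) Y(1,2) by (intro exI[of _ "Y \<union> Y'"]) blast
qed

lemma (in cring) tuple_submodule_cover:
  fixes N :: "('a \<times> 'm) list set"
  assumes noeth: "noetherian_ring R" and N: "submodule N R (Tup n)"
  shows "\<exists>l. \<exists>g\<in>mod_hom R (Tup l) (Tup n). g ` carrier (Tup l :: ('a, ('a \<times> 'm) list) module) = N"
proof -
  interpret T: module R "Tup n :: ('a, ('a \<times> 'm) list) module" by (rule tuple_module_module)
  note ND = T.submoduleE[OF N]
  obtain Y where Y: "finite Y" "Y \<subseteq> N" "\<And>Q. submodule Q R (Tup n) \<Longrightarrow> Y \<subseteq> Q \<Longrightarrow> N \<subseteq> Q"
    using tuple_submodule_finite[OF noeth N le_refl] by fastforce
  obtain ys where ys: "set ys = Y" using finite_list[OF Y(1)] by blast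
  let ?l = "length ys"
  have y: "ys ! i \<in> N" if "i < ?l" for i using that ys Y(2) nth_mem by blast
  then have yc: "ys ! i \<in> carrier (Tup n)" if "i < ?l" for i using that ND(1) by blast
  let ?g = "T.tuple_lift ?l (\<lambda>i. ys ! i)"
  have g: "?g \<in> mod_hom R (Tup ?l) (Tup n)" by (rule T.tuple_lift_hom[OF yc])
  have "Y \<subseteq> ?g ` carrier (Tup ?l :: ('a, ('a \<times> 'm) list) module)"
  proof
    fix z assume "z \<in> Y"
    then obtain j where j: "j < ?l" "z = ys ! j" using ys by (auto simp: in_set_conv_nth)
    have "?g (tuple ?l (\<lambda>i. if i = j then \<one> else \<zero>) :: ('a \<times> 'm) list) = ys ! j"
      by (rule T.tuple_lift_unit[OF yc j(1)])
    then show "z \<in> ?g ` carrier (Tup ?l :: ('a, ('a \<times> 'm) list) module)"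
      unfolding j(2) by (rule image_eqI[OF sym]) simp
  qed
  then have "N \<subseteq> ?g ` carrier (Tup ?l :: ('a, ('a \<times> 'm) list) module)"
    using Y(3) image_submodule[OF tuple_module_module tuple_module_module g] by blast
  moreover have "?g x \<in> N" if x: "x \<in> carrier (Tup ?l)" for x :: "('a \<times> 'm) list"
  proof -
    have "(\<Oplus>\<^bsub>Tup n\<^esub>i\<in>B. entry x i \<odot>\<^bsub>Tup n\<^esub> ys ! i) \<in> N" if "finite B" "B \<subseteq> {..<?l}" for B
      using that
    proof (induct B)
      case empty
      then show ?case using subgroup.one_closed[OF submodule.axioms(1)[OF N]] by simp
    next
      case (insert b B)
      have "(\<lambda>i. entry x i \<odot>\<^bsub>Tup n\<^esub> ys ! i) \<in> B \<rightarrow> carrier (Tup n)" using insert x yc by auto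
      moreover have "entry x b \<odot>\<^bsub>Tup n\<^esub> ys ! b \<in> N" using insert x y ND(4) by simp
      ultimately show ?case using insert ND(1,5) by (simp add: subset_iff)
    qed
    then show ?thesis unfolding T.tuple_lift_def by simp
  qed
  ultimately show ?thesis using g by (intro exI[of _ ?l] bexI[of _ ?g]) auto
qed

text \<open>Each kernel is a submodule of some \<open>R\<^sup>n\<close>, hence the image of the next finite free module.\<close>

lemma (in "domain") free_resolution_exists:
  fixes M :: "('a, 'm, 'y) module_scheme"
  assumes noeth: "noetherian_ring R" and M: "module R M"
    and e: "e \<in> mod_hom R (Tup n) M" "e ` carrier (Tup n :: ('a, ('a \<times> 'm) list) module) = carrier M"
  shows "\<exists>(P :: nat \<Rightarrow> ('a, ('a \<times> 'm) list) module) d. P 0 = Tup n \<and> free_resolution R M P d e"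
proof -
  let ?hom = "\<lambda>s :: nat \<times> nat \<times> (('a \<times> 'm) list \<Rightarrow> ('a \<times> 'm) list).
    snd (snd s) \<in> mod_hom R (Tup (fst s)) (Tup (fst (snd s)))"
  let ?P = "\<lambda>k :: nat. \<lambda>s. ?hom s \<and> (k = 0 \<longrightarrow> fst (snd s) = n \<and>
      snd (snd s) ` carrier (Tup (fst s)) = a_kernel (Tup n) M e)"
  let ?Q = "\<lambda>(k :: nat) s s'. fst (snd s') = fst s \<and>
      snd (snd s') ` carrier (Tup (fst s')) = a_kernel (Tup (fst s)) (Tup (fst (snd s))) (snd (snd s))"
  have "\<exists>f. \<forall>k. ?P k (f k) \<and> ?Q k (f k) (f (Suc k))"
  proof (rule dependent_nat_choice)
    obtain l and g :: "('a \<times> 'm) list \<Rightarrow> ('a \<times> 'm) list" where "g \<in> mod_hom R (Tup l) (Tup n)" "g ` carrier (Tup l) = a_kernel (Tup n) M e"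
      using tuple_submodule_cover[OF noeth kernel_submodule[OF tuple_module_module M e(1)]] by blast
    then show "\<exists>s. ?P 0 s" by (intro exI[of _ "(l, n, g)"]) simp
    fix s k assume "?P k s"
    then have "?hom s" by simp
    then obtain l and g :: "('a \<times> 'm) list \<Rightarrow> ('a \<times> 'm) list" where "g \<in> mod_hom R (Tup l) (Tup (fst s))"
      "g ` carrier (Tup l) = a_kernel (Tup (fst s)) (Tup (fst (snd s))) (snd (snd s))"
      using tuple_submodule_cover[OF noeth kernel_submodule[OF tuple_module_module tuple_module_module]] by blast
    then show "\<exists>s'. ?P (Suc k) s' \<and> ?Q k s s'" by (intro exI[of _ "(l, fst s, g)"]) simp
  qed
  then obtain f where f0: "\<forall>k. ?P k (f k) \<and> ?Q k (f k) (f (Suc k))" by (rule exE)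
  have f: "?P k (f k)" "?Q k (f k) (f (Suc k))" for k
    by (rule conjunct1[OF spec[OF f0]], rule conjunct2[OF spec[OF f0]])
  let ?M = "\<lambda>k. Tup (fst (snd (f k))) :: ('a, ('a \<times> 'm) list) module"
  let ?d = "\<lambda>k. snd (snd (f k))"
  have M0: "?M 0 = Tup n" using f(1)[of 0] by simp
  have MS: "?M (Suc k) = Tup (fst (f k))" for k using f(2)[of k] by simp
  have "free_resolution R M ?M ?d e"
    unfolding free_resolution_def
  proof (intro conjI allI)
    show "free_mod R (?M k)" for k by (rule tuple_module_free)
    show "e \<in> mod_hom R (?M 0) M" "e ` carrier (?M 0) = carrier M" unfolding M0 by (rule e)+
    show "?d k \<in> mod_hom R (?M (Suc k)) (?M k)" for k unfolding MS using f(1)[of k] by simp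
    show "?d 0 ` carrier (?M (Suc 0)) = a_kernel (?M 0) M e" unfolding MS M0 using f(1)[of 0] by simp
    show "?d (Suc k) ` carrier (?M (Suc (Suc k))) = a_kernel (?M (Suc k)) (?M k) (?d k)" for k
      unfolding MS[of "Suc k"] MS[of k] using f(2)[of k] by simp
  qed
  then show ?thesis by (intro exI[of _ ?M] exI[of _ ?d] conjI M0)
qed

text \<open>With a free cover \<open>e\<close> of \<open>M\<close> with kernel \<open>Z\<close>, the group \<open>Ext\<^sup>1(M, N)\<close> is the cokernel of the
  restriction from \<open>Hom(P\<^sub>0, N)\<close> to \<open>Hom(Z, N)\<close>.\<close>

lemma (in "domain") ext1_vanishesI:
  fixes M :: "('a, 'm, 'y) module_scheme" and N :: "('a, 'n, 'z) module_scheme"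
  assumes noeth: "noetherian_ring R" and M: "module R M" and N: "module R N"
    and e: "e \<in> mod_hom R (Tup n) M" "e ` carrier (Tup n :: ('a, ('a \<times> 'm) list) module) = carrier M"
    and ext: "\<And>h. h \<in> mod_hom R ((Tup n)\<lparr>carrier := a_kernel (Tup n) M e\<rparr>) N \<Longrightarrow>
      \<exists>g\<in>mod_hom R (Tup n) N. \<forall>z\<in>a_kernel (Tup n) M e. g z = h z"
  shows "ext_vanishes R 1 M N"
proof -
  obtain P :: "nat \<Rightarrow> ('a, ('a \<times> 'm) list) module" and d
    where P0: "P 0 = Tup n" and res: "free_resolution R M P d e"
    using free_resolution_exists[OF noeth M e] by blast
  have Pm: "module R (P k)" for k using res by (simp add: free_resolution_def free_mod_def)
  have dh: "d k \<in> mod_hom R (P (Suc k)) (P k)" for k using res by (simp add: free_resolution_def)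
  have d0: "d 0 ` carrier (P 1) = a_kernel (P 0) M e" using res by (simp add: free_resolution_def)
  have d1: "d 1 ` carrier (P 2) = a_kernel (P 1) (P 0) (d 0)"
    using res unfolding free_resolution_def by (simp add: numeral_2_eq_2)
  have "hom_coboundary R P d N 1 f" if f: "hom_cocycle R P d N 1 f" for f
  proof -
    have fh: "f \<in> mod_hom R (P 1) N" and fd: "\<And>x. x \<in> carrier (P 2) \<Longrightarrow> f (d 1 x) = \<zero>\<^bsub>N\<^esub>"
      using f by (simp_all add: hom_cocycle_def numeral_2_eq_2)
    note fD = mod_homD[OF fh] and dD = mod_homD[OF dh[of 0], folded One_nat_def]
    interpret P1: module R "P 1" by (rule Pm)
    interpret P0: module R "P 0" by (rule Pm)
    interpret N: module R N by (rule N)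
    let ?Z = "a_kernel (Tup n) M e"
    have f_cong: "f w = f w'" if w: "w \<in> carrier (P 1)" "w' \<in> carrier (P 1)" "d 0 w = d 0 w'" for w w'
    proof -
      have "d 0 (w \<ominus>\<^bsub>P 1\<^esub> w') = d 0 w \<ominus>\<^bsub>P 0\<^esub> d 0 w'"
        using mod_hom_minus[OF Pm Pm dh[of 0], folded One_nat_def, OF w(1,2)] .
      then have "w \<ominus>\<^bsub>P 1\<^esub> w' \<in> a_kernel (P 1) (P 0) (d 0)"
        using w(3) dD(1)[OF w(2)] P1.M.minus_closed[OF w(1,2)]
        unfolding a_kernel_def' by (simp add: a_minus_def P0.M.r_neg)
      then obtain x where "x \<in> carrier (P 2)" "w \<ominus>\<^bsub>P 1\<^esub> w' = d 1 x" unfolding d1[symmetric] by (rule imageE)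
      then have "f (w \<ominus>\<^bsub>P 1\<^esub> w') = \<zero>\<^bsub>N\<^esub>" using fd by simp
      then have "f w \<ominus>\<^bsub>N\<^esub> f w' = \<zero>\<^bsub>N\<^esub>" using mod_hom_minus[OF Pm N fh w(1,2)] by simp
      moreover have "f w = (f w \<ominus>\<^bsub>N\<^esub> f w') \<oplus>\<^bsub>N\<^esub> f w'"
        using fD(1)[OF w(1)] fD(1)[OF w(2)] by (simp add: a_minus_def N.M.a_assoc N.M.l_neg)
      ultimately show ?thesis using fD(1)[OF w(2)] by simp
    qed
    define w where "w z = (SOME w. w \<in> carrier (P 1) \<and> d 0 w = z)" for z
    have w: "w z \<in> carrier (P 1)" "d 0 (w z) = z" if "z \<in> ?Z" for z
    proof -
      have "\<exists>w. w \<in> carrier (P 1) \<and> d 0 w = z" using that d0 unfolding P0 by (metis imageE)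
      from someI_ex[OF this] show "w z \<in> carrier (P 1)" "d 0 (w z) = z" unfolding w_def by auto
    qed
    have dZ: "d 0 x \<in> ?Z" if "x \<in> carrier (P 1)" for x using that d0 unfolding P0 by blast
    let ?h = "\<lambda>z. f (w z)"
    have h_d: "?h (d 0 x) = f x" if "x \<in> carrier (P 1)" for x
      using f_cong[OF w(1)[OF dZ[OF that]] that w(2)[OF dZ[OF that]]] .
    have "?h \<in> mod_hom R ((Tup n)\<lparr>carrier := ?Z\<rparr>) N"
    proof (rule mod_homI; simp)
      fix x assume x: "x \<in> ?Z"
      show "?h x \<in> carrier N" using fD(1) w(1)[OF x] by simp
      fix y assume y: "y \<in> ?Z"
      have "d 0 (w x \<oplus>\<^bsub>P 1\<^esub> w y) = x \<oplus>\<^bsub>Tup n\<^esub> y" using dD(2)[OF w(1)[OF x] w(1)[OF y]] w(2)[OF x] w(2)[OF y] P0 by simp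
      then have "?h (x \<oplus>\<^bsub>Tup n\<^esub> y) = f (w x \<oplus>\<^bsub>P 1\<^esub> w y)" using h_d[OF P1.M.a_closed[OF w(1)[OF x] w(1)[OF y]]] by simp
      then show "?h (x \<oplus>\<^bsub>Tup n\<^esub> y) = ?h x \<oplus>\<^bsub>N\<^esub> ?h y" using fD(2)[OF w(1)[OF x] w(1)[OF y]] by simp
    next
      fix r x assume r: "r \<in> carrier R" and x: "x \<in> ?Z"
      have "d 0 (r \<odot>\<^bsub>P 1\<^esub> w x) = r \<odot>\<^bsub>Tup n\<^esub> x" using dD(3)[OF r w(1)[OF x]] w(2)[OF x] P0 by simp
      then have "?h (r \<odot>\<^bsub>Tup n\<^esub> x) = f (r \<odot>\<^bsub>P 1\<^esub> w x)" using h_d[OF P1.smult_closed[OF r w(1)[OF x]]] by simp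
      then show "?h (r \<odot>\<^bsub>Tup n\<^esub> x) = r \<odot>\<^bsub>N\<^esub> ?h x" using fD(3)[OF r w(1)[OF x]] by simp
    qed
    then have "\<exists>g\<in>mod_hom R (Tup n) N. \<forall>z\<in>?Z. g z = ?h z" by (rule ext)
    then obtain g where g: "g \<in> mod_hom R (P 0) N" "\<And>z. z \<in> ?Z \<Longrightarrow> g z = ?h z" unfolding P0 by (elim bexE) simp
    have "\<forall>x\<in>carrier (P 1). f x = g (d 0 x)" using g(2) dZ h_d by simp
    then show ?thesis unfolding hom_coboundary_def using g(1) by (auto intro!: bexI[of _ g])
  qed
  then show ?thesis unfolding ext_vanishes_def
    by (intro exI[of _ P] exI[of _ d] exI[of _ e] conjI res allI impI)
qed

text \<open>Two elements \<open>b\<close>, \<open>b'\<close> of an ideal satisfy the relation \<open>b' b - b b' = 0\<close>, so a basis of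
  an ideal has at most one element.\<close>

lemma (in "domain") free_ideal_principal:
  assumes I: "ideal I R" and free: "free_mod R (ideal_module R I)"
  shows "\<exists>b\<in>I. I \<subseteq> PIdl b"
proof -
  interpret M: module R "ideal_module R I" by (rule ideal_module_module[OF I])
  interpret I: ideal I R by (rule I)
  obtain B where B: "is_basis R (ideal_module R I) B" using free by (auto simp: free_mod_def)
  have BI: "B \<subseteq> I" using B by (simp add: is_basis_def)
  define rep where "rep x c \<longleftrightarrow> (\<forall>b. c b \<in> carrier R) \<and> (\<forall>b. b \<notin> B \<longrightarrow> c b = \<zero>) \<and> finite {b. c b \<noteq> \<zero>} \<and>
        x = finsum (ideal_module R I) (\<lambda>b. c b \<otimes> b) {b. c b \<noteq> \<zero>}" for x c
  have ex1: "\<exists>!c. rep x c" if "x \<in> I" for x using B that by (simp add: is_basis_def rep_def)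
  have rep0: "rep \<zero> (\<lambda>_. \<zero>)" unfolding rep_def using M.M.finsum_empty by simp
  have uniq0: "c = (\<lambda>_. \<zero>)" if "rep \<zero> c" for c
    using ex1[OF I.zero_closed] that rep0 by metis
  have B0: "\<zero> \<notin> B"
  proof
    assume z: "\<zero> \<in> B"
    let ?c = "\<lambda>b. if b = \<zero> then \<one> else \<zero>"
    have s: "{b. ?c b \<noteq> \<zero>} = {\<zero>}" by auto
    have "finsum (ideal_module R I) (\<lambda>b. ?c b \<otimes> b) {\<zero>} = \<zero>"
      using M.M.finsum_insert[of "{}" "\<zero>" "\<lambda>b. ?c b \<otimes> b"] by simp
    then have "rep \<zero> ?c" unfolding rep_def s using z by auto
    then have "?c = (\<lambda>_. \<zero>)" by (rule uniq0)
    then have "?c \<zero> = \<zero>" by (rule fun_cong)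
    then show False by simp
  qed
  have B1: "b = b'" if b: "b \<in> B" "b' \<in> B" for b b'
  proof (rule ccontr)
    assume ne: "b \<noteq> b'"
    have bc: "b \<in> I" "b' \<in> I" "b \<in> carrier R" "b' \<in> carrier R" using b BI I.Icarr by auto
    have b0: "b \<noteq> \<zero>" "b' \<noteq> \<zero>" using b B0 by auto
    have mb0: "\<ominus> b \<noteq> \<zero>" using b0(1) bc(3) minus_minus[OF bc(3)] minus_equality[of \<zero> \<zero>] by auto
    let ?c = "\<lambda>x. if x = b then b' else if x = b' then \<ominus> b else \<zero>"
    have s: "{x. ?c x \<noteq> \<zero>} = {b, b'}" using ne b0 mb0 by auto
    have "finsum (ideal_module R I) (\<lambda>x. ?c x \<otimes> x) {b, b'} = ?c b \<otimes> b \<oplus> (?c b' \<otimes> b' \<oplus> \<zero>)"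
      using M.M.finsum_insert[of "{b'}" b "\<lambda>x. ?c x \<otimes> x"] M.M.finsum_insert[of "{}" b' "\<lambda>x. ?c x \<otimes> x"] ne bc I.I_l_closed
      by (simp add: Pi_def)
    also have "\<dots> = \<zero>" using ne bc by (simp add: l_minus m_comm[of b b'] r_neg)
    finally have "rep \<zero> ?c" unfolding rep_def s using b bc by auto
    then have "?c = (\<lambda>_. \<zero>)" by (rule uniq0)
    then have "?c b = \<zero>" by (rule fun_cong)
    then show False using b0 by simp
  qed
  obtain b where bI: "b \<in> I" and "B \<subseteq> {b}"
  proof (cases "B = {}")
    case True
    then show ?thesis using that[OF I.zero_closed] by simp
  next
    case False
    then obtain b where "b \<in> B" by blast
    then show ?thesis using that[of b] B1 BI by blast
  qed
  then have b: "b \<in> carrier R" "B \<subseteq> {b}" using I.Icarr by auto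
  have "x \<in> PIdl b" if x: "x \<in> I" for x
  proof -
    obtain c where "rep x c" using ex1[OF x] by blast
    then have c: "\<And>b. c b \<in> carrier R" "\<And>b. b \<notin> B \<Longrightarrow> c b = \<zero>"
      "x = finsum (ideal_module R I) (\<lambda>b. c b \<otimes> b) {b. c b \<noteq> \<zero>}" unfolding rep_def by blast+
    have sub: "{y. c y \<noteq> \<zero>} \<subseteq> {b}" using c(2) b(2) by blast
    show ?thesis
    proof (cases "c b = \<zero>")
      case True
      then have "{y. c y \<noteq> \<zero>} = {}" using sub by blast
      then have "x = \<zero>" using c(3) M.M.finsum_empty by simp
      moreover have "\<zero> \<in> PIdl b"
        using additive_subgroup.zero_closed[OF ideal.axioms(1)[OF cgenideal_ideal[OF b(1)]]] .
      ultimately show ?thesis by simp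
    next
      case False
      then have s: "{y. c y \<noteq> \<zero>} = {b}" using sub by blast
      have "c b \<in> carrier R" by (rule c(1))
      then have "finsum (ideal_module R I) (\<lambda>b. c b \<otimes> b) {b} = c b \<otimes> b"
        using M.M.finsum_insert[of "{}" b "\<lambda>b. c b \<otimes> b"] bI I.I_l_closed b(1) by simp
      then have "x = c b \<otimes> b" using c(3) unfolding s by simp
      then show ?thesis using \<open>c b \<in> carrier R\<close> unfolding cgenideal_def by blast
    qed
  qed
  then show ?thesis using bI by blast
qed

section \<open>Perpendicular subspaces of a finite extension\<close>

context ring
begin

context
  fixes K assumes K: "subfield K R"
begin

lemma dimension_subspace: "dimension m K E \<Longrightarrow> lin_subspace R K E"
  using space_subgroup_props[OF K] by (intro lin_subspaceI subfieldE(1)[OF K])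

lemma Span_dimension_le:
  assumes "set us \<subseteq> carrier R"
  shows "\<exists>m\<le>length us. dimension m K (Span K us)"
  using assms
proof (induct us)
  case Nil
  then show ?case by auto
next
  case (Cons u us)
  then obtain m where m: "m \<le> length us" "dimension m K (Span K us)" by auto
  have uc: "u \<in> carrier R" and sub: "lin_subspace R K (Span K us)"
    using Cons dimension_subspace[OF m(2)] by auto
  show ?case
  proof (cases "u \<in> Span K us")
    case True
    then have "line_extension K u (Span K us) \<subseteq> Span K us"
      using lin_subspaceD(3,4)[OF sub] by (auto simp: line_extension_mem_iff simp del: Span.simps)
    moreover have "Span K us \<subseteq> line_extension K u (Span K us)"
      using line_extension_base[OF K lin_subspaceD(1)[OF sub] uc] .
    ultimately have "Span K (u # us) = Span K us" by simp
    then show ?thesis using m by (intro exI[of _ m]) (simp del: Span.simps)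
  next
    case False
    then have "dimension (Suc m) K (Span K (u # us))" using Suc_dim[OF uc False m(2)] by simp
    then show ?thesis using m(1) by (intro exI[of _ "Suc m"]) (simp del: Span.simps)
  qed
qed

lemma subspace_dimension:
  assumes "dimension m K E" "lin_subspace R K U" "U \<subseteq> E"
  obtains l where "dimension l K U"
proof -
  have "subalgebra K U R"
    using assms(2) by (simp add: lin_subspace_def additive_subgroup_def subalgebra_def subalgebra_axioms_def)
  then have "finite_dimension K U"
    using subalbegra_incl_imp_finite_dimension[OF K finite_dimensionI[OF assms(1)] _ assms(3)] by blast
  then show thesis using that by blast
qed

lemma subspace_eq_by_dimension:
  assumes "dimension m K U" "dimension m K E" "U \<subseteq> E"
  shows "U = E"
proof -
  obtain us where us: "set us \<subseteq> carrier R" "independent K us" "length us = m" "Span K us = U"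
    using exists_base[OF K assms(1)] by blast
  have "set us \<subseteq> E" using Span_base_incl[OF K us(1)] us(4) assms(3) by blast
  then show ?thesis using independent_length_eq_dimension[OF K assms(2) us(2)] us(3,4) by blast
qed

end

end

lemma (in ring) l_coset_mem_iff: "x \<in> a <# E \<longleftrightarrow> (\<exists>y\<in>E. x = a \<otimes> y)"
  by (auto simp: l_coset_def)

lemma (in abelian_monoid) set_add_mem_iff: "x \<in> A <+>\<^bsub>G\<^esub> B \<longleftrightarrow> (\<exists>a\<in>A. \<exists>b\<in>B. x = a \<oplus> b)"
  by (auto simp: set_add_def')

lemma (in ring) l_cosetI: "y \<in> E \<Longrightarrow> x = a \<otimes> y \<Longrightarrow> x \<in> a <# E"
  unfolding l_coset_mem_iff by (rule bexI)

lemma (in abelian_monoid) set_addI: "a \<in> A \<Longrightarrow> b \<in> B \<Longrightarrow> x = a \<oplus> b \<Longrightarrow> x \<in> A <+>\<^bsub>G\<^esub> B"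
  unfolding set_add_mem_iff by blast

lemma (in "domain") dimension_scale:
  assumes "subfield K R" "a \<in> carrier R" "a \<noteq> \<zero>" "dimension m K E"
  shows "dimension m K (a <# E)"
  using assms(4,1)
proof (induct m K E rule: dimension.induct)
  case (zero_dim K)
  have "a <# {\<zero>} = {\<zero>}" using assms(2) by (simp add: l_coset_def)
  then show ?case by auto
next
  case (Suc_dim v E m K)
  have E: "E \<subseteq> carrier R" and k: "K \<subseteq> carrier R"
    using space_subgroup_props(1) k_carrier Suc_dim by blast+
  have nv: "a \<otimes> v \<notin> a <# E"
  proof
    assume "a \<otimes> v \<in> a <# E"
    then obtain y where y: "y \<in> E" "a \<otimes> v = a \<otimes> y" unfolding l_coset_mem_iff by (rule bexE)
    have "y \<in> carrier R" using y(1) E by blast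
    then have "v = y" using y(2) assms(2,3) Suc_dim(1) m_lcancel[of a v y] by simp
    then show False using y(1) Suc_dim(2) by simp
  qed
  have eq: "a \<otimes> (c \<otimes> v \<oplus> y) = c \<otimes> (a \<otimes> v) \<oplus> a \<otimes> y" if "c \<in> K" "y \<in> E" for c y
  proof -
    have "c \<in> carrier R" "y \<in> carrier R" using that k E by blast+
    then show ?thesis using assms(2) Suc_dim(1) by (simp add: r_distr m_lcomm)
  qed
  have "a <# line_extension K v E = line_extension K (a \<otimes> v) (a <# E)"
  proof (intro equalityI subsetI)
    fix x assume "x \<in> a <# line_extension K v E"
    then obtain z where z: "z \<in> line_extension K v E" "x = a \<otimes> z" unfolding l_coset_mem_iff by (rule bexE)
    from z(1) obtain c y where cy': "c \<in> K" "y \<in> E" "z = c \<otimes> v \<oplus> y" unfolding line_extension_mem_iff by blast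
    then have cy: "c \<in> K" "y \<in> E" "x = a \<otimes> (c \<otimes> v \<oplus> y)" using z(2) by simp_all
    show "x \<in> line_extension K (a \<otimes> v) (a <# E)"
      unfolding line_extension_mem_iff cy(3) eq[OF cy(1,2)]
      using cy(1,2) by (intro bexI[of _ c] bexI[of _ "a \<otimes> y"] refl) (auto simp: l_coset_mem_iff)
  next
    fix x assume "x \<in> line_extension K (a \<otimes> v) (a <# E)"
    then obtain c z where cz: "c \<in> K" "z \<in> a <# E" "x = c \<otimes> (a \<otimes> v) \<oplus> z"
      unfolding line_extension_mem_iff by blast
    from cz(2) obtain y where y: "y \<in> E" "z = a \<otimes> y" unfolding l_coset_mem_iff by (rule bexE)
    then have cy: "c \<in> K" "y \<in> E" "x = c \<otimes> (a \<otimes> v) \<oplus> a \<otimes> y" using cz by simp_all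
    show "x \<in> a <# line_extension K v E"
      unfolding l_coset_mem_iff cy(3) eq[OF cy(1,2), symmetric]
      using cy(1,2) by (intro bexI[of _ "c \<otimes> v \<oplus> y"] refl) (auto simp: line_extension_mem_iff)
  qed
  then show ?case using dimension.Suc_dim[OF _ nv Suc_dim(4)[OF Suc_dim(5)]] assms(2) Suc_dim(1) by simp
qed

locale radical_extension = field L for L (structure) +
  fixes K V :: "'a set" and \<alpha> :: 'a and n :: nat
  assumes K: "subfield K L"
    and alpha: "\<alpha> \<in> carrier L" "\<alpha> \<notin> K"
    and generates: "simple_extension K \<alpha> = carrier L"
    and degree: "dimension n K (carrier L)"
    and n_mod: "n mod 4 = 0"
    and alpha_pow: "\<alpha> [^] n \<in> K - {\<zero>}"
    and V: "lin_subspace L K V" "K \<subseteq> V"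
    and V_dim: "dimension (n div 4) K V"
    and direct: "\<forall>u\<in>V. \<forall>v\<in>V. \<forall>w\<in>V. u \<oplus> \<alpha> \<otimes> v \<oplus> \<alpha> [^] (2::nat) \<otimes> w = \<zero> \<longrightarrow>
           u = \<zero> \<and> \<alpha> \<otimes> v = \<zero> \<and> \<alpha> [^] (2::nat) \<otimes> w = \<zero>"
    and V_square: "span_prod L K V V = power_span L K \<alpha> (n - 4)"
    and V_span: "carrier L = span_prod L K V (power_span L K \<alpha> (n - 3))"
begin

abbreviation "PS \<equiv> power_span L K \<alpha>"

lemma Kc: "c \<in> K \<Longrightarrow> c \<in> carrier L"
  using k_carrier[OF K] by blast

lemma subring_K: "subring K L" by (rule subfieldE(1)[OF K])

lemmas K_props = subringE[OF subring_K]

lemma n_pos: "n \<noteq> 0"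
proof
  assume "n = 0"
  then have "carrier L = {\<zero>}" using dimension_zero[OF K] degree by simp
  then show False using one_closed one_not_zero by blast
qed

lemma n_ge: "n \<ge> 4"
  using n_pos n_mod by presburger

lemma n_div: "4 * (n div 4) = n"
  using n_mod by presburger

lemma alpha_nonzero: "\<alpha> \<noteq> \<zero>"
  using alpha(2) K_props(2) by blast

lemma pow_closed [simp]: "\<alpha> [^] (i::nat) \<in> carrier L"
  using alpha(1) by simp

lemma pow_Suc: "\<alpha> \<otimes> \<alpha> [^] (i::nat) = \<alpha> [^] Suc i"
  using alpha(1) by (simp add: m_comm)

lemma PS_rel_span: "PS i = rel_span K {\<zero>} (map (\<lambda>j. \<alpha> [^] j) [0..<Suc i])"
  unfolding power_span_def Span_eq_rel_span ..

lemma zero_subspace: "lin_subspace L K {\<zero>}"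
  by (rule lin_subspaceI[OF _ _ _ _ subring_K]) (use Kc in auto)

lemma pow_list_closed: "set (map (\<lambda>j. \<alpha> [^] j) [0..<i]) \<subseteq> carrier L"
  by auto

lemma PS_subspace: "lin_subspace L K (PS i)"
  unfolding PS_rel_span by (rule rel_span_subspace[OF K zero_subspace pow_list_closed])

lemmas PS_props = lin_subspaceD[OF PS_subspace]

lemma PS_pow: "j \<le> i \<Longrightarrow> \<alpha> [^] j \<in> PS i"
  unfolding PS_rel_span by (rule subsetD[OF rel_span_gen[OF K zero_subspace pow_list_closed]]) (auto simp del: upt_Suc)

lemma PS_min:
  assumes "lin_subspace L K M" "\<And>j. j \<le> i \<Longrightarrow> \<alpha> [^] j \<in> M"
  shows "PS i \<subseteq> M"
  unfolding PS_rel_span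
  by (rule rel_span_min[OF K assms(1)]) (use lin_subspaceD(2)[OF assms(1)] assms(2) in auto)

lemma PS_dimension_le: "\<exists>m\<le>Suc i. dimension m K (PS i)"
  using Span_dimension_le[OF K pow_list_closed, of "Suc i"] by (simp add: power_span_def del: Span.simps)

lemma transporter_subspace:
  assumes M: "lin_subspace L K M" and a: "a \<in> carrier L"
  shows "lin_subspace L K {x \<in> carrier L. a \<otimes> x \<in> M}"
proof (rule lin_subspaceI[OF _ _ _ _ subring_K])
  note MD = lin_subspaceD[OF M]
  show "\<zero> \<in> {x \<in> carrier L. a \<otimes> x \<in> M}" using MD a by simp
  show "x \<oplus> y \<in> {x \<in> carrier L. a \<otimes> x \<in> M}"
    if "x \<in> {x \<in> carrier L. a \<otimes> x \<in> M}" "y \<in> {x \<in> carrier L. a \<otimes> x \<in> M}" for x y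
    using that a MD(3) by (simp add: r_distr)
  show "c \<otimes> x \<in> {x \<in> carrier L. a \<otimes> x \<in> M}" if "c \<in> K" "x \<in> {x \<in> carrier L. a \<otimes> x \<in> M}" for c x
  proof -
    have "a \<otimes> (c \<otimes> x) = c \<otimes> (a \<otimes> x)" using that a Kc by (simp add: m_lcomm)
    then show ?thesis using that a Kc MD(4) by simp
  qed
qed blast

lemma alpha_closed_span_full:
  assumes M: "lin_subspace L K M" "K \<subseteq> M" "\<And>x. x \<in> M \<Longrightarrow> \<alpha> \<otimes> x \<in> M"
  shows "carrier L \<subseteq> M"
proof
  fix x assume "x \<in> carrier L"
  then have "x \<in> simple_extension K \<alpha>" using generates by simp
  then show "x \<in> M"
  proof (induct rule: simple_extension.induct)
    case zero
    show ?case using lin_subspaceD(2)[OF M(1)] .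
  next
    case (lin k1 k2)
    have "k1 \<in> carrier L" using lin_subspaceD(1)[OF M(1)] lin by blast
    then have "k1 \<otimes> \<alpha> = \<alpha> \<otimes> k1" using alpha(1) by (simp add: m_comm)
    then have "k1 \<otimes> \<alpha> \<in> M" using M(3)[OF lin(2)] by simp
    moreover have "k2 \<in> M" using M(2) lin(3) by blast
    ultimately show ?case by (rule lin_subspaceD(3)[OF M(1)])
  qed
qed

lemma K_subset_PS: "K \<subseteq> PS i"
proof
  fix c assume c: "c \<in> K"
  have "c \<otimes> \<alpha> [^] (0::nat) \<in> PS i" by (rule PS_props(4)[OF c PS_pow]) simp
  then show "c \<in> PS i" using Kc[OF c] by simp
qed

lemma alpha_PS_closed:
  assumes "\<alpha> [^] Suc i \<in> PS i" "x \<in> PS i"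
  shows "\<alpha> \<otimes> x \<in> PS i"
proof -
  have "PS i \<subseteq> {x \<in> carrier L. \<alpha> \<otimes> x \<in> PS i}"
  proof (rule PS_min[OF transporter_subspace[OF PS_subspace alpha(1)]])
    fix j assume j: "j \<le> i"
    have "\<alpha> [^] Suc j \<in> PS i" using assms(1) PS_pow[of "Suc j" i] j by (cases "j = i") simp_all
    then show "\<alpha> [^] j \<in> {x \<in> carrier L. \<alpha> \<otimes> x \<in> PS i}" by (simp add: pow_Suc del: nat_pow_Suc)
  qed
  then show ?thesis using assms(2) by blast
qed

lemma PS_full: "PS (n - 1) = carrier L"
proof -
  have "\<alpha> [^] Suc (n - 1) \<in> PS (n - 1)" using alpha_pow K_subset_PS n_pos by auto
  then have "carrier L \<subseteq> PS (n - 1)"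
    by (intro alpha_closed_span_full[OF PS_subspace K_subset_PS] alpha_PS_closed)
  then show ?thesis using PS_props(1) by blast
qed

lemma pow_notin_PS:
  assumes "Suc i < n"
  shows "\<alpha> [^] Suc i \<notin> PS i"
proof
  assume "\<alpha> [^] Suc i \<in> PS i"
  then have "carrier L \<subseteq> PS i"
    by (intro alpha_closed_span_full[OF PS_subspace K_subset_PS] alpha_PS_closed)
  then have "PS i = carrier L" using PS_props(1) by blast
  then obtain m where "m \<le> Suc i" "dimension m K (carrier L)" using PS_dimension_le[of i] by auto
  then show False using dimension_is_inj[OF K degree, of m] assms by simp
qed

lemma PS_zero: "PS 0 = K"
proof
  show "K \<subseteq> PS 0" by (rule K_subset_PS)
  show "PS 0 \<subseteq> K"
    by (rule PS_min[OF lin_subspaceI[OF K_props(1,2,7,6) subring_K]]) (use K_props(3) in auto)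
qed

lemma PS_mono: "i \<le> j \<Longrightarrow> PS i \<subseteq> PS j"
  by (rule PS_min[OF PS_subspace PS_pow]) simp

lemma PS_Suc: "PS (Suc i) = line_extension K (\<alpha> [^] Suc i) (PS i)"
proof
  let ?M = "line_extension K (\<alpha> [^] Suc i) (PS i)"
  have M: "lin_subspace L K ?M" by (rule line_extension_subspace[OF K PS_subspace pow_closed])
  show "PS (Suc i) \<subseteq> ?M"
  proof (rule PS_min[OF M])
    fix j assume "j \<le> Suc i"
    then show "\<alpha> [^] j \<in> ?M"
      using line_extension_base[OF K PS_props(1)[of i] pow_closed[of "Suc i"]] PS_pow[of j i]
        line_extension_gen[OF K PS_props(2)[of i] pow_closed[of "Suc i"]]
      by (cases "j = Suc i") auto
  qed
  show "?M \<subseteq> PS (Suc i)"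
  proof
    fix x assume "x \<in> ?M"
    then obtain c v where cv: "c \<in> K" "v \<in> PS i" "x = c \<otimes> \<alpha> [^] Suc i \<oplus> v"
      unfolding line_extension_mem_iff by blast
    have "v \<in> PS (Suc i)" using PS_mono[of i "Suc i"] cv(2) by auto
    then show "x \<in> PS (Suc i)"
      unfolding cv(3) by (rule PS_props(3)[OF PS_props(4)[OF cv(1) PS_pow[OF le_refl]]])
  qed
qed

lemma PS_dimension: "i < n \<Longrightarrow> dimension (Suc i) K (PS i)"
proof (induct i)
  case 0
  show ?case using dimension_one[OF K] by (simp add: PS_zero)
next
  case (Suc i)
  then show ?case unfolding PS_Suc by (intro Suc_dim pow_notin_PS pow_closed) simp_all
qed

lemma PS_mult:
  assumes "x \<in> PS i" "y \<in> PS j"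
  shows "x \<otimes> y \<in> PS (i + j)"
proof -
  have "\<alpha> [^] a \<otimes> y \<in> PS (i + j)" if a: "a \<le> i" for a
  proof -
    have "PS j \<subseteq> {y \<in> carrier L. \<alpha> [^] a \<otimes> y \<in> PS (i + j)}"
      by (rule PS_min[OF transporter_subspace[OF PS_subspace pow_closed]])
        (use a alpha(1) in \<open>auto simp: nat_pow_mult intro: PS_pow\<close>)
    then show ?thesis using assms(2) by blast
  qed
  moreover have y: "y \<in> carrier L" using assms(2) PS_props(1) by blast
  ultimately have "PS i \<subseteq> {x \<in> carrier L. y \<otimes> x \<in> PS (i + j)}"
    by (intro PS_min[OF transporter_subspace[OF PS_subspace y]]) (auto simp: m_comm)
  then show ?thesis using assms(1) y by (auto simp: m_comm)
qed

lemma alpha_mem_PS: "1 \<le> i \<Longrightarrow> \<alpha> \<in> PS i"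
  using PS_pow[of 1 i] alpha(1) by simp

definition H where "H = PS (n - 2)"

lemma H_subspace: "lin_subspace L K H" unfolding H_def by (rule PS_subspace)

lemmas H_props = lin_subspaceD[OF H_subspace]

lemma top_pow_notin_H: "\<alpha> [^] (n - 1) \<notin> H"
proof -
  have "Suc (n - 2) = n - 1" using n_ge by simp
  then show ?thesis using pow_notin_PS[of "n - 2"] n_ge unfolding H_def by simp
qed

lemma H_decomp:
  assumes "x \<in> carrier L"
  shows "\<exists>!c. c \<in> K \<and> x \<ominus> c \<otimes> \<alpha> [^] (n - 1) \<in> H"
proof -
  let ?a = "\<alpha> [^] (n - 1)"
  have s: "Suc (n - 2) = n - 1" using n_ge by simp
  have "x \<in> line_extension K ?a H" using PS_Suc[of "n - 2"] PS_full assms unfolding s H_def by simp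
  then obtain c v where cv: "c \<in> K" "v \<in> H" "x = c \<otimes> ?a \<oplus> v" unfolding line_extension_mem_iff by blast
  have cc: "c \<in> carrier L" "v \<in> carrier L" using cv(1,2) Kc H_props(1) by auto
  show ?thesis
  proof (rule ex1I[of _ c])
    have "x \<ominus> c \<otimes> ?a = v" unfolding cv(3) using cc pow_closed[of "n - 1"] by algebra
    then show "c \<in> K \<and> x \<ominus> c \<otimes> ?a \<in> H" using cv by simp
    fix d assume d: "d \<in> K \<and> x \<ominus> d \<otimes> ?a \<in> H"
    have dc: "d \<in> carrier L" using d Kc by simp
    have "(x \<ominus> d \<otimes> ?a) \<ominus> (x \<ominus> c \<otimes> ?a) \<in> H" using d \<open>c \<in> K \<and> x \<ominus> c \<otimes> ?a \<in> H\<close> H_props(6) by simp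
    moreover have "(x \<ominus> d \<otimes> ?a) \<ominus> (x \<ominus> c \<otimes> ?a) = (c \<ominus> d) \<otimes> ?a"
      using cc dc assms pow_closed[of "n - 1"] by algebra
    ultimately have h: "(c \<ominus> d) \<otimes> ?a \<in> H" by simp
    show "d = c"
    proof (rule ccontr)
      assume "d \<noteq> c"
      have cd: "c \<ominus> d \<in> K" using cv(1) d K_props(5,7) by (simp add: a_minus_def)
      have "c \<ominus> d \<noteq> \<zero>" using \<open>d \<noteq> c\<close> cc dc by simp
      then have i: "inv (c \<ominus> d) \<in> K" "inv (c \<ominus> d) \<otimes> (c \<ominus> d) = \<one>"
        using subfield_m_inv[OF K, of "c \<ominus> d"] cd by auto
      have "inv (c \<ominus> d) \<otimes> ((c \<ominus> d) \<otimes> ?a) \<in> H" by (rule H_props(4)[OF i(1) h])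
      moreover have "inv (c \<ominus> d) \<otimes> ((c \<ominus> d) \<otimes> ?a) = ?a"
        using i(2) Kc[OF i(1)] Kc[OF cd] m_assoc[of "inv (c \<ominus> d)" "c \<ominus> d" ?a] by simp
      ultimately show False using top_pow_notin_H by simp
    qed
  qed
qed

text \<open>The coordinate at \<open>\<alpha>\<^sup>n\<^sup>-\<^sup>1\<close>, a functional with kernel \<open>H\<close>. Since \<open>L\<close> is a field, the form
  \<open>(x, y) \<mapsto> \<tau> (x y)\<close> is nondegenerate.\<close>

definition \<tau> where "\<tau> x = (THE c. c \<in> K \<and> x \<ominus> c \<otimes> \<alpha> [^] (n - 1) \<in> H)"

lemma tau: "x \<in> carrier L \<Longrightarrow> \<tau> x \<in> K \<and> x \<ominus> \<tau> x \<otimes> \<alpha> [^] (n - 1) \<in> H"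
  unfolding \<tau>_def by (rule theI'[OF H_decomp])

lemma tau_eq: "x \<in> carrier L \<Longrightarrow> c \<in> K \<Longrightarrow> x \<ominus> c \<otimes> \<alpha> [^] (n - 1) \<in> H \<Longrightarrow> \<tau> x = c"
  unfolding \<tau>_def using H_decomp by (intro the1_equality) auto

lemma tau_functional: "ring_functional L K \<tau>"
proof (intro ring_functional.intro ring_functional_axioms.intro is_cring K)
  let ?a = "\<alpha> [^] (n - 1)"
  show "\<tau> x \<in> K" if "x \<in> carrier L" for x using tau[OF that] ..
  show "\<tau> (x \<oplus> y) = \<tau> x \<oplus> \<tau> y" if xy: "x \<in> carrier L" "y \<in> carrier L" for x y
  proof (rule tau_eq)
    have c: "\<tau> x \<in> carrier L" "\<tau> y \<in> carrier L" using tau xy Kc by auto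
    have "(x \<oplus> y) \<ominus> (c \<oplus> d) \<otimes> ?a = (x \<ominus> c \<otimes> ?a) \<oplus> (y \<ominus> d \<otimes> ?a)" if "c \<in> carrier L" "d \<in> carrier L" for c d
      using that xy pow_closed[of "n - 1"] by algebra
    from this[OF c] show "(x \<oplus> y) \<ominus> (\<tau> x \<oplus> \<tau> y) \<otimes> ?a \<in> H" using tau xy H_props(3) by simp
  qed (use tau xy K_props(7) in auto)
  show "\<tau> (e \<otimes> x) = e \<otimes> \<tau> x" if ex: "e \<in> K" "x \<in> carrier L" for e x
  proof (rule tau_eq)
    have c: "\<tau> x \<in> carrier L" "e \<in> carrier L" using tau ex Kc by auto
    have "e \<otimes> x \<ominus> (e \<otimes> c) \<otimes> ?a = e \<otimes> (x \<ominus> c \<otimes> ?a)" if "c \<in> carrier L" for c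
      using that ex(2) c(2) pow_closed[of "n - 1"] by algebra
    from this[OF c(1)] show "e \<otimes> x \<ominus> (e \<otimes> \<tau> x) \<otimes> ?a \<in> H" using tau ex H_props(4) by simp
  qed (use tau ex K_props(6) Kc in auto)
qed

sublocale tau: ring_functional L K \<tau> by (rule tau_functional)

lemma tau_eq_zero_iff: "x \<in> carrier L \<Longrightarrow> \<tau> x = \<zero> \<longleftrightarrow> x \<in> H"
proof
  assume x: "x \<in> carrier L"
  show "x \<in> H" if "\<tau> x = \<zero>" using tau[OF x] that x by (simp add: a_minus_def)
  show "\<tau> x = \<zero>" if "x \<in> H" using that x K_props(2) by (intro tau_eq) (simp_all add: a_minus_def)
qed

lemma nondegenerate:
  assumes "x \<in> carrier L" "\<And>y. y \<in> carrier L \<Longrightarrow> y \<otimes> x \<in> H"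
  shows "x = \<zero>"
proof (rule ccontr)
  assume "x \<noteq> \<zero>"
  then have u: "x \<in> Units L" using assms(1) field_Units by simp
  have "\<alpha> [^] (n - 1) \<otimes> inv x \<otimes> x \<in> H" using assms u by simp
  then show False using top_pow_notin_H u assms(1) by (simp add: m_assoc)
qed

lemma tau_radical: "tau.radical = {\<zero>}"
  unfolding tau.radical_def using nondegenerate tau_eq_zero_iff H_props(2) by auto

definition perp where "perp U = {x \<in> carrier L. \<forall>u\<in>U. x \<otimes> u \<in> H}"

lemma perp_subspace:
  assumes "U \<subseteq> carrier L"
  shows "lin_subspace L K (perp U)"
proof (rule lin_subspaceI[OF _ _ _ _ subring_K])
  show "c \<otimes> x \<in> perp U" if "c \<in> K" "x \<in> perp U" for c x
  proof -
    have "c \<otimes> x \<otimes> u \<in> H" if u: "u \<in> U" for u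
    proof -
      have "c \<otimes> x \<otimes> u = c \<otimes> (x \<otimes> u)" using u assms Kc \<open>c \<in> K\<close> \<open>x \<in> perp U\<close>
        by (intro m_assoc) (auto simp: perp_def)
      then show ?thesis using H_props(4) \<open>c \<in> K\<close> \<open>x \<in> perp U\<close> u by (simp add: perp_def)
    qed
    then show ?thesis using that Kc by (simp add: perp_def)
  qed
  show "x \<oplus> y \<in> perp U" if "x \<in> perp U" "y \<in> perp U" for x y
  proof -
    have "(x \<oplus> y) \<otimes> u \<in> H" if u: "u \<in> U" for u
    proof -
      have "u \<in> carrier L" using u assms by blast
      then have "(x \<oplus> y) \<otimes> u = x \<otimes> u \<oplus> y \<otimes> u" using \<open>x \<in> perp U\<close> \<open>y \<in> perp U\<close> by (simp add: perp_def l_distr)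
      then show ?thesis using H_props(3) \<open>x \<in> perp U\<close> \<open>y \<in> perp U\<close> u by (simp add: perp_def)
    qed
    then show ?thesis using that by (simp add: perp_def)
  qed
qed (use assms H_props(2) in \<open>auto simp: perp_def\<close>)

lemma annihilated_iff_perp:
  "U \<subseteq> carrier L \<Longrightarrow> tau.annihilated U b \<longleftrightarrow> b \<in> perp U"
  using tau_eq_zero_iff by (auto simp: tau.annihilated_def perp_def subset_iff)

text \<open>Each new vector in a basis of \<open>U\<close> cuts the dimension of the perpendicular space by one, since some vector
  perpendicular to the old ones pairs to \<open>1\<close> with it.\<close>

lemma perp_dimension:
  assumes "dimension m K U"
  shows "\<exists>l. dimension l K (perp U) \<and> m + l = n"
proof -
  have "\<exists>l. dimension l K (perp U) \<and> m + l = n" if "dimension m k U" "k = K" for k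
    using that
  proof (induct m k U rule: dimension.induct)
    case (zero_dim k)
    have "perp {\<zero>} = carrier L" using H_props(2) by (auto simp: perp_def)
    then show ?case using degree by auto
  next
    case (Suc_dim v E m k)
    then obtain l where l: "dimension l K (perp E)" "m + l = n" and dE: "dimension m K E" by auto
    have kK: "k = K" by fact
    note ED = lin_subspaceD[OF dimension_subspace[OF K dE]]
    have v: "v \<in> carrier L" "v \<notin> E" by fact+
    obtain us where us: "set us \<subseteq> carrier L" "Span K us = E" using exists_base[OF K dE] by blast
    have E_eq: "rel_span K tau.radical us = E" using us(2) unfolding tau_radical Span_eq_rel_span .
    obtain b where b: "b \<in> perp E" "\<tau> (b \<otimes> v) = \<one>"
      using tau.dual_element_ex[OF us(1) v(1)] v(2) annihilated_iff_perp[OF ED(1)] unfolding E_eq by blast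
    have bc: "b \<in> carrier L" using b by (simp add: perp_def)
    let ?E' = "line_extension K v E"
    have E'c: "?E' \<subseteq> carrier L" using lin_subspaceD(1)[OF line_extension_subspace[OF K dimension_subspace[OF K dE] v(1)]] .
    have E_sub: "E \<subseteq> ?E'" using line_extension_base[OF K ED(1) v(1)] .
    have vE': "v \<in> ?E'" using line_extension_gen[OF K ED(2) v(1)] .
    have perp_E': "x \<in> perp ?E' \<longleftrightarrow> x \<in> perp E \<and> x \<otimes> v \<in> H" for x
    proof
      assume "x \<in> perp ?E'"
      then show "x \<in> perp E \<and> x \<otimes> v \<in> H" using E_sub vE' by (auto simp: perp_def)
    next
      assume x: "x \<in> perp E \<and> x \<otimes> v \<in> H"
      then have xc: "x \<in> carrier L" by (simp add: perp_def)
      have "x \<otimes> u \<in> H" if "u \<in> ?E'" for u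
      proof -
        obtain c w where cw: "c \<in> K" "w \<in> E" "u = c \<otimes> v \<oplus> w" using \<open>u \<in> ?E'\<close> unfolding line_extension_mem_iff by blast
        have "x \<otimes> u = c \<otimes> (x \<otimes> v) \<oplus> x \<otimes> w" using cw Kc ED(1) xc v(1) by (auto simp: r_distr m_lcomm)
        then show ?thesis using H_props(3,4) x cw(1,2) by (simp add: perp_def)
      qed
      then show "x \<in> perp ?E'" using xc by (simp add: perp_def)
    qed
    have bn: "b \<notin> perp ?E'" using perp_E' b(2) tau_eq_zero_iff[of "b \<otimes> v"] bc v(1) by auto
    have sub: "lin_subspace L K (perp ?E')" by (rule perp_subspace[OF E'c])
    have "perp E = line_extension K b (perp ?E')"
    proof (intro equalityI subsetI)
      fix x assume x: "x \<in> perp E"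
      then have xc: "x \<in> carrier L" by (simp add: perp_def)
      let ?c = "\<tau> (x \<otimes> v)"
      have c: "?c \<in> K" "?c \<in> carrier L" using tau.mu_closed xc v(1) Kc by auto
      have "x \<ominus> ?c \<otimes> b \<in> perp E"
        using lin_subspaceD(4,6)[OF perp_subspace[OF ED(1)]] x b(1) c(1) by simp
      moreover have "(x \<ominus> ?c \<otimes> b) \<otimes> v \<in> H"
      proof -
        have "(x \<ominus> d \<otimes> b) \<otimes> v = x \<otimes> v \<ominus> d \<otimes> (b \<otimes> v)" if "d \<in> carrier L" for d using xc bc v(1) that by algebra
        from this[OF c(2)] have "\<tau> ((x \<ominus> ?c \<otimes> b) \<otimes> v) = ?c \<ominus> ?c \<otimes> \<one>"
          using xc bc v(1) c b(2) by (simp add: tau.mu_minus tau.mu_smult)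
        then have "\<tau> ((x \<ominus> ?c \<otimes> b) \<otimes> v) = \<zero>" using c(2) by (simp add: a_minus_def r_neg)
        then show ?thesis using tau_eq_zero_iff xc bc v(1) c(2) by simp
      qed
      ultimately have "x \<ominus> ?c \<otimes> b \<in> perp ?E'" using perp_E' by simp
      moreover have "x = ?c \<otimes> b \<oplus> (x \<ominus> ?c \<otimes> b)"
      proof -
        have "x = d \<otimes> b \<oplus> (x \<ominus> d \<otimes> b)" if "d \<in> carrier L" for d using xc bc that by algebra
        from this[OF c(2)] show ?thesis .
      qed
      ultimately show "x \<in> line_extension K b (perp ?E')" unfolding line_extension_mem_iff using c(1) by (intro bexI)
    next
      fix x assume "x \<in> line_extension K b (perp ?E')"
      then obtain c w where cw: "c \<in> K" "w \<in> perp ?E'" "x = c \<otimes> b \<oplus> w" unfolding line_extension_mem_iff by blast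
      then show "x \<in> perp E"
        using lin_subspaceD(3,4)[OF perp_subspace[OF ED(1)]] b(1) perp_E' by simp
    qed
    moreover obtain p where p: "dimension p K (perp ?E')"
      using subspace_dimension[OF K degree sub lin_subspaceD(1)[OF sub]] .
    ultimately have "dimension (Suc p) K (perp E)" using dimension.Suc_dim[OF bc bn p] by simp
    then have "l = Suc p" using dimension_is_inj[OF K l(1)] by simp
    then show ?case using p l(2) kK by auto
  qed
  then show ?thesis using assms by blast
qed

lemma perp_eqI:
  assumes "dimension m K U" "dimension l K Z" "m + l = n" "\<And>u z. u \<in> U \<Longrightarrow> z \<in> Z \<Longrightarrow> u \<otimes> z \<in> H"
  shows "perp Z = U"
proof -
  obtain m' where m': "dimension m' K (perp Z)" "l + m' = n" using perp_dimension[OF assms(2)] by blast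
  have "m' = m" using m'(2) assms(3) by simp
  moreover have "U \<subseteq> perp Z"
    using assms(4) lin_subspaceD(1)[OF dimension_subspace[OF K assms(1)]] by (auto simp: perp_def)
  ultimately show ?thesis using subspace_eq_by_dimension[OF K assms(1)] m'(1) by blast
qed

end

section \<open>The spaces built from \<open>V\<close>\<close>

context radical_extension
begin

lemma span_prod_mem:
  assumes "U \<subseteq> carrier L" "U' \<subseteq> carrier L" "u \<in> U" "u' \<in> U'"
  shows "u \<otimes> u' \<in> span_prod L K U U'"
proof -
  have c: "set [u \<otimes> u'] \<subseteq> carrier L" using assms by auto
  have "set [u \<otimes> u'] \<subseteq> Span K [u \<otimes> u']"
    unfolding Span_eq_rel_span by (rule rel_span_gen[OF K zero_subspace c])
  then have "u \<otimes> u' \<in> Span K [u \<otimes> u']" by simp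
  moreover have "set [u \<otimes> u'] \<subseteq> {u \<otimes> v |u v. u \<in> U \<and> v \<in> U'}" using assms(3,4) by auto
  ultimately show ?thesis unfolding span_prod_def by blast
qed

lemma span_prod_min:
  assumes M: "lin_subspace L K M" and "\<And>u v. u \<in> U \<Longrightarrow> v \<in> U' \<Longrightarrow> u \<otimes> v \<in> M"
  shows "span_prod L K U U' \<subseteq> M"
proof
  fix x assume "x \<in> span_prod L K U U'"
  then obtain xs where xs: "x \<in> Span K xs" "set xs \<subseteq> {u \<otimes> v | u v. u \<in> U \<and> v \<in> U'}"
    unfolding span_prod_def by blast
  have "set xs \<subseteq> M" using xs(2) assms(2) by blast
  then have "Span K xs \<subseteq> M"
    unfolding Span_eq_rel_span using lin_subspaceD(2)[OF M] by (intro rel_span_min[OF K M]) auto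
  then show "x \<in> M" using xs(1) by blast
qed

lemmas V_props = lin_subspaceD[OF V(1)]

lemma Vc: "v \<in> V \<Longrightarrow> v \<in> carrier L"
  using V_props(1) by blast

lemma V_one: "\<one> \<in> V"
  using V(2) K_props(3) by blast

lemma V_mult: "u \<in> V \<Longrightarrow> v \<in> V \<Longrightarrow> u \<otimes> v \<in> PS (n - 4)"
  using span_prod_mem[OF V_props(1) V_props(1)] V_square by simp

definition W where "W = V <+>\<^bsub>L\<^esub> (\<alpha> <# V)"

lemma W_mem_iff: "w \<in> W \<longleftrightarrow> (\<exists>u\<in>V. \<exists>v\<in>V. w = u \<oplus> \<alpha> \<otimes> v)"
  unfolding W_def set_add_mem_iff Bex_def l_coset_mem_iff by blast

lemma WI: "u \<in> V \<Longrightarrow> v \<in> V \<Longrightarrow> u \<oplus> \<alpha> \<otimes> v \<in> W"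
  unfolding W_mem_iff by blast

lemma V_subset_W: "V \<subseteq> W"
proof
  fix v assume v: "v \<in> V"
  then have "v \<oplus> \<alpha> \<otimes> \<zero> \<in> W" using V_props(2) by (intro WI)
  then show "v \<in> W" using Vc[OF v] alpha(1) by simp
qed

lemma alpha_V_subset_W: "v \<in> V \<Longrightarrow> \<alpha> \<otimes> v \<in> W"
  using WI[OF V_props(2), of v] Vc[of v] alpha(1) by simp

lemma sum_subspace:
  assumes A: "lin_subspace L K A" and B: "lin_subspace L K B"
  shows "lin_subspace L K (A <+>\<^bsub>L\<^esub> B)"
proof (rule lin_subspaceI[OF _ _ _ _ subring_K])
  note AD = lin_subspaceD[OF A] and BD = lin_subspaceD[OF B]
  show "A <+>\<^bsub>L\<^esub> B \<subseteq> carrier L" using AD(1) BD(1) by (auto simp: set_add_mem_iff subset_iff)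
  show "\<zero> \<in> A <+>\<^bsub>L\<^esub> B" unfolding set_add_mem_iff using AD(2) BD(2) by (intro bexI[of _ \<zero>]) simp_all
  show "x \<oplus> y \<in> A <+>\<^bsub>L\<^esub> B" if xy: "x \<in> A <+>\<^bsub>L\<^esub> B" "y \<in> A <+>\<^bsub>L\<^esub> B" for x y
  proof -
    obtain a b where ab: "a \<in> A" "b \<in> B" "x = a \<oplus> b" using xy(1) unfolding set_add_mem_iff by blast
    obtain c d where cd: "c \<in> A" "d \<in> B" "y = c \<oplus> d" using xy(2) unfolding set_add_mem_iff by blast
    have m: "a \<in> carrier L" "b \<in> carrier L" "c \<in> carrier L" "d \<in> carrier L" using ab cd AD(1) BD(1) by auto
    have "x \<oplus> y = (a \<oplus> c) \<oplus> (b \<oplus> d)" unfolding ab(3) cd(3) using m by algebra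
    then show ?thesis by (rule set_addI[OF AD(3)[OF ab(1) cd(1)] BD(3)[OF ab(2) cd(2)]])
  qed
  show "c \<otimes> x \<in> A <+>\<^bsub>L\<^esub> B" if cx: "c \<in> K" "x \<in> A <+>\<^bsub>L\<^esub> B" for c x
  proof -
    obtain a b where ab: "a \<in> A" "b \<in> B" "x = a \<oplus> b" using cx(2) unfolding set_add_mem_iff by blast
    have "c \<otimes> x = c \<otimes> a \<oplus> c \<otimes> b" using ab AD(1) BD(1) Kc[OF cx(1)] by (auto simp: r_distr subset_iff)
    then show ?thesis by (rule set_addI[OF AD(4)[OF cx(1) ab(1)] BD(4)[OF cx(1) ab(2)]])
  qed
qed

lemma scale_subspace:
  assumes A: "lin_subspace L K A" and a: "a \<in> carrier L"
  shows "lin_subspace L K (a <# A)"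
proof (rule lin_subspaceI[OF _ _ _ _ subring_K])
  note AD = lin_subspaceD[OF A]
  show "a <# A \<subseteq> carrier L" using AD(1) a by (auto simp: l_coset_mem_iff subset_iff)
  show "\<zero> \<in> a <# A" unfolding l_coset_mem_iff using AD(2) a by (intro bexI[of _ \<zero>]) simp_all
  show "x \<oplus> y \<in> a <# A" if xy: "x \<in> a <# A" "y \<in> a <# A" for x y
  proof -
    obtain u v where uv: "u \<in> A" "x = a \<otimes> u" "v \<in> A" "y = a \<otimes> v" using xy unfolding l_coset_mem_iff by blast
    have "x \<oplus> y = a \<otimes> (u \<oplus> v)" using uv a AD(1) by (auto simp: r_distr subset_iff)
    then show ?thesis by (rule l_cosetI[OF AD(3)[OF uv(1,3)]])
  qed
  show "c \<otimes> x \<in> a <# A" if cx: "c \<in> K" "x \<in> a <# A" for c x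
  proof -
    obtain u where u: "u \<in> A" "x = a \<otimes> u" using cx unfolding l_coset_mem_iff by blast
    have "c \<otimes> x = a \<otimes> (c \<otimes> u)" using u a AD(1) Kc[OF cx(1)] by (auto simp: m_lcomm subset_iff)
    then show ?thesis by (rule l_cosetI[OF AD(4)[OF cx(1) u(1)]])
  qed
qed

lemma W_subspace: "lin_subspace L K W"
  unfolding W_def by (rule sum_subspace[OF V(1) scale_subspace[OF V(1) alpha(1)]])

lemmas W_props = lin_subspaceD[OF W_subspace]

lemma alpha2: "\<alpha> [^] (2::nat) = \<alpha> \<otimes> \<alpha>"
  using alpha(1) by (simp add: numeral_2_eq_2)

lemma directD:
  assumes "u \<in> V" "v \<in> V" "w \<in> V" "u \<oplus> \<alpha> \<otimes> v \<oplus> \<alpha> \<otimes> \<alpha> \<otimes> w = \<zero>"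
  shows "u = \<zero>" "\<alpha> \<otimes> v = \<zero>" "\<alpha> \<otimes> \<alpha> \<otimes> w = \<zero>"
  using direct assms unfolding alpha2 by auto

lemma V_alpha_V: assumes "v \<in> V" "\<alpha> \<otimes> v \<in> V" shows "v = \<zero>"
proof -
  have m: "v \<in> carrier L" "\<alpha> \<otimes> v \<in> carrier L" using assms Vc by auto
  have "\<alpha> \<otimes> v \<oplus> \<alpha> \<otimes> (\<ominus> v) \<oplus> \<alpha> \<otimes> \<alpha> \<otimes> \<zero> = \<zero>"
    using m alpha(1) by (simp add: r_minus r_neg)
  then have "\<alpha> \<otimes> v = \<zero>" using directD(1)[OF assms(2) V_props(5)[OF assms(1)] V_props(2)] by simp
  then show ?thesis using integral[of \<alpha> v] alpha(1) alpha_nonzero m(1) by blast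
qed

definition V3 where "V3 = W <+>\<^bsub>L\<^esub> (\<alpha> \<otimes> \<alpha> <# V)"

lemma V3_mem_iff: "x \<in> V3 \<longleftrightarrow> (\<exists>u\<in>V. \<exists>v\<in>V. \<exists>w\<in>V. x = u \<oplus> \<alpha> \<otimes> v \<oplus> \<alpha> \<otimes> \<alpha> \<otimes> w)"
  unfolding V3_def set_add_mem_iff Bex_def l_coset_mem_iff W_mem_iff by blast

lemma W_dimension: "dimension (n div 4 + n div 4) K W"
  unfolding W_def
proof (rule dimension_direct_sum_space[OF K V_dim dimension_scale[OF K alpha(1) alpha_nonzero V_dim]])
  show "V \<inter> (\<alpha> <# V) = {\<zero>}"
  proof (intro equalityI subsetI)
    fix x assume x: "x \<in> V \<inter> (\<alpha> <# V)"
    then have xV: "x \<in> V" and "x \<in> \<alpha> <# V" by simp_all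
    then obtain v where v: "v \<in> V" "x = \<alpha> \<otimes> v" unfolding l_coset_mem_iff by (elim bexE)
    then have "v = \<zero>" using V_alpha_V xV by simp
    then show "x \<in> {\<zero>}" using v alpha(1) by simp
  next
    fix x assume "x \<in> {\<zero>}"
    then show "x \<in> V \<inter> (\<alpha> <# V)"
      using V_props(2) lin_subspaceD(2)[OF scale_subspace[OF V(1) alpha(1)]] by simp
  qed
qed

lemma V3_dimension: "dimension (n div 4 + n div 4 + n div 4) K V3"
  unfolding V3_def
proof (rule dimension_direct_sum_space[OF K W_dimension])
  have a2: "\<alpha> \<otimes> \<alpha> \<in> carrier L" "\<alpha> \<otimes> \<alpha> \<noteq> \<zero>" using alpha(1) alpha_nonzero integral by auto
  show "dimension (n div 4) K (\<alpha> \<otimes> \<alpha> <# V)" by (rule dimension_scale[OF K a2 V_dim])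
  show "W \<inter> (\<alpha> \<otimes> \<alpha> <# V) = {\<zero>}"
  proof (intro equalityI subsetI)
    fix x assume x: "x \<in> W \<inter> (\<alpha> \<otimes> \<alpha> <# V)"
    then obtain u v where uv: "u \<in> V" "v \<in> V" "x = u \<oplus> \<alpha> \<otimes> v" unfolding W_mem_iff Int_iff by blast
    from x obtain w where w: "w \<in> V" "x = \<alpha> \<otimes> \<alpha> \<otimes> w" unfolding l_coset_mem_iff Int_iff by blast
    have m: "u \<in> carrier L" "v \<in> carrier L" "w \<in> carrier L" using uv w Vc by auto
    have "u \<oplus> \<alpha> \<otimes> v \<oplus> \<alpha> \<otimes> \<alpha> \<otimes> (\<ominus> w) = x \<ominus> \<alpha> \<otimes> \<alpha> \<otimes> w"
      unfolding uv(3) using m alpha(1) by algebra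
    also have "\<dots> = \<zero>" using m alpha(1) by (simp add: w(2) a_minus_def r_neg)
    finally have "\<alpha> \<otimes> \<alpha> \<otimes> (\<ominus> w) = \<zero>" by (rule directD(3)[OF uv(1,2) V_props(5)[OF w(1)]])
    then have "w = \<zero>" using integral[OF _ a2(1), of "\<ominus> w"] a2 m(3) by (metis a_inv_closed minus_minus minus_zero)
    then show "x \<in> {\<zero>}" using w a2 by simp
  next
    fix x assume "x \<in> {\<zero>}"
    then show "x \<in> W \<inter> (\<alpha> \<otimes> \<alpha> <# V)"
      using W_props(2) lin_subspaceD(2)[OF scale_subspace[OF V(1) a2(1)]] by simp
  qed
qed

lemma alpha_PS: "x \<in> PS i \<Longrightarrow> \<alpha> \<otimes> x \<in> PS (Suc i)"
  using PS_mult[OF alpha_mem_PS[OF le_refl], of x i] by simp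

lemma H_ge: "i \<le> n - 2 \<Longrightarrow> PS i \<subseteq> H"
  unfolding H_def by (rule PS_mono)

lemma H_products:
  assumes "u \<in> V" "v \<in> V"
  shows "u \<otimes> v \<in> H" "\<alpha> \<otimes> (u \<otimes> v) \<in> H" "\<alpha> \<otimes> \<alpha> \<otimes> (u \<otimes> v) \<in> H"
proof -
  have uv: "u \<otimes> v \<in> PS (n - 4)" "u \<in> carrier L" "v \<in> carrier L" using V_mult assms Vc by auto
  have a: "\<alpha> \<otimes> (u \<otimes> v) \<in> PS (Suc (n - 4))" using alpha_PS[OF uv(1)] .
  have "\<alpha> \<otimes> (\<alpha> \<otimes> (u \<otimes> v)) \<in> PS (Suc (Suc (n - 4)))" using alpha_PS[OF a] .
  moreover have "Suc (Suc (n - 4)) = n - 2" using n_ge by simp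
  ultimately show "\<alpha> \<otimes> \<alpha> \<otimes> (u \<otimes> v) \<in> H" using uv alpha(1) by (simp add: H_def m_assoc)
  show "u \<otimes> v \<in> H" by (rule subsetD[OF H_ge uv(1)]) simp
  show "\<alpha> \<otimes> (u \<otimes> v) \<in> H" by (rule subsetD[OF H_ge a]) (use n_ge in simp)
qed

lemma V3_times_V:
  assumes "x \<in> V3" "v \<in> V"
  shows "x \<otimes> v \<in> H"
proof -
  obtain a b c where abc: "a \<in> V" "b \<in> V" "c \<in> V" "x = a \<oplus> \<alpha> \<otimes> b \<oplus> \<alpha> \<otimes> \<alpha> \<otimes> c"
    using assms(1) unfolding V3_mem_iff by blast
  have m: "a \<in> carrier L" "b \<in> carrier L" "c \<in> carrier L" "v \<in> carrier L" using abc assms(2) Vc by auto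
  have "x \<otimes> v = a \<otimes> v \<oplus> \<alpha> \<otimes> (b \<otimes> v) \<oplus> \<alpha> \<otimes> \<alpha> \<otimes> (c \<otimes> v)"
    unfolding abc(4) using m alpha(1) by algebra
  then show ?thesis
    using H_products[OF abc(1) assms(2)] H_products[OF abc(2) assms(2)] H_products[OF abc(3) assms(2)] H_props(3)
    by simp
qed

lemma W_mult: assumes "w \<in> W" "w' \<in> W" shows "w \<otimes> w' \<in> H"
proof -
  obtain a b where ab: "a \<in> V" "b \<in> V" "w = a \<oplus> \<alpha> \<otimes> b" using assms(1) unfolding W_mem_iff by blast
  obtain c d where cd: "c \<in> V" "d \<in> V" "w' = c \<oplus> \<alpha> \<otimes> d" using assms(2) unfolding W_mem_iff by blast
  have m: "a \<in> carrier L" "b \<in> carrier L" "c \<in> carrier L" "d \<in> carrier L" using ab cd Vc by auto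
  have "w \<otimes> w' = a \<otimes> c \<oplus> \<alpha> \<otimes> (a \<otimes> d) \<oplus> \<alpha> \<otimes> (b \<otimes> c) \<oplus> \<alpha> \<otimes> \<alpha> \<otimes> (b \<otimes> d)"
    unfolding ab(3) cd(3) using m alpha(1) by algebra
  then show ?thesis
    using H_products[OF ab(1) cd(1)] H_products[OF ab(1) cd(2)] H_products[OF ab(2) cd(1)] H_products[OF ab(2) cd(2)] H_props(3)
    by simp
qed

text \<open>The symmetry \<open>G\<^sub>i\<^sup>\<bottom> = G\<^sub>2\<^sub>-\<^sub>i\<close> of the graded pieces \<open>K\<close>, \<open>W\<close>, \<open>H\<close>: the products lie in
  \<open>H\<close> (for \<open>W\<close> because \<open>W\<^sup>2 = L\<^bsub>n-4\<^esub> + \<alpha>L\<^bsub>n-4\<^esub> + \<alpha>\<^sup>2L\<^bsub>n-4\<^esub>\<close>), and the dimensions add up to \<open>n\<close>.\<close>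

lemma perp_W: "perp W = W"
  using perp_eqI[OF W_dimension W_dimension _ W_mult] n_div by simp

lemma perp_K: "perp K = H"
proof (rule perp_eqI)
  have "Suc (n - 2) = n - 1" using n_ge by simp
  then show "dimension (n - 1) K H" using PS_dimension[of "n - 2"] n_ge unfolding H_def by simp
  show "dimension 1 K K" by (rule dimension_one[OF K])
  show "n - 1 + 1 = n" using n_ge by simp
  show "u \<otimes> z \<in> H" if "u \<in> H" "z \<in> K" for u z
    using H_props(4)[OF that(2,1)] H_props(1) that Kc m_comm[of u z] by auto
qed

lemma perp_H: "perp H = K"
proof (rule perp_eqI)
  have "Suc (n - 2) = n - 1" using n_ge by simp
  then show "dimension (n - 1) K H" using PS_dimension[of "n - 2"] n_ge unfolding H_def by simp
  show "dimension 1 K K" by (rule dimension_one[OF K])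
  show "1 + (n - 1) = n" using n_ge by simp
qed (rule H_props(4))

text \<open>\<open>V3 = V + \<alpha>V + \<alpha>\<^sup>2V\<close> has dimension \<open>3n/4\<close> because the sum is direct, which is what makes \<open>V\<close> all of its
  perpendicular space.\<close>

lemma perp_V3: "perp V3 = V"
proof (rule perp_eqI[OF V_dim V3_dimension])
  show "n div 4 + (n div 4 + n div 4 + n div 4) = n" using n_div by linarith
  show "u \<otimes> z \<in> H" if "u \<in> V" "z \<in> V3" for u z
  proof -
    have "z \<in> carrier L" using lin_subspaceD(1)[OF dimension_subspace[OF K V3_dimension]] that(2) by blast
    then show ?thesis using V3_times_V[OF that(2,1)] Vc[OF that(1)] by (simp add: m_comm)
  qed
qed

lemma perp_PS: "perp (PS (n - 4)) = PS 2"
proof (rule perp_eqI)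
  show "dimension 3 K (PS 2)" using PS_dimension[of 2] n_ge by (simp add: eval_nat_numeral)
  have "Suc (n - 4) = n - 3" using n_ge by simp
  then show "dimension (n - 3) K (PS (n - 4))" using PS_dimension[of "n - 4"] n_ge by simp
  show "3 + (n - 3) = n" using n_ge by simp
  have "2 + (n - 4) = n - 2" using n_ge by simp
  then show "u \<otimes> z \<in> H" if "u \<in> PS 2" "z \<in> PS (n - 4)" for u z
    using PS_mult[OF that] by (simp add: H_def)
qed

lemma K_line: "PS 1 = {a \<oplus> \<alpha> \<otimes> b | a b. a \<in> K \<and> b \<in> K}"
proof (intro equalityI subsetI)
  fix x assume "x \<in> PS 1"
  then have "x \<in> line_extension K (\<alpha> [^] Suc 0) (PS 0)" using PS_Suc[of 0] by simp
  then obtain c v where cv: "c \<in> K" "v \<in> K" "x = c \<otimes> \<alpha> [^] Suc 0 \<oplus> v"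
    unfolding line_extension_mem_iff PS_zero by blast
  have "c \<in> carrier L" "v \<in> carrier L" using cv Kc by auto
  then have "x = v \<oplus> \<alpha> \<otimes> c" using cv(3) alpha(1) by (simp add: m_comm a_comm)
  then show "x \<in> {a \<oplus> \<alpha> \<otimes> b | a b. a \<in> K \<and> b \<in> K}" using cv by blast
next
  fix x assume "x \<in> {a \<oplus> \<alpha> \<otimes> b | a b. a \<in> K \<and> b \<in> K}"
  then obtain a b where ab: "a \<in> K" "b \<in> K" "x = a \<oplus> \<alpha> \<otimes> b" by blast
  have "\<alpha> \<otimes> b \<in> PS (Suc 0)" using alpha_PS[of b 0] ab(2) by (simp add: PS_zero)
  then show "x \<in> PS 1" unfolding ab(3) using K_subset_PS ab(1) by (intro PS_props(3)) auto
qed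

lemma PS2_decomp:
  assumes "x \<in> PS 2"
  shows "\<exists>a\<in>K. \<exists>b\<in>K. \<exists>c\<in>K. x = a \<oplus> \<alpha> \<otimes> b \<oplus> \<alpha> \<otimes> \<alpha> \<otimes> c"
proof -
  have "x \<in> line_extension K (\<alpha> [^] Suc 1) (PS 1)" using PS_Suc[of 1] assms by (simp add: numeral_2_eq_2)
  then obtain c v where cv: "c \<in> K" "v \<in> PS 1" "x = c \<otimes> \<alpha> [^] Suc 1 \<oplus> v"
    unfolding line_extension_mem_iff by blast
  obtain a b where ab: "a \<in> K" "b \<in> K" "v = a \<oplus> \<alpha> \<otimes> b" using cv(2) unfolding K_line by blast
  have m: "a \<in> carrier L" "b \<in> carrier L" "c \<in> carrier L" using ab cv Kc by auto
  have "x = a \<oplus> \<alpha> \<otimes> b \<oplus> \<alpha> \<otimes> \<alpha> \<otimes> c" using cv(3) ab(3) m alpha(1) by (simp add: m_comm a_comm)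
  then show ?thesis using ab cv by blast
qed

text \<open>Otherwise \<open>L = xL = xVL\<^bsub>n-3\<^esub>\<close> would lie in \<open>L\<^sub>1L\<^bsub>n-3\<^esub> = H\<close>.\<close>

lemma multiplier_into_line:
  assumes x: "x \<in> carrier L" and xV: "\<And>v. v \<in> V \<Longrightarrow> x \<otimes> v \<in> PS 1"
  shows "x = \<zero>"
proof (rule nondegenerate[OF x])
  have "span_prod L K V (PS (n - 3)) \<subseteq> {y \<in> carrier L. x \<otimes> y \<in> H}"
  proof (rule span_prod_min[OF transporter_subspace[OF H_subspace x]])
    fix v l assume v: "v \<in> V" and l: "l \<in> PS (n - 3)"
    have m: "v \<in> carrier L" "l \<in> carrier L" using Vc v l PS_props(1) by auto
    have "1 + (n - 3) = n - 2" using n_ge by simp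
    then have "(x \<otimes> v) \<otimes> l \<in> H" using PS_mult[OF xV[OF v] l] by (simp add: H_def)
    then show "v \<otimes> l \<in> {y \<in> carrier L. x \<otimes> y \<in> H}" using m x by (simp add: m_assoc)
  qed
  then show "y \<otimes> x \<in> H" if "y \<in> carrier L" for y
    using V_span that x by (auto simp: m_comm[of y x])
qed

text \<open>\<open>xV\<^sup>2 \<subseteq> (V3)V \<subseteq> H\<close>, and \<open>V\<^sup>2 = L\<^bsub>n-4\<^esub>\<close> has the perpendicular space \<open>L\<^sub>2\<close>.\<close>

lemma multiplier_into_V3:
  assumes x: "x \<in> carrier L" and xV: "\<And>v. v \<in> V \<Longrightarrow> x \<otimes> v \<in> V3"
  shows "x \<in> PS 2"
proof -
  have "span_prod L K V V \<subseteq> {y \<in> carrier L. x \<otimes> y \<in> H}"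
  proof (rule span_prod_min[OF transporter_subspace[OF H_subspace x]])
    fix u v assume u: "u \<in> V" and v: "v \<in> V"
    have m: "u \<in> carrier L" "v \<in> carrier L" using Vc u v by auto
    have "(x \<otimes> u) \<otimes> v \<in> H" by (rule V3_times_V[OF xV[OF u] v])
    then show "u \<otimes> v \<in> {y \<in> carrier L. x \<otimes> y \<in> H}" using m x by (simp add: m_assoc)
  qed
  then have "x \<in> perp (PS (n - 4))" using x unfolding V_square perp_def by blast
  then show ?thesis using perp_PS by simp
qed

text \<open>\<open>L = V + \<alpha>V + \<alpha>\<^sup>2V + \<alpha>\<^sup>3V\<close>: a vector \<open>x\<close> perpendicular to the right-hand side has \<open>x\<close> and \<open>\<alpha>x\<close> in
  \<open>(V + \<alpha>V + \<alpha>\<^sup>2V)\<^sup>\<bottom> = V\<close>, so it is zero because \<open>V \<inter> \<alpha>V = 0\<close>.\<close>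

lemma W_decomp:
  assumes x: "x \<in> carrier L"
  shows "\<exists>a\<in>W. \<exists>b\<in>W. \<exists>c\<in>W. x = a \<oplus> \<alpha> \<otimes> b \<oplus> \<alpha> \<otimes> \<alpha> \<otimes> c"
proof -
  let ?S = "W <+>\<^bsub>L\<^esub> (\<alpha> <# W) <+>\<^bsub>L\<^esub> (\<alpha> \<otimes> \<alpha> <# W)"
  have a2: "\<alpha> \<otimes> \<alpha> \<in> carrier L" using alpha(1) by simp
  have S: "lin_subspace L K ?S"
    by (intro sum_subspace scale_subspace W_subspace alpha(1) a2)
  note SD = lin_subspaceD[OF S]
  have S_mem: "y \<in> ?S \<longleftrightarrow> (\<exists>a\<in>W. \<exists>b\<in>W. \<exists>c\<in>W. y = a \<oplus> \<alpha> \<otimes> b \<oplus> \<alpha> \<otimes> \<alpha> \<otimes> c)" for y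
    unfolding set_add_mem_iff Bex_def l_coset_mem_iff by blast
  have SI: "a \<oplus> \<alpha> \<otimes> b \<oplus> \<alpha> \<otimes> \<alpha> \<otimes> c \<in> ?S" if "a \<in> W" "b \<in> W" "c \<in> W" for a b c
    unfolding S_mem using that by blast
  have Wc: "w \<in> carrier L" if "w \<in> W" for w using that W_props(1) by blast
  have V3_S: "V3 \<subseteq> ?S"
  proof
    fix y assume "y \<in> V3"
    then obtain u v w where uvw: "u \<in> V" "v \<in> V" "w \<in> V" "y = u \<oplus> \<alpha> \<otimes> v \<oplus> \<alpha> \<otimes> \<alpha> \<otimes> w"
      unfolding V3_mem_iff by blast
    then show "y \<in> ?S" using V_subset_W by (auto intro!: SI)
  qed
  have aV3_S: "\<alpha> \<otimes> y \<in> ?S" if "y \<in> V3" for y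
  proof -
    obtain u v w where uvw: "u \<in> V" "v \<in> V" "w \<in> V" "y = u \<oplus> \<alpha> \<otimes> v \<oplus> \<alpha> \<otimes> \<alpha> \<otimes> w"
      using \<open>y \<in> V3\<close> unfolding V3_mem_iff by blast
    have m: "u \<in> carrier L" "v \<in> carrier L" "w \<in> carrier L" using uvw Vc by auto
    have "\<alpha> \<otimes> y = \<zero> \<oplus> \<alpha> \<otimes> u \<oplus> \<alpha> \<otimes> \<alpha> \<otimes> (v \<oplus> \<alpha> \<otimes> w)"
      unfolding uvw(4) using m alpha(1) by algebra
    moreover have "\<dots> \<in> ?S"
      using uvw(1) V_subset_W W_props(2) WI[OF uvw(2,3)] by (intro SI) blast+
    ultimately show ?thesis by (simp only:)
  qed
  have "perp ?S = {\<zero>}"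
  proof (intro equalityI subsetI)
    fix y assume y: "y \<in> perp ?S"
    have yc: "y \<in> carrier L" using y by (simp add: perp_def)
    have "y \<in> perp V3" using y V3_S by (auto simp: perp_def)
    then have yV: "y \<in> V" unfolding perp_V3 .
    have "\<alpha> \<otimes> y \<otimes> u \<in> H" if u: "u \<in> V3" for u
    proof -
      have uc: "u \<in> carrier L" using u V3_S SD(1) by blast
      have "\<alpha> \<otimes> y \<otimes> u = y \<otimes> (\<alpha> \<otimes> u)" using yc uc alpha(1) by (simp add: m_ac)
      then show ?thesis using y aV3_S[OF u] by (simp add: perp_def)
    qed
    then have "\<alpha> \<otimes> y \<in> perp V3" using yc alpha(1) by (simp add: perp_def)
    then have "\<alpha> \<otimes> y \<in> V" unfolding perp_V3 .
    then show "y \<in> {\<zero>}" using V_alpha_V[OF yV] by simp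
  next
    fix y assume "y \<in> {\<zero>}"
    then show "y \<in> perp ?S" using lin_subspaceD(2)[OF perp_subspace[OF SD(1)]] by simp
  qed
  moreover obtain m where m: "dimension m K ?S" using subspace_dimension[OF K degree S SD(1)] .
  ultimately obtain l where l: "dimension l K {\<zero>}" "m + l = n" using perp_dimension[OF m] by metis
  have "l = 0" using dimension_is_inj[OF K l(1) zero_dim] .
  then have "?S = carrier L" using subspace_eq_by_dimension[OF K _ degree SD(1)] m l(2) by simp
  then show ?thesis using x S_mem by blast
qed

lemma H_decomp_alpha:
  assumes x: "x \<in> carrier L"
  shows "\<exists>a\<in>H. \<exists>b\<in>H. x = a \<oplus> \<alpha> \<otimes> b"
proof -
  let ?S = "H <+>\<^bsub>L\<^esub> (\<alpha> <# H)"
  have S: "lin_subspace L K ?S" by (intro sum_subspace scale_subspace H_subspace alpha(1))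
  have S_mem: "y \<in> ?S \<longleftrightarrow> (\<exists>a\<in>H. \<exists>b\<in>H. y = a \<oplus> \<alpha> \<otimes> b)" for y
    unfolding set_add_mem_iff Bex_def l_coset_mem_iff by blast
  have "PS (n - 1) \<subseteq> ?S"
  proof (rule PS_min[OF S])
    fix j assume j: "j \<le> n - 1"
    show "\<alpha> [^] j \<in> ?S"
    proof (cases "j \<le> n - 2")
      case True
      then have "\<alpha> [^] j \<in> H" "\<alpha> [^] j = \<alpha> [^] j \<oplus> \<alpha> \<otimes> \<zero>"
        using PS_pow alpha(1) by (simp_all add: H_def)
      then show ?thesis unfolding S_mem using H_props(2) by blast
    next
      case False
      then have "j = Suc (n - 2)" using j by simp
      then have "\<alpha> [^] j = \<zero> \<oplus> \<alpha> \<otimes> \<alpha> [^] (n - 2)" using alpha(1) by (simp add: m_comm)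
      moreover have "\<alpha> [^] (n - 2) \<in> H" by (simp add: H_def PS_pow)
      ultimately show ?thesis unfolding S_mem using H_props(2) by blast
    qed
  qed
  then show ?thesis using x S_mem unfolding PS_full by blast
qed

text \<open>\<open>H = V\<^sup>2 + \<alpha>V\<^sup>2 + \<alpha>\<^sup>2V\<^sup>2\<close>, and \<open>\<alpha>\<^sup>i(uv)\<close> with \<open>i \<le> 2\<close> is a product of two elements of \<open>V \<union> \<alpha>V\<close>.\<close>

lemma H_generated:
  assumes M: "lin_subspace L K M" and "\<And>w w'. w \<in> W \<Longrightarrow> w' \<in> W \<Longrightarrow> w \<otimes> w' \<in> M"
  shows "H \<subseteq> M"
  unfolding H_def
proof (rule PS_min[OF M])
  have tr: "y \<in> PS (n - 4) \<Longrightarrow> a \<otimes> y \<in> M"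
    if a: "a \<in> carrier L" and uv: "\<And>u v. u \<in> V \<Longrightarrow> v \<in> V \<Longrightarrow> a \<otimes> (u \<otimes> v) \<in> M" for a y
  proof -
    have "span_prod L K V V \<subseteq> {y \<in> carrier L. a \<otimes> y \<in> M}"
      by (rule span_prod_min[OF transporter_subspace[OF M a]]) (use uv Vc in auto)
    then show "y \<in> PS (n - 4) \<Longrightarrow> a \<otimes> y \<in> M" unfolding V_square by blast
  qed
  have e0: "y \<in> M" if "y \<in> PS (n - 4)" for y
  proof -
    have "\<one> \<otimes> y \<in> M" by (rule tr[OF one_closed _ that]) (use assms(2) V_subset_W Vc in auto)
    moreover have "y \<in> carrier L" using PS_props(1) that by blast
    ultimately show ?thesis by simp
  qed
  have e1: "\<alpha> \<otimes> y \<in> M" if "y \<in> PS (n - 4)" for y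
  proof (rule tr[OF alpha(1) _ that])
    fix u v assume "u \<in> V" "v \<in> V"
    then show "\<alpha> \<otimes> (u \<otimes> v) \<in> M"
      using assms(2)[OF alpha_V_subset_W, of u v] V_subset_W Vc alpha(1) by (auto simp: m_assoc)
  qed
  have e2: "\<alpha> \<otimes> \<alpha> \<otimes> y \<in> M" if "y \<in> PS (n - 4)" for y
  proof (rule tr[OF _ _ that])
    fix u v assume uv: "u \<in> V" "v \<in> V"
    have "\<alpha> \<otimes> u \<otimes> (\<alpha> \<otimes> v) \<in> M" by (rule assms(2)[OF alpha_V_subset_W alpha_V_subset_W]) fact+
    moreover have "\<alpha> \<otimes> u \<otimes> (\<alpha> \<otimes> v) = \<alpha> \<otimes> \<alpha> \<otimes> (u \<otimes> v)" using uv Vc alpha(1) by (simp add: m_ac)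
    ultimately show "\<alpha> \<otimes> \<alpha> \<otimes> (u \<otimes> v) \<in> M" by simp
  qed (use alpha(1) in simp)
  fix j assume j: "j \<le> n - 2"
  consider "j \<le> n - 4" | "j = Suc (n - 4)" | "j = Suc (Suc (n - 4))" using j n_ge by linarith
  then show "\<alpha> [^] j \<in> M"
  proof cases
    case 1
    then show ?thesis using e0 PS_pow by blast
  next
    case 2
    then show ?thesis using e1[OF PS_pow[OF le_refl]] pow_Suc[of "n - 4"] by (simp del: nat_pow_Suc)
  next
    case 3
    have "\<alpha> \<otimes> \<alpha> \<otimes> \<alpha> [^] (n - 4) = \<alpha> [^] j"
      using 3 pow_Suc[of "n - 4"] pow_Suc[of "Suc (n - 4)"] alpha(1) by (simp add: m_assoc del: nat_pow_Suc)
    then show ?thesis using e2[OF PS_pow[OF le_refl]] by simp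
  qed
qed

text \<open>\<open>L = VL\<^bsub>n-3\<^esub>\<close>, where \<open>V \<subseteq> W\<close> and \<open>L\<^bsub>n-3\<^esub> \<subseteq> H\<close>.\<close>

lemma L_generated:
  assumes M: "lin_subspace L K M" and "\<And>w h. w \<in> W \<Longrightarrow> h \<in> H \<Longrightarrow> w \<otimes> h \<in> M"
  shows "carrier L \<subseteq> M"
  unfolding V_span
proof (rule span_prod_min[OF M])
  fix u v assume u: "u \<in> V" and v: "v \<in> PS (n - 3)"
  show "u \<otimes> v \<in> M"
    by (rule assms(2)[OF subsetD[OF V_subset_W u] subsetD[OF H_ge v]]) simp
qed

end

section \<open>The graded ring\<close>

context ring
begin

lemma finsum_in_subspace:
  assumes "lin_subspace R k M" "finite A" "\<And>i. i \<in> A \<Longrightarrow> f i \<in> M"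
  shows "finsum R f A \<in> M"
  using assms(2,3)
proof (induct A)
  case empty
  then show ?case using lin_subspaceD(2)[OF assms(1)] by simp
next
  case (insert i A)
  have f: "f \<in> A \<rightarrow> carrier R" "f i \<in> carrier R" using insert(4) lin_subspaceD(1)[OF assms(1)] by auto
  have "f i \<oplus> finsum R f A \<in> M" using insert by (intro lin_subspaceD(3)[OF assms(1)]) auto
  then show ?case using insert(1,2) f by simp
qed

end

context radical_extension
begin

sublocale up: UP_domain L "UP L"
  by unfold_locales

abbreviation "cf \<equiv> up_ring.coeff (UP L)"
abbreviation "mn \<equiv> up_ring.monom (UP L)"
abbreviation "PL \<equiv> UP L"

definition degree_below :: "nat \<Rightarrow> (nat \<Rightarrow> 'a) \<Rightarrow> bool" where
  "degree_below m p \<longleftrightarrow> (\<forall>i\<ge>m. cf p i = \<zero>)"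

lemma degree_below_ex: "p \<in> carrier PL \<Longrightarrow> \<exists>m. degree_below m p"
  unfolding degree_below_def using up.deg_aboveD[of p] by (intro exI[of _ "Suc (deg L p)"]) simp

lemma leading:
  assumes "p \<in> carrier PL" "p \<noteq> \<zero>\<^bsub>PL\<^esub>"
  obtains d where "cf p d \<noteq> \<zero>" "degree_below (Suc d) p"
  using up.lcoeff_nonzero[OF assms(2,1)] up.deg_aboveD[OF _ assms(1)] that[of "deg L p"]
  by (simp add: degree_below_def)

lemma degree_below_zero: "p \<in> carrier PL \<Longrightarrow> degree_below 0 p \<Longrightarrow> p = \<zero>\<^bsub>PL\<^esub>"
  by (rule up.up_eqI) (simp_all add: degree_below_def)

lemma cf_mon_mult:
  assumes "a \<in> carrier L" "p \<in> carrier PL"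
  shows "cf (mn a m \<otimes>\<^bsub>PL\<^esub> p) i = (if m \<le> i then a \<otimes> cf p (i - m) else \<zero>)"
proof (cases "m \<le> i")
  case True
  then show ?thesis using up.coeff_monom_mult[OF assms, of m "i - m"] by (simp add: add.commute)
next
  case False
  have "cf (mn a m \<otimes>\<^bsub>PL\<^esub> p) i = (\<Oplus>j\<in>{..i}. cf (mn a m) j \<otimes> cf p (i - j))"
    using assms by (simp add: up.coeff_mult)
  also have "\<dots> = (\<Oplus>j\<in>{..i}. \<zero>)" using False assms by (intro finsum_cong') auto
  finally show ?thesis using False by simp
qed

lemma cf_mult_top:
  assumes pq: "p \<in> carrier PL" "q \<in> carrier PL" and b: "degree_below (Suc m) p" "degree_below (Suc l) q"
  shows "cf (p \<otimes>\<^bsub>PL\<^esub> q) (m + l) = cf p m \<otimes> cf q l" "degree_below (Suc (m + l)) (p \<otimes>\<^bsub>PL\<^esub> q)"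
proof -
  have "cf (p \<otimes>\<^bsub>PL\<^esub> q) (m + l) = (\<Oplus>j\<in>{..m + l}. cf p j \<otimes> cf q (m + l - j))"
    using pq by (simp add: up.coeff_mult)
  also have "\<dots> = (\<Oplus>j\<in>{..m + l}. if m = j then cf p j \<otimes> cf q (m + l - j) else \<zero>)"
  proof (intro finsum_cong')
    fix j assume "j \<in> {..m + l}"
    show "cf p j \<otimes> cf q (m + l - j) = (if m = j then cf p j \<otimes> cf q (m + l - j) else \<zero>)"
    proof (cases "m = j")
      case False
      then consider "m < j" | "l < m + l - j" by linarith
      then show ?thesis using b pq False by cases (simp_all add: degree_below_def)
    qed simp
  qed (use pq in auto)
  also have "\<dots> = cf p m \<otimes> cf q l"
    using finsum_singleton[of m "{..m + l}" "\<lambda>j. cf p j \<otimes> cf q (m + l - j)"] pq by (simp add: Pi_def)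
  finally show "cf (p \<otimes>\<^bsub>PL\<^esub> q) (m + l) = cf p m \<otimes> cf q l" .
  show "degree_below (Suc (m + l)) (p \<otimes>\<^bsub>PL\<^esub> q)" unfolding degree_below_def
  proof (intro allI impI)
    fix i assume i: "Suc (m + l) \<le> i"
    have "cf (p \<otimes>\<^bsub>PL\<^esub> q) i = (\<Oplus>j\<in>{..i}. cf p j \<otimes> cf q (i - j))" using pq by (simp add: up.coeff_mult)
    also have "\<dots> = (\<Oplus>j\<in>{..i}. \<zero>)"
    proof (intro finsum_cong')
      fix j assume "j \<in> {..i}"
      consider "m < j" | "l < i - j" using i by linarith
      then show "cf p j \<otimes> cf q (i - j) = \<zero>" using b pq by cases (simp_all add: degree_below_def)
    qed auto
    finally show "cf (p \<otimes>\<^bsub>PL\<^esub> q) i = \<zero>" by simp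
  qed
qed

definition G :: "nat \<Rightarrow> 'a set" where
  "G = (\<lambda>i. if i = 0 then K else if i = 1 then W else if i = 2 then H else carrier L)"

lemma G_simps: "G 0 = K" "G (Suc 0) = W" "G 2 = H" "i \<ge> 3 \<Longrightarrow> G i = carrier L"
  by (simp_all add: G_def)

lemma carrier_subspace: "lin_subspace L K (carrier L)"
  by (rule lin_subspaceI[OF _ _ _ _ subring_K]) (use Kc in auto)

lemma K_subspace: "lin_subspace L K K"
  by (rule lin_subspaceI[OF K_props(1,2,7,6) subring_K])

lemma G_subspace: "lin_subspace L K (G i)"
  unfolding G_def using K_subspace W_subspace H_subspace carrier_subspace by simp

lemmas G_props = lin_subspaceD[OF G_subspace]

lemma G_c: "x \<in> G i \<Longrightarrow> x \<in> carrier L" using G_props(1) by blast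

text \<open>The only products that are not trivially in place are those of \<open>W\<close> with itself.\<close>

lemma G_mult:
  assumes x: "x \<in> G i" and y: "y \<in> G j"
  shows "x \<otimes> y \<in> G (i + j)"
proof -
  have c: "x \<in> carrier L" "y \<in> carrier L" using x y G_c by auto
  consider "i = 0" | "j = 0" | "i = 1 \<and> j = 1" | "i + j \<ge> 3" by linarith
  then show ?thesis
  proof cases
    case 1
    then show ?thesis using x y G_props(4)[of x y j] by (simp add: G_simps)
  next
    case 2
    then show ?thesis using x y G_props(4)[of y x i] m_comm[OF c] by (simp add: G_simps)
  next
    case 3
    then show ?thesis using x y W_mult[of x y] by (simp add: G_simps numeral_2_eq_2[symmetric])
  next
    case 4
    then show ?thesis using c by (simp add: G_simps)
  qed
qed

definition Rg where "Rg = coeff_restricted L G"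

lemma Rg_def': "Rg = PL\<lparr>carrier := {p \<in> carrier PL. \<forall>i. cf p i \<in> G i}\<rparr>"
  by (simp add: Rg_def coeff_restricted_def)

lemma Rg_simps [simp]:
  "x \<oplus>\<^bsub>Rg\<^esub> y = x \<oplus>\<^bsub>PL\<^esub> y" "x \<otimes>\<^bsub>Rg\<^esub> y = x \<otimes>\<^bsub>PL\<^esub> y" "\<zero>\<^bsub>Rg\<^esub> = \<zero>\<^bsub>PL\<^esub>" "\<one>\<^bsub>Rg\<^esub> = \<one>\<^bsub>PL\<^esub>"
  by (simp_all add: Rg_def')

lemma Rg_carrier: "carrier Rg = {p \<in> carrier PL. \<forall>i. cf p i \<in> G i}"
  by (simp add: Rg_def')

lemma Rg_c: "p \<in> carrier Rg \<Longrightarrow> p \<in> carrier PL" and Rg_cf: "p \<in> carrier Rg \<Longrightarrow> cf p i \<in> G i"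
  by (simp_all add: Rg_carrier)

lemma Rg_I: "p \<in> carrier PL \<Longrightarrow> (\<And>i. cf p i \<in> G i) \<Longrightarrow> p \<in> carrier Rg"
  by (simp add: Rg_carrier)

lemma Rg_subring: "subring (carrier Rg) PL"
proof (rule up.P.subringI)
  show "carrier Rg \<subseteq> carrier PL" using Rg_c by blast
  show "\<one>\<^bsub>PL\<^esub> \<in> carrier Rg"
    by (rule Rg_I) (use K_props(3) G_props(2) in \<open>auto simp: G_simps\<close>)
  show "\<ominus>\<^bsub>PL\<^esub> p \<in> carrier Rg" if "p \<in> carrier Rg" for p
    using that G_props(5) by (simp add: Rg_carrier)
  show "p \<oplus>\<^bsub>PL\<^esub> q \<in> carrier Rg" if "p \<in> carrier Rg" "q \<in> carrier Rg" for p q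
    using that G_props(3) by (simp add: Rg_carrier)
  show "p \<otimes>\<^bsub>PL\<^esub> q \<in> carrier Rg" if pq: "p \<in> carrier Rg" "q \<in> carrier Rg" for p q
  proof (rule Rg_I)
    show "p \<otimes>\<^bsub>PL\<^esub> q \<in> carrier PL" using pq Rg_c by simp
    fix i
    have "(\<Oplus>j\<in>{..i}. cf p j \<otimes> cf q (i - j)) \<in> G i"
    proof (rule finsum_in_subspace[OF G_subspace])
      fix j assume "j \<in> {..i}"
      then show "cf p j \<otimes> cf q (i - j) \<in> G i" using G_mult[OF Rg_cf[OF pq(1), of j] Rg_cf[OF pq(2), of "i - j"]] by simp
    qed simp
    then show "cf (p \<otimes>\<^bsub>PL\<^esub> q) i \<in> G i" using pq Rg_c by (simp add: up.coeff_mult)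
  qed
qed

lemma Rg_eq: "Rg = PL\<lparr>carrier := carrier Rg\<rparr>"
  by (simp add: Rg_def')

lemma Rg_domain: "domain Rg"
  using up.P.subdomain_is_domain[OF up.subdomainI'[OF Rg_subring]] Rg_eq by simp

sublocale Rg: "domain" Rg by (rule Rg_domain)

lemma Rg_a_inv: "p \<in> carrier Rg \<Longrightarrow> \<ominus>\<^bsub>Rg\<^esub> p = \<ominus>\<^bsub>PL\<^esub> p"
proof (rule Rg.minus_equality)
  assume p: "p \<in> carrier Rg"
  show "\<ominus>\<^bsub>PL\<^esub> p \<oplus>\<^bsub>Rg\<^esub> p = \<zero>\<^bsub>Rg\<^esub>" using Rg_c[OF p] by (simp add: up.P.l_neg)
  show "\<ominus>\<^bsub>PL\<^esub> p \<in> carrier Rg" using subringE(5)[OF Rg_subring p] .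
qed

lemma Rg_minus: "p \<in> carrier Rg \<Longrightarrow> q \<in> carrier Rg \<Longrightarrow> p \<ominus>\<^bsub>Rg\<^esub> q = p \<ominus>\<^bsub>PL\<^esub> q"
  by (simp add: a_minus_def Rg_a_inv)

lemma Rg_finsum:
  assumes "finite A" "f \<in> A \<rightarrow> carrier Rg"
  shows "finsum Rg f A = finsum PL f A"
  using assms
proof (induct A)
  case (insert i A)
  then have "f \<in> A \<rightarrow> carrier Rg" "f i \<in> carrier Rg" "f \<in> A \<rightarrow> carrier PL" "f i \<in> carrier PL"
    using Rg_c by (auto simp: Pi_iff)
  then show ?case using insert by simp
qed simp

lemma mon_Rg: "a \<in> G i \<Longrightarrow> mn a i \<in> carrier Rg"
  by (rule Rg_I) (use G_c G_props(2) in auto)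

lemma mon_K_mult:
  assumes "c \<in> carrier L" "p \<in> carrier PL"
  shows "cf (mn c 0 \<otimes>\<^bsub>PL\<^esub> p) i = c \<otimes> cf p i"
  using cf_mon_mult[OF assms, of 0 i] by simp

definition base_field :: "(nat \<Rightarrow> 'a) set" where "base_field = homogeneous_part L G 0"

lemma base_field_eq: "base_field = (\<lambda>c. mn c 0) ` K"
  by (simp add: base_field_def homogeneous_part_def G_simps)

lemma base_fieldI: "c \<in> K \<Longrightarrow> mn c 0 \<in> base_field" by (simp add: base_field_eq)

lemma base_fieldE: assumes "x \<in> base_field" obtains c where "c \<in> K" "x = mn c 0"
  using assms unfolding base_field_eq by (rule imageE) blast

lemma const_mult_monom: "a \<in> carrier L \<Longrightarrow> b \<in> carrier L \<Longrightarrow> mn a 0 \<otimes>\<^bsub>PL\<^esub> mn b i = mn (a \<otimes> b) i"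
  using up.monom_mult[of a b 0 i] by simp

lemma base_field_subfield: "subfield base_field Rg"
proof (rule Rg.subfieldI)
  have sub: "base_field \<subseteq> carrier Rg" using mon_Rg[of _ 0] by (auto simp: base_field_eq G_simps)
  show "subcring base_field Rg"
  proof (rule Rg.subcringI'[OF Rg.subringI[OF sub]])
    show "\<one>\<^bsub>Rg\<^esub> \<in> base_field" using base_fieldI[OF K_props(3)] by simp
    fix x y assume "x \<in> base_field" "y \<in> base_field"
    then obtain c d where cd: "c \<in> K" "x = mn c 0" "d \<in> K" "y = mn d 0" by (elim base_fieldE)
    show "\<ominus>\<^bsub>Rg\<^esub> x \<in> base_field" using Rg_a_inv[of x] sub \<open>x \<in> base_field\<close> cd base_fieldI[OF K_props(5)[OF cd(1)]] Kc by (auto simp: subset_iff)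
    show "x \<otimes>\<^bsub>Rg\<^esub> y \<in> base_field" using cd base_fieldI[OF K_props(6)[OF cd(1,3)]] Kc by (simp add: const_mult_monom)
    show "x \<oplus>\<^bsub>Rg\<^esub> y \<in> base_field" using cd base_fieldI[OF K_props(7)[OF cd(1,3)]] Kc by simp
  qed
  show "Units (Rg\<lparr>carrier := base_field\<rparr>) = base_field - {\<zero>\<^bsub>Rg\<^esub>}"
  proof (intro equalityI subsetI)
    fix x assume "x \<in> Units (Rg\<lparr>carrier := base_field\<rparr>)"
    then obtain y where x: "x \<in> base_field" "y \<in> base_field" "x \<otimes>\<^bsub>PL\<^esub> y = \<one>\<^bsub>PL\<^esub>" by (auto simp: Units_def)
    have "x \<noteq> \<zero>\<^bsub>PL\<^esub>"
    proof
      assume "x = \<zero>\<^bsub>PL\<^esub>"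
      then have "\<zero>\<^bsub>PL\<^esub> = \<one>\<^bsub>PL\<^esub>" using x sub Rg_c by (auto simp: subset_iff)
      then show False using Rg.one_not_zero by simp
    qed
    then show "x \<in> base_field - {\<zero>\<^bsub>Rg\<^esub>}" using x(1) by simp
  next
    fix x assume x: "x \<in> base_field - {\<zero>\<^bsub>Rg\<^esub>}"
    then have "x \<in> base_field" by blast
    then obtain c where c: "c \<in> K" "x = mn c 0" by (rule base_fieldE)
    have "c \<noteq> \<zero>" using x c by auto
    then have i: "inv c \<in> K" "inv c \<otimes> c = \<one>" "c \<otimes> inv c = \<one>" using subfield_m_inv[OF K, of c] c(1) by auto
    show "x \<in> Units (Rg\<lparr>carrier := base_field\<rparr>)"
      unfolding Units_def using c i base_fieldI[OF i(1)] base_fieldI[OF c(1)] Kc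
      by (auto intro!: bexI[of _ "mn (inv c) 0"] simp: const_mult_monom)
  qed
qed

lemma cf_minus: "p \<in> carrier PL \<Longrightarrow> q \<in> carrier PL \<Longrightarrow> cf (p \<ominus>\<^bsub>PL\<^esub> q) i = cf p i \<ominus> cf q i"
  by (simp add: a_minus_def)

text \<open>One step of long division in \<open>L[t]\<close>.\<close>

lemma leading_term_cancel:
  assumes a: "a \<in> carrier PL" "cf a d \<noteq> \<zero>" "degree_below (Suc d) a" and p: "p \<in> carrier PL" "degree_below (Suc m) p" and m: "d \<le> m"
  obtains c where "c \<in> carrier L" "degree_below m (p \<ominus>\<^bsub>PL\<^esub> a \<otimes>\<^bsub>PL\<^esub> mn c (m - d))"
proof -
  have u: "cf a d \<in> Units L" using a by (simp add: field_Units)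
  let ?c = "inv (cf a d) \<otimes> cf p m"
  have c: "?c \<in> carrier L" using u p by simp
  have ac: "cf a d \<otimes> ?c = cf p m" using u a p by (simp add: m_assoc[symmetric])
  have t: "mn ?c (m - d) \<in> carrier PL" "degree_below (Suc (m - d)) (mn ?c (m - d))" using c by (auto simp: degree_below_def)
  note top = cf_mult_top[OF a(1) t(1) a(3) t(2)]
  have "cf (a \<otimes>\<^bsub>PL\<^esub> mn ?c (m - d)) m = cf p m" using top(1) m c ac by simp
  moreover have "cf (a \<otimes>\<^bsub>PL\<^esub> mn ?c (m - d)) i = \<zero>" if "i > m" for i
    using top(2) m that by (simp add: degree_below_def)
  moreover have "cf p i = \<zero>" if "i > m" for i using p(2) that by (simp add: degree_below_def)
  ultimately have "degree_below m (p \<ominus>\<^bsub>PL\<^esub> a \<otimes>\<^bsub>PL\<^esub> mn ?c (m - d))"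
    unfolding degree_below_def using p(1) a(1) t(1)
    by (auto simp: cf_minus le_less a_minus_def r_neg simp del: up.coeff_mult)
  then show thesis using that c by blast
qed

lemma division_ex:
  assumes a: "a \<in> carrier PL" "cf a d \<noteq> \<zero>" "degree_below (Suc d) a" and p: "p \<in> carrier PL"
  shows "\<exists>q\<in>carrier PL. degree_below d (p \<ominus>\<^bsub>PL\<^esub> a \<otimes>\<^bsub>PL\<^esub> q)"
proof -
  obtain m where "degree_below m p" using degree_below_ex[OF p] by blast
  then show ?thesis using p
  proof (induct m arbitrary: p)
    case 0
    then have "p = \<zero>\<^bsub>PL\<^esub>" using degree_below_zero by blast
    then show ?case using a(1) by (intro bexI[of _ "\<zero>\<^bsub>PL\<^esub>"]) (simp_all add: degree_below_def a_minus_def)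
  next
    case (Suc m)
    show ?case
    proof (cases "d \<le> m")
      case False
      then have "degree_below d p" using Suc(2) by (simp add: degree_below_def)
      then show ?thesis using a(1) Suc(3) by (intro bexI[of _ "\<zero>\<^bsub>PL\<^esub>"]) (simp_all add: a_minus_def)
    next
      case True
      obtain c where c: "c \<in> carrier L" "degree_below m (p \<ominus>\<^bsub>PL\<^esub> a \<otimes>\<^bsub>PL\<^esub> mn c (m - d))"
        using leading_term_cancel[OF a Suc(3,2) True] .
      let ?t = "mn c (m - d)"
      have t: "?t \<in> carrier PL" using c by simp
      obtain q where q: "q \<in> carrier PL" "degree_below d (p \<ominus>\<^bsub>PL\<^esub> a \<otimes>\<^bsub>PL\<^esub> ?t \<ominus>\<^bsub>PL\<^esub> a \<otimes>\<^bsub>PL\<^esub> q)"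
        using Suc(1)[OF c(2)] Suc(3) a(1) t by blast
      have "p \<ominus>\<^bsub>PL\<^esub> a \<otimes>\<^bsub>PL\<^esub> (s \<oplus>\<^bsub>PL\<^esub> q) = p \<ominus>\<^bsub>PL\<^esub> a \<otimes>\<^bsub>PL\<^esub> s \<ominus>\<^bsub>PL\<^esub> a \<otimes>\<^bsub>PL\<^esub> q" if "s \<in> carrier PL" for s
        using Suc(3) a(1) that q(1) by algebra
      from this[OF t] show ?thesis using q t by (intro bexI[of _ "?t \<oplus>\<^bsub>PL\<^esub> q"]) simp_all
    qed
  qed
qed

lemma division_unique:
  assumes a: "a \<in> carrier PL" "cf a d \<noteq> \<zero>" "degree_below (Suc d) a" and p: "p \<in> carrier PL"
    and q: "q \<in> carrier PL" "degree_below d (p \<ominus>\<^bsub>PL\<^esub> a \<otimes>\<^bsub>PL\<^esub> q)" and q': "q' \<in> carrier PL" "degree_below d (p \<ominus>\<^bsub>PL\<^esub> a \<otimes>\<^bsub>PL\<^esub> q')"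
  shows "q = q'"
proof (rule ccontr)
  assume "q \<noteq> q'"
  let ?s = "q \<ominus>\<^bsub>PL\<^esub> q'"
  have s: "?s \<in> carrier PL" using q q' by simp
  have "?s \<noteq> \<zero>\<^bsub>PL\<^esub>" using \<open>q \<noteq> q'\<close> q(1) q'(1) by simp
  then obtain l where l: "cf ?s l \<noteq> \<zero>" "degree_below (Suc l) ?s" using leading[OF s] by blast
  have "a \<otimes>\<^bsub>PL\<^esub> ?s = (p \<ominus>\<^bsub>PL\<^esub> a \<otimes>\<^bsub>PL\<^esub> q') \<ominus>\<^bsub>PL\<^esub> (p \<ominus>\<^bsub>PL\<^esub> a \<otimes>\<^bsub>PL\<^esub> q)" using a(1) p q(1) q'(1) by algebra
  moreover have "cf ((p \<ominus>\<^bsub>PL\<^esub> a \<otimes>\<^bsub>PL\<^esub> q') \<ominus>\<^bsub>PL\<^esub> (p \<ominus>\<^bsub>PL\<^esub> a \<otimes>\<^bsub>PL\<^esub> q)) (d + l)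
      = cf (p \<ominus>\<^bsub>PL\<^esub> a \<otimes>\<^bsub>PL\<^esub> q') (d + l) \<ominus> cf (p \<ominus>\<^bsub>PL\<^esub> a \<otimes>\<^bsub>PL\<^esub> q) (d + l)"
    by (rule cf_minus) (use a(1) p q(1) q'(1) in simp_all)
  moreover have "cf (p \<ominus>\<^bsub>PL\<^esub> a \<otimes>\<^bsub>PL\<^esub> q') (d + l) = \<zero>" "cf (p \<ominus>\<^bsub>PL\<^esub> a \<otimes>\<^bsub>PL\<^esub> q) (d + l) = \<zero>"
    using q(2) q'(2) unfolding degree_below_def by simp_all
  ultimately have "cf (a \<otimes>\<^bsub>PL\<^esub> ?s) (d + l) = \<zero>" by (simp only: a_minus_def minus_zero r_zero zero_closed)
  then have "cf a d \<otimes> cf ?s l = \<zero>" using cf_mult_top(1)[OF a(1) s a(3) l(2)] by simp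
  then show False using integral[of "cf a d" "cf ?s l"] a(1,2) l(1) s by auto
qed

lemma G_finite: "\<exists>bs. set bs \<subseteq> G i \<and> (\<forall>M. lin_subspace L K M \<longrightarrow> set bs \<subseteq> M \<longrightarrow> G i \<subseteq> M)"
proof -
  obtain m where "dimension m K (G i)" using subspace_dimension[OF K degree G_subspace G_props(1)] .
  then obtain bs where bs: "set bs \<subseteq> carrier L" "Span K bs = G i" using exists_base[OF K] by blast
  have "set bs \<subseteq> G i" using Span_base_incl[OF K bs(1)] unfolding bs(2) .
  moreover have "G i \<subseteq> M" if "lin_subspace L K M" "set bs \<subseteq> M" for M
    unfolding bs(2)[symmetric] Span_eq_rel_span using that lin_subspaceD(2)[OF that(1)]
    by (intro rel_span_min[OF K that(1)]) auto
  ultimately show ?thesis by blast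
qed

lemma coefficient_subspace:
  assumes "lin_subspace Rg base_field M"
  shows "lin_subspace L K {g \<in> G i. mn g i \<in> M}"
proof (rule lin_subspaceI[OF _ _ _ _ subring_K])
  note MD = ring.lin_subspaceD[OF Rg.ring_axioms assms]
  show "{g \<in> G i. mn g i \<in> M} \<subseteq> carrier L" using G_c by blast
  show "\<zero> \<in> {g \<in> G i. mn g i \<in> M}" using G_props(2) MD(2) by simp
  show "x \<oplus> y \<in> {g \<in> G i. mn g i \<in> M}" if "x \<in> {g \<in> G i. mn g i \<in> M}" "y \<in> {g \<in> G i. mn g i \<in> M}" for x y
    using that G_props(3)[of x i y] MD(3)[of "mn x i" "mn y i"] up.monom_add[of x y i] G_c[of x i] G_c[of y i] by auto
  show "c \<otimes> x \<in> {g \<in> G i. mn g i \<in> M}" if "c \<in> K" "x \<in> {g \<in> G i. mn g i \<in> M}" for c x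
    using that G_props(4)[of c x i] MD(4)[OF base_fieldI[OF that(1)], of "mn x i"] G_c[of x i] Kc[of c] by (auto simp: const_mult_monom)
qed

text \<open>Let \<open>d\<close> be the degree of \<open>a\<close>. A leading term of degree \<open>m \<ge> d + 3\<close> can be cancelled by a multiple
  \<open>a c t\<^sup>m\<^sup>-\<^sup>d\<close> within the ring, because every multiple of \<open>t\<^sup>m\<^sup>-\<^sup>d\<close> with \<open>m - d \<ge> 3\<close> belongs to it. So the finitely many
  homogeneous parts of degree less than \<open>d + 3\<close> span the quotient.\<close>

lemma Rg_quotient_finite:
  assumes a: "a \<in> carrier Rg" "a \<noteq> \<zero>\<^bsub>Rg\<^esub>"
  shows "\<exists>xs. set xs \<subseteq> carrier Rg \<and> carrier Rg \<subseteq> ring.rel_span Rg base_field (PIdl\<^bsub>Rg\<^esub> a) xs"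
proof -
  have aP: "a \<in> carrier PL" using Rg_c[OF a(1)] .
  obtain d where d: "cf a d \<noteq> \<zero>" "degree_below (Suc d) a" using leading[OF aP] a(2) by auto
  have "\<forall>i. \<exists>bs. set bs \<subseteq> G i \<and> (\<forall>M. lin_subspace L K M \<longrightarrow> set bs \<subseteq> M \<longrightarrow> G i \<subseteq> M)" using G_finite by blast
  then obtain bs where bs: "\<And>i. set (bs i) \<subseteq> G i"
    "\<And>i M. lin_subspace L K M \<Longrightarrow> set (bs i) \<subseteq> M \<Longrightarrow> G i \<subseteq> M" by metis
  define xs where "xs = concat (map (\<lambda>i. map (\<lambda>b. mn b i) (bs i)) [0..<d + 3])"
  have xs_mem: "mn b i \<in> set xs" if "i < d + 3" "b \<in> set (bs i)" for b i
    using that unfolding xs_def by auto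
  have xs: "set xs \<subseteq> carrier Rg"
  proof
    fix x assume "x \<in> set xs"
    then obtain i b where ib: "b \<in> set (bs i)" "x = mn b i" unfolding xs_def by auto
    then show "x \<in> carrier Rg" using mon_Rg[OF subsetD[OF bs(1) ib(1)]] by simp
  qed
  let ?M = "ring.rel_span Rg base_field (PIdl\<^bsub>Rg\<^esub> a) xs"
  have I: "lin_subspace Rg base_field (PIdl\<^bsub>Rg\<^esub> a)"
    by (rule Rg.ideal_lin_subspace[OF Rg.cgenideal_ideal[OF a(1)] Rg.k_carrier[OF base_field_subfield]])
  have M: "lin_subspace Rg base_field ?M" by (rule Rg.rel_span_subspace[OF base_field_subfield I xs])
  note MD = Rg.lin_subspaceD[OF M]
  have low: "mn g i \<in> ?M" if "i < d + 3" "g \<in> G i" for i g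
  proof -
    have "set (bs i) \<subseteq> {g \<in> G i. mn g i \<in> ?M}"
      using bs(1)[of i] xs_mem[OF that(1)] Rg.rel_span_gen[OF base_field_subfield I xs] by blast
    then have "G i \<subseteq> {g \<in> G i. mn g i \<in> ?M}" by (rule bs(2)[OF coefficient_subspace[OF M]])
    then show ?thesis using that(2) by blast
  qed
  have "p \<in> ?M" if "p \<in> carrier Rg" "degree_below m p" for p m
    using that
  proof (induct m arbitrary: p)
    case 0
    then have "p = \<zero>\<^bsub>PL\<^esub>" using degree_below_zero Rg_c by blast
    then show ?case using MD(2) by simp
  next
    case (Suc m)
    have pP: "p \<in> carrier PL" using Rg_c[OF Suc(2)] .
    obtain t where t: "t \<in> ?M" "t \<in> carrier Rg" "degree_below m (p \<ominus>\<^bsub>PL\<^esub> t)"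
    proof (cases "m < d + 3")
      case True
      let ?t = "mn (cf p m) m"
      have g: "cf p m \<in> G m" using Rg_cf[OF Suc(2)] .
      have "degree_below m (p \<ominus>\<^bsub>PL\<^esub> ?t)" unfolding degree_below_def
      proof (intro allI impI)
        fix i assume "m \<le> i"
        then have "i = m \<or> Suc m \<le> i" by linarith
        then have "i = m \<or> cf p i = \<zero>" using Suc(3) unfolding degree_below_def by blast
        then show "cf (p \<ominus>\<^bsub>PL\<^esub> ?t) i = \<zero>" using pP by (auto simp: cf_minus a_minus_def r_neg)
      qed
      then show ?thesis using that[OF low[OF True g] mon_Rg[OF g]] by blast
    next
      case False
      obtain c where c: "c \<in> carrier L" "degree_below m (p \<ominus>\<^bsub>PL\<^esub> a \<otimes>\<^bsub>PL\<^esub> mn c (m - d))"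
        using leading_term_cancel[OF aP d pP Suc(3)] False by auto
      have cR: "mn c (m - d) \<in> carrier Rg" using c(1) False by (intro mon_Rg) (simp add: G_simps)
      have "mn c (m - d) \<otimes>\<^bsub>Rg\<^esub> a \<in> PIdl\<^bsub>Rg\<^esub> a" unfolding cgenideal_def using cR by blast
      then have "a \<otimes>\<^bsub>PL\<^esub> mn c (m - d) \<in> ?M"
        using Rg.rel_span_base[OF base_field_subfield I xs] aP c(1) by (auto simp: up.P.m_comm[of a])
      then show ?thesis using that[of "a \<otimes>\<^bsub>PL\<^esub> mn c (m - d)"] c(2) Rg.m_closed[OF a(1) cR] by simp
    qed
    have "p \<ominus>\<^bsub>Rg\<^esub> t \<in> ?M"
      using Suc(1)[of "p \<ominus>\<^bsub>Rg\<^esub> t"] t Suc(2) Rg_minus[OF Suc(2) t(2)] Rg.minus_closed[OF Suc(2) t(2)] by simp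
    then have "(p \<ominus>\<^bsub>Rg\<^esub> t) \<oplus>\<^bsub>Rg\<^esub> t \<in> ?M" using t(1) by (rule MD(3))
    moreover have "(p \<ominus>\<^bsub>Rg\<^esub> t) \<oplus>\<^bsub>Rg\<^esub> t = p"
      unfolding a_minus_def using Suc(2) t(2) Rg.a_assoc[of p "\<ominus>\<^bsub>Rg\<^esub> t" t] Rg.l_neg[of t] Rg.r_zero[of p] Rg.a_inv_closed by metis
    ultimately show ?case by simp
  qed
  then have "carrier Rg \<subseteq> ?M" using degree_below_ex Rg_c by blast
  then show ?thesis using xs by blast
qed

end

section \<open>Duality for the quotients by principal ideals\<close>

context radical_extension
begin

lemma degree_below_add: "p \<in> carrier PL \<Longrightarrow> q \<in> carrier PL \<Longrightarrow> degree_below m p \<Longrightarrow> degree_below m q \<Longrightarrow> degree_below m (p \<oplus>\<^bsub>PL\<^esub> q)"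
  by (simp add: degree_below_def)

text \<open>The top coefficient of the quotient \<open>s\<close> in a division with remainder by \<open>a\<close>.\<close>

lemma quotient_top:
  assumes a: "a \<in> carrier PL" "cf a d \<noteq> \<zero>" "degree_below (Suc d) a"
    and s: "s \<in> carrier PL" and r: "r \<in> carrier PL" "degree_below d r" and b: "degree_below (Suc (d + l)) (a \<otimes>\<^bsub>PL\<^esub> s \<oplus>\<^bsub>PL\<^esub> r)"
  shows "cf a d \<otimes> cf s l = cf (a \<otimes>\<^bsub>PL\<^esub> s \<oplus>\<^bsub>PL\<^esub> r) (d + l)"
proof -
  have as: "a \<otimes>\<^bsub>PL\<^esub> s \<in> carrier PL" using a s by simp
  have c: "cf (a \<otimes>\<^bsub>PL\<^esub> s \<oplus>\<^bsub>PL\<^esub> r) (d + i) = cf (a \<otimes>\<^bsub>PL\<^esub> s) (d + i)" for i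
    using up.coeff_add[OF as r(1), of "d + i"] r(2) up.coeff_closed[OF as] by (simp add: degree_below_def del: up.coeff_mult up.coeff_add)
  have "degree_below (Suc l) s"
  proof (cases "s = \<zero>\<^bsub>PL\<^esub>")
    case True
    then show ?thesis by (simp add: degree_below_def)
  next
    case False
    then obtain m where m: "cf s m \<noteq> \<zero>" "degree_below (Suc m) s" using leading[OF s] by blast
    have "m \<le> l"
    proof (rule ccontr)
      assume "\<not> m \<le> l"
      then have "Suc (d + l) \<le> d + m" by simp
      then have "cf (a \<otimes>\<^bsub>PL\<^esub> s \<oplus>\<^bsub>PL\<^esub> r) (d + m) = \<zero>" using b unfolding degree_below_def by blast
      then have "cf a d \<otimes> cf s m = \<zero>" using c[of m] cf_mult_top(1)[OF a(1) s a(3) m(2)] by simp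
      then show False using integral[of "cf a d" "cf s m"] a(1,2) m(1) s by auto
    qed
    then show ?thesis using m(2) unfolding degree_below_def by simp
  qed
  then show ?thesis using c[of l] cf_mult_top(1)[OF a(1) s a(3)] by simp
qed

text \<open>The functional \<open>\<mu> b = \<tau> (q\<^sub>2)\<close>, where \<open>q \<in> L[t]\<close> is the quotient of \<open>b\<close> in the division with remainder by \<open>a\<close>.
  Multiples of \<open>a\<close> in the ring are in the radical because \<open>q\<^sub>2 \<in> H\<close> for \<open>q\<close> in the ring. Conversely let
  \<open>x = a q + r\<close> be in the radical. Multiplication by \<open>c t\<^sup>m\<close> with \<open>m \<ge> 3\<close> moves any nonzero coefficient of \<open>r\<close> to
  the quotient, with \<open>c \<in> L\<close> arbitrary, so \<open>r = 0\<close> by nondegeneracy. Then testing against \<open>c t\<^sup>j\<close> with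
  \<open>c \<in> G j\<close>, \<open>j \<le> 2\<close>, gives \<open>q\<^sub>2\<^sub>-\<^sub>j \<in> G\<^sub>j\<^sup>\<bottom> = G\<^sub>2\<^sub>-\<^sub>j\<close>, so \<open>q\<close> is in the ring.\<close>

lemma Rg_quotient_dual:
  assumes a: "a \<in> carrier Rg" "a \<noteq> \<zero>\<^bsub>Rg\<^esub>"
  shows "\<exists>\<mu>. ring_functional Rg base_field \<mu> \<and> ring_functional.radical Rg \<mu> = PIdl\<^bsub>Rg\<^esub> a"
proof -
  have aP: "a \<in> carrier PL" using Rg_c[OF a(1)] .
  obtain d where d: "cf a d \<noteq> \<zero>" "degree_below (Suc d) a" using leading[OF aP] a(2) by auto
  define dv where "dv b = (SOME q. q \<in> carrier PL \<and> degree_below d (b \<ominus>\<^bsub>PL\<^esub> a \<otimes>\<^bsub>PL\<^esub> q))" for b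
  have dv: "dv b \<in> carrier PL" "degree_below d (b \<ominus>\<^bsub>PL\<^esub> a \<otimes>\<^bsub>PL\<^esub> dv b)" if "b \<in> carrier PL" for b
    using someI_ex[of "\<lambda>q. q \<in> carrier PL \<and> degree_below d (b \<ominus>\<^bsub>PL\<^esub> a \<otimes>\<^bsub>PL\<^esub> q)"] division_ex[OF aP d that]
    unfolding dv_def by blast+
  have rem: "b = a \<otimes>\<^bsub>PL\<^esub> dv b \<oplus>\<^bsub>PL\<^esub> (b \<ominus>\<^bsub>PL\<^esub> a \<otimes>\<^bsub>PL\<^esub> dv b)" if "b \<in> carrier PL" for b
    using that dv(1)[OF that] aP by algebra
  have dvI: "dv (a \<otimes>\<^bsub>PL\<^esub> q \<oplus>\<^bsub>PL\<^esub> r) = q" if "q \<in> carrier PL" "r \<in> carrier PL" "degree_below d r" for q r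
  proof -
    have c: "a \<otimes>\<^bsub>PL\<^esub> q \<oplus>\<^bsub>PL\<^esub> r \<in> carrier PL" using that aP by simp
    have "a \<otimes>\<^bsub>PL\<^esub> q \<oplus>\<^bsub>PL\<^esub> r \<ominus>\<^bsub>PL\<^esub> a \<otimes>\<^bsub>PL\<^esub> q = r" using that(1,2) aP by algebra
    then show ?thesis using division_unique[OF aP d c dv[OF c] that(1)] that(3) by simp
  qed
  have dv_add: "dv (x \<oplus>\<^bsub>PL\<^esub> y) = dv x \<oplus>\<^bsub>PL\<^esub> dv y" if xy: "x \<in> carrier PL" "y \<in> carrier PL" for x y
  proof -
    let ?r = "\<lambda>x. x \<ominus>\<^bsub>PL\<^esub> a \<otimes>\<^bsub>PL\<^esub> dv x"
    have r: "?r x \<in> carrier PL" "?r y \<in> carrier PL" using xy dv(1) aP by simp_all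
    have "x \<oplus>\<^bsub>PL\<^esub> y = a \<otimes>\<^bsub>PL\<^esub> (dv x \<oplus>\<^bsub>PL\<^esub> dv y) \<oplus>\<^bsub>PL\<^esub> (?r x \<oplus>\<^bsub>PL\<^esub> ?r y)"
      using xy dv(1)[OF xy(1)] dv(1)[OF xy(2)] aP by algebra
    moreover have "dv (a \<otimes>\<^bsub>PL\<^esub> (dv x \<oplus>\<^bsub>PL\<^esub> dv y) \<oplus>\<^bsub>PL\<^esub> (?r x \<oplus>\<^bsub>PL\<^esub> ?r y)) = dv x \<oplus>\<^bsub>PL\<^esub> dv y"
      using dv xy r by (intro dvI degree_below_add) simp_all
    ultimately show ?thesis by simp
  qed
  have dv_mult: "dv (a \<otimes>\<^bsub>PL\<^esub> q) = q" if "q \<in> carrier PL" for q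
    using dvI[OF that up.P.zero_closed] aP that by (simp add: degree_below_def)
  have dv_scale: "dv (mn c 0 \<otimes>\<^bsub>PL\<^esub> x) = mn c 0 \<otimes>\<^bsub>PL\<^esub> dv x" if c: "c \<in> carrier L" and x: "x \<in> carrier PL" for c x
  proof -
    let ?r = "x \<ominus>\<^bsub>PL\<^esub> a \<otimes>\<^bsub>PL\<^esub> dv x"
    have r: "?r \<in> carrier PL" using x dv(1) aP by simp
    have m: "mn c 0 \<in> carrier PL" using c by simp
    have "mn c 0 \<otimes>\<^bsub>PL\<^esub> x = a \<otimes>\<^bsub>PL\<^esub> (mn c 0 \<otimes>\<^bsub>PL\<^esub> dv x) \<oplus>\<^bsub>PL\<^esub> mn c 0 \<otimes>\<^bsub>PL\<^esub> ?r"
      using m x dv(1)[OF x] aP by algebra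
    moreover have "degree_below d (mn c 0 \<otimes>\<^bsub>PL\<^esub> ?r)"
      using dv(2)[OF x] mon_K_mult[OF c r] c by (simp add: degree_below_def del: up.coeff_mult)
    then have "dv (a \<otimes>\<^bsub>PL\<^esub> (mn c 0 \<otimes>\<^bsub>PL\<^esub> dv x) \<oplus>\<^bsub>PL\<^esub> mn c 0 \<otimes>\<^bsub>PL\<^esub> ?r) = mn c 0 \<otimes>\<^bsub>PL\<^esub> dv x"
      using dv(1)[OF x] r m by (intro dvI) simp_all
    ultimately show ?thesis by simp
  qed
  define \<mu> where "\<mu> b = mn (\<tau> (cf (dv b) 2)) 0" for b
  have cfc: "cf (dv b) 2 \<in> carrier L" if "b \<in> carrier PL" for b using dv(1)[OF that] by simp
  have mu: "ring_functional Rg base_field \<mu>"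
  proof (intro ring_functional.intro ring_functional_axioms.intro Rg.is_cring base_field_subfield)
    fix x assume x: "x \<in> carrier Rg"
    note xc = cfc[OF Rg_c[OF x]]
    show "\<mu> x \<in> base_field" unfolding \<mu>_def using tau[OF xc] by (intro base_fieldI) simp
    show "\<mu> (c \<otimes>\<^bsub>Rg\<^esub> x) = c \<otimes>\<^bsub>Rg\<^esub> \<mu> x" if c: "c \<in> base_field" for c
    proof -
      obtain c' where c': "c' \<in> K" "c = mn c' 0" using c by (rule base_fieldE)
      have "cf (dv (mn c' 0 \<otimes>\<^bsub>PL\<^esub> x)) 2 = c' \<otimes> cf (dv x) 2"
        unfolding dv_scale[OF Kc[OF c'(1)] Rg_c[OF x]] by (rule mon_K_mult[OF Kc[OF c'(1)] dv(1)[OF Rg_c[OF x]]])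
      then show ?thesis
        using tau.mu_smult[OF c'(1) xc] const_mult_monom[of c' "\<tau> (cf (dv x) 2)" 0] Kc[OF c'(1)] tau[OF xc] Kc
        by (simp add: \<mu>_def c'(2))
    qed
    fix y assume y: "y \<in> carrier Rg"
    note yc = cfc[OF Rg_c[OF y]]
    have "cf (dv (x \<oplus>\<^bsub>PL\<^esub> y)) 2 = cf (dv x) 2 \<oplus> cf (dv y) 2"
      unfolding dv_add[OF Rg_c[OF x] Rg_c[OF y]] by (rule up.coeff_add[OF dv(1)[OF Rg_c[OF x]] dv(1)[OF Rg_c[OF y]]])
    then show "\<mu> (x \<oplus>\<^bsub>Rg\<^esub> y) = \<mu> x \<oplus>\<^bsub>Rg\<^esub> \<mu> y"
      using tau.mu_add[OF xc yc] tau.mu_carrier[OF xc] tau.mu_carrier[OF yc] by (simp add: \<mu>_def)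
  qed
  have mu0: "\<mu> b = \<zero>\<^bsub>Rg\<^esub> \<longleftrightarrow> cf (dv b) 2 \<in> H" if b: "b \<in> carrier PL" for b
  proof -
    have t: "\<tau> (cf (dv b) 2) \<in> carrier L" by (rule tau.mu_carrier[OF cfc[OF b]])
    have "\<mu> b = \<zero>\<^bsub>Rg\<^esub> \<longleftrightarrow> \<tau> (cf (dv b) 2) = \<zero>"
    proof
      assume "\<mu> b = \<zero>\<^bsub>Rg\<^esub>"
      then have "cf (mn (\<tau> (cf (dv b) 2)) 0) 0 = cf \<zero>\<^bsub>PL\<^esub> 0" by (simp add: \<mu>_def)
      then show "\<tau> (cf (dv b) 2) = \<zero>" using t by simp
    qed (simp add: \<mu>_def)
    then show ?thesis using tau_eq_zero_iff[OF cfc[OF b]] by simp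
  qed
  have rad: "x \<in> ring_functional.radical Rg \<mu> \<longleftrightarrow> x \<in> carrier Rg \<and> (\<forall>b\<in>carrier Rg. cf (dv (b \<otimes>\<^bsub>PL\<^esub> x)) 2 \<in> H)" for x
    unfolding ring_functional.radical_def[OF mu] using mu0 Rg_c by auto
  have "PIdl\<^bsub>Rg\<^esub> a \<subseteq> ring_functional.radical Rg \<mu>"
  proof
    fix x assume "x \<in> PIdl\<^bsub>Rg\<^esub> a"
    then obtain r where r: "r \<in> carrier Rg" "x = r \<otimes>\<^bsub>Rg\<^esub> a" by (rule Rg.cgenidealE)
    show "x \<in> ring_functional.radical Rg \<mu>" unfolding rad
    proof (intro conjI ballI)
      show "x \<in> carrier Rg" unfolding r(2) by (rule Rg.m_closed[OF r(1) a(1)])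
      fix b assume b: "b \<in> carrier Rg"
      have "b \<otimes>\<^bsub>PL\<^esub> x = a \<otimes>\<^bsub>PL\<^esub> (b \<otimes>\<^bsub>PL\<^esub> r)"
        using Rg_c[OF b] Rg_c[OF r(1)] aP by (simp add: r(2) up.P.m_ac)
      then have "dv (b \<otimes>\<^bsub>PL\<^esub> x) = b \<otimes>\<^bsub>Rg\<^esub> r" using dv_mult[of "b \<otimes>\<^bsub>PL\<^esub> r"] Rg_c[OF b] Rg_c[OF r(1)] by simp
      then have "cf (dv (b \<otimes>\<^bsub>PL\<^esub> x)) 2 \<in> G 2" using Rg_cf[OF Rg.m_closed[OF b r(1)], of 2] by simp
      then show "cf (dv (b \<otimes>\<^bsub>PL\<^esub> x)) 2 \<in> H" by (simp only: G_simps)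
    qed
  qed
  moreover have "ring_functional.radical Rg \<mu> \<subseteq> PIdl\<^bsub>Rg\<^esub> a"
  proof
    fix x assume "x \<in> ring_functional.radical Rg \<mu>"
    then have x: "x \<in> carrier Rg" "\<And>b. b \<in> carrier Rg \<Longrightarrow> cf (dv (b \<otimes>\<^bsub>PL\<^esub> x)) 2 \<in> H" unfolding rad by blast+
    have xP: "x \<in> carrier PL" by (rule Rg_c[OF x(1)])
    define q where "q = dv x"
    define r where "r = x \<ominus>\<^bsub>PL\<^esub> a \<otimes>\<^bsub>PL\<^esub> q"
    have q: "q \<in> carrier PL" and r: "r \<in> carrier PL" "degree_below d r" and xqr: "x = a \<otimes>\<^bsub>PL\<^esub> q \<oplus>\<^bsub>PL\<^esub> r"
      using dv[OF xP] rem[OF xP] xP aP by (simp_all add: q_def r_def)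
    have "r = \<zero>\<^bsub>PL\<^esub>"
    proof (rule ccontr)
      assume "r \<noteq> \<zero>\<^bsub>PL\<^esub>"
      then obtain e where e: "cf r e \<noteq> \<zero>" "degree_below (Suc e) r" using leading[OF r(1)] by blast
      have ed: "e < d" using e(1) r(2) unfolding degree_below_def by (meson not_le)
      have "y \<otimes> cf r e \<in> H" if y: "y \<in> carrier L" for y
      proof -
        define c where "c = cf a d \<otimes> y"
        \<comment> \<open>The exponent moves the leading term of \<open>r\<close> to degree \<open>d + 2\<close>, where it is seen by the coefficient
          of degree 2 of the quotient; it is at least 3 because \<open>e < d\<close>, so \<open>c\<close> may be any element of \<open>L\<close>.\<close>
        define b where "b = mn c (d - e + 2)"
        have c: "c \<in> carrier L" using y aP by (simp add: c_def)
        have bR: "b \<in> carrier Rg" unfolding b_def using c ed by (intro mon_Rg) (simp add: G_simps)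
        have bP: "b \<in> carrier PL" by (rule Rg_c[OF bR])
        have brP: "b \<otimes>\<^bsub>PL\<^esub> r \<in> carrier PL" "b \<otimes>\<^bsub>PL\<^esub> q \<in> carrier PL" using bP r(1) q by simp_all
        have "b \<otimes>\<^bsub>PL\<^esub> x = a \<otimes>\<^bsub>PL\<^esub> (b \<otimes>\<^bsub>PL\<^esub> q) \<oplus>\<^bsub>PL\<^esub> b \<otimes>\<^bsub>PL\<^esub> r"
          unfolding xqr using bP aP q r(1) by algebra
        then have "dv (b \<otimes>\<^bsub>PL\<^esub> x) = b \<otimes>\<^bsub>PL\<^esub> q \<oplus>\<^bsub>PL\<^esub> dv (b \<otimes>\<^bsub>PL\<^esub> r)"
          using dv_add[of "a \<otimes>\<^bsub>PL\<^esub> (b \<otimes>\<^bsub>PL\<^esub> q)" "b \<otimes>\<^bsub>PL\<^esub> r"] dv_mult brP aP by simp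
        moreover have "cf (b \<otimes>\<^bsub>PL\<^esub> q) 2 = \<zero>" unfolding b_def cf_mon_mult[OF c q] using ed by simp
        ultimately have h: "cf (dv (b \<otimes>\<^bsub>PL\<^esub> r)) 2 \<in> H"
          using x(2)[OF bR] up.coeff_add[OF brP(2) dv(1)[OF brP(1)], of 2] cfc[OF brP(1)] by simp
        have "degree_below (Suc (d + 2)) (b \<otimes>\<^bsub>PL\<^esub> r)" unfolding degree_below_def b_def cf_mon_mult[OF c r(1)]
          using e(2) ed c unfolding degree_below_def by auto
        then have "cf a d \<otimes> cf (dv (b \<otimes>\<^bsub>PL\<^esub> r)) 2 = cf (b \<otimes>\<^bsub>PL\<^esub> r) (d + 2)"
          using quotient_top[OF aP d dv(1)[OF brP(1)] _ dv(2)[OF brP(1)], of 2] rem[OF brP(1)] brP aP dv(1)[OF brP(1)] by simp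
        also have "\<dots> = cf a d \<otimes> (y \<otimes> cf r e)" unfolding b_def cf_mon_mult[OF c r(1)]
          using ed y aP r(1) by (simp add: c_def m_assoc)
        finally have "cf (dv (b \<otimes>\<^bsub>PL\<^esub> r)) 2 = y \<otimes> cf r e"
          using m_lcancel[of "cf a d"] d(1) aP cfc[OF brP(1)] y r(1) by simp
        then show ?thesis using h by simp
      qed
      then show False using nondegenerate[of "cf r e"] r(1) e(1) by simp
    qed
    then have xq: "x = a \<otimes>\<^bsub>PL\<^esub> q" using xqr q aP by simp
    have low: "cf q (2 - j) \<in> perp (G j)" if j: "j \<le> 2" for j
      unfolding perp_def
    proof (intro CollectI conjI ballI)
      show "cf q (2 - j) \<in> carrier L" using q by simp
      fix c assume c: "c \<in> G j"
      have bR: "mn c j \<in> carrier Rg" by (rule mon_Rg[OF c])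
      have "mn c j \<otimes>\<^bsub>PL\<^esub> x = a \<otimes>\<^bsub>PL\<^esub> (mn c j \<otimes>\<^bsub>PL\<^esub> q)"
        unfolding xq using Rg_c[OF bR] aP q by (simp add: up.P.m_lcomm)
      then have "dv (mn c j \<otimes>\<^bsub>PL\<^esub> x) = mn c j \<otimes>\<^bsub>PL\<^esub> q" using dv_mult[of "mn c j \<otimes>\<^bsub>PL\<^esub> q"] Rg_c[OF bR] q by simp
      then have "c \<otimes> cf q (2 - j) \<in> H" using x(2)[OF bR] cf_mon_mult[OF G_c[OF c] q, of j 2] j by simp
      then show "cf q (2 - j) \<otimes> c \<in> H" using G_c[OF c] q by (simp add: m_comm)
    qed
    have "q \<in> carrier Rg"
    proof (rule Rg_I[OF q])
      fix i :: nat
      consider "i = 0" | "i = 1" | "i = 2" | "i \<ge> 3" by linarith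
      then show "cf q i \<in> G i"
        using low[of 2] low[of 1] low[of 0] perp_H perp_W perp_K q by cases (simp_all add: G_simps)
    qed
    moreover have "x = q \<otimes>\<^bsub>Rg\<^esub> a" unfolding xq using q aP by (simp add: up.P.m_comm)
    ultimately show "x \<in> PIdl\<^bsub>Rg\<^esub> a" unfolding cgenideal_def by blast
  qed
  ultimately show ?thesis using mu by blast
qed

sublocale frob: frobenius_domain Rg base_field
  by (intro frobenius_domain.intro frobenius_domain_axioms.intro Rg_domain base_field_subfield Rg_quotient_finite Rg_quotient_dual)

end

section \<open>Krull dimension and standard grading\<close>

context radical_extension
begin

lemma cf_mult_0: "p \<in> carrier PL \<Longrightarrow> q \<in> carrier PL \<Longrightarrow> cf (p \<otimes>\<^bsub>PL\<^esub> q) 0 = cf p 0 \<otimes> cf q 0"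
  by (simp add: up.coeff_mult)

lemma positive_part_prime: "primeideal {p \<in> carrier Rg. cf p 0 = \<zero>} Rg" (is "primeideal ?M Rg")
proof (rule primeidealI)
  show "ideal ?M Rg"
  proof (rule idealI[OF Rg.ring_axioms])
    show "subgroup ?M (add_monoid Rg)"
    proof (rule Rg.add.subgroupI)
      show "?M \<noteq> {}" using Rg.zero_closed by (auto intro!: exI[of _ "\<zero>\<^bsub>PL\<^esub>"])
      fix p q assume p: "p \<in> ?M" and q: "q \<in> ?M"
      show "p \<oplus>\<^bsub>Rg\<^esub> q \<in> ?M" using p q Rg.a_closed[of p q] Rg_c by simp
      show "\<ominus>\<^bsub>Rg\<^esub> p \<in> ?M" using p Rg.a_inv_closed[of p] Rg_c Rg_a_inv[of p] by simp
    qed blast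
    fix a x assume a: "a \<in> ?M" and x: "x \<in> carrier Rg"
    show "x \<otimes>\<^bsub>Rg\<^esub> a \<in> ?M" "a \<otimes>\<^bsub>Rg\<^esub> x \<in> ?M"
      using a x Rg.m_closed[of a x] Rg.m_closed[of x a] Rg_c[of a] Rg_c[OF x]
      by (simp_all add: cf_mult_0 del: up.coeff_mult)
  qed
  show "cring Rg" by (rule Rg.is_cring)
  show "carrier Rg \<noteq> ?M"
  proof
    assume "carrier Rg = ?M"
    then have "\<one>\<^bsub>PL\<^esub> \<in> ?M" using Rg.one_closed by simp
    then show False using one_not_zero by simp
  qed
  fix a b assume ab: "a \<in> carrier Rg" "b \<in> carrier Rg" "a \<otimes>\<^bsub>Rg\<^esub> b \<in> ?M"
  then have "cf a 0 \<otimes> cf b 0 = \<zero>" using cf_mult_0[of a b] Rg_c by simp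
  then show "a \<in> ?M \<or> b \<in> ?M" using integral[of "cf a 0" "cf b 0"] ab Rg_c by auto
qed

abbreviation "t \<equiv> mn \<one> 1"

lemma one_W: "\<one> \<in> W" using V_one V_subset_W by blast

lemma t_Rg: "t \<in> carrier Rg"
  by (rule mon_Rg) (use one_W in \<open>simp add: G_simps\<close>)

lemma mn_eq_zero: assumes "a \<in> carrier L" "mn a i = \<zero>\<^bsub>PL\<^esub>" shows "a = \<zero>"
proof -
  have "cf (mn a i) i = cf \<zero>\<^bsub>PL\<^esub> i" using assms(2) by simp
  then show ?thesis using assms(1) by simp
qed

lemma t_nonzero: "t \<noteq> \<zero>\<^bsub>PL\<^esub>"
  using mn_eq_zero[of \<one> 1] by auto

lemma krull_dim_Rg: "krull_dim Rg = 1"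
proof (rule frob.krull_dim_eq_1[OF positive_part_prime])
  have "t \<in> {p \<in> carrier Rg. cf p 0 = \<zero>}" using t_Rg by simp
  moreover have "t \<notin> {\<zero>\<^bsub>Rg\<^esub>}" using t_nonzero by simp
  ultimately show "{p \<in> carrier Rg. cf p 0 = \<zero>} \<noteq> {\<zero>\<^bsub>Rg\<^esub>}" by blast
qed

lemma cf_sum_mon:
  assumes "finite A" "\<And>i. g i \<in> carrier L"
  shows "cf (finsum PL (\<lambda>i. mn (g i) i) A) j = (if j \<in> A then g j else \<zero>)"
  using assms(1)
proof (induct A)
  case (insert i A)
  have c: "(\<lambda>i. mn (g i) i) \<in> A \<rightarrow> carrier PL" "mn (g i) i \<in> carrier PL" "finsum PL (\<lambda>i. mn (g i) i) A \<in> carrier PL"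
    using assms(2) by (auto intro!: up.P.finsum_closed)
  have "finsum PL (\<lambda>i. mn (g i) i) (insert i A) = mn (g i) i \<oplus>\<^bsub>PL\<^esub> finsum PL (\<lambda>i. mn (g i) i) A"
    by (rule up.P.finsum_insert) (use insert c in auto)
  then show ?case using insert(2,3) c assms(2) up.coeff_add[OF c(2,3), of j] by auto
qed simp

lemma homogeneous_part_eq: "homogeneous_part L G i = (\<lambda>a. mn a i) ` G i"
  by (simp add: homogeneous_part_def)

lemma finite_support: "p \<in> carrier PL \<Longrightarrow> finite {i. cf p i \<noteq> \<zero>}"
  using degree_below_ex[of p] by (auto simp: degree_below_def intro: finite_subset[OF _ finite_lessThan] dest: not_le_imp_less)

lemma mon_decomposition:
  assumes p: "p \<in> carrier Rg"
  shows "p = finsum Rg (\<lambda>i. mn (cf p i) i) {i. cf p i \<noteq> \<zero>}"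
proof -
  have pP: "p \<in> carrier PL" by (rule Rg_c[OF p])
  note fin = finite_support[OF pP]
  have "finsum Rg (\<lambda>i. mn (cf p i) i) {i. cf p i \<noteq> \<zero>} = finsum PL (\<lambda>i. mn (cf p i) i) {i. cf p i \<noteq> \<zero>}"
    by (rule Rg_finsum[OF fin]) (use mon_Rg[OF Rg_cf[OF p]] in blast)
  moreover have "p = finsum PL (\<lambda>i. mn (cf p i) i) {i. cf p i \<noteq> \<zero>}"
  proof (rule up.up_eqI[OF _ pP])
    show "finsum PL (\<lambda>i. mn (cf p i) i) {i. cf p i \<noteq> \<zero>} \<in> carrier PL"
      by (rule up.P.finsum_closed) (use pP in auto)
    show "cf p j = cf (finsum PL (\<lambda>i. mn (cf p i) i) {i. cf p i \<noteq> \<zero>}) j" for j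
      using cf_sum_mon[OF fin, of "cf p" j] pP by auto
  qed
  ultimately show ?thesis by simp
qed

lemma homogeneous_decomposition:
  assumes p: "p \<in> carrier Rg"
  shows "\<exists>!f. (\<forall>i. f i \<in> homogeneous_part L G i) \<and> finite {i. f i \<noteq> \<zero>\<^bsub>Rg\<^esub>} \<and>
    p = finsum Rg f {i. f i \<noteq> \<zero>\<^bsub>Rg\<^esub>}"
proof (rule ex1I[of _ "\<lambda>i. mn (cf p i) i"])
  have pP: "p \<in> carrier PL" by (rule Rg_c[OF p])
  have "{i. mn (cf p i) i \<noteq> \<zero>\<^bsub>Rg\<^esub>} = {i. cf p i \<noteq> \<zero>}"
    using mn_eq_zero[of "cf p _"] pP by auto
  then show "(\<forall>i. mn (cf p i) i \<in> homogeneous_part L G i) \<and> finite {i. mn (cf p i) i \<noteq> \<zero>\<^bsub>Rg\<^esub>} \<and>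
      p = finsum Rg (\<lambda>i. mn (cf p i) i) {i. mn (cf p i) i \<noteq> \<zero>\<^bsub>Rg\<^esub>}"
    using mon_decomposition[OF p] finite_support[OF pP] Rg_cf[OF p] by (simp add: homogeneous_part_eq)
  fix f assume f: "(\<forall>i. f i \<in> homogeneous_part L G i) \<and> finite {i. f i \<noteq> \<zero>\<^bsub>Rg\<^esub>} \<and>
    p = finsum Rg f {i. f i \<noteq> \<zero>\<^bsub>Rg\<^esub>}"
  have "\<forall>i. \<exists>a. a \<in> G i \<and> f i = mn a i" using f unfolding homogeneous_part_eq by blast
  then obtain g where "\<forall>i. g i \<in> G i \<and> f i = mn (g i) i" using choice[of "\<lambda>i a. a \<in> G i \<and> f i = mn a i"] by blast
  then have g: "\<And>i. g i \<in> G i" and fg: "f = (\<lambda>i. mn (g i) i)" by auto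
  let ?A = "{i. f i \<noteq> \<zero>\<^bsub>PL\<^esub>}"
  have fin: "finite ?A" using f by simp
  have "finsum Rg f ?A = finsum PL f ?A"
    by (rule Rg_finsum[OF fin]) (use mon_Rg[OF g] in \<open>simp add: fg\<close>)
  then have pf: "p = finsum PL (\<lambda>i. mn (g i) i) ?A" using f unfolding fg by simp
  show "f = (\<lambda>i. mn (cf p i) i)"
  proof
    fix j
    have "cf p j = (if j \<in> ?A then g j else \<zero>)"
      using cf_sum_mon[OF fin, of g j] G_c[OF g] unfolding pf[symmetric] by simp
    moreover have "j \<notin> ?A \<Longrightarrow> f j = mn \<zero> j" by simp
    ultimately show "f j = mn (cf p j) j" by (cases "j \<in> ?A") (simp_all add: fg)
  qed
qed

text \<open>Degree 1 reaches degree 2 by \<open>H_generated\<close> and degree 3 by \<open>L_generated\<close>; from there on multiplication by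
  \<open>t\<close> is enough.\<close>

lemma Rg_generated:
  obtains S where "finite S" "S \<subseteq> homogeneous_part L G 1" "generate_ring Rg (base_field \<union> S) = carrier Rg"
proof -
  obtain bs where bs: "set bs \<subseteq> G 1" "\<And>M. lin_subspace L K M \<Longrightarrow> set bs \<subseteq> M \<Longrightarrow> G 1 \<subseteq> M"
    using G_finite[of 1] by blast
  define S where "S = (\<lambda>b. mn b 1) ` set bs"
  have S: "finite S" "S \<subseteq> homogeneous_part L G 1" unfolding S_def homogeneous_part_eq using bs(1) by auto
  have Sc: "base_field \<union> S \<subseteq> carrier Rg"
    using S(2) mon_Rg[of _ 1] Rg.k_carrier[OF base_field_subfield] unfolding homogeneous_part_eq by blast
  define T where "T = generate_ring Rg (base_field \<union> S)"
  have T: "subring T Rg" unfolding T_def by (rule Rg.generate_ring_is_subring[OF Sc])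
  have gen: "base_field \<union> S \<subseteq> T" unfolding T_def using generate_ring.incl by (metis subsetI)
  note TD = subringE[OF T]
  have TL: "lin_subspace Rg base_field T"
    by (rule Rg.lin_subspaceI[OF TD(1,2,7) _ subfieldE(1)[OF base_field_subfield]]) (use TD(6) gen in blast)+
  define C where "C i = {g \<in> G i. mn g i \<in> T}" for i
  have C: "lin_subspace L K (C i)" for i unfolding C_def by (rule coefficient_subspace[OF TL])
  have prod: "a \<otimes> b \<in> C (i + j)" if "a \<in> C i" "b \<in> C j" for a b i j
    using that G_mult[of a i b j] TD(6)[of "mn a i" "mn b j"] G_c[of a i] G_c[of b j]
    by (simp add: C_def)
  have "set bs \<subseteq> C 1" unfolding C_def using gen bs(1) by (auto simp: S_def)
  then have 1: "G 1 \<subseteq> C 1" by (rule bs(2)[OF C])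
  have W1: "W \<subseteq> C 1" using 1 by (simp add: G_simps)
  have "H \<subseteq> C (1 + 1)" by (rule H_generated[OF C]) (use W1 prod in blast)
  then have 2: "H \<subseteq> C 2" by (simp add: numeral_2_eq_2)
  have "carrier L \<subseteq> C (1 + 2)" by (rule L_generated[OF C]) (use W1 2 prod in blast)
  then have 3: "carrier L \<subseteq> C 3" by (simp add: numeral_3_eq_3)
  have high: "carrier L \<subseteq> C (3 + m)" for m
  proof (induct m)
    case (Suc m)
    show ?case
    proof
      fix x assume x: "x \<in> carrier L"
      have "x \<otimes> \<one> \<in> C (3 + m + 1)" by (rule prod) (use Suc x W1 one_W in blast)+
      then show "x \<in> C (3 + Suc m)" using x by simp
    qed
  qed (use 3 in simp)
  have GC: "G i \<subseteq> C i" for i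
  proof -
    consider "i = 0" | "i = 1" | "i = 2" | "i \<ge> 3" by linarith
    then show ?thesis
    proof cases
      case 1
      then show ?thesis using gen base_fieldI by (auto simp: C_def G_simps)
    qed (use \<open>G 1 \<subseteq> C 1\<close> \<open>H \<subseteq> C 2\<close> high[of "i - 3"] in \<open>simp_all add: G_simps\<close>)
  qed
  have "p \<in> T" if p: "p \<in> carrier Rg" for p
  proof -
    have "finsum Rg (\<lambda>i. mn (cf p i) i) {i. cf p i \<noteq> \<zero>} \<in> T"
      by (rule Rg.finsum_in_subspace[OF TL finite_support[OF Rg_c[OF p]]])
        (use GC Rg_cf[OF p] in \<open>auto simp: C_def\<close>)
    then show ?thesis using mon_decomposition[OF p] by simp
  qed
  then have "T = carrier Rg" using TD(1) by blast
  then show thesis using that[OF S] T_def by simp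
qed

lemma Rg_standard_graded: "standard_graded base_field Rg (homogeneous_part L G)"
  unfolding standard_graded_def
proof (intro conjI allI ballI)
  show "cring Rg" by (rule Rg.is_cring)
  show "subfield base_field Rg" by (rule base_field_subfield)
  show "lin_subspace Rg base_field (homogeneous_part L G i)" for i
  proof (rule Rg.lin_subspaceI[OF _ _ _ _ subfieldE(1)[OF base_field_subfield]])
    show "homogeneous_part L G i \<subseteq> carrier Rg" unfolding homogeneous_part_eq using mon_Rg by blast
    show "\<zero>\<^bsub>Rg\<^esub> \<in> homogeneous_part L G i" unfolding homogeneous_part_eq
      by (rule image_eqI[OF _ G_props(2)]) simp
    fix x y assume "x \<in> homogeneous_part L G i" "y \<in> homogeneous_part L G i"
    then obtain a b where ab: "a \<in> G i" "x = mn a i" "b \<in> G i" "y = mn b i" unfolding homogeneous_part_eq by blast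
    show "x \<oplus>\<^bsub>Rg\<^esub> y \<in> homogeneous_part L G i" unfolding homogeneous_part_eq
      by (rule image_eqI[OF _ G_props(3)[OF ab(1,3)]]) (use ab G_c in simp)
  next
    fix c x assume "c \<in> base_field" "x \<in> homogeneous_part L G i"
    then obtain c' a where ca: "c' \<in> K" "c = mn c' 0" "a \<in> G i" "x = mn a i" unfolding homogeneous_part_eq by (blast elim: base_fieldE)
    show "c \<otimes>\<^bsub>Rg\<^esub> x \<in> homogeneous_part L G i" unfolding homogeneous_part_eq
      by (rule image_eqI[OF _ G_props(4)[OF ca(1,3)]]) (use ca G_c Kc const_mult_monom in simp)
  qed
  fix x y i j assume "x \<in> homogeneous_part L G i" "y \<in> homogeneous_part L G j"
  then obtain a b where ab: "a \<in> G i" "x = mn a i" "b \<in> G j" "y = mn b j" unfolding homogeneous_part_eq by blast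
  show "x \<otimes>\<^bsub>Rg\<^esub> y \<in> homogeneous_part L G (i + j)" unfolding homogeneous_part_eq
    by (rule image_eqI[OF _ G_mult[OF ab(1,3)]]) (use ab G_c in simp)
next
  show "\<exists>S. finite S \<and> S \<subseteq> homogeneous_part L G 1 \<and> generate_ring Rg (base_field \<union> S) = carrier Rg"
    using Rg_generated by metis
  show "homogeneous_part L G 0 = base_field" by (simp add: homogeneous_part_eq base_field_eq G_simps)
qed (rule homogeneous_decomposition)

end

section \<open>The ideal generated by \<open>t\<close> and \<open>\<alpha>t\<close>\<close>

context radical_extension
begin

abbreviation "\<alpha>t \<equiv> mn \<alpha> 1"

definition line_ideal where "line_ideal = genideal Rg {t, \<alpha>t}"

lemma alpha_t_Rg: "\<alpha>t \<in> carrier Rg"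
  by (rule mon_Rg) (use alpha_V_subset_W[OF V_one] alpha(1) in \<open>simp add: G_simps\<close>)

lemma line_ideal_ideal: "ideal line_ideal Rg"
  unfolding line_ideal_def by (rule Rg.genideal_ideal) (use t_Rg alpha_t_Rg in simp)

sublocale I: ideal line_ideal Rg by (rule line_ideal_ideal)

lemma t_line_ideal: "t \<in> line_ideal" and alpha_t_line_ideal: "\<alpha>t \<in> line_ideal"
  unfolding line_ideal_def using Rg.genideal_self[of "{t, \<alpha>t}"] t_Rg alpha_t_Rg by auto

lemma line_idealE:
  assumes "x \<in> line_ideal"
  obtains r s where "r \<in> carrier Rg" "s \<in> carrier Rg" "x = r \<otimes>\<^bsub>PL\<^esub> t \<oplus>\<^bsub>PL\<^esub> s \<otimes>\<^bsub>PL\<^esub> \<alpha>t"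
proof -
  let ?J = "PIdl\<^bsub>Rg\<^esub> t <+>\<^bsub>Rg\<^esub> PIdl\<^bsub>Rg\<^esub> \<alpha>t"
  have J: "ideal ?J Rg" by (intro Rg.add_ideals Rg.cgenideal_ideal t_Rg alpha_t_Rg)
  have z: "\<zero>\<^bsub>Rg\<^esub> \<in> PIdl\<^bsub>Rg\<^esub> a" if "a \<in> carrier Rg" for a
    by (rule additive_subgroup.zero_closed[OF ideal.axioms(1)[OF Rg.cgenideal_ideal[OF that]]])
  have "t \<in> ?J"
    by (rule Rg.set_addI[OF Rg.cgenideal_self[OF t_Rg] z[OF alpha_t_Rg]]) (use Rg_c[OF t_Rg] in simp)
  moreover have "\<alpha>t \<in> ?J"
    by (rule Rg.set_addI[OF z[OF t_Rg] Rg.cgenideal_self[OF alpha_t_Rg]]) (use Rg_c[OF alpha_t_Rg] in simp)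
  ultimately have "line_ideal \<subseteq> ?J" unfolding line_ideal_def by (intro Rg.genideal_minimal[OF J]) simp
  then have "x \<in> ?J" using assms by (rule subsetD)
  then obtain u v where uv: "u \<in> PIdl\<^bsub>Rg\<^esub> t" "v \<in> PIdl\<^bsub>Rg\<^esub> \<alpha>t" "x = u \<oplus>\<^bsub>Rg\<^esub> v"
    unfolding Rg.set_add_mem_iff by (elim bexE)
  obtain r where r: "r \<in> carrier Rg" "u = r \<otimes>\<^bsub>Rg\<^esub> t" using uv(1) by (rule Rg.cgenidealE)
  obtain s where s: "s \<in> carrier Rg" "v = s \<otimes>\<^bsub>Rg\<^esub> \<alpha>t" using uv(2) by (rule Rg.cgenidealE)
  show thesis by (rule that[OF r(1) s(1)]) (use uv r s in simp)
qed

lemma line_ideal_coefficients: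
  assumes "x \<in> line_ideal"
  shows "cf x 0 = \<zero>" "cf x 1 \<in> PS 1" "cf x 2 \<in> V3"
proof -
  obtain r s where rs: "r \<in> carrier Rg" "s \<in> carrier Rg" "x = r \<otimes>\<^bsub>PL\<^esub> t \<oplus>\<^bsub>PL\<^esub> s \<otimes>\<^bsub>PL\<^esub> \<alpha>t"
    using assms by (rule line_idealE)
  have P: "r \<in> carrier PL" "s \<in> carrier PL" using rs Rg_c by auto
  have m: "t \<in> carrier PL" "\<alpha>t \<in> carrier PL" using alpha(1) by simp_all
  have x: "x = t \<otimes>\<^bsub>PL\<^esub> r \<oplus>\<^bsub>PL\<^esub> \<alpha>t \<otimes>\<^bsub>PL\<^esub> s" using rs(3) P m by (simp add: up.P.m_comm)
  have c: "cf x i = cf (t \<otimes>\<^bsub>PL\<^esub> r) i \<oplus> cf (\<alpha>t \<otimes>\<^bsub>PL\<^esub> s) i" for i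
    unfolding x by (rule up.coeff_add) (use P m in simp_all)
  show "cf x 0 = \<zero>" unfolding c cf_mon_mult[OF one_closed P(1)] cf_mon_mult[OF alpha(1) P(2)] by simp
  have k: "cf x (Suc i) = cf r i \<oplus> \<alpha> \<otimes> cf s i" for i
    unfolding c cf_mon_mult[OF one_closed P(1)] cf_mon_mult[OF alpha(1) P(2)] using P by simp
  have "cf r 0 \<in> K" "cf s 0 \<in> K" using Rg_cf[OF rs(1), of 0] Rg_cf[OF rs(2), of 0] by (simp_all add: G_simps)
  then show "cf x 1 \<in> PS 1" using k[of 0] unfolding K_line by auto
  have "cf r 1 \<in> W" "cf s 1 \<in> W" using Rg_cf[OF rs(1), of 1] Rg_cf[OF rs(2), of 1] by (simp_all add: G_simps)
  then obtain u v u' v' where uv: "u \<in> V" "v \<in> V" "cf r 1 = u \<oplus> \<alpha> \<otimes> v" "u' \<in> V" "v' \<in> V" "cf s 1 = u' \<oplus> \<alpha> \<otimes> v'"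
    unfolding W_mem_iff by (elim bexE)
  have "cf x 2 = (u \<oplus> \<alpha> \<otimes> v) \<oplus> \<alpha> \<otimes> (u' \<oplus> \<alpha> \<otimes> v')" using k[of 1] uv by (simp add: numeral_2_eq_2)
  moreover have "\<dots> = u \<oplus> \<alpha> \<otimes> (v \<oplus> u') \<oplus> \<alpha> \<otimes> \<alpha> \<otimes> v'"
    using uv(1,2,4,5)[THEN Vc] alpha(1) by algebra
  ultimately have "cf x 2 = u \<oplus> \<alpha> \<otimes> (v \<oplus> u') \<oplus> \<alpha> \<otimes> \<alpha> \<otimes> v'" by simp
  then show "cf x 2 \<in> V3" unfolding V3_mem_iff
    using uv(1,5) V_props(3)[OF uv(2,4)] by (intro bexI[of _ u] bexI[of _ "v \<oplus> u'"] bexI[of _ v'])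
qed

lemma cf_mult_1: "p \<in> carrier PL \<Longrightarrow> q \<in> carrier PL \<Longrightarrow> cf (p \<otimes>\<^bsub>PL\<^esub> q) 1 = cf p 0 \<otimes> cf q 1 \<oplus> cf p 1 \<otimes> cf q 0"
  by (simp add: up.coeff_mult atMost_Suc a_comm)

text \<open>A single generator would have a coefficient \<open>b\<^sub>1\<close> with \<open>1, \<alpha> \<in> K b\<^sub>1\<close>, so \<open>\<alpha>\<close> would lie in \<open>K\<close>.\<close>

lemma line_ideal_not_free: "\<not> free_mod Rg (ideal_module Rg line_ideal)"
proof
  assume "free_mod Rg (ideal_module Rg line_ideal)"
  then obtain b where b: "b \<in> line_ideal" "line_ideal \<subseteq> PIdl\<^bsub>Rg\<^esub> b"
    using Rg.free_ideal_principal[OF line_ideal_ideal] by blast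
  have bP: "b \<in> carrier PL" using b(1) I.Icarr Rg_c by blast
  obtain r where r: "r \<in> carrier Rg" "t = r \<otimes>\<^bsub>Rg\<^esub> b" using subsetD[OF b(2) t_line_ideal] by (rule Rg.cgenidealE)
  obtain s where s: "s \<in> carrier Rg" "\<alpha>t = s \<otimes>\<^bsub>Rg\<^esub> b" using subsetD[OF b(2) alpha_t_line_ideal] by (rule Rg.cgenidealE)
  have b1: "cf b 1 \<in> carrier L" using bP by simp
  have r0: "cf r 0 \<in> K" "cf s 0 \<in> K" using Rg_cf[OF r(1), of 0] Rg_cf[OF s(1), of 0] by (simp_all add: G_simps)
  have c: "cf (x \<otimes>\<^bsub>PL\<^esub> b) 1 = cf x 0 \<otimes> cf b 1" if "x \<in> carrier Rg" for x
    using cf_mult_1[OF Rg_c[OF that] bP] line_ideal_coefficients(1)[OF b(1)] Rg_c[OF that] bP by simp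
  have "cf t 1 = cf r 0 \<otimes> cf b 1" unfolding r(2) Rg_simps by (rule c[OF r(1)])
  moreover have "cf \<alpha>t 1 = cf s 0 \<otimes> cf b 1" unfolding s(2) Rg_simps by (rule c[OF s(1)])
  ultimately have e: "cf r 0 \<otimes> cf b 1 = \<one>" "cf s 0 \<otimes> cf b 1 = \<alpha>" using alpha(1) by simp_all
  have rc: "cf r 0 \<in> carrier L" "cf s 0 \<in> carrier L" using r0 Kc by auto
  have "cf r 0 \<noteq> \<zero>"
  proof
    assume "cf r 0 = \<zero>"
    then have "\<zero> = \<one>" using e(1) b1 by simp
    then show False using one_not_zero by simp
  qed
  then have i: "inv (cf r 0) \<in> K" "inv (cf r 0) \<otimes> cf r 0 = \<one>" using subfield_m_inv[OF K, of "cf r 0"] r0 by auto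
  have "(inv (cf r 0) \<otimes> cf r 0) \<otimes> cf b 1 = inv (cf r 0) \<otimes> (cf r 0 \<otimes> cf b 1)"
    by (rule m_assoc[OF Kc[OF i(1)] rc(1) b1])
  then have "cf b 1 = inv (cf r 0)" unfolding i(2) e(1) using b1 Kc[OF i(1)] by simp
  then have "cf s 0 \<otimes> inv (cf r 0) = \<alpha>" using e(2) by simp
  then have "\<alpha> \<in> K" using K_props(6)[OF r0(2) i(1)] by simp
  then show False using alpha(2) by blast
qed

text \<open>\<open>L = G\<^sub>i + \<alpha>G\<^sub>i + \<alpha>\<^sup>2G\<^sub>i\<close> for \<open>i \<ge> 1\<close>, while for \<open>i = 0\<close> the right-hand side is \<open>L\<^sub>2\<close>. The zero vector is
  decomposed trivially so that decompositions of all coefficients of a polynomial form polynomials again.\<close>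

lemma coefficients_decompose:
  assumes x: "x \<in> carrier L" and low: "i = 0 \<Longrightarrow> x \<in> PS 2"
  shows "\<exists>a\<in>G i. \<exists>b\<in>G i. \<exists>c\<in>G i. x = a \<oplus> \<alpha> \<otimes> b \<oplus> \<alpha> \<otimes> \<alpha> \<otimes> c \<and> (x = \<zero> \<longrightarrow> a = \<zero> \<and> b = \<zero> \<and> c = \<zero>)"
proof (cases "x = \<zero>")
  case True
  then show ?thesis using G_props(2)[of i] alpha(1) by (intro bexI[of _ \<zero>]) simp_all
next
  case False
  have "\<exists>a\<in>G i. \<exists>b\<in>G i. \<exists>c\<in>G i. x = a \<oplus> \<alpha> \<otimes> b \<oplus> \<alpha> \<otimes> \<alpha> \<otimes> c"
  proof -
    consider "i = 0" | "i = 1" | "i = 2" | "i \<ge> 3" by linarith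
    then show ?thesis
    proof cases
      case 1
      then show ?thesis using PS2_decomp[OF low] by (simp add: G_simps)
    next
      case 2
      then show ?thesis using W_decomp[OF x] by (simp add: G_simps)
    next
      case 3
      obtain a b where ab: "a \<in> H" "b \<in> H" "x = a \<oplus> \<alpha> \<otimes> b" using H_decomp_alpha[OF x] by (elim bexE)
      have "a \<in> carrier L" "b \<in> carrier L" using ab(1,2) H_props(1) by blast+
      then show ?thesis unfolding 3 G_simps ab(3) using ab(1,2) H_props(2) alpha(1)
        by (intro bexI[of _ a] bexI[of _ b] bexI[of _ \<zero>]) simp_all
    next
      case 4
      then show ?thesis using x alpha(1)
        by (intro bexI[of _ x] bexI[of _ \<zero>]) (simp_all add: G_simps)
    qed
  qed
  then show ?thesis using False by simp
qed

lemma polynomial_with_coefficients: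
  assumes "\<And>i. g i \<in> G i" "\<And>i. i \<ge> m \<Longrightarrow> g i = \<zero>"
  shows "\<exists>p\<in>carrier Rg. \<forall>i. cf p i = g i"
proof -
  let ?p = "finsum PL (\<lambda>i. mn (g i) i) {..<m}"
  have g: "g i \<in> carrier L" for i using G_c[OF assms(1)] .
  have c: "cf ?p i = g i" for i using cf_sum_mon[of "{..<m}" g i] g assms(2)[of i] by auto
  have "?p \<in> carrier PL" by (rule up.P.finsum_closed) (use g in simp)
  then have "?p \<in> carrier Rg" by (rule Rg_I) (use c assms(1) in simp)
  then show ?thesis by (rule bexI[rotated]) (intro allI c)
qed

abbreviation "A \<equiv> mn \<alpha> 0"

lemma A_PL: "A \<in> carrier PL" using alpha(1) by simp

lemma shifted_combination:
  assumes p: "p \<in> carrier Rg" and low: "\<And>i. i < 4 \<Longrightarrow> cf p i = \<zero>" and p4: "cf p 4 \<in> PS 2"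
  obtains r0 r1 r2 where "r0 \<in> carrier Rg" "r1 \<in> carrier Rg" "r2 \<in> carrier Rg"
    "p = mn \<one> 3 \<otimes>\<^bsub>PL\<^esub> (t \<otimes>\<^bsub>PL\<^esub> (r0 \<oplus>\<^bsub>PL\<^esub> A \<otimes>\<^bsub>PL\<^esub> r1 \<oplus>\<^bsub>PL\<^esub> A \<otimes>\<^bsub>PL\<^esub> (A \<otimes>\<^bsub>PL\<^esub> r2)))"
proof -
  have pP: "p \<in> carrier PL" by (rule Rg_c[OF p])
  define \<phi> where "\<phi> i z \<longleftrightarrow> fst z \<in> G i \<and> fst (snd z) \<in> G i \<and> snd (snd z) \<in> G i \<and>
      cf p (i + 4) = fst z \<oplus> \<alpha> \<otimes> fst (snd z) \<oplus> \<alpha> \<otimes> \<alpha> \<otimes> snd (snd z) \<and>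
      (cf p (i + 4) = \<zero> \<longrightarrow> fst z = \<zero> \<and> fst (snd z) = \<zero> \<and> snd (snd z) = \<zero>)" for i z
  have "\<exists>z. \<phi> i z" for i
  proof -
    have "\<exists>a\<in>G i. \<exists>b\<in>G i. \<exists>c\<in>G i. cf p (i + 4) = a \<oplus> \<alpha> \<otimes> b \<oplus> \<alpha> \<otimes> \<alpha> \<otimes> c \<and> (cf p (i + 4) = \<zero> \<longrightarrow> a = \<zero> \<and> b = \<zero> \<and> c = \<zero>)"
      by (rule coefficients_decompose) (use pP p4 in simp_all)
    then obtain a b c where "\<phi> i (a, b, c)" unfolding \<phi>_def fst_conv snd_conv by (elim bexE) blast
    then show ?thesis by (rule exI)
  qed
  then have "\<exists>z. \<forall>i. \<phi> i (z i)" by (intro choice allI)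
  then obtain z where z: "\<forall>i. \<phi> i (z i)" by (rule exE)
  note zs = spec[OF z, unfolded \<phi>_def]
  note zG = zs[THEN conjunct1] zs[THEN conjunct2, THEN conjunct1] zs[THEN conjunct2, THEN conjunct2, THEN conjunct1]
  note zp = zs[THEN conjunct2, THEN conjunct2, THEN conjunct2, THEN conjunct1]
  note z0 = zs[THEN conjunct2, THEN conjunct2, THEN conjunct2, THEN conjunct2, THEN mp]
  obtain m where m: "degree_below m p" using degree_below_ex[OF pP] by blast
  have high: "cf p (i + 4) = \<zero>" if "i \<ge> m" for i using m that unfolding degree_below_def by simp
  have zh: "fst (z i) = \<zero>" "fst (snd (z i)) = \<zero>" "snd (snd (z i)) = \<zero>" if "i \<ge> m" for i
    by (rule z0[OF high[OF that], THEN conjunct1], rule z0[OF high[OF that], THEN conjunct2, THEN conjunct1],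
      rule z0[OF high[OF that], THEN conjunct2, THEN conjunct2])
  have "\<exists>r\<in>carrier Rg. \<forall>i. cf r i = fst (z i)"
    by (rule polynomial_with_coefficients[where m = m]) (rule zG(1), erule zh(1))
  then obtain r0 where r0: "r0 \<in> carrier Rg" "\<forall>i. cf r0 i = fst (z i)" by (rule bexE)
  have "\<exists>r\<in>carrier Rg. \<forall>i. cf r i = fst (snd (z i))"
    by (rule polynomial_with_coefficients[where m = m]) (rule zG(2), erule zh(2))
  then obtain r1 where r1: "r1 \<in> carrier Rg" "\<forall>i. cf r1 i = fst (snd (z i))" by (rule bexE)
  have "\<exists>r\<in>carrier Rg. \<forall>i. cf r i = snd (snd (z i))"
    by (rule polynomial_with_coefficients[where m = m]) (rule zG(3), erule zh(3))
  then obtain r2 where r2: "r2 \<in> carrier Rg" "\<forall>i. cf r2 i = snd (snd (z i))" by (rule bexE)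
  let ?q = "r0 \<oplus>\<^bsub>PL\<^esub> A \<otimes>\<^bsub>PL\<^esub> r1 \<oplus>\<^bsub>PL\<^esub> A \<otimes>\<^bsub>PL\<^esub> (A \<otimes>\<^bsub>PL\<^esub> r2)"
  have rP: "r0 \<in> carrier PL" "r1 \<in> carrier PL" "r2 \<in> carrier PL" using r0 r1 r2 Rg_c by auto
  have Ar: "A \<otimes>\<^bsub>PL\<^esub> r1 \<in> carrier PL" "A \<otimes>\<^bsub>PL\<^esub> r2 \<in> carrier PL" "A \<otimes>\<^bsub>PL\<^esub> (A \<otimes>\<^bsub>PL\<^esub> r2) \<in> carrier PL"
    using rP A_PL by simp_all
  have qP: "?q \<in> carrier PL" using rP(1) Ar by simp
  have tq: "t \<otimes>\<^bsub>PL\<^esub> ?q \<in> carrier PL" using qP by simp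
  have cq: "cf ?q i = cf p (i + 4)" for i
  proof -
    have "cf ?q i = cf r0 i \<oplus> cf (A \<otimes>\<^bsub>PL\<^esub> r1) i \<oplus> cf (A \<otimes>\<^bsub>PL\<^esub> (A \<otimes>\<^bsub>PL\<^esub> r2)) i"
      using rP(1) Ar by (simp del: up.coeff_mult)
    also have "\<dots> = cf r0 i \<oplus> \<alpha> \<otimes> cf r1 i \<oplus> \<alpha> \<otimes> (\<alpha> \<otimes> cf r2 i)"
      unfolding mon_K_mult[OF alpha(1) rP(2)] mon_K_mult[OF alpha(1) Ar(2)] mon_K_mult[OF alpha(1) rP(3)] ..
    also have "\<dots> = fst (z i) \<oplus> \<alpha> \<otimes> fst (snd (z i)) \<oplus> \<alpha> \<otimes> \<alpha> \<otimes> snd (snd (z i))"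
      using alpha(1) up.coeff_closed[OF rP(3), of i] unfolding r0(2)[THEN spec, of i] r1(2)[THEN spec, of i] r2(2)[THEN spec, of i] by (simp add: m_assoc)
    also have "\<dots> = cf p (i + 4)" by (rule zp[symmetric])
    finally show ?thesis .
  qed
  have "p = mn \<one> 3 \<otimes>\<^bsub>PL\<^esub> (t \<otimes>\<^bsub>PL\<^esub> ?q)"
  proof (rule up.up_eqI[OF _ pP])
    show "mn \<one> 3 \<otimes>\<^bsub>PL\<^esub> (t \<otimes>\<^bsub>PL\<^esub> ?q) \<in> carrier PL" using tq by simp
    fix i
    show "cf p i = cf (mn \<one> 3 \<otimes>\<^bsub>PL\<^esub> (t \<otimes>\<^bsub>PL\<^esub> ?q)) i"
    proof (cases "i < 4")
      case True
      then have "i - 3 < 1" by simp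
      then have "cf (mn \<one> 3 \<otimes>\<^bsub>PL\<^esub> (t \<otimes>\<^bsub>PL\<^esub> ?q)) i = \<zero>"
        unfolding cf_mon_mult[OF one_closed tq] cf_mon_mult[OF one_closed qP] by simp
      then show ?thesis unfolding low[OF True] by (rule sym)
    next
      case False
      then have i: "3 \<le> i" "1 \<le> i - 3" "i - 3 - 1 + 4 = i" by simp_all
      have "cf (mn \<one> 3 \<otimes>\<^bsub>PL\<^esub> (t \<otimes>\<^bsub>PL\<^esub> ?q)) i = \<one> \<otimes> (\<one> \<otimes> cf p i)"
        unfolding cf_mon_mult[OF one_closed tq] cf_mon_mult[OF one_closed qP] cq i(3) by (simp only: i(1,2) if_True)
      also have "\<dots> = cf p i" using up.coeff_closed[OF pP] by (simp only: l_one)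
      finally show ?thesis by (rule sym)
    qed
  qed
  then show thesis by (rule that[OF r0(1) r1(1) r2(1)])
qed

text \<open>The hypothesis states that \<open>p/t\<^sup>3\<close> multiplies \<open>Vt\<close> into the ideal, whose elements have the coefficients
  \<open>0\<close>, in \<open>L\<^sub>1\<close> and in \<open>V3\<close> in degrees 0, 1 and 2. So \<open>p\<^sub>3V \<subseteq> L\<^sub>1\<close> and \<open>p\<^sub>4V \<subseteq> V3\<close>.\<close>

lemma low_coefficients:
  assumes p: "p \<in> line_ideal"
    and div: "\<And>v. v \<in> V \<Longrightarrow> \<exists>x\<in>line_ideal. mn v 1 \<otimes>\<^bsub>PL\<^esub> p = mn \<one> 3 \<otimes>\<^bsub>PL\<^esub> x"
  shows "i < 4 \<Longrightarrow> cf p i = \<zero>" "cf p 4 \<in> PS 2"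
proof -
  have pP: "p \<in> carrier PL" by (rule Rg_c[OF I.Icarr[OF p]])
  have pc: "cf p i \<in> carrier L" for i by (rule up.coeff_closed[OF pP])
  have key: "\<exists>x\<in>line_ideal. \<forall>i. cf p i \<otimes> v = (if 2 \<le> i then cf x (i - 2) else \<zero>)" if v: "v \<in> V" for v
  proof -
    obtain x where x: "x \<in> line_ideal" "mn v 1 \<otimes>\<^bsub>PL\<^esub> p = mn \<one> 3 \<otimes>\<^bsub>PL\<^esub> x" using div[OF v] by (rule bexE)
    have xP: "x \<in> carrier PL" by (rule Rg_c[OF I.Icarr[OF x(1)]])
    have "cf p i \<otimes> v = (if 2 \<le> i then cf x (i - 2) else \<zero>)" for i
    proof -
      have "cf (mn v 1 \<otimes>\<^bsub>PL\<^esub> p) (Suc i) = v \<otimes> cf p i" unfolding cf_mon_mult[OF Vc[OF v] pP] by simp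
      moreover have "cf (mn \<one> 3 \<otimes>\<^bsub>PL\<^esub> x) (Suc i) = (if 2 \<le> i then cf x (i - 2) else \<zero>)"
        unfolding cf_mon_mult[OF one_closed xP] using xP by (simp add: numeral_3_eq_3 numeral_2_eq_2)
      ultimately show ?thesis unfolding x(2) using m_comm[OF pc Vc[OF v], of i] by (simp only:)
    qed
    then show ?thesis by (intro bexI[OF _ x(1)] allI)
  qed
  have at_one: "\<exists>x\<in>line_ideal. \<forall>i. cf p i = (if 2 \<le> i then cf x (i - 2) else \<zero>)"
    using key[OF V_one] pc by (simp only: r_one)
  then obtain x where x: "x \<in> line_ideal" "\<forall>i. cf p i = (if 2 \<le> i then cf x (i - 2) else \<zero>)" by (rule bexE)
  have "cf p 0 = \<zero>" using spec[OF x(2), of 0] by simp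
  moreover have "cf p 1 = \<zero>" using spec[OF x(2), of 1] by simp
  moreover have "cf p 2 = \<zero>" using spec[OF x(2), of 2] line_ideal_coefficients(1)[OF x(1)] by simp
  moreover have "cf p 3 = \<zero>"
  proof (rule multiplier_into_line[OF pc])
    fix v assume "v \<in> V"
    from key[OF this] obtain y where y: "y \<in> line_ideal" "\<forall>i. cf p i \<otimes> v = (if 2 \<le> i then cf y (i - 2) else \<zero>)" by (rule bexE)
    have "cf p 3 \<otimes> v = cf y 1" using spec[OF y(2), of 3] by simp
    then show "cf p 3 \<otimes> v \<in> PS 1" using line_ideal_coefficients(2)[OF y(1)] by (simp only:)
  qed
  moreover have "i = 0 \<or> i = 1 \<or> i = 2 \<or> i = 3" if "i < 4" for i :: nat using that by linarith
  ultimately show "i < 4 \<Longrightarrow> cf p i = \<zero>" for i by metis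
  show "cf p 4 \<in> PS 2"
  proof (rule multiplier_into_V3[OF pc])
    fix v assume "v \<in> V"
    from key[OF this] obtain y where y: "y \<in> line_ideal" "\<forall>i. cf p i \<otimes> v = (if 2 \<le> i then cf y (i - 2) else \<zero>)" by (rule bexE)
    have "cf p 4 \<otimes> v = cf y 2" using spec[OF y(2), of 4] by simp
    then show "cf p 4 \<otimes> v \<in> V3" using line_ideal_coefficients(3)[OF y(1)] by (simp only:)
  qed
qed

lemma line_ideal_tuple_lift:
  assumes M: "module Rg (ideal_module Rg line_ideal)" and y: "y 0 \<in> line_ideal" "y 1 \<in> line_ideal"
    and x: "x \<in> carrier (tuple_module Rg 2)"
  shows "module.tuple_lift (ideal_module Rg line_ideal) 2 y x = entry x 0 \<otimes>\<^bsub>PL\<^esub> y 0 \<oplus>\<^bsub>PL\<^esub> entry x 1 \<otimes>\<^bsub>PL\<^esub> y 1"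
proof -
  interpret M: module Rg "ideal_module Rg line_ideal" by (rule M)
  have c: "entry x 0 \<otimes>\<^bsub>PL\<^esub> y 0 \<in> line_ideal" "entry x 1 \<otimes>\<^bsub>PL\<^esub> y 1 \<in> line_ideal"
    using I.I_l_closed[OF y(1), of "entry x 0"] I.I_l_closed[OF y(2), of "entry x 1"] x by simp_all
  have s: "{..<2} = {0, 1 :: nat}" by auto
  have zc: "entry x 1 \<otimes>\<^bsub>PL\<^esub> y 1 \<in> carrier PL" by (rule Rg_c[OF I.Icarr[OF c(2)]])
  have "module.tuple_lift (ideal_module Rg line_ideal) 2 y x
      = (\<Oplus>\<^bsub>ideal_module Rg line_ideal\<^esub>i\<in>{0, 1}. entry x i \<otimes>\<^bsub>PL\<^esub> y i)"
    unfolding M.tuple_lift_def s by simp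
  also have "\<dots> = entry x 0 \<otimes>\<^bsub>PL\<^esub> y 0 \<oplus>\<^bsub>PL\<^esub> (entry x 1 \<otimes>\<^bsub>PL\<^esub> y 1 \<oplus>\<^bsub>PL\<^esub> \<zero>\<^bsub>PL\<^esub>)"
    using M.M.finsum_insert[of "{1}" 0 "\<lambda>i. entry x i \<otimes>\<^bsub>PL\<^esub> y i"] M.M.finsum_insert[of "{}" 1 "\<lambda>i. entry x i \<otimes>\<^bsub>PL\<^esub> y i"] c
    by (simp add: Pi_def)
  finally show ?thesis using zc by simp
qed

text \<open>The kernel of \<open>(r, s) \<mapsto> r t + s \<alpha>t\<close> consists of the vectors \<open>z u = (-\<alpha>u, u)\<close> with \<open>u\<close> in
  \<open>D = {u. u, \<alpha>u \<in> R}\<close>. A linear map \<open>h\<close> from it to the ideal is multiplication of \<open>u\<close> by \<open>p/t\<^sup>3\<close>, where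
  \<open>p = h (z t\<^sup>3)\<close>, since \<open>t\<^sup>3 h (z u) = h (z (t\<^sup>3u)) = u p\<close>. As \<open>Vt \<subseteq> D\<close>, the coefficients of \<open>p\<close> are
  restricted by \<open>low_coefficients\<close>, and therefore \<open>p/t\<^sup>3 = t (r0 + \<alpha> r1 + \<alpha>\<^sup>2 r2)\<close> with \<open>r0\<close>, \<open>r1\<close>, \<open>r2\<close> in the ring.
  The map that sends the unit vectors to \<open>-(r1 t + r2 \<alpha>t)\<close> and \<open>r0 t\<close> extends \<open>h\<close>.\<close>

lemma line_ideal_rigid: "rigid_ideal Rg line_ideal"
  unfolding rigid_ideal_def
proof (intro conjI line_ideal_ideal)
  let ?N = "ideal_module Rg line_ideal"
  have N: "module Rg ?N" by (rule Rg.ideal_module_module[OF line_ideal_ideal])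
  interpret N: module Rg ?N by (rule N)
  let ?T = "tuple_module Rg 2 :: (nat \<Rightarrow> 'a, ((nat \<Rightarrow> 'a) \<times> (nat \<Rightarrow> 'a)) list) module"
  define y where "y i = (if i = (0::nat) then t else \<alpha>t)" for i
  have y: "y 0 \<in> line_ideal" "y 1 \<in> line_ideal" using t_line_ideal alpha_t_line_ideal by (simp_all add: y_def)
  define e :: "((nat \<Rightarrow> 'a) \<times> (nat \<Rightarrow> 'a)) list \<Rightarrow> nat \<Rightarrow> 'a" where "e = N.tuple_lift 2 y"
  have eh: "e \<in> mod_hom Rg ?T ?N" unfolding e_def
    by (rule N.tuple_lift_hom) (use t_line_ideal alpha_t_line_ideal in \<open>simp add: y_def\<close>)
  have e: "e x = entry x 0 \<otimes>\<^bsub>PL\<^esub> t \<oplus>\<^bsub>PL\<^esub> entry x 1 \<otimes>\<^bsub>PL\<^esub> \<alpha>t" if "x \<in> carrier ?T" for x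
    unfolding e_def line_ideal_tuple_lift[OF N y that] by (simp add: y_def)
  have tP: "t \<in> carrier PL" "mn \<one> 3 \<in> carrier PL" by simp_all
  have t3: "mn \<one> 3 \<noteq> \<zero>\<^bsub>PL\<^esub>" using mn_eq_zero[of \<one> 3] by auto
  have At: "A \<otimes>\<^bsub>PL\<^esub> mn a i = mn (\<alpha> \<otimes> a) i" if "a \<in> carrier L" for a i by (rule const_mult_monom[OF alpha(1) that])
  have At': "\<alpha>t = A \<otimes>\<^bsub>PL\<^esub> t" using At[OF one_closed, of 1] alpha(1) by simp
  let ?ker = "a_kernel ?T ?N e"
  have ker: "x \<in> ?ker \<longleftrightarrow> x \<in> carrier ?T \<and> entry x 0 = \<ominus>\<^bsub>PL\<^esub> (A \<otimes>\<^bsub>PL\<^esub> entry x 1)" for x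
  proof -
    have "e x = \<zero>\<^bsub>PL\<^esub> \<longleftrightarrow> entry x 0 = \<ominus>\<^bsub>PL\<^esub> (A \<otimes>\<^bsub>PL\<^esub> entry x 1)" if x: "x \<in> carrier ?T"
    proof -
      have z: "entry x 0 \<in> carrier PL" "entry x 1 \<in> carrier PL" using x Rg_c by simp_all
      have s: "entry x 0 \<oplus>\<^bsub>PL\<^esub> A \<otimes>\<^bsub>PL\<^esub> entry x 1 \<in> carrier PL" using z A_PL by simp
      have "e x = t \<otimes>\<^bsub>PL\<^esub> (entry x 0 \<oplus>\<^bsub>PL\<^esub> A \<otimes>\<^bsub>PL\<^esub> entry x 1)"
        unfolding e[OF x] At' using z tP(1) A_PL by algebra
      then have "e x = \<zero>\<^bsub>PL\<^esub> \<longleftrightarrow> entry x 0 \<oplus>\<^bsub>PL\<^esub> A \<otimes>\<^bsub>PL\<^esub> entry x 1 = \<zero>\<^bsub>PL\<^esub>"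
        using up.integral_iff[OF tP(1) s] t_nonzero by simp
      also have "\<dots> \<longleftrightarrow> entry x 0 = \<ominus>\<^bsub>PL\<^esub> (A \<otimes>\<^bsub>PL\<^esub> entry x 1)"
        using up.P.minus_equality[of "entry x 0" "A \<otimes>\<^bsub>PL\<^esub> entry x 1"] up.P.l_neg[of "A \<otimes>\<^bsub>PL\<^esub> entry x 1"] z A_PL by auto
      finally show ?thesis .
    qed
    then show ?thesis unfolding a_kernel_def' by auto
  qed
  define D where "D = {u \<in> carrier Rg. A \<otimes>\<^bsub>PL\<^esub> u \<in> carrier Rg}"
  define z :: "(nat \<Rightarrow> 'a) \<Rightarrow> ((nat \<Rightarrow> 'a) \<times> (nat \<Rightarrow> 'a)) list"
    where "z u = tuple 2 (\<lambda>i. if i = 0 then \<ominus>\<^bsub>PL\<^esub> (A \<otimes>\<^bsub>PL\<^esub> u) else u)" for u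
  have z: "z u \<in> carrier ?T" "entry (z u) 0 = \<ominus>\<^bsub>PL\<^esub> (A \<otimes>\<^bsub>PL\<^esub> u)" "entry (z u) 1 = u" "z u \<in> ?ker" if "u \<in> D" for u
  proof -
    have "\<ominus>\<^bsub>PL\<^esub> (A \<otimes>\<^bsub>PL\<^esub> u) \<in> carrier Rg" using that Rg.a_inv_closed[of "A \<otimes>\<^bsub>PL\<^esub> u"] Rg_a_inv[of "A \<otimes>\<^bsub>PL\<^esub> u"] by (simp add: D_def)
    then show 1: "z u \<in> carrier ?T" unfolding z_def using that by (intro tuple_closed) (simp add: D_def)
    show 2: "entry (z u) 0 = \<ominus>\<^bsub>PL\<^esub> (A \<otimes>\<^bsub>PL\<^esub> u)" "entry (z u) 1 = u" by (simp_all add: z_def)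
    show "z u \<in> ?ker" unfolding ker using 1 2 by simp
  qed
  have kerE: "entry x 1 \<in> D" "x = z (entry x 1)" if x: "x \<in> ?ker" for x
  proof -
    have xT: "x \<in> carrier ?T" and x0: "entry x 0 = \<ominus>\<^bsub>PL\<^esub> (A \<otimes>\<^bsub>PL\<^esub> entry x 1)" using x ker by auto
    have c: "entry x 0 \<in> carrier Rg" "entry x 1 \<in> carrier Rg" using xT by simp_all
    have "A \<otimes>\<^bsub>PL\<^esub> entry x 1 = \<ominus>\<^bsub>PL\<^esub> entry x 0" unfolding x0 using Rg_c[OF c(2)] A_PL by simp
    then have "A \<otimes>\<^bsub>PL\<^esub> entry x 1 \<in> carrier Rg" using Rg.a_inv_closed[OF c(1)] Rg_a_inv[OF c(1)] by simp
    then show d: "entry x 1 \<in> D" using c by (simp add: D_def)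
    show "x = z (entry x 1)"
    proof (rule tuple_eqI[OF xT z(1)[OF d]])
      fix i :: nat assume "i < 2"
      then have "i = 0 \<or> i = 1" by linarith
      then show "entry x i = entry (z (entry x 1)) i" using z(2,3)[OF d] x0 by auto
    qed
  qed
  have monD: "mn a i \<in> D" if "a \<in> G i" "\<alpha> \<otimes> a \<in> G i" for a i
    using mon_Rg[OF that(1)] mon_Rg[OF that(2)] At[OF G_c[OF that(1)], of i] by (simp add: D_def)
  have t3D: "mn \<one> 3 \<in> D" by (rule monD) (use alpha(1) in \<open>simp_all add: G_simps\<close>)
  have vD: "mn v 1 \<in> D" if "v \<in> V" for v
    by (rule monD) (use that alpha_V_subset_W V_subset_W in \<open>auto simp: G_simps\<close>)
  show "ext_vanishes Rg 1 ?N ?N"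
  proof (rule Rg.ext1_vanishesI[OF frob.noetherian N N eh])
    have "x \<in> e ` carrier ?T" if x: "x \<in> line_ideal" for x
    proof -
      obtain r s where rs: "r \<in> carrier Rg" "s \<in> carrier Rg" "x = r \<otimes>\<^bsub>PL\<^esub> t \<oplus>\<^bsub>PL\<^esub> s \<otimes>\<^bsub>PL\<^esub> \<alpha>t" using x by (rule line_idealE)
      let ?x = "tuple 2 (\<lambda>i. if i = 0 then r else s) :: ((nat \<Rightarrow> 'a) \<times> (nat \<Rightarrow> 'a)) list"
      have xT: "?x \<in> carrier ?T" by (rule tuple_closed) (use rs in simp)
      have "e ?x = x" unfolding e[OF xT] rs(3) by simp
      then show ?thesis using xT by (intro image_eqI[of _ _ ?x]) (rule sym)
    qed
    then show "e ` carrier ?T = carrier ?N" using mod_homD(1)[OF eh] by auto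
    fix h assume h: "h \<in> mod_hom Rg (?T\<lparr>carrier := ?ker\<rparr>) ?N"
    define \<phi> where "\<phi> u = h (z u)" for u
    have phi_I: "\<phi> u \<in> line_ideal" if "u \<in> D" for u
      unfolding \<phi>_def using mod_homD(1)[OF h, of "z u"] z(4)[OF that] by simp
    have phi_smult: "\<phi> (r \<otimes>\<^bsub>PL\<^esub> u) = r \<otimes>\<^bsub>PL\<^esub> \<phi> u" if r: "r \<in> carrier Rg" and u: "u \<in> D" for r u
    proof -
      have P: "r \<in> carrier PL" "u \<in> carrier PL" "u \<in> carrier Rg" using r u Rg_c by (auto simp: D_def)
      have m: "A \<otimes>\<^bsub>PL\<^esub> (r \<otimes>\<^bsub>PL\<^esub> u) = r \<otimes>\<^bsub>PL\<^esub> (A \<otimes>\<^bsub>PL\<^esub> u)" using P A_PL by (simp add: up.P.m_lcomm)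
      have d: "r \<otimes>\<^bsub>PL\<^esub> u \<in> D" unfolding D_def
        using Rg.m_closed[OF r P(3)] Rg.m_closed[OF r, of "A \<otimes>\<^bsub>PL\<^esub> u"] u m by (simp add: D_def)
      have "z (r \<otimes>\<^bsub>PL\<^esub> u) = r \<odot>\<^bsub>?T\<^esub> z u"
      proof (rule tuple_eqI[OF z(1)[OF d]])
        show "r \<odot>\<^bsub>?T\<^esub> z u \<in> carrier ?T" unfolding tuple_smult
          using Rg.m_closed[OF r entry_closed[OF z(1)[OF u]]] by (intro tuple_closed) simp
        fix i :: nat assume i: "i < 2"
        have "r \<otimes>\<^bsub>PL\<^esub> (\<ominus>\<^bsub>PL\<^esub> (A \<otimes>\<^bsub>PL\<^esub> u)) = \<ominus>\<^bsub>PL\<^esub> (A \<otimes>\<^bsub>PL\<^esub> (r \<otimes>\<^bsub>PL\<^esub> u))"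
          unfolding m using P A_PL by (simp add: up.P.r_minus)
        moreover have "i = 0 \<or> i = 1" using i by linarith
        ultimately show "entry (z (r \<otimes>\<^bsub>PL\<^esub> u)) i = entry (r \<odot>\<^bsub>?T\<^esub> z u) i"
          using z(2,3)[OF d] z(2,3)[OF u] by auto
      qed
      then show ?thesis unfolding \<phi>_def using mod_homD(3)[OF h r, of "z u"] z(4)[OF u] by simp
    qed
    define p where "p = \<phi> (mn \<one> 3)"
    have pI: "p \<in> line_ideal" unfolding p_def by (rule phi_I[OF t3D])
    have pR: "p \<in> carrier Rg" by (rule I.Icarr[OF pI])
    have t3R: "mn \<one> 3 \<in> carrier Rg" using t3D by (simp add: D_def)
    have swap: "u \<otimes>\<^bsub>PL\<^esub> p = mn \<one> 3 \<otimes>\<^bsub>PL\<^esub> \<phi> u" if u: "u \<in> D" for u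
    proof -
      have uR: "u \<in> carrier Rg" using u by (simp add: D_def)
      have "u \<otimes>\<^bsub>PL\<^esub> mn \<one> 3 = mn \<one> 3 \<otimes>\<^bsub>PL\<^esub> u" by (rule up.P.m_comm[OF Rg_c[OF uR] tP(2)])
      then have "\<phi> (u \<otimes>\<^bsub>PL\<^esub> mn \<one> 3) = \<phi> (mn \<one> 3 \<otimes>\<^bsub>PL\<^esub> u)" by (rule arg_cong)
      then show ?thesis unfolding p_def phi_smult[OF uR t3D] phi_smult[OF t3R u] .
    qed
    have div: "\<exists>x\<in>line_ideal. mn v 1 \<otimes>\<^bsub>PL\<^esub> p = mn \<one> 3 \<otimes>\<^bsub>PL\<^esub> x" if "v \<in> V" for v
      by (rule bexI[of _ "\<phi> (mn v 1)"]) (rule swap[OF vD[OF that]], rule phi_I[OF vD[OF that]])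
    obtain r0 r1 r2 where r: "r0 \<in> carrier Rg" "r1 \<in> carrier Rg" "r2 \<in> carrier Rg"
      and pr: "p = mn \<one> 3 \<otimes>\<^bsub>PL\<^esub> (t \<otimes>\<^bsub>PL\<^esub> (r0 \<oplus>\<^bsub>PL\<^esub> A \<otimes>\<^bsub>PL\<^esub> r1 \<oplus>\<^bsub>PL\<^esub> A \<otimes>\<^bsub>PL\<^esub> (A \<otimes>\<^bsub>PL\<^esub> r2)))"
      by (rule shifted_combination[OF pR low_coefficients(1)[OF pI div] low_coefficients(2)[OF pI div]])
    have rP: "r0 \<in> carrier PL" "r1 \<in> carrier PL" "r2 \<in> carrier PL" using r Rg_c by auto
    let ?q = "t \<otimes>\<^bsub>PL\<^esub> (r0 \<oplus>\<^bsub>PL\<^esub> A \<otimes>\<^bsub>PL\<^esub> r1 \<oplus>\<^bsub>PL\<^esub> A \<otimes>\<^bsub>PL\<^esub> (A \<otimes>\<^bsub>PL\<^esub> r2))"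
    have qP: "?q \<in> carrier PL" using rP A_PL tP by simp
    have phi: "\<phi> u = u \<otimes>\<^bsub>PL\<^esub> ?q" if u: "u \<in> D" for u
    proof -
      have uP: "u \<in> carrier PL" using u Rg_c by (simp add: D_def)
      have fP: "\<phi> u \<in> carrier PL" by (rule Rg_c[OF I.Icarr[OF phi_I[OF u]]])
      have "mn \<one> 3 \<otimes>\<^bsub>PL\<^esub> \<phi> u = mn \<one> 3 \<otimes>\<^bsub>PL\<^esub> (u \<otimes>\<^bsub>PL\<^esub> ?q)"
        unfolding swap[OF u, symmetric] pr by (rule up.P.m_lcomm[OF uP tP(2) qP])
      then show ?thesis
        using up.m_lcancel[OF t3 tP(2) fP, of "u \<otimes>\<^bsub>PL\<^esub> ?q"] up.P.m_closed[OF uP qP] by simp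
    qed
    define g0 where "g0 = \<ominus>\<^bsub>Rg\<^esub> (r1 \<otimes>\<^bsub>Rg\<^esub> t \<oplus>\<^bsub>Rg\<^esub> r2 \<otimes>\<^bsub>Rg\<^esub> \<alpha>t)"
    define g1 where "g1 = r0 \<otimes>\<^bsub>Rg\<^esub> t"
    have g: "g0 \<in> line_ideal" "g1 \<in> line_ideal" unfolding g0_def g1_def
      by (intro I.a_inv_closed I.a_closed I.I_l_closed t_line_ideal alpha_t_line_ideal r)+
    have "r1 \<otimes>\<^bsub>Rg\<^esub> t \<oplus>\<^bsub>Rg\<^esub> r2 \<otimes>\<^bsub>Rg\<^esub> \<alpha>t \<in> carrier Rg"
      by (intro Rg.a_closed Rg.m_closed t_Rg alpha_t_Rg r)
    then have g0: "g0 = \<ominus>\<^bsub>PL\<^esub> (r1 \<otimes>\<^bsub>PL\<^esub> t \<oplus>\<^bsub>PL\<^esub> r2 \<otimes>\<^bsub>PL\<^esub> (A \<otimes>\<^bsub>PL\<^esub> t))"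
      unfolding g0_def using Rg_a_inv At' by simp
    define gg where "gg i = (if i = (0::nat) then g0 else g1)" for i
    have gg: "gg 0 \<in> line_ideal" "gg 1 \<in> line_ideal" using g by (simp_all add: gg_def)
    let ?g = "N.tuple_lift 2 gg :: ((nat \<Rightarrow> 'a) \<times> (nat \<Rightarrow> 'a)) list \<Rightarrow> nat \<Rightarrow> 'a"
    have "?g \<in> mod_hom Rg ?T ?N" by (rule N.tuple_lift_hom) (use g in \<open>simp add: gg_def\<close>)
    moreover have "?g x = h x" if x: "x \<in> ?ker" for x
    proof -
      define u where "u = entry x 1"
      have u: "u \<in> D" "x = z u" using kerE[OF x] by (simp_all add: u_def)
      have uP: "u \<in> carrier PL" using u(1) Rg_c by (simp add: D_def)
      have "?g x = \<ominus>\<^bsub>PL\<^esub> (A \<otimes>\<^bsub>PL\<^esub> u) \<otimes>\<^bsub>PL\<^esub> g0 \<oplus>\<^bsub>PL\<^esub> u \<otimes>\<^bsub>PL\<^esub> g1"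
        unfolding u(2) line_ideal_tuple_lift[OF N gg z(1)[OF u(1)]] z(2,3)[OF u(1)] by (simp add: gg_def)
      moreover have "\<ominus>\<^bsub>PL\<^esub> (A \<otimes>\<^bsub>PL\<^esub> u) \<otimes>\<^bsub>PL\<^esub> g0 \<oplus>\<^bsub>PL\<^esub> u \<otimes>\<^bsub>PL\<^esub> g1 = u \<otimes>\<^bsub>PL\<^esub> ?q"
        unfolding g0 g1_def Rg_simps using uP A_PL rP tP(1) by algebra
      moreover have "h x = u \<otimes>\<^bsub>PL\<^esub> ?q" using phi[OF u(1)] unfolding \<phi>_def u(2) .
      ultimately show ?thesis by (simp only:)
    qed
    ultimately show "\<exists>g\<in>mod_hom Rg ?T ?N. \<forall>x\<in>?ker. g x = h x" by (intro bexI[of _ ?g] ballI)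
  qed
qed

end

theorem proposition3p2:
  fixes L :: "('a, 'b) ring_scheme" (structure)
    and K V W H :: "'a set"
    and \<alpha> :: 'a
    and n :: nat
    and G :: "nat \<Rightarrow> 'a set"
    and R :: "('a, nat \<Rightarrow> 'a) up_ring"
    and I :: "(nat \<Rightarrow> 'a) set"
  assumes "field L"
    and "subfield K L"
    and "\<alpha> \<in> carrier L" and "\<alpha> \<notin> K"
    and "ring.simple_extension L K \<alpha> = carrier L"
    and "ring.dimension L n K (carrier L)"
    and "n mod 4 = 0"
    and "\<alpha> [^] n \<in> K - {\<zero>}"
    and "lin_subspace L K V" and "K \<subseteq> V"
    and "ring.dimension L (n div 4) K V"
    and "\<forall>u\<in>V. \<forall>v\<in>V. \<forall>w\<in>V. u \<oplus> \<alpha> \<otimes> v \<oplus> \<alpha> [^] (2::nat) \<otimes> w = \<zero> \<longrightarrow>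
           u = \<zero> \<and> \<alpha> \<otimes> v = \<zero> \<and> \<alpha> [^] (2::nat) \<otimes> w = \<zero>"
    and "span_prod L K V V = power_span L K \<alpha> (n - 4)"
    and "carrier L = span_prod L K V (power_span L K \<alpha> (n - 3))"
    and "W = V <+> (\<alpha> <# V)"
    and "H = power_span L K \<alpha> (n - 2)"
    and "G = (\<lambda>i. if i = 0 then K else if i = 1 then W else if i = 2 then H else carrier L)"
    and "R = coeff_restricted L G"
    and "I = genideal R {monom (UP L) \<one> 1, monom (UP L) \<alpha> 1}"
  shows "standard_graded (homogeneous_part L G 0) R (homogeneous_part L G)
    \<and> domain R
    \<and> gorenstein TYPE('u) R
    \<and> krull_dim R = 1
    \<and> rigid_ideal R I
    \<and> \<not> free_mod R (ideal_module R I)"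
proof -
  interpret E: radical_extension L K V \<alpha> n
    by (intro radical_extension.intro radical_extension_axioms.intro assms)
  have G: "G = E.G" unfolding E.G_def E.W_def E.H_def assms(15-17) ..
  have R: "R = E.Rg" unfolding E.Rg_def assms(18) G ..
  have I: "I = E.line_ideal" unfolding E.line_ideal_def assms(19) R ..
  show ?thesis
    unfolding G R I
    by (intro conjI E.Rg_standard_graded[unfolded E.base_field_def] E.Rg_domain E.frob.gorenstein E.krull_dim_Rg
        E.line_ideal_rigid E.line_ideal_not_free)
qed

end
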